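(* Let $\mathcal{C}$ be a compact or skew-symmetric cluster category and let $\mathcal{T}$ be a cluster-tilting subcategory of $\mathcal{C}$. For any cluster-tilting subcategory $\mathcal{U}$ of $\mathcal{C}$ and any $U\in\operatorname{indec}\mathcal{U}$, the vectors $\overline{\mathrm{ind}}{}_{\mathcal{U}}^{\mathcal{T}}[S^{\mathcal{U}}_U]$ and $\overline{\mathrm{coind}}{}_{\mathcal{U}}^{\mathcal{T}}[S^{\mathcal{U}}_U]$ are sign-coherent. That is, for any $T,T'\in\operatorname{indec}\mathcal{T}$, we have $$\langle\overline{\mathrm{ind}}{}_{\mathcal{U}}^{\mathcal{T}}[S^{\mathcal{U}}_U],[T]\rangle_{\mathcal{T}}\geq 0\iff\langle\overline{\mathrm{ind}}{}_{\mathcal{U}}^{\mathcal{T}}[S^{\mathcal{U}}_U],[T']\rangle_{\mathcal{T}}\geq 0,$$ $$\langle\overline{\mathrm{coind}}{}_{\mathcal{U}}^{\mathcal{T}}[S^{\mathcal{U}}_U],[T]\rangle_{\mathcal{T}}\geq 0\iff\langle\overline{\mathrm{coind}}{}_{\mathcal{U}}^{\mathcal{T}}[S^{\mathcal{U}}_U],[T']\rangle_{\mathcal{T}}\geq 0.$$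
   Context: $\mathbb{K}$ is a perfect field; categories are additive and $\mathbb{K}$-linear; $\operatorname{indec}\mathcal{A}$ is a set of representatives of the isomorphism classes of indecomposable objects of $\mathcal{A}$. Cluster categories. Extriangulated categories are those of Nakaoka--Palu: they carry a bifunctor $\operatorname{Ext}^1$, and each element of $\operatorname{Ext}^1_{\mathcal{C}}(X,Y)$ is realised by a conflation $Y\to E\to X$ (an inflation followed by a deflation). Exact categories, and triangulated categories with $\operatorname{Ext}^1(X,Y)=\operatorname{Hom}(X,\Sigma Y)$, are examples. An object $P$ is projective if $\operatorname{Ext}^1(P,-)=0$ and injective if $\operatorname{Ext}^1(-,P)=0$; $\mathcal{C}$ is Frobenius if it has enough projectives and enough injectives and these coincide. For a full additively closed subcategory $\mathcal{P}$ of projective-injectives, the additive quotient $\mathcal{C}/\mathcal{P}$ is extriangulated with $\operatorname{Ext}^1_{\mathcal{C}/\mathcal{P}}=\operatorname{Ext}^1_{\mathcal{C}}$ and conflations the images of those of $\mathcal{C}$; $\mathcal{C}$ is algebraic if it is equivalent, as an extriangulated category, to such a quotient $\mathcal{E}/\mathcal{P}$ of an exact category $\mathcal{E}$. If $\mathcal{C}$ is Frobenius, $\underline{\mathcal{C}}$ denotes its quotient by all projectives, which is triangulated with suspension $\Sigma$. A right $\mathcal{T}$-approximation of $X$ is a map $T_0\to X$ with $T_0\in\mathcal{T}$ through which every map from an object of $\mathcal{T}$ to $X$ factors; left approximations are dual. A full subcategory $\mathcal{T}\subseteq\mathcal{C}$ is cluster-tilting if $\mathcal{T}=\{X:\operatorname{Ext}^1(T,X)=0\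 \forall T\in\mathcal{T}\}=\{X:\operatorname{Ext}^1(X,T)=0\ \forall T\in\mathcal{T}\}$ and every object of $\mathcal{C}$ has a left $\mathcal{T}$-approximation which is an inflation and a right $\mathcal{T}$-approximation which is a deflation. A cluster category is an idempotent complete algebraic Frobenius extriangulated category $\mathcal{C}$ having a cluster-tilting subcategory and such that $\underline{\mathcal{C}}$ is Hom-finite and $2$-Calabi--Yau (functorially $\operatorname{Hom}(X,Y)\cong\operatorname{Hom}_{\mathbb{K}}(\operatorname{Hom}(Y,\Sigma^2X),\mathbb{K})$). Compactness. $D_X=\operatorname{End}(X)^{\mathrm{op}}/\operatorname{rad}$ and $d_X=\dim_{\mathbb{K}}D_X$. A topological vector space $V$ is pseudocompact if it is Hausdorff and has a system of open subspaces $U_i$ with $\dim V/U_i<\infty$ and $V\cong\varprojlim V/U_i$. A category is pseudocompact if its Hom-spaces are pseudocompact with continuous composition, and radically pseudocompact if this holds for the topology whose basic neighbourhoods of $0$ are the powers $\operatorname{rad}^n(X,Y)$ of its radical ideal. A cluster category is compact if it is pseudocompact, $d_X<\infty$ for all $X$, and every cluster-tilting subcategory is radically pseudocompact (this implies Krull--Schmidt); it is skew-symmetric if it is Krull--Schmidt and $d_X=1$ for all indecomposable $X$. Index and coindex. $\mathsf{K}_0(\mathcal{T})$ is the Grothendieck group of $\mathcal{T}$ with its split exact structure. For $X\in\mathcal{C}$ there are conflations $K\to R\to X$ and $X\to L\to C$ with $K,R,L,C\in\mathcal{T}$; put $\operatorname{ind}_{\mathcal{C}}^{\mathcal{T}}[X]=[R]-[K]$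 and $\operatorname{coind}_{\mathcal{C}}^{\mathcal{T}}[X]=[L]-[C]$ in $\mathsf{K}_0(\mathcal{T})$ (independent of choices). For another cluster-tilting $\mathcal{U}$, $\operatorname{ind}_{\mathcal{U}}^{\mathcal{T}},\operatorname{coind}_{\mathcal{U}}^{\mathcal{T}}\colon\mathsf{K}_0(\mathcal{U})\to\mathsf{K}_0(\mathcal{T})$ send $[U]$ to $\operatorname{ind}_{\mathcal{C}}^{\mathcal{T}}[U]$, $\operatorname{coind}_{\mathcal{C}}^{\mathcal{T}}[U]$. Modules and adjoints. A $\mathcal{T}$-module is a contravariant $\mathbb{K}$-linear functor $\mathcal{T}\to\operatorname{Mod}\mathbb{K}$; $\operatorname{lfd}\mathcal{T}$ consists of those with finite-dimensional values; $S^{\mathcal{T}}_X=\operatorname{Hom}_{\mathcal{T}}(-,X)/\operatorname{rad}_{\mathcal{T}}(-,X)$ is the simple module at $X\in\operatorname{indec}\mathcal{T}$. $\mathsf{K}_0^{\mathrm{num}}(\operatorname{lfd}\mathcal{T})$ is the quotient of $\mathsf{K}_0(\operatorname{lfd}\mathcal{T})$ by the left kernel of the pairing $\langle[M],[T]\rangle=\dim_{\mathbb{K}}M(T)$ with $\mathsf{K}_0(\mathcal{T})$; the induced non-degenerate pairing is $\langle-,-\rangle_{\mathcal{T}}$. $\overline{\mathrm{ind}}{}_{\mathcal{U}}^{\mathcal{T}},\overline{\mathrm{coind}}{}_{\mathcal{U}}^{\mathcal{T}}\colon\mathsf{K}_0^{\mathrm{num}}(\operatorname{lfd}\mathcal{U})\to\mathsf{K}_0^{\mathrm{num}}(\operatorname{lfd}\mathcal{T})$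 are the unique maps with $\langle\overline{\mathrm{ind}}{}_{\mathcal{U}}^{\mathcal{T}}v,[T]\rangle_{\mathcal{T}}=\langle v,\operatorname{coind}_{\mathcal{T}}^{\mathcal{U}}[T]\rangle_{\mathcal{U}}$ and $\langle\overline{\mathrm{coind}}{}_{\mathcal{U}}^{\mathcal{T}}v,[T]\rangle_{\mathcal{T}}=\langle v,\operatorname{ind}_{\mathcal{T}}^{\mathcal{U}}[T]\rangle_{\mathcal{U}}$ for all $T\in\mathcal{T}$.
   Formalization: Sign-coherent is taken to mean that the coordinates are all ≥ 0 or all ≤ 0; the displayed equivalences thus hold only for T, T' with non-zero coordinates, since as written they fail when a vector has both a zero and a negative coordinate (e.g. a mutation in type A_2). *)

theory Defs
  imports
    "HOL-Algebra.AbelCoset"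
    "HOL-Algebra.Free_Abelian_Groups"
    "HOL-Analysis.Analysis"
    "HOL-Computational_Algebra.Polynomial_Factorial"
    "Jordan_Normal_Form.VS_Connect"
begin

section \<open>Linear algebra over a field given as a type\<close>

definition perfect_field :: "'k::field itself \<Rightarrow> bool" where
  "perfect_field _ \<longleftrightarrow> (\<forall>p :: 'k poly. Factorial_Ring.irreducible p \<longrightarrow> Rings.coprime p (pderiv p))"

abbreviation lin_maps ::
  "('k::field, 'v) module \<Rightarrow> ('k, 'w) module \<Rightarrow> ('v \<Rightarrow> 'w) set" where
  "lin_maps V W \<equiv> LinearCombinations.module_hom class_ring V W"

text \<open>The multiplicative structure of a \<open>module\<close> record is junk throughout.\<close>

definition quot_space :: "('k::field, 'v) module \<Rightarrow> 'v set \<Rightarrow> ('k, 'v set) module" where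
  "quot_space V W =
    \<lparr>carrier = a_rcosets\<^bsub>V\<^esub> W, monoid.mult = undefined, monoid.one = undefined, ring.zero = W,
     ring.add = (\<lambda>A B. A <+>\<^bsub>V\<^esub> B), module.smult = (\<lambda>c A. \<Union>a\<in>A. W +>\<^bsub>V\<^esub> (c \<odot>\<^bsub>V\<^esub> a))\<rparr>"

definition dual_space :: "('k::field, 'v) module \<Rightarrow> ('k, 'v \<Rightarrow> 'k) module" where
  "dual_space V =
    \<lparr>carrier = {\<phi> \<in> extensional (carrier V).
        (\<forall>u\<in>carrier V. \<forall>v\<in>carrier V. \<phi> (u \<oplus>\<^bsub>V\<^esub> v) = \<phi> u + \<phi> v) \<and>
        (\<forall>c. \<forall>v\<in>carrier V. \<phi> (c \<odot>\<^bsub>V\<^esub> v) = c * \<phi> v)},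
     monoid.mult = undefined, monoid.one = undefined,
     ring.zero = (\<lambda>v\<in>carrier V. 0),
     ring.add = (\<lambda>\<phi> \<psi>. \<lambda>v\<in>carrier V. \<phi> v + \<psi> v),
     module.smult = (\<lambda>c \<phi>. \<lambda>v\<in>carrier V. c * \<phi> v)\<rparr>"


section \<open>Linear and additive categories\<close>

text \<open>
  Hom-spaces are vector spaces with explicit carriers. Distinct Hom-spaces are required to be
  disjoint, so that a morphism determines its source and target and composition needs no object
  arguments. \<open>g \<cdot> f\<close> is ``first \<open>f\<close>, then \<open>g\<close>''.
\<close>

record ('k, 'o, 'm) lcat =
  Obj :: "'o set"
  Hom :: "'o \<Rightarrow> 'o \<Rightarrow> ('k, 'm) module"
  Comp :: "'m \<Rightarrow> 'm \<Rightarrow> 'm"  (infixl "\<cdot>\<index>" 75)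
  Ident :: "'o \<Rightarrow> 'm"

abbreviation Mor :: "('k, 'o, 'm, 'z) lcat_scheme \<Rightarrow> 'o \<Rightarrow> 'o \<Rightarrow> 'm set" where
  "Mor C X Y \<equiv> carrier (Hom C X Y)"

abbreviation full_sub :: "('k, 'o, 'm, 'z) lcat_scheme \<Rightarrow> 'o set \<Rightarrow> ('k, 'o, 'm, 'z) lcat_scheme" where
  "full_sub C \<T> \<equiv> C\<lparr>Obj := \<T>\<rparr>"

locale linear_category =
  fixes C :: "('k::field, 'o, 'm, 'z) lcat_scheme" (structure)
  assumes Hom_vectorspace:
      "\<lbrakk>X \<in> Obj C; Y \<in> Obj C\<rbrakk> \<Longrightarrow> vectorspace class_ring (Hom C X Y)"
    and Hom_disjoint:
      "\<lbrakk>X \<in> Obj C; Y \<in> Obj C; X' \<in> Obj C; Y' \<in> Obj C; f \<in> Mor C X Y; f \<in> Mor C X' Y'\<rbrakk>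
        \<Longrightarrow> X = X' \<and> Y = Y'"
    and Ident_closed: "X \<in> Obj C \<Longrightarrow> Ident C X \<in> Mor C X X"
    and Comp_linear_left:
      "\<lbrakk>X \<in> Obj C; Y \<in> Obj C; Z \<in> Obj C; f \<in> Mor C X Y\<rbrakk>
        \<Longrightarrow> (\<lambda>g. g \<cdot> f) \<in> lin_maps (Hom C Y Z) (Hom C X Z)"
    and Comp_linear_right:
      "\<lbrakk>X \<in> Obj C; Y \<in> Obj C; Z \<in> Obj C; g \<in> Mor C Y Z\<rbrakk>
        \<Longrightarrow> (\<lambda>f. g \<cdot> f) \<in> lin_maps (Hom C X Y) (Hom C X Z)"
    and Comp_Ident: "\<lbrakk>X \<in> Obj C; Y \<in> Obj C; f \<in> Mor C X Y\<rbrakk> \<Longrightarrow> f \<cdot> Ident C X = f"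
    and Ident_Comp: "\<lbrakk>X \<in> Obj C; Y \<in> Obj C; f \<in> Mor C X Y\<rbrakk> \<Longrightarrow> Ident C Y \<cdot> f = f"
    and Comp_assoc:
      "\<lbrakk>W \<in> Obj C; X \<in> Obj C; Y \<in> Obj C; Z \<in> Obj C;
        f \<in> Mor C W X; g \<in> Mor C X Y; h \<in> Mor C Y Z\<rbrakk> \<Longrightarrow> (h \<cdot> g) \<cdot> f = h \<cdot> (g \<cdot> f)"

definition zero_object :: "('k, 'o, 'm, 'z) lcat_scheme \<Rightarrow> 'o \<Rightarrow> bool" where
  "zero_object C Z \<longleftrightarrow> Z \<in> Obj C \<and> Ident C Z = \<zero>\<^bsub>Hom C Z Z\<^esub>"

definition iso_mor :: "('k, 'o, 'm, 'z) lcat_scheme \<Rightarrow> 'o \<Rightarrow> 'o \<Rightarrow> 'm \<Rightarrow> bool" where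
  "iso_mor C X Y f \<longleftrightarrow> f \<in> Mor C X Y \<and>
     (\<exists>g\<in>Mor C Y X. g \<cdot>\<^bsub>C\<^esub> f = Ident C X \<and> f \<cdot>\<^bsub>C\<^esub> g = Ident C Y)"

definition isomorphic :: "('k, 'o, 'm, 'z) lcat_scheme \<Rightarrow> 'o \<Rightarrow> 'o \<Rightarrow> bool" where
  "isomorphic C X Y \<longleftrightarrow> X \<in> Obj C \<and> Y \<in> Obj C \<and> (\<exists>f. iso_mor C X Y f)"

text \<open>\<open>Z\<close> is the direct sum of \<open>X\<close> and \<open>Y\<close> with inclusions \<open>i\<close>, \<open>j\<close> and projections \<open>p\<close>, \<open>q\<close>.\<close>

definition biproduct ::
  "('k, 'o, 'm, 'z) lcat_scheme \<Rightarrow> 'o \<Rightarrow> 'o \<Rightarrow> 'o \<Rightarrow> 'm \<Rightarrow> 'm \<Rightarrow> 'm \<Rightarrow> 'm \<Rightarrow> bool" where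
  "biproduct C X Y Z i j p q \<longleftrightarrow>
     X \<in> Obj C \<and> Y \<in> Obj C \<and> Z \<in> Obj C \<and>
     i \<in> Mor C X Z \<and> j \<in> Mor C Y Z \<and> p \<in> Mor C Z X \<and> q \<in> Mor C Z Y \<and>
     p \<cdot>\<^bsub>C\<^esub> i = Ident C X \<and> q \<cdot>\<^bsub>C\<^esub> j = Ident C Y \<and>
     q \<cdot>\<^bsub>C\<^esub> i = \<zero>\<^bsub>Hom C X Y\<^esub> \<and> p \<cdot>\<^bsub>C\<^esub> j = \<zero>\<^bsub>Hom C Y X\<^esub> \<and>
     (i \<cdot>\<^bsub>C\<^esub> p) \<oplus>\<^bsub>Hom C Z Z\<^esub> (j \<cdot>\<^bsub>C\<^esub> q) = Ident C Z"

definition is_direct_sum :: "('k, 'o, 'm, 'z) lcat_scheme \<Rightarrow> 'o \<Rightarrow> 'o \<Rightarrow> 'o \<Rightarrow> bool" where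
  "is_direct_sum C X Y Z \<longleftrightarrow> (\<exists>i j p q. biproduct C X Y Z i j p q)"

locale additive_category = linear_category +
  assumes zero_object_exists: "\<exists>Z. zero_object C Z"
    and direct_sum_exists: "\<lbrakk>X \<in> Obj C; Y \<in> Obj C\<rbrakk> \<Longrightarrow> \<exists>Z. is_direct_sum C X Y Z"

definition additively_closed :: "('k, 'o, 'm, 'z) lcat_scheme \<Rightarrow> 'o set \<Rightarrow> bool" where
  "additively_closed C P \<longleftrightarrow>
     P \<subseteq> Obj C \<and> {Z. zero_object C Z} \<subseteq> P \<and>
     (\<forall>X Y Z. is_direct_sum C X Y Z \<longrightarrow> (Z \<in> P \<longleftrightarrow> X \<in> P \<and> Y \<in> P))"

definition idempotent_complete :: "('k, 'o, 'm, 'z) lcat_scheme \<Rightarrow> bool" where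
  "idempotent_complete C \<longleftrightarrow>
     (\<forall>X\<in>Obj C. \<forall>e\<in>Mor C X X. e \<cdot>\<^bsub>C\<^esub> e = e \<longrightarrow>
       (\<exists>Y\<in>Obj C. \<exists>r\<in>Mor C X Y. \<exists>s\<in>Mor C Y X. s \<cdot>\<^bsub>C\<^esub> r = e \<and> r \<cdot>\<^bsub>C\<^esub> s = Ident C Y))"

definition indecomposable :: "('k, 'o, 'm, 'z) lcat_scheme \<Rightarrow> 'o \<Rightarrow> bool" where
  "indecomposable C X \<longleftrightarrow> X \<in> Obj C \<and> \<not> zero_object C X \<and>
     (\<forall>Y Z. is_direct_sum C Y Z X \<longrightarrow> zero_object C Y \<or> zero_object C Z)"

definition local_object :: "('k, 'o, 'm, 'z) lcat_scheme \<Rightarrow> 'o \<Rightarrow> bool" where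
  "local_object C X \<longleftrightarrow> X \<in> Obj C \<and> \<not> zero_object C X \<and>
     (\<forall>f\<in>Mor C X X. \<forall>g\<in>Mor C X X.
        iso_mor C X X (f \<oplus>\<^bsub>Hom C X X\<^esub> g) \<longrightarrow> iso_mor C X X f \<or> iso_mor C X X g)"

definition krull_schmidt :: "('k, 'o, 'm, 'z) lcat_scheme \<Rightarrow> bool" where
  "krull_schmidt C \<longleftrightarrow> (\<forall>Z\<in>Obj C. \<exists>(n::nat) X i p.
     (\<forall>k<n. local_object C (X k) \<and> i k \<in> Mor C (X k) Z \<and> p k \<in> Mor C Z (X k)) \<and>
     (\<forall>k<n. \<forall>l<n. p k \<cdot>\<^bsub>C\<^esub> i l = (if k = l then Ident C (X k) else \<zero>\<^bsub>Hom C (X l) (X k)\<^esub>)) \<and>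
     finsum (Hom C Z Z) (\<lambda>k. i k \<cdot>\<^bsub>C\<^esub> p k) {..<n} = Ident C Z)"


section \<open>The radical\<close>

definition rad :: "('k, 'o, 'm, 'z) lcat_scheme \<Rightarrow> 'o \<Rightarrow> 'o \<Rightarrow> 'm set" where
  "rad C X Y = {f \<in> Mor C X Y. \<forall>g\<in>Mor C Y X. iso_mor C X X (Ident C X \<ominus>\<^bsub>Hom C X X\<^esub> (g \<cdot>\<^bsub>C\<^esub> f))}"

primrec rad_pow :: "('k::field, 'o, 'm, 'z) lcat_scheme \<Rightarrow> nat \<Rightarrow> 'o \<Rightarrow> 'o \<Rightarrow> 'm set" where
  "rad_pow C 0 = (\<lambda>X Y. Mor C X Y)"
| "rad_pow C (Suc n) = (\<lambda>X Y. LinearCombinations.module.span class_ring (Hom C X Y)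
     {g \<cdot>\<^bsub>C\<^esub> f | f g Z. Z \<in> Obj C \<and> f \<in> rad_pow C n X Z \<and> g \<in> rad C Z Y})"

text \<open>The vector space underlying \<open>D\<^sub>X\<close>; the multiplication of \<open>D\<^sub>X\<close> plays no role.\<close>

definition D_space :: "('k::field, 'o, 'm, 'z) lcat_scheme \<Rightarrow> 'o \<Rightarrow> ('k, 'm set) module" where
  "D_space C X = quot_space (Hom C X X) (rad C X X)"


section \<open>Sequences of two morphisms\<close>

definition sequences :: "('k, 'o, 'm, 'z) lcat_scheme \<Rightarrow> 'o \<Rightarrow> 'o \<Rightarrow> ('m \<times> 'm) set" where
  "sequences C Y X = {(x, y). \<exists>E\<in>Obj C. x \<in> Mor C Y E \<and> y \<in> Mor C E X}"

definition seq_mor ::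
  "('k, 'o, 'm, 'z) lcat_scheme \<Rightarrow> 'm \<times> 'm \<Rightarrow> 'm \<times> 'm \<Rightarrow> 'm \<Rightarrow> 'm \<Rightarrow> 'm \<Rightarrow> bool" where
  "seq_mor C s s' a b c \<longleftrightarrow>
     (\<exists>Y\<in>Obj C. \<exists>E\<in>Obj C. \<exists>X\<in>Obj C. \<exists>Y'\<in>Obj C. \<exists>E'\<in>Obj C. \<exists>X'\<in>Obj C.
        fst s \<in> Mor C Y E \<and> snd s \<in> Mor C E X \<and>
        fst s' \<in> Mor C Y' E' \<and> snd s' \<in> Mor C E' X' \<and>
        a \<in> Mor C Y Y' \<and> b \<in> Mor C E E' \<and> c \<in> Mor C X X' \<and>
        b \<cdot>\<^bsub>C\<^esub> fst s = fst s' \<cdot>\<^bsub>C\<^esub> a \<and> c \<cdot>\<^bsub>C\<^esub> snd s = snd s' \<cdot>\<^bsub>C\<^esub> b)"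

definition seq_class ::
  "('k, 'o, 'm, 'z) lcat_scheme \<Rightarrow> 'o \<Rightarrow> 'o \<Rightarrow> 'm \<times> 'm \<Rightarrow> ('m \<times> 'm) set" where
  "seq_class C Y X s =
     {s' \<in> sequences C Y X. \<exists>E E' b. E \<in> Obj C \<and> E' \<in> Obj C \<and> iso_mor C E E' b \<and>
        seq_mor C s s' (Ident C Y) b (Ident C X)}"


section \<open>Extriangulated categories\<close>

text \<open>
  The bifunctor $\mathrm{Ext}^1$ is contravariant in its first and covariant in its second
  argument; \<open>push a \<delta>\<close> is $a_*\delta$ and \<open>pull c \<delta>\<close> is $c^*\delta$. \<open>realise \<delta>\<close>, for \<open>\<delta>\<close> in
  \<open>Ext X Y\<close>, is the equivalence class of sequences \<open>Y \<rightarrow> E \<rightarrow> X\<close> realising \<open>\<delta>\<close>.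
\<close>

record ('k, 'o, 'm, 'e) extri = "('k, 'o, 'm) lcat" +
  Ext :: "'o \<Rightarrow> 'o \<Rightarrow> ('k, 'e) module"
  push :: "'m \<Rightarrow> 'e \<Rightarrow> 'e"
  pull :: "'m \<Rightarrow> 'e \<Rightarrow> 'e"
  realise :: "'e \<Rightarrow> ('m \<times> 'm) set"

definition realises ::
  "('k, 'o, 'm, 'e, 'z) extri_scheme \<Rightarrow> 'o \<Rightarrow> 'o \<Rightarrow> 'o \<Rightarrow> 'm \<Rightarrow> 'm \<Rightarrow> 'e \<Rightarrow> bool" where
  "realises C Y E X x y \<delta> \<longleftrightarrow>
     Y \<in> Obj C \<and> E \<in> Obj C \<and> X \<in> Obj C \<and> x \<in> Mor C Y E \<and> y \<in> Mor C E X \<and>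
     \<delta> \<in> carrier (Ext C X Y) \<and> (x, y) \<in> realise C \<delta>"

definition conflation ::
  "('k, 'o, 'm, 'e, 'z) extri_scheme \<Rightarrow> 'o \<Rightarrow> 'o \<Rightarrow> 'o \<Rightarrow> 'm \<Rightarrow> 'm \<Rightarrow> bool" where
  "conflation C Y E X x y \<longleftrightarrow> (\<exists>\<delta>. realises C Y E X x y \<delta>)"

text \<open>The axioms of Nakaoka and Palu, with values in vector spaces instead of abelian groups.\<close>

locale extriangulated_category = additive_category C
  for C :: "('k::field, 'o, 'm, 'e, 'z) extri_scheme" (structure) +
  assumes Ext_vectorspace:
      "\<lbrakk>X \<in> Obj C; Y \<in> Obj C\<rbrakk> \<Longrightarrow> vectorspace class_ring (Ext C X Y)"
    and Ext_disjoint: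
      "\<lbrakk>X \<in> Obj C; Y \<in> Obj C; X' \<in> Obj C; Y' \<in> Obj C;
        \<delta> \<in> carrier (Ext C X Y); \<delta> \<in> carrier (Ext C X' Y')\<rbrakk> \<Longrightarrow> X = X' \<and> Y = Y'"
    \<comment> \<open>(ET1): \<open>Ext\<close> is a bilinear bifunctor\<close>
    and push_linear:
      "\<lbrakk>X \<in> Obj C; Y \<in> Obj C; Y' \<in> Obj C; a \<in> Mor C Y Y'\<rbrakk>
        \<Longrightarrow> push C a \<in> lin_maps (Ext C X Y) (Ext C X Y')"
    and push_linear_mor:
      "\<lbrakk>X \<in> Obj C; Y \<in> Obj C; Y' \<in> Obj C; \<delta> \<in> carrier (Ext C X Y)\<rbrakk>
        \<Longrightarrow> (\<lambda>a. push C a \<delta>) \<in> lin_maps (Hom C Y Y') (Ext C X Y')"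
    and push_Ident:
      "\<lbrakk>X \<in> Obj C; Y \<in> Obj C; \<delta> \<in> carrier (Ext C X Y)\<rbrakk> \<Longrightarrow> push C (Ident C Y) \<delta> = \<delta>"
    and push_Comp:
      "\<lbrakk>X \<in> Obj C; Y \<in> Obj C; Y' \<in> Obj C; Y'' \<in> Obj C; a \<in> Mor C Y Y'; b \<in> Mor C Y' Y'';
        \<delta> \<in> carrier (Ext C X Y)\<rbrakk> \<Longrightarrow> push C (b \<cdot> a) \<delta> = push C b (push C a \<delta>)"
    and pull_linear:
      "\<lbrakk>X \<in> Obj C; X' \<in> Obj C; Y \<in> Obj C; c \<in> Mor C X' X\<rbrakk>
        \<Longrightarrow> pull C c \<in> lin_maps (Ext C X Y) (Ext C X' Y)"
    and pull_linear_mor: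
      "\<lbrakk>X \<in> Obj C; X' \<in> Obj C; Y \<in> Obj C; \<delta> \<in> carrier (Ext C X Y)\<rbrakk>
        \<Longrightarrow> (\<lambda>c. pull C c \<delta>) \<in> lin_maps (Hom C X' X) (Ext C X' Y)"
    and pull_Ident:
      "\<lbrakk>X \<in> Obj C; Y \<in> Obj C; \<delta> \<in> carrier (Ext C X Y)\<rbrakk> \<Longrightarrow> pull C (Ident C X) \<delta> = \<delta>"
    and pull_Comp:
      "\<lbrakk>X \<in> Obj C; X' \<in> Obj C; X'' \<in> Obj C; Y \<in> Obj C; c \<in> Mor C X' X; d \<in> Mor C X'' X';
        \<delta> \<in> carrier (Ext C X Y)\<rbrakk> \<Longrightarrow> pull C (c \<cdot> d) \<delta> = pull C d (pull C c \<delta>)"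
    and pull_push:
      "\<lbrakk>X \<in> Obj C; X' \<in> Obj C; Y \<in> Obj C; Y' \<in> Obj C; c \<in> Mor C X' X; a \<in> Mor C Y Y';
        \<delta> \<in> carrier (Ext C X Y)\<rbrakk> \<Longrightarrow> pull C c (push C a \<delta>) = push C a (pull C c \<delta>)"
    \<comment> \<open>(ET2): \<open>realise\<close> is an additive realisation\<close>
    and realise_class:
      "\<lbrakk>X \<in> Obj C; Y \<in> Obj C; \<delta> \<in> carrier (Ext C X Y)\<rbrakk>
        \<Longrightarrow> \<exists>s\<in>sequences C Y X. realise C \<delta> = seq_class C Y X s"
    and realise_mor:
      "\<lbrakk>realises C Y E X x y \<delta>; realises C Y' E' X' x' y' \<delta>';
        a \<in> Mor C Y Y'; c \<in> Mor C X X'; push C a \<delta> = pull C c \<delta>'\<rbrakk>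
        \<Longrightarrow> \<exists>b. seq_mor C (x, y) (x', y') a b c"
    and realise_zero:
      "biproduct C Y X E i j p q \<Longrightarrow> (i, q) \<in> realise C (\<zero>\<^bsub>Ext C X Y\<^esub>)"
    and realise_sum:
      "\<lbrakk>realises C Y E X x y \<delta>; realises C Y' E' X' x' y' \<delta>';
        biproduct C Y Y' Y2 iY jY pY qY; biproduct C E E' E2 iE jE pE qE;
        biproduct C X X' X2 iX jX pX qX\<rbrakk>
        \<Longrightarrow> ((iE \<cdot> x \<cdot> pY) \<oplus>\<^bsub>Hom C Y2 E2\<^esub> (jE \<cdot> x' \<cdot> qY),
             (iX \<cdot> y \<cdot> pE) \<oplus>\<^bsub>Hom C E2 X2\<^esub> (jX \<cdot> y' \<cdot> qE))
           \<in> realise C (push C iY (pull C pX \<delta>) \<oplus>\<^bsub>Ext C X2 Y2\<^esub> push C jY (pull C qX \<delta>'))"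
    and ET3:
      "\<lbrakk>realises C Y E X x y \<delta>; realises C Y' E' X' x' y' \<delta>';
        a \<in> Mor C Y Y'; b \<in> Mor C E E'; b \<cdot> x = x' \<cdot> a\<rbrakk>
        \<Longrightarrow> \<exists>c\<in>Mor C X X'. c \<cdot> y = y' \<cdot> b \<and> push C a \<delta> = pull C c \<delta>'"
    and ET3_op:
      "\<lbrakk>realises C Y E X x y \<delta>; realises C Y' E' X' x' y' \<delta>';
        b \<in> Mor C E E'; c \<in> Mor C X X'; c \<cdot> y = y' \<cdot> b\<rbrakk>
        \<Longrightarrow> \<exists>a\<in>Mor C Y Y'. b \<cdot> x = x' \<cdot> a \<and> push C a \<delta> = pull C c \<delta>'"
    and ET4:
      "\<lbrakk>realises C A B D f f' \<delta>; realises C B G F g g' \<delta>'\<rbrakk>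
        \<Longrightarrow> \<exists>E d e h' \<delta>''. realises C A G E (g \<cdot> f) h' \<delta>'' \<and>
             realises C D E F d e (push C f' \<delta>') \<and>
             h' \<cdot> g = d \<cdot> f' \<and> e \<cdot> h' = g' \<and>
             pull C d \<delta>'' = \<delta> \<and> push C f \<delta>'' = pull C e \<delta>'"
    and ET4_op:
      "\<lbrakk>realises C D A B f' f \<delta>; realises C F B G g' g \<delta>'\<rbrakk>
        \<Longrightarrow> \<exists>E d e h' \<delta>''. realises C E A G h' (g \<cdot> f) \<delta>'' \<and>
             realises C D E F d e (pull C g' \<delta>) \<and>
             h' \<cdot> d = f' \<and> f \<cdot> h' = g' \<cdot> e \<and>
             push C e \<delta>'' = \<delta>' \<and> push C d \<delta> = pull C g \<delta>''"

definition projective :: "('k, 'o, 'm, 'e, 'z) extri_scheme \<Rightarrow> 'o \<Rightarrow> bool" where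
  "projective C P \<longleftrightarrow> P \<in> Obj C \<and> (\<forall>Y\<in>Obj C. carrier (Ext C P Y) = {\<zero>\<^bsub>Ext C P Y\<^esub>})"

definition injective :: "('k, 'o, 'm, 'e, 'z) extri_scheme \<Rightarrow> 'o \<Rightarrow> bool" where
  "injective C P \<longleftrightarrow> P \<in> Obj C \<and> (\<forall>X\<in>Obj C. carrier (Ext C X P) = {\<zero>\<^bsub>Ext C X P\<^esub>})"

definition frobenius :: "('k, 'o, 'm, 'e, 'z) extri_scheme \<Rightarrow> bool" where
  "frobenius C \<longleftrightarrow>
     (\<forall>X\<in>Obj C. \<exists>Y P x y. projective C P \<and> conflation C Y P X x y) \<and>
     (\<forall>X\<in>Obj C. \<exists>I Y x y. injective C I \<and> conflation C X I Y x y) \<and>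
     (\<forall>P. projective C P \<longleftrightarrow> injective C P)"


section \<open>Quotients by projective-injective objects\<close>

definition factoring :: "('k, 'o, 'm, 'z) lcat_scheme \<Rightarrow> 'o set \<Rightarrow> 'o \<Rightarrow> 'o \<Rightarrow> 'm set" where
  "factoring C P X Y =
     {f \<in> Mor C X Y. \<exists>Z\<in>P. \<exists>g\<in>Mor C X Z. \<exists>h\<in>Mor C Z Y. f = h \<cdot>\<^bsub>C\<^esub> g}"

definition quot_mor :: "('k, 'o, 'm, 'z) lcat_scheme \<Rightarrow> 'o set \<Rightarrow> 'o \<Rightarrow> 'o \<Rightarrow> 'm \<Rightarrow> 'm set" where
  "quot_mor C P X Y f = factoring C P X Y +>\<^bsub>Hom C X Y\<^esub> f"

definition quot_lcat ::
  "('k::field, 'o, 'm, 'z) lcat_scheme \<Rightarrow> 'o set \<Rightarrow> ('k, 'o, 'm set) lcat" where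
  "quot_lcat C P =
    \<lparr>Obj = Obj C,
     Hom = (\<lambda>X Y. quot_space (Hom C X Y) (factoring C P X Y)),
     Comp = (\<lambda>G F. {h. \<exists>g\<in>G. \<exists>f\<in>F. \<exists>X\<in>Obj C. \<exists>Z\<in>Obj C.
               g \<cdot>\<^bsub>C\<^esub> f \<in> Mor C X Z \<and> h \<in> quot_mor C P X Z (g \<cdot>\<^bsub>C\<^esub> f)}),
     Ident = (\<lambda>X. quot_mor C P X X (Ident C X))\<rparr>"

text \<open>
  For an additively closed subcategory \<open>P\<close> of projective-injective objects the action of a morphism
  on \<open>Ext\<close> depends only on its class, so the images below are singletons.
\<close>

definition quotient ::
  "('k::field, 'o, 'm, 'e, 'z) extri_scheme \<Rightarrow> 'o set \<Rightarrow> ('k, 'o, 'm set, 'e) extri" where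
  "quotient C P =
    \<lparr>Obj = Obj (quot_lcat C P), Hom = Hom (quot_lcat C P),
     Comp = Comp (quot_lcat C P), Ident = Ident (quot_lcat C P),
     Ext = Ext C,
     push = (\<lambda>A \<delta>. the_elem ((\<lambda>a. push C a \<delta>) ` A)),
     pull = (\<lambda>A \<delta>. the_elem ((\<lambda>a. pull C a \<delta>) ` A)),
     realise = (\<lambda>\<delta>. \<Union>{seq_class (quot_lcat C P) Y X (quot_mor C P Y E x, quot_mor C P E X y)
                        | Y E X x y. realises C Y E X x y \<delta>})\<rparr>"

abbreviation stable_category ::
  "('k::field, 'o, 'm, 'e, 'z) extri_scheme \<Rightarrow> ('k, 'o, 'm set, 'e) extri" where
  "stable_category C \<equiv> quotient C {P. projective C P}"


section \<open>Exact categories as extriangulated categories\<close>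

definition kernel_of ::
  "('k, 'o, 'm, 'z) lcat_scheme \<Rightarrow> 'o \<Rightarrow> 'o \<Rightarrow> 'o \<Rightarrow> 'm \<Rightarrow> 'm \<Rightarrow> bool" where
  "kernel_of C Y Z X i p \<longleftrightarrow> i \<in> Mor C Y Z \<and> p \<in> Mor C Z X \<and> p \<cdot>\<^bsub>C\<^esub> i = \<zero>\<^bsub>Hom C Y X\<^esub> \<and>
     (\<forall>W\<in>Obj C. \<forall>f\<in>Mor C W Z. p \<cdot>\<^bsub>C\<^esub> f = \<zero>\<^bsub>Hom C W X\<^esub> \<longrightarrow> (\<exists>!g. g \<in> Mor C W Y \<and> i \<cdot>\<^bsub>C\<^esub> g = f))"

definition cokernel_of ::
  "('k, 'o, 'm, 'z) lcat_scheme \<Rightarrow> 'o \<Rightarrow> 'o \<Rightarrow> 'o \<Rightarrow> 'm \<Rightarrow> 'm \<Rightarrow> bool" where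
  "cokernel_of C Y Z X i p \<longleftrightarrow> i \<in> Mor C Y Z \<and> p \<in> Mor C Z X \<and> p \<cdot>\<^bsub>C\<^esub> i = \<zero>\<^bsub>Hom C Y X\<^esub> \<and>
     (\<forall>W\<in>Obj C. \<forall>f\<in>Mor C Z W. f \<cdot>\<^bsub>C\<^esub> i = \<zero>\<^bsub>Hom C Y W\<^esub> \<longrightarrow> (\<exists>!g. g \<in> Mor C X W \<and> g \<cdot>\<^bsub>C\<^esub> p = f))"

text \<open>The commutative square \<open>b \<cdot> i = i' \<cdot> a\<close> with \<open>i : Y \<rightarrow> Z\<close>, \<open>a : Y \<rightarrow> Y'\<close>.\<close>

definition pushout ::
  "('k, 'o, 'm, 'z) lcat_scheme \<Rightarrow> 'o \<Rightarrow> 'o \<Rightarrow> 'o \<Rightarrow> 'o \<Rightarrow> 'm \<Rightarrow> 'm \<Rightarrow> 'm \<Rightarrow> 'm \<Rightarrow> bool" where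
  "pushout C Y Z Y' Z' i a b i' \<longleftrightarrow>
     i \<in> Mor C Y Z \<and> a \<in> Mor C Y Y' \<and> b \<in> Mor C Z Z' \<and> i' \<in> Mor C Y' Z' \<and>
     b \<cdot>\<^bsub>C\<^esub> i = i' \<cdot>\<^bsub>C\<^esub> a \<and>
     (\<forall>W\<in>Obj C. \<forall>u\<in>Mor C Z W. \<forall>v\<in>Mor C Y' W. u \<cdot>\<^bsub>C\<^esub> i = v \<cdot>\<^bsub>C\<^esub> a \<longrightarrow>
        (\<exists>!w. w \<in> Mor C Z' W \<and> w \<cdot>\<^bsub>C\<^esub> b = u \<and> w \<cdot>\<^bsub>C\<^esub> i' = v))"

text \<open>The commutative square \<open>p \<cdot> b = c \<cdot> p'\<close> with \<open>p : Z \<rightarrow> X\<close>, \<open>c : X' \<rightarrow> X\<close>.\<close>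

definition pullback ::
  "('k, 'o, 'm, 'z) lcat_scheme \<Rightarrow> 'o \<Rightarrow> 'o \<Rightarrow> 'o \<Rightarrow> 'o \<Rightarrow> 'm \<Rightarrow> 'm \<Rightarrow> 'm \<Rightarrow> 'm \<Rightarrow> bool" where
  "pullback C Z X Z' X' p c b p' \<longleftrightarrow>
     p \<in> Mor C Z X \<and> c \<in> Mor C X' X \<and> b \<in> Mor C Z' Z \<and> p' \<in> Mor C Z' X' \<and>
     p \<cdot>\<^bsub>C\<^esub> b = c \<cdot>\<^bsub>C\<^esub> p' \<and>
     (\<forall>W\<in>Obj C. \<forall>u\<in>Mor C W Z. \<forall>v\<in>Mor C W X'. p \<cdot>\<^bsub>C\<^esub> u = c \<cdot>\<^bsub>C\<^esub> v \<longrightarrow>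
        (\<exists>!w. w \<in> Mor C W Z' \<and> b \<cdot>\<^bsub>C\<^esub> w = u \<and> p' \<cdot>\<^bsub>C\<^esub> w = v))"

text \<open>Quillen's axioms for the class \<open>S\<close> of conflations \<open>(i, p)\<close>.\<close>

locale exact_category = additive_category C
  for C :: "('k::field, 'o, 'm, 'z) lcat_scheme" (structure) +
  fixes S :: "('m \<times> 'm) set"
  assumes kernel_cokernel:
      "(i, p) \<in> S \<Longrightarrow> \<exists>Y\<in>Obj C. \<exists>Z\<in>Obj C. \<exists>X\<in>Obj C. kernel_of C Y Z X i p \<and> cokernel_of C Y Z X i p"
    and iso_closed:
      "\<lbrakk>(i, p) \<in> S; seq_mor C (i, p) (i', p') a b c; iso_mor C Y Y' a; iso_mor C Z Z' b;
        iso_mor C X X' c; {Y, Y', Z, Z', X, X'} \<subseteq> Obj C\<rbrakk> \<Longrightarrow> (i', p') \<in> S"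
    and Ident_inflation: "X \<in> Obj C \<Longrightarrow> \<exists>p. (Ident C X, p) \<in> S"
    and Ident_deflation: "X \<in> Obj C \<Longrightarrow> \<exists>i. (i, Ident C X) \<in> S"
    and inflation_Comp:
      "\<lbrakk>(i, p) \<in> S; (j, q) \<in> S; X \<in> Obj C; Y \<in> Obj C; Z \<in> Obj C; i \<in> Mor C X Y; j \<in> Mor C Y Z\<rbrakk>
        \<Longrightarrow> \<exists>r. (j \<cdot> i, r) \<in> S"
    and deflation_Comp:
      "\<lbrakk>(i, p) \<in> S; (j, q) \<in> S; X \<in> Obj C; Y \<in> Obj C; Z \<in> Obj C; p \<in> Mor C X Y; q \<in> Mor C Y Z\<rbrakk>
        \<Longrightarrow> \<exists>k. (k, q \<cdot> p) \<in> S"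
    and inflation_pushout:
      "\<lbrakk>(i, p) \<in> S; Y \<in> Obj C; Z \<in> Obj C; Y' \<in> Obj C; i \<in> Mor C Y Z; a \<in> Mor C Y Y'\<rbrakk>
        \<Longrightarrow> \<exists>Z'\<in>Obj C. \<exists>b i' p'. pushout C Y Z Y' Z' i a b i' \<and> (i', p') \<in> S"
    and deflation_pullback:
      "\<lbrakk>(i, p) \<in> S; Z \<in> Obj C; X \<in> Obj C; X' \<in> Obj C; p \<in> Mor C Z X; c \<in> Mor C X' X\<rbrakk>
        \<Longrightarrow> \<exists>Z'\<in>Obj C. \<exists>b i' p'. pullback C Z X Z' X' p c b p' \<and> (i', p') \<in> S"

text \<open>
  The extensions of an exact category are the Yoneda classes of conflations. The sets of conflations
  defining \<open>yoneda_push\<close> and \<open>yoneda_pull\<close> are again single Yoneda classes, because a morphism of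
  conflations which is the identity at one end is a pushout or pullback. The sum is the Baer sum.
\<close>

definition yoneda_push ::
  "('k, 'o, 'm, 'z) lcat_scheme \<Rightarrow> ('m \<times> 'm) set \<Rightarrow> 'm \<Rightarrow> ('m \<times> 'm) set \<Rightarrow> ('m \<times> 'm) set" where
  "yoneda_push C S a \<xi> = {s'\<in>S. \<exists>s\<in>\<xi>. \<exists>b. \<exists>X\<in>Obj C. seq_mor C s s' a b (Ident C X)}"

definition yoneda_pull ::
  "('k, 'o, 'm, 'z) lcat_scheme \<Rightarrow> ('m \<times> 'm) set \<Rightarrow> 'm \<Rightarrow> ('m \<times> 'm) set \<Rightarrow> ('m \<times> 'm) set" where
  "yoneda_pull C S c \<xi> = {s'\<in>S. \<exists>s\<in>\<xi>. \<exists>b. \<exists>Y\<in>Obj C. seq_mor C s' s (Ident C Y) b c}"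

definition baer_sum ::
  "('k, 'o, 'm, 'z) lcat_scheme \<Rightarrow> ('m \<times> 'm) set \<Rightarrow> 'o \<Rightarrow> 'o \<Rightarrow>
     ('m \<times> 'm) set \<Rightarrow> ('m \<times> 'm) set \<Rightarrow> ('m \<times> 'm) set" where
  "baer_sum C S X Y \<xi> \<eta> =
     {s. \<exists>x y E x' y' E' Y2 iY jY pY qY E2 iE jE pE qE X2 iX jX pX qX.
        (x, y) \<in> \<xi> \<and> (x', y') \<in> \<eta> \<and>
        biproduct C Y Y Y2 iY jY pY qY \<and>
        biproduct C E E' E2 iE jE pE qE \<and>
        biproduct C X X X2 iX jX pX qX \<and>
        x \<in> Mor C Y E \<and> y \<in> Mor C E X \<and> x' \<in> Mor C Y E' \<and> y' \<in> Mor C E' X \<and>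
        s \<in> yoneda_push C S (pY \<oplus>\<^bsub>Hom C Y2 Y\<^esub> qY)
              (yoneda_pull C S (iX \<oplus>\<^bsub>Hom C X X2\<^esub> jX)
                {((iE \<cdot>\<^bsub>C\<^esub> x \<cdot>\<^bsub>C\<^esub> pY) \<oplus>\<^bsub>Hom C Y2 E2\<^esub> (jE \<cdot>\<^bsub>C\<^esub> x' \<cdot>\<^bsub>C\<^esub> qY),
                  (iX \<cdot>\<^bsub>C\<^esub> y \<cdot>\<^bsub>C\<^esub> pE) \<oplus>\<^bsub>Hom C E2 X2\<^esub> (jX \<cdot>\<^bsub>C\<^esub> y' \<cdot>\<^bsub>C\<^esub> qE))})}"

definition extri_of_exact ::
  "('k, 'o, 'm) lcat \<Rightarrow> ('m \<times> 'm) set \<Rightarrow> ('k, 'o, 'm, ('m \<times> 'm) set) extri" where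
  "extri_of_exact C S =
    \<lparr>Obj = Obj C, Hom = Hom C, Comp = Comp C, Ident = Ident C,
     Ext = (\<lambda>X Y.
       \<lparr>carrier = seq_class C Y X ` (S \<inter> sequences C Y X), monoid.mult = undefined, monoid.one = undefined,
        ring.zero = {(i, p) \<in> S \<inter> sequences C Y X.
                  \<exists>Z\<in>Obj C. p \<in> Mor C Z X \<and> (\<exists>s\<in>Mor C X Z. p \<cdot>\<^bsub>C\<^esub> s = Ident C X)},
        ring.add = baer_sum C S X Y,
        module.smult = (\<lambda>c. yoneda_push C S (c \<odot>\<^bsub>Hom C Y Y\<^esub> Ident C Y))\<rparr>),
     push = yoneda_push C S,
     pull = yoneda_pull C S,
     realise = (\<lambda>\<xi>. \<xi>)\<rparr>"


section \<open>Equivalences and algebraic extriangulated categories\<close>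

definition linear_functor ::
  "('k::field, 'o, 'm, 'z) lcat_scheme \<Rightarrow> ('k, 'p, 'n, 'y) lcat_scheme \<Rightarrow>
     ('o \<Rightarrow> 'p) \<Rightarrow> ('m \<Rightarrow> 'n) \<Rightarrow> bool" where
  "linear_functor C D Fo Fm \<longleftrightarrow>
     Fo \<in> Obj C \<rightarrow> Obj D \<and>
     (\<forall>X\<in>Obj C. \<forall>Y\<in>Obj C. Fm \<in> lin_maps (Hom C X Y) (Hom D (Fo X) (Fo Y))) \<and>
     (\<forall>X\<in>Obj C. Fm (Ident C X) = Ident D (Fo X)) \<and>
     (\<forall>X\<in>Obj C. \<forall>Y\<in>Obj C. \<forall>Z\<in>Obj C. \<forall>f\<in>Mor C X Y. \<forall>g\<in>Mor C Y Z.
        Fm (g \<cdot>\<^bsub>C\<^esub> f) = Fm g \<cdot>\<^bsub>D\<^esub> Fm f)"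

definition linear_equivalence ::
  "('k::field, 'o, 'm, 'z) lcat_scheme \<Rightarrow> ('k, 'p, 'n, 'y) lcat_scheme \<Rightarrow>
     ('o \<Rightarrow> 'p) \<Rightarrow> ('m \<Rightarrow> 'n) \<Rightarrow> bool" where
  "linear_equivalence C D Fo Fm \<longleftrightarrow> linear_functor C D Fo Fm \<and>
     (\<forall>X\<in>Obj C. \<forall>Y\<in>Obj C. bij_betw Fm (Mor C X Y) (Mor D (Fo X) (Fo Y))) \<and>
     (\<forall>Z\<in>Obj D. \<exists>X\<in>Obj C. isomorphic D (Fo X) Z)"

definition extri_equivalence ::
  "('k::field, 'o, 'm, 'e, 'z) extri_scheme \<Rightarrow> ('k, 'p, 'n, 'd, 'y) extri_scheme \<Rightarrow>
     ('o \<Rightarrow> 'p) \<Rightarrow> ('m \<Rightarrow> 'n) \<Rightarrow> ('e \<Rightarrow> 'd) \<Rightarrow> bool" where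
  "extri_equivalence C D Fo Fm \<Gamma> \<longleftrightarrow> linear_equivalence C D Fo Fm \<and>
     (\<forall>X\<in>Obj C. \<forall>Y\<in>Obj C. \<Gamma> \<in> lin_maps (Ext C X Y) (Ext D (Fo X) (Fo Y)) \<and>
        bij_betw \<Gamma> (carrier (Ext C X Y)) (carrier (Ext D (Fo X) (Fo Y)))) \<and>
     (\<forall>X\<in>Obj C. \<forall>Y\<in>Obj C. \<forall>Y'\<in>Obj C. \<forall>a\<in>Mor C Y Y'. \<forall>\<delta>\<in>carrier (Ext C X Y).
        \<Gamma> (push C a \<delta>) = push D (Fm a) (\<Gamma> \<delta>)) \<and>
     (\<forall>X\<in>Obj C. \<forall>X'\<in>Obj C. \<forall>Y\<in>Obj C. \<forall>c\<in>Mor C X' X. \<forall>\<delta>\<in>carrier (Ext C X Y).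
        \<Gamma> (pull C c \<delta>) = pull D (Fm c) (\<Gamma> \<delta>)) \<and>
     (\<forall>Y E X x y \<delta>. realises C Y E X x y \<delta> \<longrightarrow>
        realises D (Fo Y) (Fo E) (Fo X) (Fm x) (Fm y) (\<Gamma> \<delta>))"

text \<open>
  HOL cannot quantify over types inside a formula, so the types carrying the objects and morphisms
  of the exact category are parameters. A theorem with this hypothesis is polymorphic in them, which
  amounts to the existential quantification over all (small) exact categories.
\<close>

definition algebraic ::
  "'p itself \<Rightarrow> 'n itself \<Rightarrow> ('k::field, 'o, 'm, 'e, 'z) extri_scheme \<Rightarrow> bool" where
  "algebraic _ _ C \<longleftrightarrow>
     (\<exists>(A :: ('k, 'p, 'n) lcat) S P Fo Fm \<Gamma>.
        exact_category A S \<and> additively_closed A P \<and>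
        (\<forall>X\<in>P. projective (extri_of_exact A S) X \<and> injective (extri_of_exact A S) X) \<and>
        extri_equivalence (quotient (extri_of_exact A S) P) C Fo Fm \<Gamma>)"


section \<open>Cluster categories\<close>

definition hom_finite :: "('k::field, 'o, 'm, 'z) lcat_scheme \<Rightarrow> bool" where
  "hom_finite C \<longleftrightarrow> (\<forall>X\<in>Obj C. \<forall>Y\<in>Obj C. vectorspace.fin_dim class_ring (Hom C X Y))"

text \<open>
  The suspension of a triangulated category, regarded as an extriangulated one, is the functor
  \<open>(\<Sigma>o, \<Sigma>m)\<close> with $\mathrm{Ext}^1(X,Y) = \mathrm{Hom}(X,\Sigma Y)$ naturally in both arguments. By
  the Yoneda lemma this identification is pullback of universal elements \<open>\<sigma> Y\<close> in \<open>Ext (\<Sigma>o Y) Y\<close>,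
  and naturality in the second argument is the last clause.
\<close>

definition suspension ::
  "('k, 'o, 'm, 'e, 'z) extri_scheme \<Rightarrow> ('o \<Rightarrow> 'o) \<Rightarrow> ('m \<Rightarrow> 'm) \<Rightarrow> ('o \<Rightarrow> 'e) \<Rightarrow> bool" where
  "suspension C \<Sigma>o \<Sigma>m \<sigma> \<longleftrightarrow>
     (\<forall>Y\<in>Obj C. \<Sigma>o Y \<in> Obj C \<and> \<sigma> Y \<in> carrier (Ext C (\<Sigma>o Y) Y) \<and>
        (\<forall>X\<in>Obj C. bij_betw (\<lambda>g. pull C g (\<sigma> Y)) (Mor C X (\<Sigma>o Y)) (carrier (Ext C X Y)))) \<and>
     (\<forall>Y\<in>Obj C. \<forall>Y'\<in>Obj C. \<forall>f\<in>Mor C Y Y'.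
        \<Sigma>m f \<in> Mor C (\<Sigma>o Y) (\<Sigma>o Y') \<and> pull C (\<Sigma>m f) (\<sigma> Y') = push C f (\<sigma> Y))"

definition two_calabi_yau :: "('k::field, 'o, 'm, 'e, 'z) extri_scheme \<Rightarrow> bool" where
  "two_calabi_yau C \<longleftrightarrow>
     (\<exists>\<Sigma>o \<Sigma>m \<sigma> \<phi>. suspension C \<Sigma>o \<Sigma>m \<sigma> \<and>
       (\<forall>X\<in>Obj C. \<forall>Y\<in>Obj C.
          \<phi> X Y \<in> lin_maps (Hom C X Y) (dual_space (Hom C Y (\<Sigma>o (\<Sigma>o X)))) \<and>
          bij_betw (\<phi> X Y) (Mor C X Y) (carrier (dual_space (Hom C Y (\<Sigma>o (\<Sigma>o X)))))) \<and>
       (\<forall>X\<in>Obj C. \<forall>X'\<in>Obj C. \<forall>Y\<in>Obj C. \<forall>Y'\<in>Obj C.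
          \<forall>h\<in>Mor C X' X. \<forall>f\<in>Mor C X Y. \<forall>g\<in>Mor C Y Y'. \<forall>u\<in>Mor C Y' (\<Sigma>o (\<Sigma>o X')).
            \<phi> X' Y' (g \<cdot>\<^bsub>C\<^esub> f \<cdot>\<^bsub>C\<^esub> h) u = \<phi> X Y f (\<Sigma>m (\<Sigma>m h) \<cdot>\<^bsub>C\<^esub> u \<cdot>\<^bsub>C\<^esub> g)))"

definition ext_zero :: "('k, 'o, 'm, 'e, 'z) extri_scheme \<Rightarrow> 'o \<Rightarrow> 'o \<Rightarrow> bool" where
  "ext_zero C X Y \<longleftrightarrow> carrier (Ext C X Y) = {\<zero>\<^bsub>Ext C X Y\<^esub>}"

definition cluster_tilting :: "('k, 'o, 'm, 'e, 'z) extri_scheme \<Rightarrow> 'o set \<Rightarrow> bool" where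
  "cluster_tilting C \<T> \<longleftrightarrow>
     \<T> = {X \<in> Obj C. \<forall>T\<in>\<T>. ext_zero C T X} \<and>
     \<T> = {X \<in> Obj C. \<forall>T\<in>\<T>. ext_zero C X T} \<and>
     (\<forall>X\<in>Obj C. \<exists>T\<in>\<T>. \<exists>f\<in>Mor C X T.
        (\<forall>T'\<in>\<T>. \<forall>g\<in>Mor C X T'. \<exists>h\<in>Mor C T T'. g = h \<cdot>\<^bsub>C\<^esub> f) \<and>
        (\<exists>Y y. conflation C X T Y f y)) \<and>
     (\<forall>X\<in>Obj C. \<exists>T\<in>\<T>. \<exists>f\<in>Mor C T X.
        (\<forall>T'\<in>\<T>. \<forall>g\<in>Mor C T' X. \<exists>h\<in>Mor C T' T. g = f \<cdot>\<^bsub>C\<^esub> h) \<and>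
        (\<exists>Y y. conflation C Y T X y f))"

definition cluster_category ::
  "'p itself \<Rightarrow> 'n itself \<Rightarrow> ('k::field, 'o, 'm, 'e, 'z) extri_scheme \<Rightarrow> bool" where
  "cluster_category tp tn C \<longleftrightarrow>
     extriangulated_category C \<and> idempotent_complete C \<and> algebraic tp tn C \<and> frobenius C \<and>
     (\<exists>\<T>. cluster_tilting C \<T>) \<and>
     hom_finite (stable_category C) \<and> two_calabi_yau (stable_category C)"


section \<open>Compactness and skew-symmetry\<close>

text \<open>
  The base field carries the discrete topology. The isomorphism with the inverse limit is the
  canonical one, where the limit is the space of compatible families of cosets, with the quotients
  by open subspaces being discrete.
\<close>

definition pseudocompact_space :: "('k::field, 'v) module \<Rightarrow> 'v topology \<Rightarrow> bool" where
  "pseudocompact_space V \<tau> \<longleftrightarrow>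
     topspace \<tau> = carrier V \<and>
     continuous_map (prod_topology \<tau> \<tau>) \<tau> (\<lambda>(u, v). u \<oplus>\<^bsub>V\<^esub> v) \<and>
     continuous_map (prod_topology (discrete_topology UNIV) \<tau>) \<tau> (\<lambda>(c, v). c \<odot>\<^bsub>V\<^esub> v) \<and>
     Hausdorff_space \<tau> \<and>
     (\<exists>\<U>. \<U> \<noteq> {} \<and>
        (\<forall>U\<in>\<U>. \<forall>U'\<in>\<U>. \<exists>U''\<in>\<U>. U'' \<subseteq> U \<inter> U') \<and>
        (\<forall>U\<in>\<U>. VectorSpace.subspace class_ring U V \<and> openin \<tau> U \<and>
            vectorspace.fin_dim class_ring (quot_space V U)) \<and>
        homeomorphic_map \<tau>
          (subtopology (product_topology (\<lambda>U. discrete_topology (a_rcosets\<^bsub>V\<^esub> U)) \<U>)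
             {c. \<forall>U\<in>\<U>. \<forall>U'\<in>\<U>. U \<subseteq> U' \<longrightarrow> c U \<subseteq> c U'})
          (\<lambda>v. \<lambda>U\<in>\<U>. U +>\<^bsub>V\<^esub> v))"

definition pseudocompact_homs ::
  "('k::field, 'o, 'm, 'z) lcat_scheme \<Rightarrow> ('o \<Rightarrow> 'o \<Rightarrow> 'm topology) \<Rightarrow> bool" where
  "pseudocompact_homs C \<tau> \<longleftrightarrow>
     (\<forall>X\<in>Obj C. \<forall>Y\<in>Obj C. pseudocompact_space (Hom C X Y) (\<tau> X Y)) \<and>
     (\<forall>X\<in>Obj C. \<forall>Y\<in>Obj C. \<forall>Z\<in>Obj C.
        continuous_map (prod_topology (\<tau> Y Z) (\<tau> X Y)) (\<tau> X Z) (\<lambda>(g, f). g \<cdot>\<^bsub>C\<^esub> f))"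

definition pseudocompact :: "('k::field, 'o, 'm, 'z) lcat_scheme \<Rightarrow> bool" where
  "pseudocompact C \<longleftrightarrow> (\<exists>\<tau>. pseudocompact_homs C \<tau>)"

definition radically_pseudocompact :: "('k::field, 'o, 'm, 'z) lcat_scheme \<Rightarrow> bool" where
  "radically_pseudocompact C \<longleftrightarrow>
     (\<exists>\<tau>. pseudocompact_homs C \<tau> \<and>
        (\<forall>X\<in>Obj C. \<forall>Y\<in>Obj C. \<forall>U. openin (\<tau> X Y) U \<longleftrightarrow>
           U \<subseteq> Mor C X Y \<and> (\<forall>f\<in>U. \<exists>n. rad_pow C n X Y +>\<^bsub>Hom C X Y\<^esub> f \<subseteq> U)))"

definition compact_cluster_category ::
  "'p itself \<Rightarrow> 'n itself \<Rightarrow> ('k::field, 'o, 'm, 'e, 'z) extri_scheme \<Rightarrow> bool" where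
  "compact_cluster_category tp tn C \<longleftrightarrow>
     cluster_category tp tn C \<and> pseudocompact C \<and>
     (\<forall>X\<in>Obj C. vectorspace.fin_dim class_ring (D_space C X)) \<and>
     (\<forall>\<T>. cluster_tilting C \<T> \<longrightarrow> radically_pseudocompact (full_sub C \<T>))"

definition skew_symmetric_cluster_category ::
  "'p itself \<Rightarrow> 'n itself \<Rightarrow> ('k::field, 'o, 'm, 'e, 'z) extri_scheme \<Rightarrow> bool" where
  "skew_symmetric_cluster_category tp tn C \<longleftrightarrow>
     cluster_category tp tn C \<and> krull_schmidt C \<and>
     (\<forall>X. indecomposable C X \<longrightarrow>
        vectorspace.fin_dim class_ring (D_space C X) \<and>
        vectorspace.dim class_ring (D_space C X) = 1)"


section \<open>Grothendieck groups\<close>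

text \<open>
  \<open>R\<close> is a set of triples \<open>(A, B, C)\<close>, each imposing the relation \<open>[B] = [A] + [C]\<close>. The groups
  are abelian but, as usual in HOL-Algebra, are written multiplicatively.
\<close>

definition groth_relations :: "'a set \<Rightarrow> ('a \<times> 'a \<times> 'a) set \<Rightarrow> ('a \<Rightarrow>\<^sub>0 int) set" where
  "groth_relations S R = generate (free_Abelian_group S)
     {frag_of B - frag_of A - frag_of C | A B C. (A, B, C) \<in> R}"

definition groth_group :: "'a set \<Rightarrow> ('a \<times> 'a \<times> 'a) set \<Rightarrow> ('a \<Rightarrow>\<^sub>0 int) set monoid" where
  "groth_group S R = free_Abelian_group S Mod groth_relations S R"

definition groth_class :: "'a set \<Rightarrow> ('a \<times> 'a \<times> 'a) set \<Rightarrow> 'a \<Rightarrow> ('a \<Rightarrow>\<^sub>0 int) set" where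
  "groth_class S R X = groth_relations S R #>\<^bsub>free_Abelian_group S\<^esub> frag_of X"

definition split_sequences :: "('k, 'o, 'm, 'z) lcat_scheme \<Rightarrow> ('o \<times> 'o \<times> 'o) set" where
  "split_sequences A = {(X, Z, Y). is_direct_sum A X Y Z}"

definition K0 :: "('k, 'o, 'm, 'z) lcat_scheme \<Rightarrow> ('o \<Rightarrow>\<^sub>0 int) set monoid" where
  "K0 A = groth_group (Obj A) (split_sequences A)"

definition K0_class :: "('k, 'o, 'm, 'z) lcat_scheme \<Rightarrow> 'o \<Rightarrow> ('o \<Rightarrow>\<^sub>0 int) set" where
  "K0_class A X = groth_class (Obj A) (split_sequences A) X"


section \<open>Index and coindex\<close>

definition index ::
  "('k, 'o, 'm, 'e, 'z) extri_scheme \<Rightarrow> 'o set \<Rightarrow> 'o \<Rightarrow> ('o \<Rightarrow>\<^sub>0 int) set" where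
  "index C \<T> X = (THE v. \<exists>K\<in>\<T>. \<exists>R\<in>\<T>. \<exists>x y. conflation C K R X x y \<and>
     v = K0_class (full_sub C \<T>) R \<otimes>\<^bsub>K0 (full_sub C \<T>)\<^esub>
         inv\<^bsub>K0 (full_sub C \<T>)\<^esub> K0_class (full_sub C \<T>) K)"

definition coindex ::
  "('k, 'o, 'm, 'e, 'z) extri_scheme \<Rightarrow> 'o set \<Rightarrow> 'o \<Rightarrow> ('o \<Rightarrow>\<^sub>0 int) set" where
  "coindex C \<T> X = (THE v. \<exists>L\<in>\<T>. \<exists>N\<in>\<T>. \<exists>x y. conflation C X L N x y \<and>
     v = K0_class (full_sub C \<T>) L \<otimes>\<^bsub>K0 (full_sub C \<T>)\<^esub>
         inv\<^bsub>K0 (full_sub C \<T>)\<^esub> K0_class (full_sub C \<T>) N)"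

text \<open>
  \<open>index_map C \<U> \<T>\<close> is $\mathrm{ind}_{\mathcal U}^{\mathcal T} : K_0(\mathcal U) \to K_0(\mathcal T)$;
  likewise for the coindex.
\<close>

definition index_map ::
  "('k, 'o, 'm, 'e, 'z) extri_scheme \<Rightarrow> 'o set \<Rightarrow> 'o set \<Rightarrow> ('o \<Rightarrow>\<^sub>0 int) set \<Rightarrow> ('o \<Rightarrow>\<^sub>0 int) set" where
  "index_map C \<U> \<T> = (THE f.
     f \<in> hom (K0 (full_sub C \<U>)) (K0 (full_sub C \<T>)) \<inter> extensional (carrier (K0 (full_sub C \<U>))) \<and>
     (\<forall>U\<in>\<U>. f (K0_class (full_sub C \<U>) U) = index C \<T> U))"

definition coindex_map ::
  "('k, 'o, 'm, 'e, 'z) extri_scheme \<Rightarrow> 'o set \<Rightarrow> 'o set \<Rightarrow> ('o \<Rightarrow>\<^sub>0 int) set \<Rightarrow> ('o \<Rightarrow>\<^sub>0 int) set" where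
  "coindex_map C \<U> \<T> = (THE f.
     f \<in> hom (K0 (full_sub C \<U>)) (K0 (full_sub C \<T>)) \<inter> extensional (carrier (K0 (full_sub C \<U>))) \<and>
     (\<forall>U\<in>\<U>. f (K0_class (full_sub C \<U>) U) = coindex C \<T> U))"


section \<open>Modules over a linear category\<close>

record ('k, 'o, 'm, 'v) cmod =
  Val :: "'o \<Rightarrow> ('k, 'v) module"
  Act :: "'m \<Rightarrow> 'v \<Rightarrow> 'v"

definition is_cmod ::
  "('k::field, 'o, 'm, 'z) lcat_scheme \<Rightarrow> ('k, 'o, 'm, 'v) cmod \<Rightarrow> bool" where
  "is_cmod A M \<longleftrightarrow>
     (\<forall>X\<in>Obj A. vectorspace class_ring (Val M X)) \<and>
     (\<forall>X\<in>Obj A. \<forall>Y\<in>Obj A. \<forall>f\<in>Mor A X Y. Act M f \<in> lin_maps (Val M Y) (Val M X)) \<and>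
     (\<forall>X\<in>Obj A. \<forall>Y\<in>Obj A. \<forall>v\<in>carrier (Val M Y).
        (\<lambda>f. Act M f v) \<in> lin_maps (Hom A X Y) (Val M X)) \<and>
     (\<forall>X\<in>Obj A. \<forall>v\<in>carrier (Val M X). Act M (Ident A X) v = v) \<and>
     (\<forall>X\<in>Obj A. \<forall>Y\<in>Obj A. \<forall>Z\<in>Obj A. \<forall>f\<in>Mor A X Y. \<forall>g\<in>Mor A Y Z. \<forall>v\<in>carrier (Val M Z).
        Act M (g \<cdot>\<^bsub>A\<^esub> f) v = Act M f (Act M g v))"

definition cmod_hom ::
  "('k::field, 'o, 'm, 'z) lcat_scheme \<Rightarrow> ('k, 'o, 'm, 'v) cmod \<Rightarrow> ('k, 'o, 'm, 'v) cmod \<Rightarrow>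
     ('o \<Rightarrow> 'v \<Rightarrow> 'v) \<Rightarrow> bool" where
  "cmod_hom A M N \<eta> \<longleftrightarrow>
     (\<forall>X\<in>Obj A. \<eta> X \<in> lin_maps (Val M X) (Val N X)) \<and>
     (\<forall>X\<in>Obj A. \<forall>Y\<in>Obj A. \<forall>f\<in>Mor A X Y. \<forall>v\<in>carrier (Val M Y).
        \<eta> X (Act M f v) = Act N f (\<eta> Y v))"

definition lfd :: "('k::field, 'o, 'm, 'z) lcat_scheme \<Rightarrow> ('k, 'o, 'm, 'v) cmod set" where
  "lfd A = {M. is_cmod A M \<and> (\<forall>X\<in>Obj A. vectorspace.fin_dim class_ring (Val M X))}"

definition exact_sequences ::
  "('k::field, 'o, 'm, 'z) lcat_scheme \<Rightarrow>
     (('k, 'o, 'm, 'v) cmod \<times> ('k, 'o, 'm, 'v) cmod \<times> ('k, 'o, 'm, 'v) cmod) set" where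
  "exact_sequences A = {(L, M, N). L \<in> lfd A \<and> M \<in> lfd A \<and> N \<in> lfd A \<and>
     (\<exists>\<eta> \<theta>. cmod_hom A L M \<eta> \<and> cmod_hom A M N \<theta> \<and>
        (\<forall>X\<in>Obj A. inj_on (\<eta> X) (carrier (Val L X)) \<and>
           \<eta> X ` carrier (Val L X) = {v \<in> carrier (Val M X). \<theta> X v = \<zero>\<^bsub>Val N X\<^esub>} \<and>
           \<theta> X ` carrier (Val M X) = carrier (Val N X)))}"

definition simple_cmod ::
  "('k::field, 'o, 'm, 'z) lcat_scheme \<Rightarrow> 'o \<Rightarrow> ('k, 'o, 'm, 'm set) cmod" where
  "simple_cmod A X =
    \<lparr>Val = (\<lambda>Y. quot_space (Hom A Y X) (rad A Y X)),
     Act = (\<lambda>f G. {h. \<exists>g\<in>G. \<exists>Y\<in>Obj A. g \<cdot>\<^bsub>A\<^esub> f \<in> Mor A Y X \<and>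
                      h \<in> rad A Y X +>\<^bsub>Hom A Y X\<^esub> (g \<cdot>\<^bsub>A\<^esub> f)})\<rparr>"

text \<open>
  Modules take values in vector spaces carried by subsets of \<open>'m set\<close>, the type in which the simple
  modules live. As soon as the ambient cluster category is non-zero, this type is large enough for
  every finite-dimensional vector space, so that up to isomorphism no module is lost.
\<close>

definition K0_lfd ::
  "('k::field, 'o, 'm, 'z) lcat_scheme \<Rightarrow> (('k, 'o, 'm, 'm set) cmod \<Rightarrow>\<^sub>0 int) set monoid" where
  "K0_lfd A = groth_group (lfd A) (exact_sequences A)"

definition K0_lfd_class ::
  "('k::field, 'o, 'm, 'z) lcat_scheme \<Rightarrow> ('k, 'o, 'm, 'm set) cmod \<Rightarrow>
     (('k, 'o, 'm, 'm set) cmod \<Rightarrow>\<^sub>0 int) set" where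
  "K0_lfd_class A M = groth_class (lfd A) (exact_sequences A) M"

text \<open>The bilinear form with \<open>\<langle>[M], [T]\<rangle> = dim M(T)\<close>, computed on representatives.\<close>

definition pairing ::
  "('k::field, 'o, 'm, 'z) lcat_scheme \<Rightarrow> (('k, 'o, 'm, 'm set) cmod \<Rightarrow>\<^sub>0 int) set \<Rightarrow>
     ('o \<Rightarrow>\<^sub>0 int) set \<Rightarrow> int" where
  "pairing A v w = (THE n. \<exists>a\<in>v. \<exists>b\<in>w.
     n = (\<Sum>M\<in>Poly_Mapping.keys a. \<Sum>T\<in>Poly_Mapping.keys b.
            Poly_Mapping.lookup a M * Poly_Mapping.lookup b T *
            int (vectorspace.dim class_ring (Val M T))))"

definition left_kernel ::
  "('k::field, 'o, 'm, 'z) lcat_scheme \<Rightarrow> (('k, 'o, 'm, 'm set) cmod \<Rightarrow>\<^sub>0 int) set set" where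
  "left_kernel A = {v \<in> carrier (K0_lfd A). \<forall>w\<in>carrier (K0 A). pairing A v w = 0}"

definition K0_num ::
  "('k::field, 'o, 'm, 'z) lcat_scheme \<Rightarrow> (('k, 'o, 'm, 'm set) cmod \<Rightarrow>\<^sub>0 int) set set monoid" where
  "K0_num A = K0_lfd A Mod left_kernel A"

definition K0_num_class ::
  "('k::field, 'o, 'm, 'z) lcat_scheme \<Rightarrow> ('k, 'o, 'm, 'm set) cmod \<Rightarrow>
     (('k, 'o, 'm, 'm set) cmod \<Rightarrow>\<^sub>0 int) set set" where
  "K0_num_class A M = left_kernel A #>\<^bsub>K0_lfd A\<^esub> K0_lfd_class A M"

definition num_pairing ::
  "('k::field, 'o, 'm, 'z) lcat_scheme \<Rightarrow> (('k, 'o, 'm, 'm set) cmod \<Rightarrow>\<^sub>0 int) set set \<Rightarrow>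
     ('o \<Rightarrow>\<^sub>0 int) set \<Rightarrow> int" where
  "num_pairing A v w = (THE n. \<exists>a\<in>v. n = pairing A a w)"


section \<open>Adjoints of index and coindex, and sign-coherence\<close>

text \<open>
  \<open>index_adj C \<U> \<T>\<close> and \<open>coindex_adj C \<U> \<T>\<close> are maps from \<open>K0_num\<close> of \<open>\<U>\<close> to \<open>K0_num\<close> of \<open>\<T>\<close>;
  the former is adjoint to the coindex and the latter to the index.
\<close>

definition index_adj ::
  "('k::field, 'o, 'm, 'e, 'z) extri_scheme \<Rightarrow> 'o set \<Rightarrow> 'o set \<Rightarrow>
     (('k, 'o, 'm, 'm set) cmod \<Rightarrow>\<^sub>0 int) set set \<Rightarrow> (('k, 'o, 'm, 'm set) cmod \<Rightarrow>\<^sub>0 int) set set" where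
  "index_adj C \<U> \<T> v = (THE w. w \<in> carrier (K0_num (full_sub C \<T>)) \<and>
     (\<forall>T\<in>\<T>. num_pairing (full_sub C \<T>) w (K0_class (full_sub C \<T>) T) =
            num_pairing (full_sub C \<U>) v (coindex_map C \<T> \<U> (K0_class (full_sub C \<T>) T))))"

definition coindex_adj ::
  "('k::field, 'o, 'm, 'e, 'z) extri_scheme \<Rightarrow> 'o set \<Rightarrow> 'o set \<Rightarrow>
     (('k, 'o, 'm, 'm set) cmod \<Rightarrow>\<^sub>0 int) set set \<Rightarrow> (('k, 'o, 'm, 'm set) cmod \<Rightarrow>\<^sub>0 int) set set" where
  "coindex_adj C \<U> \<T> v = (THE w. w \<in> carrier (K0_num (full_sub C \<T>)) \<and>
     (\<forall>T\<in>\<T>. num_pairing (full_sub C \<T>) w (K0_class (full_sub C \<T>) T) =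
            num_pairing (full_sub C \<U>) v (index_map C \<T> \<U> (K0_class (full_sub C \<T>) T))))"

text \<open>
  Sign-coherence has its usual meaning: the coordinates are all non-negative or all non-positive.
  A zero coordinate is compatible with both signs, so in the formulation by equivalences
  \<open>\<langle>v, [T]\<rangle> \<ge> 0 \<longleftrightarrow> \<langle>v, [T']\<rangle> \<ge> 0\<close> one has to restrict to non-zero coordinates.
\<close>

definition sign_coherent ::
  "('k::field, 'o, 'm, 'z) lcat_scheme \<Rightarrow> (('k, 'o, 'm, 'm set) cmod \<Rightarrow>\<^sub>0 int) set set \<Rightarrow> bool" where
  "sign_coherent A v \<longleftrightarrow>
     (\<forall>T. indecomposable A T \<longrightarrow> num_pairing A v (K0_class A T) \<ge> 0) \<or>
     (\<forall>T. indecomposable A T \<longrightarrow> num_pairing A v (K0_class A T) \<le> 0)"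

lemma sign_coherent_iff:
  "sign_coherent A v \<longleftrightarrow>
     (\<forall>T T'. indecomposable A T \<longrightarrow> indecomposable A T' \<longrightarrow>
        num_pairing A v (K0_class A T) \<noteq> 0 \<longrightarrow> num_pairing A v (K0_class A T') \<noteq> 0 \<longrightarrow>
        (num_pairing A v (K0_class A T) \<ge> 0 \<longleftrightarrow> num_pairing A v (K0_class A T') \<ge> 0))"
  unfolding sign_coherent_def by (smt (verit))

end

theory Submission
  imports Defs "Jordan_Normal_Form.DL_Rank"
begin

text \<open>
  Let $F = \mathrm{Hom}(-,U)/\mathrm{rad}(-,U)$ be the simple $\mathcal U$-module at $U$. The coordinate of its
  image under the adjoint of the coindex at an object \<open>X\<close> of \<open>\<T>\<close> is \<open>dim F(L) - dim F(N)\<close>, where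
  \<open>X \<rightarrow> L \<rightarrow> N\<close> is a conflation with \<open>L\<close> and \<open>N\<close> in \<open>\<U>\<close>; for the adjoint of the index one has
  \<open>dim F(R) - dim F(K)\<close> with \<open>K \<rightarrow> R \<rightarrow> X\<close>. Write \<open>d : A \<rightarrow> B\<close> for the map \<open>L \<rightarrow> N\<close> or \<open>K \<rightarrow> R\<close>. As
  \<open>F(d)\<close> goes from \<open>F(B)\<close> to \<open>F(A)\<close>, the number \<open>dim F(A) - dim F(B)\<close> is the dimension of the cokernel of
  \<open>F(d)\<close> minus that of its kernel.

  There are no extensions between objects of \<open>\<T>\<close>, nor between objects of \<open>\<U>\<close>. So for any two objects
  \<open>X\<close> and \<open>X'\<close> of \<open>\<T>\<close>, with complexes \<open>d\<close> and \<open>d'\<close>, every map \<open>A' \<rightarrow> B\<close> is of the form \<open>\<beta> d' + d \<alpha>\<close>.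
  Suppose that \<open>F(d)\<close> kills the class of a non-radical map \<open>v : B \<rightarrow> U\<close>. The endomorphism ring of \<open>U\<close> is
  local, hence \<open>v\<close> has a section \<open>t\<close>. An arbitrary \<open>w : A' \<rightarrow> U\<close> equals \<open>v (t w)\<close>, and writing \<open>t w\<close> in the
  above form shows that \<open>w\<close> is \<open>(v \<beta>) d'\<close> modulo the radical. So if one of the maps \<open>F(d)\<close> is not injective,
  then all of them are surjective, and all coordinates have the same sign. This is lemma \<open>dichotomy\<close>.

  The adjoints are given by descriptions, so the vector with these coordinates must be shown to exist. A map
  \<open>X \<rightarrow> X'\<close> lifts to the complexes, uniquely up to homotopy, so the cokernel and the kernel of \<open>F(d)\<close> are
  modules over \<open>\<T>\<close>, and by the dichotomy the coordinates are, up to a common sign, the dimension vector of one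
  of them (\<open>dimension_difference_realised\<close>). Such a vector comes from a unique element of the numerical
  Grothendieck group (\<open>num_element_of_dimension_vector\<close>). Index and coindex are well defined by Schanuel's
  lemma (\<open>schanuel\<close>, \<open>schanuel_op\<close>).

  The endomorphism ring of \<open>U\<close> is local and \<open>F\<close> has finite-dimensional values for different reasons in the two
  cases. In a skew-symmetric category, \<open>U\<close> is isomorphic to an object of a Krull-Schmidt decomposition. In a
  compact category, approximate idempotents in the endomorphism ring converge in the radical topology
  (\<open>radically_pseudocompact_local\<close>), and \<open>F(V)\<close> is a corner of the endomorphism ring of \<open>V \<oplus> U\<close> modulo its
  radical.
\<close>

section \<open>Vector spaces, quotients and dimension\<close>

lemma vs_abelian_group: "vectorspace class_ring V \<Longrightarrow> abelian_group V"
  by (simp add: vectorspace_def module_def)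

lemma vs_module: "vectorspace class_ring V \<Longrightarrow> Module.module class_ring V"
  by (simp add: vectorspace_def)

lemma subspace_iff:
  fixes V :: "('k::field, 'v) module"
  shows "VectorSpace.subspace class_ring W V \<longleftrightarrow> vectorspace class_ring V \<and> W \<subseteq> carrier V \<and> \<zero>\<^bsub>V\<^esub> \<in> W \<and>
    (\<forall>u\<in>W. \<forall>v\<in>W. u \<oplus>\<^bsub>V\<^esub> v \<in> W) \<and> (\<forall>c. \<forall>v\<in>W. c \<odot>\<^bsub>V\<^esub> v \<in> W)"
  by (auto simp: VectorSpace.subspace_def submodule_def vs_module)

lemma vs_add_closed:
  "vectorspace class_ring V \<Longrightarrow> u \<in> carrier V \<Longrightarrow> v \<in> carrier V \<Longrightarrow> u \<oplus>\<^bsub>V\<^esub> v \<in> carrier V"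
  by (rule abelian_monoid.a_closed[OF abelian_group.axioms(1)[OF vs_abelian_group]])

lemma vs_smult_closed:
  fixes V :: "('k::field, 'v) module"
  shows "vectorspace class_ring V \<Longrightarrow> v \<in> carrier V \<Longrightarrow> c \<odot>\<^bsub>V\<^esub> v \<in> carrier V"
  using Module.module.smult_closed[OF vs_module, of V c v] by simp

lemma vs_smult_minus_one:
  fixes V :: "('k::field, 'v) module"
  assumes "vectorspace class_ring V" "v \<in> carrier V"
  shows "(- 1) \<odot>\<^bsub>V\<^esub> v = \<ominus>\<^bsub>V\<^esub> v"
proof -
  interpret V: vectorspace class_ring V by fact
  have "v \<oplus>\<^bsub>V\<^esub> (- 1) \<odot>\<^bsub>V\<^esub> v = (1 + - 1) \<odot>\<^bsub>V\<^esub> v"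
    using V.smult_l_distr[of 1 "- 1" v] V.smult_one[of v] assms(2) by simp
  also have "\<dots> = \<zero>\<^bsub>V\<^esub>" using V.smult_l_null[of v] assms(2) by simp
  finally show ?thesis
    using V.minus_unique[of v "(- 1) \<odot>\<^bsub>V\<^esub> v"] assms vs_smult_closed[OF assms, of "-1"]
    by (metis V.M.minus_equality V.a_comm)
qed

lemma lin_mapsI:
  fixes V :: "('k::field, 'v) module" and W :: "('k, 'w) module"
  assumes "\<And>v. v \<in> carrier V \<Longrightarrow> f v \<in> carrier W"
    and "\<And>u v. u \<in> carrier V \<Longrightarrow> v \<in> carrier V \<Longrightarrow> f (u \<oplus>\<^bsub>V\<^esub> v) = f u \<oplus>\<^bsub>W\<^esub> f v"
    and "\<And>c v. v \<in> carrier V \<Longrightarrow> f (c \<odot>\<^bsub>V\<^esub> v) = c \<odot>\<^bsub>W\<^esub> f v"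
  shows "f \<in> lin_maps V W"
  using assms by (auto simp: LinearCombinations.module_hom_def)

lemma lin_maps_closed: "f \<in> lin_maps V W \<Longrightarrow> v \<in> carrier V \<Longrightarrow> f v \<in> carrier W"
  by (auto simp: LinearCombinations.module_hom_def)

lemma lin_maps_add:
  "f \<in> lin_maps V W \<Longrightarrow> u \<in> carrier V \<Longrightarrow> v \<in> carrier V \<Longrightarrow> f (u \<oplus>\<^bsub>V\<^esub> v) = f u \<oplus>\<^bsub>W\<^esub> f v"
  by (auto simp: LinearCombinations.module_hom_def)

lemma lin_maps_smult:
  fixes V :: "('k::field, 'v) module"
  shows "f \<in> lin_maps V W \<Longrightarrow> v \<in> carrier V \<Longrightarrow> f (c \<odot>\<^bsub>V\<^esub> v) = c \<odot>\<^bsub>W\<^esub> f v"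
  by (auto simp: LinearCombinations.module_hom_def)

lemma lin_maps_linear_map:
  "vectorspace class_ring V \<Longrightarrow> vectorspace class_ring W \<Longrightarrow> f \<in> lin_maps V W \<Longrightarrow>
    linear_map class_ring V W f"
  by (simp add: linear_map_def mod_hom_def mod_hom_axioms_def vs_module)

lemma lin_maps_zero:
  "vectorspace class_ring V \<Longrightarrow> vectorspace class_ring W \<Longrightarrow> f \<in> lin_maps V W \<Longrightarrow> f \<zero>\<^bsub>V\<^esub> = \<zero>\<^bsub>W\<^esub>"
  using mod_hom.f0_is_0[OF linear_map.axioms(3)[OF lin_maps_linear_map]] .

lemma lin_maps_neg:
  "vectorspace class_ring V \<Longrightarrow> vectorspace class_ring W \<Longrightarrow> f \<in> lin_maps V W \<Longrightarrow>
    v \<in> carrier V \<Longrightarrow> f (\<ominus>\<^bsub>V\<^esub> v) = \<ominus>\<^bsub>W\<^esub> f v"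
  using mod_hom.f_neg[OF linear_map.axioms(3)[OF lin_maps_linear_map]] .

lemma vs_restrict:
  fixes V :: "('k::field, 'v) module"
  shows "VectorSpace.subspace class_ring W V \<Longrightarrow> vectorspace class_ring (V\<lparr>carrier := W\<rparr>)"
  using vectorspace.subspace_is_vs VectorSpace.subspace.vs by blast

context
  fixes V :: "('k::field, 'v) module" and W
  assumes sub: "VectorSpace.subspace class_ring W V"
begin

private lemma V: "vectorspace class_ring V"
  using sub by (simp add: subspace_iff)

private lemma ab: "abelian_group V"
  using V by (rule vs_abelian_group)

private lemma W_neg: "w \<in> W \<Longrightarrow> \<ominus>\<^bsub>V\<^esub> w \<in> W"
  using sub vs_smult_minus_one[OF V, of w] by (auto simp: subspace_iff) (metis subsetD)

lemma subspace_abelian_subgroup: "abelian_subgroup W V"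
proof -
  interpret abelian_group V by (rule ab)
  have "subgroup W (add_monoid V)"
    using sub W_neg a_inv_def by unfold_locales (auto simp: subspace_iff a_inv_def)
  thus ?thesis
    by (intro abelian_subgroupI3 additive_subgroup.intro ab)
qed

interpretation W: abelian_subgroup W V by (rule subspace_abelian_subgroup)

lemma coset_eq_iff:
  assumes "u \<in> carrier V" "v \<in> carrier V"
  shows "W +>\<^bsub>V\<^esub> u = W +>\<^bsub>V\<^esub> v \<longleftrightarrow> u \<ominus>\<^bsub>V\<^esub> v \<in> W"
  using assms W.a_rcos_module[of v u] W.a_rcos_self[of u] W.a_repr_independence[OF _ assms(2) W.a_subgroup]
  by (auto simp: a_minus_def)

lemma quot_carrier: "carrier (quot_space V W) = (\<lambda>v. W +>\<^bsub>V\<^esub> v) ` carrier V"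
  by (auto simp: quot_space_def A_RCOSETS_def' )

lemma quot_add:
  assumes "u \<in> carrier V" "v \<in> carrier V"
  shows "(W +>\<^bsub>V\<^esub> u) \<oplus>\<^bsub>quot_space V W\<^esub> (W +>\<^bsub>V\<^esub> v) = W +>\<^bsub>V\<^esub> (u \<oplus>\<^bsub>V\<^esub> v)"
  using assms by (simp add: quot_space_def W.a_rcos_sum)

lemma coset_mem: "u \<in> W +>\<^bsub>V\<^esub> v \<longleftrightarrow> (\<exists>w\<in>W. u = w \<oplus>\<^bsub>V\<^esub> v)"
  by (auto simp: a_r_coset_def')

lemma coset_self: "v \<in> carrier V \<Longrightarrow> v \<in> W +>\<^bsub>V\<^esub> v"
  by (rule W.a_rcos_self)

lemma quot_smult:
  assumes "v \<in> carrier V"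
  shows "c \<odot>\<^bsub>quot_space V W\<^esub> (W +>\<^bsub>V\<^esub> v) = W +>\<^bsub>V\<^esub> (c \<odot>\<^bsub>V\<^esub> v)"
proof -
  interpret VV: vectorspace class_ring V by (rule V)
  have *: "W +>\<^bsub>V\<^esub> (c \<odot>\<^bsub>V\<^esub> a) = W +>\<^bsub>V\<^esub> (c \<odot>\<^bsub>V\<^esub> v)" if a: "a \<in> W +>\<^bsub>V\<^esub> v" for a
  proof -
    from a obtain w where w: "w \<in> W" "a = w \<oplus>\<^bsub>V\<^esub> v" by (auto simp: coset_mem)
    have wc: "w \<in> carrier V" using w sub by (auto simp: subspace_iff)
    have "c \<odot>\<^bsub>V\<^esub> a = c \<odot>\<^bsub>V\<^esub> w \<oplus>\<^bsub>V\<^esub> c \<odot>\<^bsub>V\<^esub> v"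
      using VV.smult_r_distr[of c w v] w wc assms by simp
    moreover have "c \<odot>\<^bsub>V\<^esub> w \<in> W" using w sub by (auto simp: subspace_iff)
    ultimately have "c \<odot>\<^bsub>V\<^esub> a \<in> W +>\<^bsub>V\<^esub> (c \<odot>\<^bsub>V\<^esub> v)" by (auto simp: coset_mem)
    thus ?thesis
      using W.a_repr_independence[OF _ vs_smult_closed[OF V assms] W.a_subgroup] by blast
  qed
  have "W +>\<^bsub>V\<^esub> v \<noteq> {}" using coset_self[OF assms] by blast
  hence "(\<Union>a\<in>W +>\<^bsub>V\<^esub> v. W +>\<^bsub>V\<^esub> (c \<odot>\<^bsub>V\<^esub> a)) = W +>\<^bsub>V\<^esub> (c \<odot>\<^bsub>V\<^esub> v)"
    by (rule SUP_eq_const) (rule *)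
  thus ?thesis by (simp add: quot_space_def)
qed

lemma quot_zero: "\<zero>\<^bsub>quot_space V W\<^esub> = W +>\<^bsub>V\<^esub> \<zero>\<^bsub>V\<^esub>"
  using W.a_rcos_const[of "\<zero>\<^bsub>V\<^esub>"] sub by (simp add: quot_space_def subspace_iff)

lemma quot_vs: "vectorspace class_ring (quot_space V W)"
proof -
  interpret VV: vectorspace class_ring V by (rule V)
  note am = abelian_group.axioms(1)[OF ab]
  note simps = quot_carrier quot_add quot_smult quot_zero
  show ?thesis
  proof (rule vs_criteria, goal_cases)
    case 1 show ?case by (rule class_field)
  next
    case 2 show ?case by (auto simp: simps)
  next
    case 3 show ?case by (auto simp: simps)
  next
    case 4
    have "\<exists>u\<in>carrier V. (W +>\<^bsub>V\<^esub> v) \<oplus>\<^bsub>quot_space V W\<^esub> (W +>\<^bsub>V\<^esub> u) = \<zero>\<^bsub>quot_space V W\<^esub>"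
      if "v \<in> carrier V" for v
      using that by (intro bexI[of _ "\<ominus>\<^bsub>V\<^esub> v"]) (auto simp: simps abelian_group.r_neg[OF ab])
    thus ?case by (auto simp: quot_carrier)
  next
    case 5 show ?case using vs_smult_closed[OF V] by (auto simp: simps)
  next
    case 6 show ?case by (auto simp: simps abelian_monoid.a_comm[OF am])
  next
    case 7 show ?case by (auto simp: simps abelian_monoid.a_assoc[OF am])
  next
    case 8 show ?case by (auto simp: simps)
  next
    case 9 show ?case using vs_smult_closed[OF V] VV.smult_assoc1 by (auto simp: simps)
  next
    case 10 show ?case using VV.smult_one by (auto simp: simps)
  next
    case 11 show ?case using vs_smult_closed[OF V] VV.smult_l_distr by (auto simp: simps)
  next
    case 12 show ?case using vs_smult_closed[OF V] VV.smult_r_distr by (auto simp: simps)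
  qed
qed

end

lemma coset_eq_zero_iff:
  fixes V :: "('k::field, 'v) module"
  assumes sub: "VectorSpace.subspace class_ring W V" and v: "v \<in> carrier V"
  shows "W +>\<^bsub>V\<^esub> v = \<zero>\<^bsub>quot_space V W\<^esub> \<longleftrightarrow> v \<in> W"
proof -
  interpret W: abelian_subgroup W V by (rule subspace_abelian_subgroup[OF sub])
  show ?thesis using W.a_rcos_const[of v] W.a_rcos_self[OF v] by (auto simp: quot_space_def)
qed

text \<open>Congruence modulo \<open>W\<close> in additive form: comparisons of morphisms below come as equations \<open>u = v + w\<close>.\<close>

lemma coset_eqI:
  fixes V :: "('k::field, 'v) module"
  assumes sub: "VectorSpace.subspace class_ring W V" and "v \<in> carrier V" "w \<in> W" "u = v \<oplus>\<^bsub>V\<^esub> w"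
  shows "W +>\<^bsub>V\<^esub> u = W +>\<^bsub>V\<^esub> v"
proof -
  interpret V: vectorspace class_ring V using sub by (simp add: subspace_iff)
  interpret W: abelian_subgroup W V by (rule subspace_abelian_subgroup[OF sub])
  have w: "w \<in> carrier V" using assms by (auto simp: subspace_iff)
  have "u = w \<oplus>\<^bsub>V\<^esub> v" using assms w V.a_comm by metis
  hence "u \<in> W +>\<^bsub>V\<^esub> v" using assms(3) coset_mem[OF sub] by blast
  thus ?thesis
    using V.M.a_repr_independence[OF _ assms(2) W.a_subgroup] by blast
qed

subsection \<open>Dimension\<close>

text \<open>An independent subset of \<open>W\<close> has at most \<open>dim V\<close> elements, so there is a maximal one, and it is a basis.\<close>

lemma fin_dim_subspace:
  fixes V :: "('k::field, 'v) module"
  assumes sub: "VectorSpace.subspace class_ring W V" and fd: "vectorspace.fin_dim class_ring V"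
  shows "vectorspace.fin_dim class_ring (V\<lparr>carrier := W\<rparr>)"
proof -
  interpret V: vectorspace class_ring V using sub by (simp add: subspace_iff)
  interpret W: vectorspace class_ring "V\<lparr>carrier := W\<rparr>" using sub by (rule vs_restrict)
  have subm: "submodule class_ring W V" using sub by (simp add: VectorSpace.subspace_def)
  have WV: "W \<subseteq> carrier V" using sub by (simp add: subspace_iff)
  have P: "finite A \<and> card A \<le> V.dim" if "A \<subseteq> W \<and> W.lin_indpt A" for A
    using that V.li_le_dim[OF fd, of A] V.module.span_li_not_depend(2)[OF _ subm, of A] WV by auto
  have "W.lin_indpt {}" by (simp add: W.lin_dep_def)
  then obtain B where "finite B" "maximal B (\<lambda>A. A \<subseteq> W \<and> W.lin_indpt A)"
    using maximal_exists[of "\<lambda>A. A \<subseteq> W \<and> W.lin_indpt A" V.dim "{}"] P by auto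
  hence "W.basis B" "finite B" using W.max_li_is_basis[of B] by auto
  thus ?thesis unfolding W.fin_dim_def W.basis_def by auto
qed

lemma fin_dim_surj:
  assumes "vectorspace class_ring V" "vectorspace class_ring W" "f \<in> lin_maps V W"
    and "f ` carrier V = carrier W" "vectorspace.fin_dim class_ring V"
  shows "vectorspace.fin_dim class_ring W"
  using linear_map.surj_fin_dim[OF lin_maps_linear_map] assms by blast

lemma image_subspace:
  fixes V :: "('k::field, 'v) module" and W :: "('k, 'w) module"
  assumes "vectorspace class_ring V" "vectorspace class_ring W" "f \<in> lin_maps V W"
  shows "VectorSpace.subspace class_ring (f ` carrier V) W"
proof -
  interpret linear_map class_ring V W f using lin_maps_linear_map[OF assms] .
  show ?thesis using imT_is_subspace by (simp add: im_def)
qed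

lemma lin_maps_into_image:
  fixes V :: "('k::field, 'v) module" and W :: "('k, 'w) module"
  assumes "f \<in> lin_maps V W"
  shows "f \<in> lin_maps V (W\<lparr>carrier := f ` carrier V\<rparr>)"
  using assms by (auto simp: LinearCombinations.module_hom_def)

lemma dim_iso:
  assumes "vectorspace class_ring V" "vectorspace class_ring W" "f \<in> lin_maps V W"
    and "inj_on f (carrier V)" "f ` carrier V = carrier W" "vectorspace.fin_dim class_ring V"
  shows "vectorspace.dim class_ring V = vectorspace.dim class_ring W"
  using linear_map.dim_eq[OF lin_maps_linear_map] assms by blast

lemma fin_dim_inj:
  fixes V :: "('k::field, 'v) module" and W :: "('k, 'w) module"
  assumes V: "vectorspace class_ring V" and W: "vectorspace class_ring W" and f: "f \<in> lin_maps V W"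
    and inj: "inj_on f (carrier V)" and fd: "vectorspace.fin_dim class_ring W"
  shows "vectorspace.fin_dim class_ring V"
proof -
  let ?I = "W\<lparr>carrier := f ` carrier V\<rparr>"
  let ?g = "the_inv_into (carrier V) f"
  interpret V: vectorspace class_ring V by fact
  note sub = image_subspace[OF V W f]
  have I: "vectorspace class_ring ?I" using sub by (rule vs_restrict)
  have g: "?g (f v) = v" if "v \<in> carrier V" for v using that inj by (rule the_inv_into_f_f[rotated])
  have "?g \<in> lin_maps ?I V"
    by (rule lin_mapsI)
      (auto simp: g lin_maps_add[OF f, symmetric] lin_maps_smult[OF f, symmetric] vs_smult_closed[OF V])
  moreover have "?g ` carrier ?I = carrier V" by (force simp: g image_iff)
  ultimately show ?thesis using fin_dim_surj[OF I V] fin_dim_subspace[OF sub fd] by blast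
qed

text \<open>Rank-nullity, in the form in which all dimensions of modules are computed below.\<close>

lemma dim_exact:
  fixes L :: "('k::field, 'l) module" and M :: "('k, 'v) module" and N :: "('k, 'w) module"
  assumes L: "vectorspace class_ring L" and M: "vectorspace class_ring M" and N: "vectorspace class_ring N"
    and f: "f \<in> lin_maps L M" and g: "g \<in> lin_maps M N"
    and inj: "inj_on f (carrier L)" and ex: "f ` carrier L = {v \<in> carrier M. g v = \<zero>\<^bsub>N\<^esub>}"
    and surj: "g ` carrier M = carrier N" and fd: "vectorspace.fin_dim class_ring M"
  shows "vectorspace.dim class_ring M = vectorspace.dim class_ring L + vectorspace.dim class_ring N"
proof -
  interpret linear_map class_ring M N g using lin_maps_linear_map[OF M N g] .
  have "vectorspace.dim class_ring (M\<lparr>carrier := ker\<rparr>) = vectorspace.dim class_ring L"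
    using dim_iso[OF L vs_restrict[OF image_subspace[OF L M f]] lin_maps_into_image[OF f] inj]
      fin_dim_inj[OF L M f inj fd] ex by (simp add: ker_def)
  moreover have "N\<lparr>carrier := im\<rparr> = N" using surj by (simp add: im_def)
  ultimately show ?thesis using rank_nullity[OF fd] by simp
qed

subsection \<open>Maps between quotients\<close>

text \<open>A map between quotients is evaluated on a chosen representative. For a linear \<open>\<phi>\<close> that maps \<open>W\<close> into
  \<open>W'\<close> the choice does not matter, and this is the induced linear map.\<close>

definition quot_map ::
  "('k::field, 'v) module \<Rightarrow> 'v set \<Rightarrow> ('k, 'w) module \<Rightarrow> 'w set \<Rightarrow> ('v \<Rightarrow> 'w) \<Rightarrow> 'v set \<Rightarrow> 'w set" where
  "quot_map V W V' W' \<phi> c = W' +>\<^bsub>V'\<^esub> \<phi> (SOME v. v \<in> carrier V \<and> c = W +>\<^bsub>V\<^esub> v)"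

context
  fixes V :: "('k::field, 'v) module" and W and V' :: "('k, 'w) module" and W' and \<phi>
  assumes sub: "VectorSpace.subspace class_ring W V" and sub': "VectorSpace.subspace class_ring W' V'"
    and \<phi>: "\<phi> \<in> lin_maps V V'" and \<phi>W: "\<And>w. w \<in> W \<Longrightarrow> \<phi> w \<in> W'"
begin

private lemma dom_vs: "vectorspace class_ring V" and cod_vs: "vectorspace class_ring V'"
  using sub sub' by (simp_all add: subspace_iff)

lemma coset_image_cong:
  assumes "u \<in> carrier V" "v \<in> carrier V" "W +>\<^bsub>V\<^esub> u = W +>\<^bsub>V\<^esub> v"
  shows "W' +>\<^bsub>V'\<^esub> \<phi> u = W' +>\<^bsub>V'\<^esub> \<phi> v"
proof -
  obtain w where w: "w \<in> W" "u = w \<oplus>\<^bsub>V\<^esub> v"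
    using coset_self[OF sub assms(1)] assms(3) coset_mem[OF sub] by blast
  interpret V': abelian_group V' by (rule vs_abelian_group[OF cod_vs])
  have wc: "w \<in> carrier V" using w(1) sub by (auto simp: subspace_iff)
  have "\<phi> u = \<phi> v \<oplus>\<^bsub>V'\<^esub> \<phi> w"
    using w wc assms lin_maps_add[OF \<phi>] lin_maps_closed[OF \<phi>] V'.a_comm by simp
  thus ?thesis using coset_eqI[OF sub' _ \<phi>W[OF w(1)]] lin_maps_closed[OF \<phi> assms(2)] by blast
qed

lemma quot_map_coset:
  assumes "v \<in> carrier V"
  shows "quot_map V W V' W' \<phi> (W +>\<^bsub>V\<^esub> v) = W' +>\<^bsub>V'\<^esub> \<phi> v"
proof -
  have "\<exists>u. u \<in> carrier V \<and> W +>\<^bsub>V\<^esub> v = W +>\<^bsub>V\<^esub> u" using assms by blast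
  from someI_ex[OF this] show ?thesis
    unfolding quot_map_def by (intro coset_image_cong) (auto simp: assms)
qed

lemma quot_map_lin: "quot_map V W V' W' \<phi> \<in> lin_maps (quot_space V W) (quot_space V' W')"
proof -
  interpret V: abelian_group V by (rule vs_abelian_group[OF dom_vs])
  show ?thesis
    by (rule lin_mapsI)
      (auto simp: quot_carrier[OF sub] quot_carrier[OF sub'] quot_map_coset quot_add[OF sub] quot_add[OF sub']
        quot_smult[OF sub] quot_smult[OF sub'] lin_maps_closed[OF \<phi>] lin_maps_add[OF \<phi>]
        lin_maps_smult[OF \<phi>] vs_smult_closed[OF dom_vs])
qed

lemma quot_map_zero_iff:
  assumes "v \<in> carrier V"
  shows "quot_map V W V' W' \<phi> (W +>\<^bsub>V\<^esub> v) = \<zero>\<^bsub>quot_space V' W'\<^esub> \<longleftrightarrow> \<phi> v \<in> W'"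
  using assms by (simp add: quot_map_coset coset_eq_zero_iff[OF sub'] lin_maps_closed[OF \<phi>])

lemma quot_map_inj:
  assumes "\<And>v. v \<in> carrier V \<Longrightarrow> \<phi> v \<in> W' \<Longrightarrow> v \<in> W"
  shows "inj_on (quot_map V W V' W' \<phi>) (carrier (quot_space V W))"
proof (rule inj_onI)
  interpret V: abelian_group V by (rule vs_abelian_group[OF dom_vs])
  fix c d assume "c \<in> carrier (quot_space V W)" "d \<in> carrier (quot_space V W)"
    and eq: "quot_map V W V' W' \<phi> c = quot_map V W V' W' \<phi> d"
  then obtain u v where uv: "u \<in> carrier V" "v \<in> carrier V" "c = W +>\<^bsub>V\<^esub> u" "d = W +>\<^bsub>V\<^esub> v"
    by (auto simp: quot_carrier[OF sub])
  have "\<phi> u \<ominus>\<^bsub>V'\<^esub> \<phi> v \<in> W'"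
    using eq uv coset_eq_iff[OF sub'] lin_maps_closed[OF \<phi>] by (simp add: quot_map_coset)
  also have "\<phi> u \<ominus>\<^bsub>V'\<^esub> \<phi> v = \<phi> (u \<ominus>\<^bsub>V\<^esub> v)"
    using uv by (simp add: a_minus_def lin_maps_add[OF \<phi>] lin_maps_neg[OF dom_vs cod_vs \<phi>])
  finally have "u \<ominus>\<^bsub>V\<^esub> v \<in> W" using assms uv by simp
  thus "c = d" using uv coset_eq_iff[OF sub] by simp
qed

lemma quot_map_surj:
  assumes "\<And>v'. v' \<in> carrier V' \<Longrightarrow> \<exists>v\<in>carrier V. W' +>\<^bsub>V'\<^esub> v' = W' +>\<^bsub>V'\<^esub> \<phi> v"
  shows "quot_map V W V' W' \<phi> ` carrier (quot_space V W) = carrier (quot_space V' W')"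
proof
  show "quot_map V W V' W' \<phi> ` carrier (quot_space V W) \<subseteq> carrier (quot_space V' W')"
    using lin_maps_closed[OF quot_map_lin] by auto
  show "carrier (quot_space V' W') \<subseteq> quot_map V W V' W' \<phi> ` carrier (quot_space V W)"
    using assms quot_map_coset by (force simp: quot_carrier[OF sub] quot_carrier[OF sub'] image_iff)
qed

end

section \<open>Calculating in a linear category\<close>

text \<open>
  As Hom-spaces are disjoint, a morphism determines its source and target. Turning membership in a
  Hom-space into equations between sources and targets lets the simplifier check that composites are
  defined.
\<close>

definition arrow :: "('k::field, 'o, 'm, 'z) lcat_scheme \<Rightarrow> 'm \<Rightarrow> bool" where
  "arrow C f \<longleftrightarrow> (\<exists>X\<in>Obj C. \<exists>Y\<in>Obj C. f \<in> Mor C X Y)"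

definition source :: "('k::field, 'o, 'm, 'z) lcat_scheme \<Rightarrow> 'm \<Rightarrow> 'o" where
  "source C f = (SOME X. X \<in> Obj C \<and> (\<exists>Y\<in>Obj C. f \<in> Mor C X Y))"

definition target :: "('k::field, 'o, 'm, 'z) lcat_scheme \<Rightarrow> 'm \<Rightarrow> 'o" where
  "target C f = (SOME Y. Y \<in> Obj C \<and> (\<exists>X\<in>Obj C. f \<in> Mor C X Y))"

context linear_category
begin

lemma source_target:
  assumes "X \<in> Obj C" "Y \<in> Obj C" "f \<in> Mor C X Y"
  shows "source C f = X" "target C f = Y"
  unfolding source_def target_def using assms Hom_disjoint by (metis (mono_tags, lifting) someI)+

lemma mor_iff:
  assumes "X \<in> Obj C" "Y \<in> Obj C"
  shows "f \<in> Mor C X Y \<longleftrightarrow> arrow C f \<and> source C f = X \<and> target C f = Y"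
proof
  assume "f \<in> Mor C X Y" thus "arrow C f \<and> source C f = X \<and> target C f = Y"
    using assms source_target unfolding arrow_def by blast
next
  assume *: "arrow C f \<and> source C f = X \<and> target C f = Y"
  then obtain A B where "A \<in> Obj C" "B \<in> Obj C" "f \<in> Mor C A B" unfolding arrow_def by blast
  thus "f \<in> Mor C X Y" using * source_target by metis
qed

lemma arrow_mor: "arrow C f \<Longrightarrow> f \<in> Mor C (source C f) (target C f)"
  unfolding arrow_def using source_target by blast

lemma arrow_obj: "arrow C f \<Longrightarrow> source C f \<in> Obj C" "arrow C f \<Longrightarrow> target C f \<in> Obj C"
  unfolding arrow_def using source_target by blast+

lemma arrowI: "X \<in> Obj C \<Longrightarrow> Y \<in> Obj C \<Longrightarrow> f \<in> Mor C X Y \<Longrightarrow>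
    arrow C f \<and> source C f = X \<and> target C f = Y"
  using mor_iff by blast

lemma comp_mor:
  assumes "X \<in> Obj C" "Y \<in> Obj C" "Z \<in> Obj C" "f \<in> Mor C X Y" "g \<in> Mor C Y Z"
  shows "g \<cdot> f \<in> Mor C X Z"
  using lin_maps_closed[OF Comp_linear_left] assms by blast

lemma arrow_comp:
  assumes "arrow C f" "arrow C g" "source C g = target C f"
  shows "arrow C (g \<cdot> f)" "source C (g \<cdot> f) = source C f" "target C (g \<cdot> f) = target C g"
  using arrowI[OF _ _ comp_mor[of "source C f" "target C f" "target C g" f g]] assms arrow_obj arrow_mor
  by metis+

lemma arrow_ident:
  assumes "X \<in> Obj C"
  shows "arrow C (Ident C X)" "source C (Ident C X) = X" "target C (Ident C X) = X"
  using arrowI[OF assms assms Ident_closed[OF assms]] by auto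

lemma comp_assoc:
  assumes "arrow C f" "arrow C g" "arrow C h" "source C g = target C f" "source C h = target C g"
  shows "(h \<cdot> g) \<cdot> f = h \<cdot> (g \<cdot> f)"
  using Comp_assoc[of "source C f" "target C f" "target C g" "target C h" f g h] assms arrow_obj arrow_mor
  by metis

lemma comp_ident:
  assumes "arrow C f"
  shows "source C f = X \<Longrightarrow> f \<cdot> Ident C X = f" "target C f = X \<Longrightarrow> Ident C X \<cdot> f = f"
  using Comp_Ident Ident_Comp assms arrow_obj arrow_mor by metis+

lemma hom_abelian_group: "X \<in> Obj C \<Longrightarrow> Y \<in> Obj C \<Longrightarrow> abelian_group (Hom C X Y)"
  by (rule vs_abelian_group[OF Hom_vectorspace])

lemma arrow_zero:
  assumes "X \<in> Obj C" "Y \<in> Obj C"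
  shows "arrow C \<zero>\<^bsub>Hom C X Y\<^esub>" "source C \<zero>\<^bsub>Hom C X Y\<^esub> = X" "target C \<zero>\<^bsub>Hom C X Y\<^esub> = Y"
  using arrowI[OF assms] abelian_group.axioms(1)[OF hom_abelian_group[OF assms]]
  by (auto dest: abelian_monoid.zero_closed)

lemma arrow_add:
  assumes "arrow C f" "arrow C g" "source C f = X" "source C g = X" "target C f = Y" "target C g = Y"
  shows "arrow C (f \<oplus>\<^bsub>Hom C X Y\<^esub> g)" "source C (f \<oplus>\<^bsub>Hom C X Y\<^esub> g) = X" "target C (f \<oplus>\<^bsub>Hom C X Y\<^esub> g) = Y"
proof -
  have XY: "X \<in> Obj C" "Y \<in> Obj C" using assms arrow_obj by auto
  interpret abelian_group "Hom C X Y" using XY by (rule hom_abelian_group)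
  have "f \<oplus>\<^bsub>Hom C X Y\<^esub> g \<in> Mor C X Y"
    using a_closed[of f g] assms mor_iff[OF XY, of f] mor_iff[OF XY, of g] by blast
  from arrowI[OF XY this] show "arrow C (f \<oplus>\<^bsub>Hom C X Y\<^esub> g)" "source C (f \<oplus>\<^bsub>Hom C X Y\<^esub> g) = X"
    "target C (f \<oplus>\<^bsub>Hom C X Y\<^esub> g) = Y" by auto
qed

lemma arrow_neg:
  assumes "arrow C f" "source C f = X" "target C f = Y"
  shows "arrow C (\<ominus>\<^bsub>Hom C X Y\<^esub> f)" "source C (\<ominus>\<^bsub>Hom C X Y\<^esub> f) = X" "target C (\<ominus>\<^bsub>Hom C X Y\<^esub> f) = Y"
proof -
  have XY: "X \<in> Obj C" "Y \<in> Obj C" using assms arrow_obj by auto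
  interpret abelian_group "Hom C X Y" using XY by (rule hom_abelian_group)
  have "\<ominus>\<^bsub>Hom C X Y\<^esub> f \<in> Mor C X Y" 
    using a_inv_closed[of f] assms mor_iff[OF XY, of f] by blast
  from arrowI[OF XY this] show "arrow C (\<ominus>\<^bsub>Hom C X Y\<^esub> f)" "source C (\<ominus>\<^bsub>Hom C X Y\<^esub> f) = X"
    "target C (\<ominus>\<^bsub>Hom C X Y\<^esub> f) = Y" by auto
qed

lemma arrow_smult:
  assumes "arrow C f" "source C f = X" "target C f = Y"
  shows "arrow C (c \<odot>\<^bsub>Hom C X Y\<^esub> f)" "source C (c \<odot>\<^bsub>Hom C X Y\<^esub> f) = X" "target C (c \<odot>\<^bsub>Hom C X Y\<^esub> f) = Y"
proof -
  have XY: "X \<in> Obj C" "Y \<in> Obj C" using assms arrow_obj by auto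
  have "c \<odot>\<^bsub>Hom C X Y\<^esub> f \<in> Mor C X Y" 
    using vs_smult_closed[OF Hom_vectorspace[OF XY]] assms mor_iff[OF XY, of f] by blast
  from arrowI[OF XY this] show "arrow C (c \<odot>\<^bsub>Hom C X Y\<^esub> f)" "source C (c \<odot>\<^bsub>Hom C X Y\<^esub> f) = X"
    "target C (c \<odot>\<^bsub>Hom C X Y\<^esub> f) = Y" by auto
qed

lemma comp_add_left:
  assumes "arrow C f" "arrow C g" "arrow C h" "source C g = Y" "source C h = Y" "target C g = Z" "target C h = Z"
    "target C f = Y"
  shows "(g \<oplus>\<^bsub>Hom C Y Z\<^esub> h) \<cdot> f = g \<cdot> f \<oplus>\<^bsub>Hom C (source C f) Z\<^esub> h \<cdot> f"
  using lin_maps_add[OF Comp_linear_left[of "source C f" Y Z f], of g h] assms arrow_obj arrow_mor by metis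

lemma comp_add_right:
  assumes "arrow C f" "arrow C g" "arrow C h" "source C f = X" "source C g = X" "target C f = Y" "target C g = Y"
    "source C h = Y"
  shows "h \<cdot> (f \<oplus>\<^bsub>Hom C X Y\<^esub> g) = h \<cdot> f \<oplus>\<^bsub>Hom C X (target C h)\<^esub> h \<cdot> g"
  using lin_maps_add[OF Comp_linear_right[of X Y "target C h" h], of f g] assms arrow_obj arrow_mor by metis

lemma comp_smult_left:
  assumes "arrow C f" "arrow C g" "source C g = Y" "target C g = Z" "target C f = Y"
  shows "(c \<odot>\<^bsub>Hom C Y Z\<^esub> g) \<cdot> f = c \<odot>\<^bsub>Hom C (source C f) Z\<^esub> (g \<cdot> f)"
  using lin_maps_smult[OF Comp_linear_left[of "source C f" Y Z f], of g c] assms arrow_obj arrow_mor by metis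

lemma comp_smult_right:
  assumes "arrow C f" "arrow C h" "source C f = X" "target C f = Y" "source C h = Y"
  shows "h \<cdot> (c \<odot>\<^bsub>Hom C X Y\<^esub> f) = c \<odot>\<^bsub>Hom C X (target C h)\<^esub> (h \<cdot> f)"
  using lin_maps_smult[OF Comp_linear_right[of X Y "target C h" h], of f c] assms arrow_obj arrow_mor by metis

lemma comp_neg_left:
  assumes "arrow C f" "arrow C g" "source C g = Y" "target C g = Z" "target C f = Y"
  shows "(\<ominus>\<^bsub>Hom C Y Z\<^esub> g) \<cdot> f = \<ominus>\<^bsub>Hom C (source C f) Z\<^esub> (g \<cdot> f)"
  using lin_maps_neg[OF _ _ Comp_linear_left[of "source C f" Y Z f], of g] Hom_vectorspace assms arrow_obj arrow_mor
  by metis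

lemma comp_neg_right:
  assumes "arrow C f" "arrow C h" "source C f = X" "target C f = Y" "source C h = Y"
  shows "h \<cdot> (\<ominus>\<^bsub>Hom C X Y\<^esub> f) = \<ominus>\<^bsub>Hom C X (target C h)\<^esub> (h \<cdot> f)"
  using lin_maps_neg[OF _ _ Comp_linear_right[of X Y "target C h" h], of f] Hom_vectorspace assms arrow_obj arrow_mor
  by metis

lemma comp_zero_left:
  assumes "arrow C f" "target C f = Y" "Z \<in> Obj C"
  shows "\<zero>\<^bsub>Hom C Y Z\<^esub> \<cdot> f = \<zero>\<^bsub>Hom C (source C f) Z\<^esub>"
  using lin_maps_zero[OF _ _ Comp_linear_left[of "source C f" Y Z f]] Hom_vectorspace assms arrow_obj arrow_mor
  by metis

lemma comp_zero_right:
  assumes "arrow C h" "source C h = Y" "X \<in> Obj C"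
  shows "h \<cdot> \<zero>\<^bsub>Hom C X Y\<^esub> = \<zero>\<^bsub>Hom C X (target C h)\<^esub>"
  using lin_maps_zero[OF _ _ Comp_linear_right[of X Y "target C h" h]] Hom_vectorspace assms arrow_obj arrow_mor
  by metis

lemmas cat_simps = mor_iff arrow_comp arrow_ident arrow_zero arrow_add arrow_neg arrow_smult comp_assoc comp_ident
  comp_add_left comp_add_right comp_smult_left comp_smult_right comp_neg_left comp_neg_right
  comp_zero_left comp_zero_right arrow_obj

lemma hom_add_comm:
  assumes "X \<in> Obj C" "Y \<in> Obj C" "f \<in> Mor C X Y" "g \<in> Mor C X Y"
  shows "f \<oplus>\<^bsub>Hom C X Y\<^esub> g = g \<oplus>\<^bsub>Hom C X Y\<^esub> f"
proof -
  interpret abelian_group "Hom C X Y" using assms(1,2) by (rule hom_abelian_group)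
  show ?thesis using assms a_comm by blast
qed

lemma hom_add_assoc:
  assumes "X \<in> Obj C" "Y \<in> Obj C" "f \<in> Mor C X Y" "g \<in> Mor C X Y" "h \<in> Mor C X Y"
  shows "(f \<oplus>\<^bsub>Hom C X Y\<^esub> g) \<oplus>\<^bsub>Hom C X Y\<^esub> h = f \<oplus>\<^bsub>Hom C X Y\<^esub> (g \<oplus>\<^bsub>Hom C X Y\<^esub> h)"
proof -
  interpret abelian_group "Hom C X Y" using assms(1,2) by (rule hom_abelian_group)
  show ?thesis using assms a_assoc by blast
qed

lemma hom_cancel:
  assumes "X \<in> Obj C" "Y \<in> Obj C" "f \<in> Mor C X Y" "g \<in> Mor C X Y" "h \<in> Mor C X Y"
    "f \<oplus>\<^bsub>Hom C X Y\<^esub> h = g \<oplus>\<^bsub>Hom C X Y\<^esub> h"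
  shows "f = g"
proof -
  interpret abelian_group "Hom C X Y" using assms(1,2) by (rule hom_abelian_group)
  show ?thesis using assms by simp
qed

lemma hom_minus_iff:
  assumes "X \<in> Obj C" "Y \<in> Obj C" "f \<in> Mor C X Y" "g \<in> Mor C X Y" "h \<in> Mor C X Y"
  shows "f \<ominus>\<^bsub>Hom C X Y\<^esub> g = h \<longleftrightarrow> h \<oplus>\<^bsub>Hom C X Y\<^esub> g = f"
proof -
  interpret abelian_group "Hom C X Y" using assms(1,2) by (rule hom_abelian_group)
  show ?thesis using assms by (auto simp: a_minus_def a_assoc l_neg r_neg)
qed

lemma hom_minus_closed:
  assumes "X \<in> Obj C" "Y \<in> Obj C" "f \<in> Mor C X Y" "g \<in> Mor C X Y"
  shows "f \<ominus>\<^bsub>Hom C X Y\<^esub> g \<in> Mor C X Y"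
proof -
  interpret abelian_group "Hom C X Y" using assms(1,2) by (rule hom_abelian_group)
  show ?thesis using assms by simp
qed

subsection \<open>The radical is an ideal\<close>

lemma iso_comp:
  assumes "X \<in> Obj C" "iso_mor C X X f" "iso_mor C X X g"
  shows "iso_mor C X X (g \<cdot> f)"
proof -
  obtain f' g' where fg: "f \<in> Mor C X X" "g \<in> Mor C X X" "f' \<in> Mor C X X" "g' \<in> Mor C X X"
    and eq: "f' \<cdot> f = Ident C X" "f \<cdot> f' = Ident C X" "g' \<cdot> g = Ident C X" "g \<cdot> g' = Ident C X"
    using assms by (auto simp: iso_mor_def)
  have "(f' \<cdot> g') \<cdot> (g \<cdot> f) = f' \<cdot> ((g' \<cdot> g) \<cdot> f)" using fg assms(1) by (simp add: cat_simps)
  also have "\<dots> = Ident C X" using fg eq assms(1) by (simp add: cat_simps)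
  finally have 1: "(f' \<cdot> g') \<cdot> (g \<cdot> f) = Ident C X" .
  have "(g \<cdot> f) \<cdot> (f' \<cdot> g') = g \<cdot> ((f \<cdot> f') \<cdot> g')" using fg assms(1) by (simp add: cat_simps)
  also have "\<dots> = Ident C X" using fg eq assms(1) by (simp add: cat_simps)
  finally show ?thesis using 1 fg assms(1) comp_mor unfolding iso_mor_def by blast
qed

text \<open>The inverse of \<open>1 - a b\<close> is \<open>1 + a u b\<close> if \<open>u\<close> is the inverse of \<open>1 - b a\<close>.\<close>

lemma iso_one_minus_swap:
  assumes XY: "X \<in> Obj C" "Y \<in> Obj C" and a: "a \<in> Mor C X Y" and b: "b \<in> Mor C Y X"
    and iso: "iso_mor C X X (Ident C X \<ominus>\<^bsub>Hom C X X\<^esub> (b \<cdot> a))"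
  shows "iso_mor C Y Y (Ident C Y \<ominus>\<^bsub>Hom C Y Y\<^esub> (a \<cdot> b))"
proof -
  interpret Y: abelian_group "Hom C Y Y" using XY(2,2) by (rule hom_abelian_group)
  define c where "c = Ident C X \<ominus>\<^bsub>Hom C X X\<^esub> (b \<cdot> a)"
  define d where "d = Ident C Y \<ominus>\<^bsub>Hom C Y Y\<^esub> (a \<cdot> b)"
  note ba = comp_mor[OF XY(1,2,1) a b] and ab = comp_mor[OF XY(2,1,2) b a]
  note IX = Ident_closed[OF XY(1)] and IY = Ident_closed[OF XY(2)]
  have c: "c \<in> Mor C X X" and c1: "c \<oplus>\<^bsub>Hom C X X\<^esub> b \<cdot> a = Ident C X"
    using hom_minus_closed[OF XY(1,1) IX ba] hom_minus_iff[OF XY(1,1) IX ba] by (auto simp: c_def)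
  have d: "d \<in> Mor C Y Y" and d1: "d \<oplus>\<^bsub>Hom C Y Y\<^esub> a \<cdot> b = Ident C Y"
    using hom_minus_closed[OF XY(2,2) IY ab] hom_minus_iff[OF XY(2,2) IY ab] by (auto simp: d_def)
  obtain u where u: "u \<in> Mor C X X" and uc: "u \<cdot> c = Ident C X" and cu: "c \<cdot> u = Ident C X"
    using iso by (auto simp: iso_mor_def c_def)
  define w where "w = Ident C Y \<oplus>\<^bsub>Hom C Y Y\<^esub> a \<cdot> (u \<cdot> b)"
  have aub: "a \<cdot> (u \<cdot> b) \<in> Mor C Y Y" and w: "w \<in> Mor C Y Y"
    using a b u XY by (simp_all add: w_def cat_simps)
  have "u = (c \<oplus>\<^bsub>Hom C X X\<^esub> b \<cdot> a) \<cdot> u" using u XY by (simp add: c1 cat_simps)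
  hence u1: "u = Ident C X \<oplus>\<^bsub>Hom C X X\<^esub> b \<cdot> (a \<cdot> u)" using a b c u XY cu by (simp add: cat_simps)
  have "u = u \<cdot> (c \<oplus>\<^bsub>Hom C X X\<^esub> b \<cdot> a)" using u XY by (simp add: c1 cat_simps)
  hence u2: "u = Ident C X \<oplus>\<^bsub>Hom C X X\<^esub> u \<cdot> (b \<cdot> a)" using a b c u XY uc by (simp add: cat_simps)
  have "a \<cdot> (u \<cdot> b) = a \<cdot> ((Ident C X \<oplus>\<^bsub>Hom C X X\<^esub> b \<cdot> (a \<cdot> u)) \<cdot> b)" using u1 by simp
  also have "\<dots> = (a \<cdot> b) \<cdot> w" using a b u XY by (simp add: w_def cat_simps)
  finally have abw: "(a \<cdot> b) \<cdot> w = a \<cdot> (u \<cdot> b)" by simp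
  have "a \<cdot> (u \<cdot> b) = a \<cdot> ((Ident C X \<oplus>\<^bsub>Hom C X X\<^esub> u \<cdot> (b \<cdot> a)) \<cdot> b)" using u2 by simp
  also have "\<dots> = w \<cdot> (a \<cdot> b)" using a b u XY by (simp add: w_def cat_simps)
  finally have wab: "w \<cdot> (a \<cdot> b) = a \<cdot> (u \<cdot> b)" by simp
  have dw: "d \<cdot> w \<in> Mor C Y Y" "w \<cdot> d \<in> Mor C Y Y" using d w XY by (simp_all add: cat_simps)
  have "(d \<oplus>\<^bsub>Hom C Y Y\<^esub> a \<cdot> b) \<cdot> w = w" using w XY by (simp add: d1 cat_simps)
  hence "d \<cdot> w \<oplus>\<^bsub>Hom C Y Y\<^esub> (a \<cdot> b) \<cdot> w = w" using a b d w XY comp_add_left[of w d "a \<cdot> b" Y Y] by (simp add: cat_simps)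
  hence "d \<cdot> w \<oplus>\<^bsub>Hom C Y Y\<^esub> a \<cdot> (u \<cdot> b) = Ident C Y \<oplus>\<^bsub>Hom C Y Y\<^esub> a \<cdot> (u \<cdot> b)"
    by (simp only: abw) (simp only: w_def)
  hence 1: "d \<cdot> w = Ident C Y" using hom_cancel[OF XY(2,2) dw(1) IY aub] by simp
  have "w \<cdot> (d \<oplus>\<^bsub>Hom C Y Y\<^esub> a \<cdot> b) = w" using w XY by (simp add: d1 cat_simps)
  hence "w \<cdot> d \<oplus>\<^bsub>Hom C Y Y\<^esub> w \<cdot> (a \<cdot> b) = w" using a b d w XY comp_add_right[of d "a \<cdot> b" w Y Y] by (simp add: cat_simps)
  hence "w \<cdot> d \<oplus>\<^bsub>Hom C Y Y\<^esub> a \<cdot> (u \<cdot> b) = Ident C Y \<oplus>\<^bsub>Hom C Y Y\<^esub> a \<cdot> (u \<cdot> b)"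
    by (simp only: wab) (simp only: w_def)
  hence 2: "w \<cdot> d = Ident C Y" using hom_cancel[OF XY(2,2) dw(2) IY aub] by simp
  show ?thesis using 1 2 w d unfolding iso_mor_def d_def by blast
qed

lemma rad_mor: "f \<in> rad C X Y \<Longrightarrow> f \<in> Mor C X Y"
  by (simp add: rad_def)

lemma rad_comp_left:
  assumes "X \<in> Obj C" "Y \<in> Obj C" "Z \<in> Obj C" "f \<in> rad C X Y" "g \<in> Mor C Y Z"
  shows "g \<cdot> f \<in> rad C X Z"
proof -
  have f: "f \<in> Mor C X Y" using assms(4) by (rule rad_mor)
  have "iso_mor C X X (Ident C X \<ominus>\<^bsub>Hom C X X\<^esub> (h \<cdot> (g \<cdot> f)))" if h: "h \<in> Mor C Z X" for h
  proof -
    have "h \<cdot> (g \<cdot> f) = (h \<cdot> g) \<cdot> f" using assms(1-3,5) f h by (simp add: cat_simps)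
    thus ?thesis using assms comp_mor[OF assms(2,3,1) assms(5) h] by (simp add: rad_def)
  qed
  thus ?thesis using comp_mor[OF assms(1-3) f assms(5)] by (simp add: rad_def)
qed

text \<open>The definition of the radical is one-sided. Moving \<open>h\<close> from one end of \<open>g f h\<close> to the other makes it an
  ideal on both sides.\<close>

lemma rad_comp_right:
  assumes "W \<in> Obj C" "X \<in> Obj C" "Y \<in> Obj C" "h \<in> Mor C W X" "f \<in> rad C X Y"
  shows "f \<cdot> h \<in> rad C W Y"
proof -
  have f: "f \<in> Mor C X Y" using assms(5) by (rule rad_mor)
  have "iso_mor C W W (Ident C W \<ominus>\<^bsub>Hom C W W\<^esub> (g \<cdot> (f \<cdot> h)))" if g: "g \<in> Mor C Y W" for g
  proof -
    have "(h \<cdot> g) \<cdot> f = h \<cdot> (g \<cdot> f)" using assms(1-4) f g by (simp add: cat_simps)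
    hence "iso_mor C X X (Ident C X \<ominus>\<^bsub>Hom C X X\<^esub> (h \<cdot> (g \<cdot> f)))"
      using assms comp_mor[OF assms(3,1,2) g assms(4)] by (auto simp: rad_def)
    hence "iso_mor C W W (Ident C W \<ominus>\<^bsub>Hom C W W\<^esub> ((g \<cdot> f) \<cdot> h))"
      using iso_one_minus_swap[OF assms(2,1) comp_mor[OF assms(2,3,1) f g] assms(4)] by simp
    thus ?thesis using assms(1-4) f g by (simp add: cat_simps)
  qed
  thus ?thesis using comp_mor[OF assms(1-4) f] by (simp add: rad_def)
qed

text \<open>With \<open>c = 1 - g f\<close> and \<open>u\<close> its inverse, \<open>1 - g (f + f') = c (1 - u g f')\<close> is a product of invertible
  morphisms.\<close>

lemma rad_add:
  assumes XY: "X \<in> Obj C" "Y \<in> Obj C" and r: "f \<in> rad C X Y" "f' \<in> rad C X Y"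
  shows "f \<oplus>\<^bsub>Hom C X Y\<^esub> f' \<in> rad C X Y"
proof -
  note f = rad_mor[OF r(1)] and f' = rad_mor[OF r(2)] and I = Ident_closed[OF XY(1)]
  have "iso_mor C X X (Ident C X \<ominus>\<^bsub>Hom C X X\<^esub> (g \<cdot> (f \<oplus>\<^bsub>Hom C X Y\<^esub> f')))" if g: "g \<in> Mor C Y X" for g
  proof -
    define c where "c = Ident C X \<ominus>\<^bsub>Hom C X X\<^esub> (g \<cdot> f)"
    note gf = comp_mor[OF XY(1,2,1) f g] and gf' = comp_mor[OF XY(1,2,1) f' g]
    have c: "c \<in> Mor C X X" and c1: "c \<oplus>\<^bsub>Hom C X X\<^esub> g \<cdot> f = Ident C X"
      using hom_minus_closed[OF XY(1,1) I gf] hom_minus_iff[OF XY(1,1) I gf] by (auto simp: c_def)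
    have ic: "iso_mor C X X c" using r(1) g by (simp add: rad_def c_def)
    then obtain u where u: "u \<in> Mor C X X" and cu: "c \<cdot> u = Ident C X" by (auto simp: iso_mor_def)
    have ug: "u \<cdot> g \<in> Mor C Y X" using u g XY by (simp add: cat_simps)
    note ugf = comp_mor[OF XY(1,2,1) f' ug]
    define c' where "c' = Ident C X \<ominus>\<^bsub>Hom C X X\<^esub> ((u \<cdot> g) \<cdot> f')"
    have c': "c' \<in> Mor C X X" and c1': "c' \<oplus>\<^bsub>Hom C X X\<^esub> (u \<cdot> g) \<cdot> f' = Ident C X"
      using hom_minus_closed[OF XY(1,1) I ugf] hom_minus_iff[OF XY(1,1) I ugf] by (auto simp: c'_def)
    have ic': "iso_mor C X X c'" using r(2) ug by (simp add: rad_def c'_def)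
    have cc': "c \<cdot> c' \<in> Mor C X X" using c c' XY by (simp add: cat_simps)
    have "c \<cdot> ((u \<cdot> g) \<cdot> f') = (c \<cdot> u) \<cdot> (g \<cdot> f')" using c u g f' XY by (simp add: cat_simps)
    hence e: "c \<cdot> ((u \<cdot> g) \<cdot> f') = g \<cdot> f'" using cu g f' XY by (simp add: cat_simps)
    have "c = c \<cdot> (c' \<oplus>\<^bsub>Hom C X X\<^esub> (u \<cdot> g) \<cdot> f')" using c XY by (simp add: c1' cat_simps)
    also have "\<dots> = c \<cdot> c' \<oplus>\<^bsub>Hom C X X\<^esub> c \<cdot> ((u \<cdot> g) \<cdot> f')"
      using lin_maps_add[OF Comp_linear_right[OF XY(1,1,1) c] c' ugf] .
    finally have "c \<cdot> c' \<oplus>\<^bsub>Hom C X X\<^esub> g \<cdot> f' = c" using e by simp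
    hence "(c \<cdot> c' \<oplus>\<^bsub>Hom C X X\<^esub> g \<cdot> f') \<oplus>\<^bsub>Hom C X X\<^esub> g \<cdot> f = Ident C X" using c1 by simp
    hence "c \<cdot> c' \<oplus>\<^bsub>Hom C X X\<^esub> (g \<cdot> f \<oplus>\<^bsub>Hom C X X\<^esub> g \<cdot> f') = Ident C X"
      using hom_add_assoc[OF XY(1,1) cc' gf' gf] hom_add_comm[OF XY(1,1) gf gf'] by simp
    moreover have "g \<cdot> f \<oplus>\<^bsub>Hom C X X\<^esub> g \<cdot> f' = g \<cdot> (f \<oplus>\<^bsub>Hom C X Y\<^esub> f')"
      using lin_maps_add[OF Comp_linear_right[OF XY(1,2,1) g] f f'] by simp
    moreover have "g \<cdot> (f \<oplus>\<^bsub>Hom C X Y\<^esub> f') \<in> Mor C X X" using g f f' XY by (simp add: cat_simps)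
    ultimately have "Ident C X \<ominus>\<^bsub>Hom C X X\<^esub> (g \<cdot> (f \<oplus>\<^bsub>Hom C X Y\<^esub> f')) = c \<cdot> c'"
      using hom_minus_iff[OF XY(1,1) I _ cc'] by simp
    thus ?thesis using iso_comp[OF XY(1) ic' ic] by simp
  qed
  thus ?thesis using f f' XY by (auto simp: rad_def cat_simps)
qed

lemma rad_smult:
  assumes XY: "X \<in> Obj C" "Y \<in> Obj C" and r: "f \<in> rad C X Y"
  shows "c \<odot>\<^bsub>Hom C X Y\<^esub> f \<in> rad C X Y"
proof -
  note f = rad_mor[OF r]
  have "(c \<odot>\<^bsub>Hom C Y Y\<^esub> Ident C Y) \<cdot> f \<in> rad C X Y"
    using rad_comp_left[OF XY XY(2) r] XY by (simp add: cat_simps)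
  thus ?thesis using f XY by (simp add: cat_simps)
qed

lemma rad_zero:
  assumes XY: "X \<in> Obj C" "Y \<in> Obj C"
  shows "\<zero>\<^bsub>Hom C X Y\<^esub> \<in> rad C X Y"
proof -
  interpret abelian_group "Hom C X X" using XY(1,1) by (rule hom_abelian_group)
  have "Ident C X \<ominus>\<^bsub>Hom C X X\<^esub> \<zero>\<^bsub>Hom C X X\<^esub> = Ident C X"
    using hom_minus_iff[OF XY(1,1), of "Ident C X" "\<zero>\<^bsub>Hom C X X\<^esub>"] XY by (simp add: Ident_closed)
  moreover have "iso_mor C X X (Ident C X)"
    unfolding iso_mor_def using XY by (intro conjI bexI[of _ "Ident C X"]) (simp_all add: cat_simps)
  ultimately show ?thesis using XY by (simp add: rad_def cat_simps)
qed

lemma rad_subspace: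
  assumes XY: "X \<in> Obj C" "Y \<in> Obj C"
  shows "VectorSpace.subspace class_ring (rad C X Y) (Hom C X Y)"
  using Hom_vectorspace[OF XY] rad_zero[OF XY] rad_add[OF XY] rad_smult[OF XY] rad_mor
  by (auto simp: subspace_iff)

text \<open>
  If \<open>1 - g v\<close> is not invertible, neither is \<open>1 - v g\<close>. Locality makes \<open>v g\<close> invertible, and \<open>g\<close> followed
  after the inverse of \<open>v g\<close> is the section.
\<close>

lemma not_rad_section:
  assumes VU: "V \<in> Obj C" "U \<in> Obj C"
    and loc: "\<And>f. f \<in> Mor C U U \<Longrightarrow> iso_mor C U U f \<or> iso_mor C U U (Ident C U \<ominus>\<^bsub>Hom C U U\<^esub> f)"
    and v: "v \<in> Mor C V U" "v \<notin> rad C V U"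
  obtains t where "t \<in> Mor C U V" "v \<cdot> t = Ident C U"
proof -
  obtain g where g: "g \<in> Mor C U V" "\<not> iso_mor C V V (Ident C V \<ominus>\<^bsub>Hom C V V\<^esub> (g \<cdot> v))"
    using v by (auto simp: rad_def)
  have "\<not> iso_mor C U U (Ident C U \<ominus>\<^bsub>Hom C U U\<^esub> (v \<cdot> g))"
    using iso_one_minus_swap[OF VU(2,1) g(1) v(1)] g(2) by blast
  hence "iso_mor C U U (v \<cdot> g)" using loc[OF comp_mor[OF VU(2,1,2) g(1) v(1)]] by blast
  then obtain s where s: "s \<in> Mor C U U" "(v \<cdot> g) \<cdot> s = Ident C U" by (auto simp: iso_mor_def)
  show ?thesis
    using that[of "g \<cdot> s"] s g(1) v(1) VU by (simp add: cat_simps)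
qed

end

section \<open>Exact sequences in an extriangulated category\<close>

context linear_category
begin

lemma biproduct_swap:
  assumes "biproduct C X Y Z i j p q" shows "biproduct C Y X Z j i q p"
proof -
  have XYZ: "X \<in> Obj C" "Y \<in> Obj C" "Z \<in> Obj C" using assms by (auto simp: biproduct_def)
  have "i \<cdot> p \<in> Mor C Z Z" "j \<cdot> q \<in> Mor C Z Z"
    using assms XYZ comp_mor[of Z X Z p i] comp_mor[of Z Y Z q j] by (auto simp: biproduct_def)
  thus ?thesis using assms XYZ hom_add_comm[of Z Z "i \<cdot> p" "j \<cdot> q"] by (auto simp: biproduct_def)
qed

lemma is_direct_sum_swap: "is_direct_sum C X Y Z \<Longrightarrow> is_direct_sum C Y X Z"
  unfolding is_direct_sum_def using biproduct_swap by blast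

lemma biproduct_zero_right:
  assumes "W \<in> Obj C" "zero_object C Z"
  shows "biproduct C W Z W (Ident C W) \<zero>\<^bsub>Hom C Z W\<^esub> (Ident C W) \<zero>\<^bsub>Hom C W Z\<^esub>"
proof -
  have Z: "Z \<in> Obj C" "Ident C Z = \<zero>\<^bsub>Hom C Z Z\<^esub>" using assms by (auto simp: zero_object_def)
  interpret abelian_group "Hom C W W" using assms(1,1) by (rule hom_abelian_group)
  show ?thesis using assms(1) Z Ident_closed[OF assms(1)] by (simp add: biproduct_def cat_simps)
qed

lemma is_direct_sum_iso:
  assumes ds: "is_direct_sum C X Y Z" and iso: "iso_mor C Y Y' b" and Y': "Y' \<in> Obj C"
  shows "is_direct_sum C X Y' Z"
proof -
  obtain i j p q where bp: "biproduct C X Y Z i j p q" using ds by (auto simp: is_direct_sum_def)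
  obtain b' where b: "b \<in> Mor C Y Y'" "b' \<in> Mor C Y' Y" "b' \<cdot> b = Ident C Y" "b \<cdot> b' = Ident C Y'"
    using iso by (auto simp: iso_mor_def)
  have obj: "X \<in> Obj C" "Y \<in> Obj C" "Z \<in> Obj C" using bp by (auto simp: biproduct_def)
  have m: "i \<in> Mor C X Z" "j \<in> Mor C Y Z" "p \<in> Mor C Z X" "q \<in> Mor C Z Y"
    and e: "p \<cdot> i = Ident C X" "q \<cdot> j = Ident C Y" "q \<cdot> i = \<zero>\<^bsub>Hom C X Y\<^esub>" "p \<cdot> j = \<zero>\<^bsub>Hom C Y X\<^esub>"
      "(i \<cdot> p) \<oplus>\<^bsub>Hom C Z Z\<^esub> (j \<cdot> q) = Ident C Z" using bp by (auto simp: biproduct_def)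
  have "(b \<cdot> q) \<cdot> (j \<cdot> b') = b \<cdot> ((q \<cdot> j) \<cdot> b')" using b m obj Y' by (simp add: cat_simps)
  also have "\<dots> = Ident C Y'" using b m obj Y' e by (simp add: cat_simps)
  finally have 1: "(b \<cdot> q) \<cdot> (j \<cdot> b') = Ident C Y'" .
  have "(j \<cdot> b') \<cdot> (b \<cdot> q) = j \<cdot> ((b' \<cdot> b) \<cdot> q)" using b(1,2) m obj Y' by (simp add: cat_simps)
  also have "\<dots> = j \<cdot> q" unfolding b(3) using m obj by (simp add: cat_simps)
  finally have 2: "(j \<cdot> b') \<cdot> (b \<cdot> q) = j \<cdot> q" .
  have 3: "p \<cdot> (j \<cdot> b') = (p \<cdot> j) \<cdot> b'" "(b \<cdot> q) \<cdot> i = b \<cdot> (q \<cdot> i)" using b m obj Y' by (simp_all add: cat_simps)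
  have "biproduct C X Y' Z i (j \<cdot> b') p (b \<cdot> q)"
    unfolding biproduct_def 1 2 3 e using b m obj Y' e by (simp add: cat_simps)
  thus ?thesis by (auto simp: is_direct_sum_def)
qed

end

context extriangulated_category
begin

lemma realisesD:
  assumes "realises C Y E X x y \<delta>"
  shows "Y \<in> Obj C" "E \<in> Obj C" "X \<in> Obj C" "x \<in> Mor C Y E" "y \<in> Mor C E X" "\<delta> \<in> carrier (Ext C X Y)"
  using assms by (auto simp: realises_def)

lemma ext_abelian_group: "X \<in> Obj C \<Longrightarrow> Y \<in> Obj C \<Longrightarrow> abelian_group (Ext C X Y)"
  by (rule vs_abelian_group[OF Ext_vectorspace])

lemma ext_zero_closed: "X \<in> Obj C \<Longrightarrow> Y \<in> Obj C \<Longrightarrow> \<zero>\<^bsub>Ext C X Y\<^esub> \<in> carrier (Ext C X Y)"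
  using abelian_monoid.zero_closed abelian_group.axioms(1) ext_abelian_group by blast

lemma push_closed:
  "\<lbrakk>X \<in> Obj C; Y \<in> Obj C; Y' \<in> Obj C; a \<in> Mor C Y Y'; \<delta> \<in> carrier (Ext C X Y)\<rbrakk>
    \<Longrightarrow> push C a \<delta> \<in> carrier (Ext C X Y')"
  using lin_maps_closed[OF push_linear] by blast

lemma pull_closed:
  "\<lbrakk>X \<in> Obj C; X' \<in> Obj C; Y \<in> Obj C; c \<in> Mor C X' X; \<delta> \<in> carrier (Ext C X Y)\<rbrakk>
    \<Longrightarrow> pull C c \<delta> \<in> carrier (Ext C X' Y)"
  using lin_maps_closed[OF pull_linear] by blast

lemma push_zero_right:
  "\<lbrakk>X \<in> Obj C; Y \<in> Obj C; Y' \<in> Obj C; a \<in> Mor C Y Y'\<rbrakk> \<Longrightarrow> push C a \<zero>\<^bsub>Ext C X Y\<^esub> = \<zero>\<^bsub>Ext C X Y'\<^esub>"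
  using lin_maps_zero[OF Ext_vectorspace Ext_vectorspace push_linear] by blast

lemma push_zero_left:
  "\<lbrakk>X \<in> Obj C; Y \<in> Obj C; Y' \<in> Obj C; \<delta> \<in> carrier (Ext C X Y)\<rbrakk> \<Longrightarrow> push C \<zero>\<^bsub>Hom C Y Y'\<^esub> \<delta> = \<zero>\<^bsub>Ext C X Y'\<^esub>"
  using lin_maps_zero[OF Hom_vectorspace Ext_vectorspace push_linear_mor] by blast

lemma pull_zero_right:
  "\<lbrakk>X \<in> Obj C; X' \<in> Obj C; Y \<in> Obj C; c \<in> Mor C X' X\<rbrakk> \<Longrightarrow> pull C c \<zero>\<^bsub>Ext C X Y\<^esub> = \<zero>\<^bsub>Ext C X' Y\<^esub>"
  using lin_maps_zero[OF Ext_vectorspace Ext_vectorspace pull_linear] by blast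

lemma pull_zero_left:
  "\<lbrakk>X \<in> Obj C; X' \<in> Obj C; Y \<in> Obj C; \<delta> \<in> carrier (Ext C X Y)\<rbrakk> \<Longrightarrow> pull C \<zero>\<^bsub>Hom C X' X\<^esub> \<delta> = \<zero>\<^bsub>Ext C X' Y\<^esub>"
  using lin_maps_zero[OF Hom_vectorspace Ext_vectorspace pull_linear_mor] by blast

lemma seq_morD:
  assumes "seq_mor C (x, y) (x', y') a b c"
    and "Y \<in> Obj C" "E \<in> Obj C" "X \<in> Obj C" "x \<in> Mor C Y E" "y \<in> Mor C E X"
    and "Y' \<in> Obj C" "E' \<in> Obj C" "X' \<in> Obj C" "x' \<in> Mor C Y' E'" "y' \<in> Mor C E' X'"
  shows "b \<in> Mor C E E'" "b \<cdot> x = x' \<cdot> a" "c \<cdot> y = y' \<cdot> b"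
  using assms unfolding seq_mor_def by (metis Hom_disjoint fst_conv snd_conv)+

text \<open>
  The split conflations \<open>W = W \<rightarrow> 0\<close> and \<open>0 \<rightarrow> W = W\<close>. Comparing an arbitrary conflation with them by (ET3),
  its dual and the lifting property of realisations gives the exactness of the long exact sequences.
\<close>

lemma realises_zero_right:
  assumes "W \<in> Obj C" "zero_object C Z"
  shows "realises C W W Z (Ident C W) \<zero>\<^bsub>Hom C W Z\<^esub> \<zero>\<^bsub>Ext C Z W\<^esub>"
proof -
  have Z: "Z \<in> Obj C" using assms by (simp add: zero_object_def)
  show ?thesis using realise_zero[OF biproduct_zero_right[OF assms]] assms Z ext_zero_closed[OF Z assms(1)]
    by (simp add: realises_def cat_simps)
qed

lemma realises_zero_left:
  assumes "W \<in> Obj C" "zero_object C Z"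
  shows "realises C Z W W \<zero>\<^bsub>Hom C Z W\<^esub> (Ident C W) \<zero>\<^bsub>Ext C W Z\<^esub>"
proof -
  have Z: "Z \<in> Obj C" using assms by (simp add: zero_object_def)
  show ?thesis using realise_zero[OF biproduct_swap[OF biproduct_zero_right[OF assms]]] assms Z
      ext_zero_closed[OF assms(1) Z]
    by (simp add: realises_def cat_simps)
qed

context
  fixes Y E X x y \<delta>
  assumes conf: "realises C Y E X x y \<delta>"
begin

private lemmas facts = realisesD[OF conf]

lemma conflation_comp_zero: "y \<cdot> x = \<zero>\<^bsub>Hom C Y X\<^esub>"
proof -
  obtain Z where Z: "zero_object C Z" using zero_object_exists by blast
  hence ZO: "Z \<in> Obj C" by (simp add: zero_object_def)
  obtain c where "c \<in> Mor C Z X" "c \<cdot> \<zero>\<^bsub>Hom C Y Z\<^esub> = y \<cdot> x"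
    using ET3[OF realises_zero_right[OF facts(1) Z] conf Ident_closed[OF facts(1)] facts(4)] by blast
  thus ?thesis using facts ZO by (simp add: cat_simps)
qed

lemma push_inflation_zero: "push C x \<delta> = \<zero>\<^bsub>Ext C X E\<^esub>"
proof -
  obtain Z where Z: "zero_object C Z" using zero_object_exists by blast
  hence ZO: "Z \<in> Obj C" by (simp add: zero_object_def)
  obtain c where "c \<in> Mor C X Z" "push C x \<delta> = pull C c \<zero>\<^bsub>Ext C Z E\<^esub>"
    using ET3[OF conf realises_zero_right[OF facts(2) Z] facts(4) Ident_closed[OF facts(2)]] by blast
  thus ?thesis using pull_zero_right[OF ZO facts(3,2)] by simp
qed

lemma pull_deflation_zero: "pull C y \<delta> = \<zero>\<^bsub>Ext C E Y\<^esub>"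
proof -
  obtain Z where Z: "zero_object C Z" using zero_object_exists by blast
  hence ZO: "Z \<in> Obj C" by (simp add: zero_object_def)
  obtain a where "a \<in> Mor C Z Y" "push C a \<zero>\<^bsub>Ext C E Z\<^esub> = pull C y \<delta>"
    using ET3_op[OF realises_zero_left[OF facts(2) Z] conf Ident_closed[OF facts(2)] facts(5)] by blast
  thus ?thesis using push_zero_right[OF facts(2) ZO facts(1)] by simp
qed

lemma factor_inflation:
  assumes W: "W \<in> Obj C" and g: "g \<in> Mor C W E" "y \<cdot> g = \<zero>\<^bsub>Hom C W X\<^esub>"
  shows "\<exists>k\<in>Mor C W Y. g = x \<cdot> k"
proof -
  obtain Z where Z: "zero_object C Z" using zero_object_exists by blast
  hence ZO: "Z \<in> Obj C" by (simp add: zero_object_def)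
  have "\<exists>a\<in>Mor C W Y. g \<cdot> Ident C W = x \<cdot> a \<and> push C a \<zero>\<^bsub>Ext C Z W\<^esub> = pull C \<zero>\<^bsub>Hom C Z X\<^esub> \<delta>"
    using ET3_op[OF realises_zero_right[OF W Z] conf g(1), of "\<zero>\<^bsub>Hom C Z X\<^esub>"] facts ZO W g
    by (simp add: cat_simps)
  thus ?thesis using Comp_Ident[OF W facts(2) g(1)] by metis
qed

lemma factor_inflation_diff:
  assumes W: "W \<in> Obj C" and g: "g \<in> Mor C W E" "g' \<in> Mor C W E" "y \<cdot> g = y \<cdot> g'"
  shows "\<exists>k\<in>Mor C W Y. g = g' \<oplus>\<^bsub>Hom C W E\<^esub> x \<cdot> k"
proof -
  interpret A: abelian_group "Hom C W X" using W facts(3) by (rule hom_abelian_group)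
  note gg = hom_minus_closed[OF W facts(2) g(1,2)]
  have "y \<cdot> (g \<ominus>\<^bsub>Hom C W E\<^esub> g') = \<zero>\<^bsub>Hom C W X\<^esub>"
    using W facts g comp_mor[OF W facts(2,3) g(2) facts(5)] by (simp add: a_minus_def cat_simps A.r_neg)
  then obtain k where k: "k \<in> Mor C W Y" "g \<ominus>\<^bsub>Hom C W E\<^esub> g' = x \<cdot> k" using factor_inflation[OF W gg] by blast
  have xk: "x \<cdot> k \<in> Mor C W E" using k(1) comp_mor W facts by blast
  hence "x \<cdot> k \<oplus>\<^bsub>Hom C W E\<^esub> g' = g" using hom_minus_iff[OF W facts(2) g(1,2)] k(2) by blast
  thus ?thesis using hom_add_comm[OF W facts(2) xk g(2)] k(1) by auto
qed

lemma factor_deflation: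
  assumes W: "W \<in> Obj C" and g: "g \<in> Mor C E W" "g \<cdot> x = \<zero>\<^bsub>Hom C Y W\<^esub>"
  shows "\<exists>k\<in>Mor C X W. g = k \<cdot> y"
proof -
  obtain Z where Z: "zero_object C Z" using zero_object_exists by blast
  hence ZO: "Z \<in> Obj C" by (simp add: zero_object_def)
  have "\<exists>c\<in>Mor C X W. c \<cdot> y = Ident C W \<cdot> g \<and> push C \<zero>\<^bsub>Hom C Y Z\<^esub> \<delta> = pull C c \<zero>\<^bsub>Ext C W Z\<^esub>"
    using ET3[OF conf realises_zero_left[OF W Z], of "\<zero>\<^bsub>Hom C Y Z\<^esub>" g] facts ZO W g
    by (simp add: cat_simps)
  thus ?thesis using Ident_Comp[OF facts(2) W g(1)] by metis
qed

lemma factor_deflation_diff: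
  assumes W: "W \<in> Obj C" and g: "g \<in> Mor C E W" "g' \<in> Mor C E W" "g \<cdot> x = g' \<cdot> x"
  shows "\<exists>k\<in>Mor C X W. g = g' \<oplus>\<^bsub>Hom C E W\<^esub> k \<cdot> y"
proof -
  interpret A: abelian_group "Hom C Y W" using facts(1) W by (rule hom_abelian_group)
  note gg = hom_minus_closed[OF facts(2) W g(1,2)]
  have "(g \<ominus>\<^bsub>Hom C E W\<^esub> g') \<cdot> x = \<zero>\<^bsub>Hom C Y W\<^esub>"
    using W facts g comp_mor[OF facts(1,2) W facts(4) g(2)] by (simp add: a_minus_def cat_simps A.r_neg)
  then obtain k where k: "k \<in> Mor C X W" "g \<ominus>\<^bsub>Hom C E W\<^esub> g' = k \<cdot> y" using factor_deflation[OF W gg] by blast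
  have ky: "k \<cdot> y \<in> Mor C E W" using k(1) comp_mor W facts by blast
  hence "k \<cdot> y \<oplus>\<^bsub>Hom C E W\<^esub> g' = g" using hom_minus_iff[OF facts(2) W g(1,2)] k(2) by blast
  thus ?thesis using hom_add_comm[OF facts(2) W ky g(2)] k(1) by auto
qed

lemma lift_deflation:
  assumes W: "W \<in> Obj C" and g: "g \<in> Mor C W X" "pull C g \<delta> = \<zero>\<^bsub>Ext C W Y\<^esub>"
  shows "\<exists>k\<in>Mor C W E. g = y \<cdot> k"
proof -
  obtain Z where Z: "zero_object C Z" using zero_object_exists by blast
  hence ZO: "Z \<in> Obj C" by (simp add: zero_object_def)
  note r = realises_zero_left[OF W Z]
  have z: "\<zero>\<^bsub>Hom C Z Y\<^esub> \<in> Mor C Z Y" using ZO facts by (simp add: cat_simps)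
  obtain b where b: "seq_mor C (\<zero>\<^bsub>Hom C Z W\<^esub>, Ident C W) (x, y) \<zero>\<^bsub>Hom C Z Y\<^esub> b g"
    using realise_mor[OF r conf z g(1)] push_zero_left[OF W ZO facts(1) realisesD(6)[OF r]] g(2) by auto
  from seq_morD[OF b realisesD(1-5)[OF r] facts(1-5)] have "b \<in> Mor C W E" "g \<cdot> Ident C W = y \<cdot> b" by auto
  thus ?thesis using Comp_Ident[OF W facts(3) g(1)] by metis
qed

lemma extend_inflation:
  assumes W: "W \<in> Obj C" and g: "g \<in> Mor C Y W" "push C g \<delta> = \<zero>\<^bsub>Ext C X W\<^esub>"
  shows "\<exists>k\<in>Mor C E W. g = k \<cdot> x"
proof -
  obtain Z where Z: "zero_object C Z" using zero_object_exists by blast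
  hence ZO: "Z \<in> Obj C" by (simp add: zero_object_def)
  note r = realises_zero_right[OF W Z]
  have z: "\<zero>\<^bsub>Hom C X Z\<^esub> \<in> Mor C X Z" using ZO facts by (simp add: cat_simps)
  obtain b where b: "seq_mor C (x, y) (Ident C W, \<zero>\<^bsub>Hom C W Z\<^esub>) g b \<zero>\<^bsub>Hom C X Z\<^esub>"
    using realise_mor[OF conf r g(1) z] pull_zero_left[OF ZO facts(3) W realisesD(6)[OF r]] g(2) by auto
  from seq_morD[OF b facts(1-5) realisesD(1-5)[OF r]] have "b \<in> Mor C E W" "b \<cdot> x = Ident C W \<cdot> g" by auto
  thus ?thesis using Ident_Comp[OF facts(1) W g(1)] by metis
qed

end

lemma realises_exists:
  assumes "X \<in> Obj C" "Y \<in> Obj C" "\<delta> \<in> carrier (Ext C X Y)"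
  obtains E x y where "realises C Y E X x y \<delta>"
proof -
  obtain s where s: "s \<in> sequences C Y X" "realise C \<delta> = seq_class C Y X s" using realise_class[OF assms] by blast
  then obtain E where E: "E \<in> Obj C" "fst s \<in> Mor C Y E" "snd s \<in> Mor C E X" by (auto simp: sequences_def)
  have "iso_mor C E E (Ident C E)"
    unfolding iso_mor_def using E by (intro conjI bexI[of _ "Ident C E"]) (simp_all add: cat_simps)
  moreover have "seq_mor C s s (Ident C Y) (Ident C E) (Ident C X)"
    unfolding seq_mor_def using E assms(1,2)
    by (intro bexI[of _ Y] bexI[of _ E] bexI[of _ X]) (simp_all add: cat_simps)
  ultimately have "s \<in> realise C \<delta>" using s E(1) by (auto simp: seq_class_def)
  thus ?thesis using that[of E "fst s" "snd s"] E assms by (auto simp: realises_def)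
qed

lemma realises_unique:
  assumes "realises C Y E X x y \<delta>" "realises C Y E' X x' y' \<delta>"
  shows "\<exists>b. iso_mor C E E' b"
proof -
  note r = realisesD[OF assms(1)] and r' = realisesD[OF assms(2)]
  obtain s where s: "s \<in> sequences C Y X" "realise C \<delta> = seq_class C Y X s"
    using realise_class[OF r(3,1,6)] by blast
  then obtain S where S: "S \<in> Obj C" "fst s \<in> Mor C Y S" "snd s \<in> Mor C S X" by (auto simp: sequences_def)
  have iso: "\<exists>b. iso_mor C S D b" if "(u, v) \<in> seq_class C Y X s" "D \<in> Obj C" "u \<in> Mor C Y D" "v \<in> Mor C D X" for u v D
  proof -
    from that(1) obtain A B b where b: "A \<in> Obj C" "B \<in> Obj C" "iso_mor C A B b" "seq_mor C s (u, v) (Ident C Y) b (Ident C X)"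
      by (auto simp: seq_class_def)
    have "b \<in> Mor C S D"
      using seq_morD(1)[of "fst s" "snd s" u v, OF _ r(1) S(1) r(3) S(2,3) r(1) that(2) r(3) that(3,4)] b(4) by simp
    moreover have "b \<in> Mor C A B" using b by (simp add: iso_mor_def)
    ultimately have "A = S" "B = D" using Hom_disjoint[OF S(1) that(2) b(1,2)] by auto
    thus ?thesis using b(3) by blast
  qed
  obtain b b' where b: "iso_mor C S E b" "iso_mor C S E' b'"
    using iso[of x y E] iso[of x' y' E'] assms r r' s by (auto simp: realises_def)
  then obtain c c' where c: "b \<in> Mor C S E" "c \<in> Mor C E S" "c \<cdot> b = Ident C S" "b \<cdot> c = Ident C E"
    "b' \<in> Mor C S E'" "c' \<in> Mor C E' S" "c' \<cdot> b' = Ident C S" "b' \<cdot> c' = Ident C E'"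
    by (auto simp: iso_mor_def)
  have "(b' \<cdot> c) \<cdot> (b \<cdot> c') = b' \<cdot> ((c \<cdot> b) \<cdot> c')" "(b \<cdot> c') \<cdot> (b' \<cdot> c) = b \<cdot> ((c' \<cdot> b') \<cdot> c)"
    using c(1,2,5,6) S r r' by (simp_all add: cat_simps)
  moreover have "b' \<cdot> ((c \<cdot> b) \<cdot> c') = Ident C E'" "b \<cdot> ((c' \<cdot> b') \<cdot> c) = Ident C E"
    unfolding c(3,7) using c S r r' by (simp_all add: cat_simps)
  moreover have "b' \<cdot> c \<in> Mor C E E'" "b \<cdot> c' \<in> Mor C E' E" using c S r r' comp_mor by blast+
  ultimately have "iso_mor C E E' (b' \<cdot> c)" unfolding iso_mor_def by metis
  thus ?thesis by blast
qed

text \<open>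
  An extension \<open>Y \<rightarrow> B \<rightarrow> W\<close> whose pushout along \<open>x\<close> splits admits a map \<open>B \<rightarrow> E\<close> that extends \<open>x\<close>. By (ET3)
  it induces the required map on the third terms. The second lemma is dual.
\<close>

lemma ext_connecting:
  assumes conf: "realises C Y E X x y \<delta>" and W: "W \<in> Obj C"
    and \<epsilon>: "\<epsilon> \<in> carrier (Ext C W Y)" "push C x \<epsilon> = \<zero>\<^bsub>Ext C W E\<^esub>"
  shows "\<exists>g\<in>Mor C W X. \<epsilon> = pull C g \<delta>"
proof -
  note r = realisesD[OF conf]
  obtain B i p where r': "realises C Y B W i p \<epsilon>" using realises_exists[OF W r(1) \<epsilon>(1)] .
  obtain b where b: "b \<in> Mor C B E" "x = b \<cdot> i" using extend_inflation[OF r' r(2,4) \<epsilon>(2)] by blast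
  have "b \<cdot> i = x \<cdot> Ident C Y" using b r by (simp add: cat_simps)
  from ET3[OF r' conf Ident_closed[OF r(1)] b(1) this]
  show ?thesis using push_Ident[OF W r(1) \<epsilon>(1)] by auto
qed

lemma ext_connecting_op:
  assumes conf: "realises C Y E X x y \<delta>" and W: "W \<in> Obj C"
    and \<epsilon>: "\<epsilon> \<in> carrier (Ext C X W)" "pull C y \<epsilon> = \<zero>\<^bsub>Ext C E W\<^esub>"
  shows "\<exists>g\<in>Mor C Y W. \<epsilon> = push C g \<delta>"
proof -
  note r = realisesD[OF conf]
  obtain B i p where r': "realises C W B X i p \<epsilon>" using realises_exists[OF r(3) W \<epsilon>(1)] .
  obtain b where b: "b \<in> Mor C E B" "y = p \<cdot> b" using lift_deflation[OF r' r(2,5) \<epsilon>(2)] by blast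
  have "Ident C X \<cdot> y = p \<cdot> b" using b r by (simp add: cat_simps)
  from ET3_op[OF conf r' b(1) Ident_closed[OF r(3)] this]
  show ?thesis using pull_Ident[OF r(3) W \<epsilon>(1)] by auto
qed

text \<open>
  A section \<open>s\<close> of the deflation gives \<open>1 = s y + x k\<close>; a retraction of the inflation shows that
  \<open>k\<close> is the projection complementary to \<open>y\<close>.
\<close>

lemma zero_extension_splits:
  assumes conf: "realises C Y E X x y \<zero>\<^bsub>Ext C X Y\<^esub>"
  shows "is_direct_sum C Y X E"
proof -
  note r = realisesD[OF conf]
  obtain t where t: "t \<in> Mor C E Y" "Ident C Y = t \<cdot> x"
    using extend_inflation[OF conf r(1) Ident_closed[OF r(1)]] push_Ident[OF r(3,1,6)] by blast
  obtain s where s: "s \<in> Mor C X E" "Ident C X = y \<cdot> s"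
    using lift_deflation[OF conf r(3) Ident_closed[OF r(3)]] pull_Ident[OF r(3,1,6)] by blast
  have "y \<cdot> Ident C E = (y \<cdot> s) \<cdot> y" using r s(1) by (simp add: s(2)[symmetric] cat_simps)
  hence "y \<cdot> Ident C E = y \<cdot> (s \<cdot> y)" using r s(1) by (simp add: cat_simps)
  then obtain k where k: "k \<in> Mor C E Y" "Ident C E = s \<cdot> y \<oplus>\<^bsub>Hom C E E\<^esub> x \<cdot> k"
    using factor_inflation_diff[OF conf r(2) Ident_closed[OF r(2)], of "s \<cdot> y"] comp_mor[OF r(2,3,2,5) s(1)] by blast
  note yx = conflation_comp_zero[OF conf]
  interpret A: abelian_group "Hom C Y E" using r by (intro hom_abelian_group)
  interpret B: abelian_group "Hom C X E" using r by (intro hom_abelian_group)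
  have xkx_mor: "x \<cdot> (k \<cdot> x) \<in> Mor C Y E" and xks_mor: "x \<cdot> (k \<cdot> s) \<in> Mor C X E"
    using r k s by (simp_all add: cat_simps)
  have "x = (s \<cdot> y \<oplus>\<^bsub>Hom C E E\<^esub> x \<cdot> k) \<cdot> x" using r by (simp add: k(2)[symmetric] cat_simps)
  also have "\<dots> = x \<cdot> (k \<cdot> x)" using r k(1) s(1) yx xkx_mor A.l_zero[of "x \<cdot> (k \<cdot> x)"] by (simp add: cat_simps)
  finally have xkx: "x = x \<cdot> (k \<cdot> x)" .
  have "k \<cdot> x = (t \<cdot> x) \<cdot> (k \<cdot> x)" using r k(1) by (simp add: t(2)[symmetric] cat_simps)
  also have "\<dots> = t \<cdot> (x \<cdot> (k \<cdot> x))" using r k(1) t(1) by (simp add: cat_simps)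
  also have "\<dots> = Ident C Y" using xkx t(2) by simp
  finally have kx: "k \<cdot> x = Ident C Y" .
  have "s = (s \<cdot> y \<oplus>\<^bsub>Hom C E E\<^esub> x \<cdot> k) \<cdot> s" using r s(1) by (simp add: k(2)[symmetric] cat_simps)
  also have "\<dots> = s \<oplus>\<^bsub>Hom C X E\<^esub> x \<cdot> (k \<cdot> s)" using r k(1) s(1) by (simp add: s(2)[symmetric] cat_simps)
  finally have "s \<oplus>\<^bsub>Hom C X E\<^esub> x \<cdot> (k \<cdot> s) = s" by simp
  hence "x \<cdot> (k \<cdot> s) \<oplus>\<^bsub>Hom C X E\<^esub> s = \<zero>\<^bsub>Hom C X E\<^esub> \<oplus>\<^bsub>Hom C X E\<^esub> s"
    using hom_add_comm[OF r(3,2) s(1) xks_mor] B.l_zero[OF s(1)] by simp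
  hence xks: "x \<cdot> (k \<cdot> s) = \<zero>\<^bsub>Hom C X E\<^esub>"
    using hom_cancel[OF r(3,2) xks_mor B.zero_closed s(1)] by blast
  have "k \<cdot> s = (t \<cdot> x) \<cdot> (k \<cdot> s)" using r k(1) s(1) by (simp add: t(2)[symmetric] cat_simps)
  also have "\<dots> = t \<cdot> (x \<cdot> (k \<cdot> s))" using r k(1) t(1) s(1) by (simp add: cat_simps)
  also have "\<dots> = \<zero>\<^bsub>Hom C X Y\<^esub>" unfolding xks using r t(1) by (simp add: cat_simps)
  finally have ks: "k \<cdot> s = \<zero>\<^bsub>Hom C X Y\<^esub>" .
  have "x \<cdot> k \<oplus>\<^bsub>Hom C E E\<^esub> s \<cdot> y = Ident C E"
    using k(2) hom_add_comm[OF r(2,2) comp_mor[OF r(2,1,2) k(1) r(4)] comp_mor[OF r(2,3,2,5) s(1)]] by simp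
  hence "biproduct C Y X E x s k y" using r s k(1) kx ks yx by (simp add: biproduct_def)
  thus ?thesis by (auto simp: is_direct_sum_def)
qed

lemma ext_zero_retract_right:
  assumes "W \<in> Obj C" "Y \<in> Obj C" "Z \<in> Obj C" "s \<in> Mor C Y Z" "r \<in> Mor C Z Y" "r \<cdot> s = Ident C Y" "ext_zero C W Z"
  shows "ext_zero C W Y"
proof -
  have "\<epsilon> = \<zero>\<^bsub>Ext C W Y\<^esub>" if \<epsilon>: "\<epsilon> \<in> carrier (Ext C W Y)" for \<epsilon>
  proof -
    have "push C s \<epsilon> = \<zero>\<^bsub>Ext C W Z\<^esub>" using push_closed[OF assms(1-4) \<epsilon>] assms(7) by (simp add: ext_zero_def)
    moreover have "push C r (push C s \<epsilon>) = \<epsilon>"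
      using push_Comp[OF assms(1-3,2,4,5) \<epsilon>] push_Ident[OF assms(1,2) \<epsilon>] unfolding assms(6) by metis
    ultimately show ?thesis using push_zero_right[OF assms(1,3,2,5)] by metis
  qed
  thus ?thesis using ext_zero_closed[OF assms(1,2)] unfolding ext_zero_def by blast
qed

lemma ext_zero_retract_left:
  assumes "W \<in> Obj C" "Y \<in> Obj C" "Z \<in> Obj C" "s \<in> Mor C Y Z" "r \<in> Mor C Z Y" "r \<cdot> s = Ident C Y" "ext_zero C Z W"
  shows "ext_zero C Y W"
proof -
  have "\<epsilon> = \<zero>\<^bsub>Ext C Y W\<^esub>" if \<epsilon>: "\<epsilon> \<in> carrier (Ext C Y W)" for \<epsilon>
  proof -
    have "pull C r \<epsilon> = \<zero>\<^bsub>Ext C Z W\<^esub>" using pull_closed[OF assms(2,3,1,5) \<epsilon>] assms(7) by (simp add: ext_zero_def)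
    moreover have "pull C s (pull C r \<epsilon>) = \<epsilon>"
      using pull_Comp[OF assms(2,3,2,1,5,4) \<epsilon>] pull_Ident[OF assms(2,1) \<epsilon>] unfolding assms(6) by metis
    ultimately show ?thesis using pull_zero_right[OF assms(3,2,1,4)] by metis
  qed
  thus ?thesis using ext_zero_closed[OF assms(2,1)] unfolding ext_zero_def by blast
qed

lemma ext_zero_direct_sum:
  assumes W: "W \<in> Obj C" and ds: "is_direct_sum C X Y Z" and z: "ext_zero C W X" "ext_zero C W Y"
  shows "ext_zero C W Z"
proof -
  obtain i j p q where bp: "biproduct C X Y Z i j p q" using ds by (auto simp: is_direct_sum_def)
  have obj: "X \<in> Obj C" "Y \<in> Obj C" "Z \<in> Obj C" using bp by (auto simp: biproduct_def)
  have m: "i \<in> Mor C X Z" "j \<in> Mor C Y Z" "p \<in> Mor C Z X" "q \<in> Mor C Z Y"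
    and e: "(i \<cdot> p) \<oplus>\<^bsub>Hom C Z Z\<^esub> (j \<cdot> q) = Ident C Z" using bp by (auto simp: biproduct_def)
  interpret A: abelian_group "Ext C W Z" using W obj by (intro ext_abelian_group)
  have "\<epsilon> = \<zero>\<^bsub>Ext C W Z\<^esub>" if \<epsilon>: "\<epsilon> \<in> carrier (Ext C W Z)" for \<epsilon>
  proof -
    have "push C p \<epsilon> = \<zero>\<^bsub>Ext C W X\<^esub>" "push C q \<epsilon> = \<zero>\<^bsub>Ext C W Y\<^esub>"
      using push_closed[OF W obj(3) _ _ \<epsilon>] m z obj by (auto simp: ext_zero_def)
    hence "push C (i \<cdot> p) \<epsilon> = \<zero>\<^bsub>Ext C W Z\<^esub>" "push C (j \<cdot> q) \<epsilon> = \<zero>\<^bsub>Ext C W Z\<^esub>"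
      using push_Comp[OF W obj(3) _ _ _ _ \<epsilon>] push_zero_right[OF W] m obj by simp_all
    moreover have "push C (Ident C Z) \<epsilon> = push C (i \<cdot> p) \<epsilon> \<oplus>\<^bsub>Ext C W Z\<^esub> push C (j \<cdot> q) \<epsilon>"
      unfolding e[symmetric]
      by (rule lin_maps_add[OF push_linear_mor[OF W obj(3) obj(3) \<epsilon>]]) (use m obj comp_mor in blast)+
    ultimately show ?thesis using push_Ident[OF W obj(3) \<epsilon>] by simp
  qed
  thus ?thesis using ext_zero_closed[OF W obj(3)] unfolding ext_zero_def by blast
qed

text \<open>
  Schanuel's lemma. The two resolutions of \<open>X\<close> are compared with the extension
  \<open>K \<oplus> K' \<rightarrow> M \<rightarrow> X\<close> whose components are the given ones: by the octahedral axiom,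
  \<open>M\<close> is an extension of \<open>R'\<close> by \<open>K\<close> and of \<open>R\<close> by \<open>K'\<close>.
\<close>

lemma schanuel_half:
  assumes bp: "biproduct C K K' P i i' p p'" and M: "realises C P M X j g \<nu>"
    and R': "realises C K' R' X f' h' (push C p' \<nu>)" and z: "ext_zero C R' K"
  shows "is_direct_sum C K R' M"
proof -
  have obj: "K \<in> Obj C" "K' \<in> Obj C" "P \<in> Obj C" and m: "i \<in> Mor C K P" "p' \<in> Mor C P K'"
    using bp by (auto simp: biproduct_def)
  have "realises C K P K' i p' \<zero>\<^bsub>Ext C K' K\<^esub>"
    using realise_zero[OF bp] obj m ext_zero_closed by (simp add: realises_def)
  from ET4[OF this M] obtain E d e q \<delta> where
    r: "realises C K M E (j \<cdot> i) q \<delta>" and E: "realises C K' E X d e (push C p' \<nu>)" by blast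
  have EO: "E \<in> Obj C" and R'O: "R' \<in> Obj C" using realisesD[OF E] realisesD[OF R'] by auto
  obtain b where b: "iso_mor C E R' b" using realises_unique[OF E R'] by blast
  then obtain b' where b': "b \<in> Mor C E R'" "b' \<in> Mor C R' E" "b' \<cdot> b = Ident C E" by (auto simp: iso_mor_def)
  have "ext_zero C E K" using ext_zero_retract_left[OF obj(1) EO R'O b' z] .
  hence "\<delta> = \<zero>\<^bsub>Ext C E K\<^esub>" using realisesD(6)[OF r] by (simp add: ext_zero_def)
  hence "is_direct_sum C K E M" using zero_extension_splits r by blast
  thus ?thesis using is_direct_sum_iso[OF _ b R'O] by blast
qed

lemma schanuel:
  assumes R: "realises C K R X f h \<delta>" and R': "realises C K' R' X f' h' \<delta>'"
    and z: "ext_zero C R' K" "ext_zero C R K'"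
  shows "\<exists>M. is_direct_sum C K R' M \<and> is_direct_sum C K' R M"
proof -
  note r = realisesD[OF R] and r' = realisesD[OF R']
  obtain P i i' p p' where bp: "biproduct C K K' P i i' p p'"
    using direct_sum_exists[OF r(1) r'(1)] by (auto simp: is_direct_sum_def)
  have P: "P \<in> Obj C" and m: "i \<in> Mor C K P" "i' \<in> Mor C K' P" "p \<in> Mor C P K" "p' \<in> Mor C P K'"
    and e: "p \<cdot> i = Ident C K" "p' \<cdot> i' = Ident C K'" "p' \<cdot> i = \<zero>\<^bsub>Hom C K K'\<^esub>" "p \<cdot> i' = \<zero>\<^bsub>Hom C K' K\<^esub>"
    using bp by (auto simp: biproduct_def)
  define \<nu> where "\<nu> = push C i \<delta> \<oplus>\<^bsub>Ext C X P\<^esub> push C i' \<delta>'"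
  interpret A: abelian_group "Ext C X P" using r P by (intro ext_abelian_group)
  interpret AK: abelian_group "Ext C X K" using r by (intro ext_abelian_group)
  interpret AK': abelian_group "Ext C X K'" using r r' by (intro ext_abelian_group)
  have c: "push C i \<delta> \<in> carrier (Ext C X P)" "push C i' \<delta>' \<in> carrier (Ext C X P)"
    using push_closed r r' P m by blast+
  hence \<nu>: "\<nu> \<in> carrier (Ext C X P)" by (simp add: \<nu>_def)
  have "push C p' \<nu> = push C (p' \<cdot> i) \<delta> \<oplus>\<^bsub>Ext C X K'\<^esub> push C (p' \<cdot> i') \<delta>'"
    using lin_maps_add[OF push_linear[OF r(3) P r'(1) m(4)] c] push_Comp r r' P m by (simp add: \<nu>_def)
  hence 1: "push C p' \<nu> = \<delta>'" using r r' by (simp add: e push_zero_left push_Ident)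
  have "push C p \<nu> = push C (p \<cdot> i) \<delta> \<oplus>\<^bsub>Ext C X K\<^esub> push C (p \<cdot> i') \<delta>'"
    using lin_maps_add[OF push_linear[OF r(3) P r(1) m(3)] c] push_Comp r r' P m by (simp add: \<nu>_def)
  hence 2: "push C p \<nu> = \<delta>" using r r' by (simp add: e push_zero_left push_Ident)
  obtain M j g where M: "realises C P M X j g \<nu>" using realises_exists[OF r(3) P \<nu>] .
  show ?thesis
    using schanuel_half[OF bp M _ z(1)] schanuel_half[OF biproduct_swap[OF bp] M _ z(2)] R R' 1 2 by blast
qed

text \<open>The dual argument, with \<open>X \<rightarrow> M \<rightarrow> N \<oplus> N'\<close> and the dual octahedral axiom.\<close>

lemma schanuel_op_half:
  assumes bp: "biproduct C N N' P i i' p p'" and M: "realises C X M P j g \<nu>"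
    and L: "realises C X L N x y (pull C i \<nu>)" and z: "ext_zero C N' L"
  shows "is_direct_sum C N' L M"
proof -
  have obj: "N \<in> Obj C" "N' \<in> Obj C" "P \<in> Obj C" and m: "i \<in> Mor C N P" "p' \<in> Mor C P N'"
    using bp by (auto simp: biproduct_def)
  have "realises C N P N' i p' \<zero>\<^bsub>Ext C N' N\<^esub>"
    using realise_zero[OF bp] obj m ext_zero_closed by (simp add: realises_def)
  from ET4_op[OF M this] obtain E d e q \<delta> where
    r: "realises C E M N' q (p' \<cdot> g) \<delta>" and E: "realises C X E N d e (pull C i \<nu>)" by blast
  have EO: "E \<in> Obj C" and LO: "L \<in> Obj C" using realisesD[OF E] realisesD[OF L] by auto
  obtain b where b: "iso_mor C E L b" using realises_unique[OF E L] by blast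
  then obtain b' where b': "b \<in> Mor C E L" "b' \<in> Mor C L E" "b' \<cdot> b = Ident C E" by (auto simp: iso_mor_def)
  have "ext_zero C N' E" using ext_zero_retract_right[OF obj(2) EO LO b' z] .
  hence "\<delta> = \<zero>\<^bsub>Ext C N' E\<^esub>" using realisesD(6)[OF r] by (simp add: ext_zero_def)
  hence "is_direct_sum C N' E M" using zero_extension_splits is_direct_sum_swap r by blast
  thus ?thesis using is_direct_sum_iso[OF _ b LO] by blast
qed

lemma schanuel_op:
  assumes L: "realises C X L N x y \<delta>" and L': "realises C X L' N' x' y' \<delta>'"
    and z: "ext_zero C N' L" "ext_zero C N L'"
  shows "\<exists>M. is_direct_sum C N' L M \<and> is_direct_sum C N L' M"
proof -
  note r = realisesD[OF L] and r' = realisesD[OF L']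
  obtain P i i' p p' where bp: "biproduct C N N' P i i' p p'"
    using direct_sum_exists[OF r(3) r'(3)] by (auto simp: is_direct_sum_def)
  have P: "P \<in> Obj C" and m: "i \<in> Mor C N P" "i' \<in> Mor C N' P" "p \<in> Mor C P N" "p' \<in> Mor C P N'"
    and e: "p \<cdot> i = Ident C N" "p' \<cdot> i' = Ident C N'" "p' \<cdot> i = \<zero>\<^bsub>Hom C N N'\<^esub>" "p \<cdot> i' = \<zero>\<^bsub>Hom C N' N\<^esub>"
    using bp by (auto simp: biproduct_def)
  define \<nu> where "\<nu> = pull C p \<delta> \<oplus>\<^bsub>Ext C P X\<^esub> pull C p' \<delta>'"
  interpret A: abelian_group "Ext C P X" using r P by (intro ext_abelian_group)
  interpret AN: abelian_group "Ext C N X" using r by (intro ext_abelian_group)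
  interpret AN': abelian_group "Ext C N' X" using r r' by (intro ext_abelian_group)
  have c: "pull C p \<delta> \<in> carrier (Ext C P X)" "pull C p' \<delta>' \<in> carrier (Ext C P X)"
    using pull_closed r r' P m by blast+
  hence \<nu>: "\<nu> \<in> carrier (Ext C P X)" by (simp add: \<nu>_def)
  have "pull C i' \<nu> = pull C (p \<cdot> i') \<delta> \<oplus>\<^bsub>Ext C N' X\<^esub> pull C (p' \<cdot> i') \<delta>'"
    using lin_maps_add[OF pull_linear[OF P r'(3) r(1) m(2)] c] pull_Comp r r' P m by (simp add: \<nu>_def)
  hence 1: "pull C i' \<nu> = \<delta>'" using r r' by (simp add: e pull_zero_left pull_Ident)
  have "pull C i \<nu> = pull C (p \<cdot> i) \<delta> \<oplus>\<^bsub>Ext C N X\<^esub> pull C (p' \<cdot> i) \<delta>'"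
    using lin_maps_add[OF pull_linear[OF P r(3) r(1) m(1)] c] pull_Comp r r' P m by (simp add: \<nu>_def)
  hence 2: "pull C i \<nu> = \<delta>" using r r' by (simp add: e pull_zero_left pull_Ident)
  obtain M j g where M: "realises C X M P j g \<nu>" using realises_exists[OF P r(1) \<nu>] .
  show ?thesis
    using schanuel_op_half[OF bp M _ z(1)] schanuel_op_half[OF biproduct_swap[OF bp] M _ z(2)] L L' 1 2 by blast
qed

text \<open>The index is additive because a sum of resolutions is a resolution of the sum.\<close>

lemma conflation_direct_sum:
  assumes c: "conflation C Y E X x y" "conflation C Y' E' X' x' y'"
    and ds: "is_direct_sum C Y Y' Y2" "is_direct_sum C E E' E2" "is_direct_sum C X X' X2"
  shows "\<exists>x2 y2. conflation C Y2 E2 X2 x2 y2"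
proof -
  obtain \<delta> \<delta>' where r: "realises C Y E X x y \<delta>" "realises C Y' E' X' x' y' \<delta>'" using c by (auto simp: conflation_def)
  obtain iY jY pY qY iE jE pE qE iX jX pX qX where
    bp: "biproduct C Y Y' Y2 iY jY pY qY" "biproduct C E E' E2 iE jE pE qE" "biproduct C X X' X2 iX jX pX qX"
    using ds by (auto simp: is_direct_sum_def)
  have o: "Y2 \<in> Obj C" "E2 \<in> Obj C" "X2 \<in> Obj C" using bp by (auto simp: biproduct_def)
  have m: "iY \<in> Mor C Y Y2" "jY \<in> Mor C Y' Y2" "pY \<in> Mor C Y2 Y" "qY \<in> Mor C Y2 Y'"
    "iE \<in> Mor C E E2" "jE \<in> Mor C E' E2" "pE \<in> Mor C E2 E" "qE \<in> Mor C E2 E'"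
    "iX \<in> Mor C X X2" "jX \<in> Mor C X' X2" "pX \<in> Mor C X2 X" "qX \<in> Mor C X2 X'"
    using bp by (auto simp: biproduct_def)
  interpret A: abelian_group "Ext C X2 Y2" using o by (intro ext_abelian_group)
  note d = realisesD[OF r(1)] and d' = realisesD[OF r(2)]
  have "push C iY (pull C pX \<delta>) \<in> carrier (Ext C X2 Y2)" "push C jY (pull C qX \<delta>') \<in> carrier (Ext C X2 Y2)"
    using push_closed[OF o(3) d(1) o(1) m(1) pull_closed[OF d(3) o(3) d(1) m(11) d(6)]]
      push_closed[OF o(3) d'(1) o(1) m(2) pull_closed[OF d'(3) o(3) d'(1) m(12) d'(6)]] by blast+
  moreover have "((iE \<cdot> x \<cdot> pY) \<oplus>\<^bsub>Hom C Y2 E2\<^esub> (jE \<cdot> x' \<cdot> qY)) \<in> Mor C Y2 E2"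
    "((iX \<cdot> y \<cdot> pE) \<oplus>\<^bsub>Hom C E2 X2\<^esub> (jX \<cdot> y' \<cdot> qE)) \<in> Mor C E2 X2"
    using d(1-5) d'(1-5) o m by (simp_all add: cat_simps)
  ultimately show ?thesis using realise_sum[OF r bp] o unfolding conflation_def realises_def by blast
qed

end

section \<open>Cluster-tilting subcategories\<close>

locale cluster_tilting_subcategory = extriangulated_category C
  for C :: "('k::field, 'o, 'm, 'e, 'z) extri_scheme" (structure) +
  fixes \<T> :: "'o set"
  assumes tilting: "cluster_tilting C \<T>"
begin

lemma tilting_obj: "T \<in> \<T> \<Longrightarrow> T \<in> Obj C"
  using tilting unfolding cluster_tilting_def by blast

lemma tilting_rigid: "T \<in> \<T> \<Longrightarrow> T' \<in> \<T> \<Longrightarrow> ext_zero C T T'"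
  using tilting unfolding cluster_tilting_def by blast

lemma tiltingI_right: "X \<in> Obj C \<Longrightarrow> (\<And>T. T \<in> \<T> \<Longrightarrow> ext_zero C T X) \<Longrightarrow> X \<in> \<T>"
  using tilting unfolding cluster_tilting_def by blast

lemma tiltingI_left: "X \<in> Obj C \<Longrightarrow> (\<And>T. T \<in> \<T> \<Longrightarrow> ext_zero C X T) \<Longrightarrow> X \<in> \<T>"
  using tilting unfolding cluster_tilting_def by blast

lemma tilting_retract:
  assumes "Z \<in> \<T>" "Y \<in> Obj C" "s \<in> Mor C Y Z" "r \<in> Mor C Z Y" "r \<cdot> s = Ident C Y"
  shows "Y \<in> \<T>"
  using assms ext_zero_retract_right[OF tilting_obj assms(2) tilting_obj[OF assms(1)] assms(3-5)] tilting_rigid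
  by (intro tiltingI_right) auto

lemma tilting_direct_sum:
  assumes "is_direct_sum C X Y Z" "X \<in> \<T>" "Y \<in> \<T>"
  shows "Z \<in> \<T>"
proof (rule tiltingI_right)
  show "Z \<in> Obj C" using assms(1) by (auto simp: is_direct_sum_def biproduct_def)
  show "ext_zero C T Z" if "T \<in> \<T>" for T
    using ext_zero_direct_sum[OF tilting_obj[OF that] assms(1)] tilting_rigid that assms by blast
qed

lemma tilting_approx_right:
  assumes "X \<in> Obj C"
  shows "\<exists>T\<in>\<T>. \<exists>f\<in>Mor C T X. (\<forall>T'\<in>\<T>. \<forall>g\<in>Mor C T' X. \<exists>h\<in>Mor C T' T. g = f \<cdot> h) \<and>
    (\<exists>Y y. conflation C Y T X y f)"
  using tilting assms unfolding cluster_tilting_def by blast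

lemma tilting_approx_left:
  assumes "X \<in> Obj C"
  shows "\<exists>T\<in>\<T>. \<exists>f\<in>Mor C X T. (\<forall>T'\<in>\<T>. \<forall>g\<in>Mor C X T'. \<exists>h\<in>Mor C T T'. g = h \<cdot> f) \<and>
    (\<exists>Y y. conflation C X T Y f y)"
  using tilting assms unfolding cluster_tilting_def by blast

text \<open>The first term \<open>K\<close> of a right approximation lies in \<open>\<T>\<close>: an extension of \<open>T\<close> by \<open>K\<close> is pulled back along
  some \<open>T \<rightarrow> X\<close>, which factors through \<open>R \<rightarrow> X\<close>, and the pullback along \<open>R \<rightarrow> X\<close> is zero.\<close>

lemma tilting_resolution:
  assumes X: "X \<in> Obj C"
  shows "\<exists>K\<in>\<T>. \<exists>R\<in>\<T>. \<exists>f h \<delta>. realises C K R X f h \<delta>"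
proof -
  obtain R h K f where R: "R \<in> \<T>" "h \<in> Mor C R X" "conflation C K R X f h"
    and approx: "\<And>T g. T \<in> \<T> \<Longrightarrow> g \<in> Mor C T X \<Longrightarrow> \<exists>k\<in>Mor C T R. g = h \<cdot> k"
    using tilting_approx_right[OF X] by metis
  obtain \<delta> where r: "realises C K R X f h \<delta>" using R by (auto simp: conflation_def)
  note d = realisesD[OF r]
  have "K \<in> \<T>"
  proof (rule tiltingI_right[OF d(1)])
    fix T assume T: "T \<in> \<T>"
    note TO = tilting_obj[OF T]
    have "\<epsilon> = \<zero>\<^bsub>Ext C T K\<^esub>" if \<epsilon>: "\<epsilon> \<in> carrier (Ext C T K)" for \<epsilon>
    proof -
      have "push C f \<epsilon> = \<zero>\<^bsub>Ext C T R\<^esub>"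
        using push_closed[OF TO d(1,2,4) \<epsilon>] tilting_rigid[OF T R(1)] by (simp add: ext_zero_def)
      then obtain g where g: "g \<in> Mor C T X" "\<epsilon> = pull C g \<delta>" using ext_connecting[OF r TO \<epsilon>] by blast
      then obtain k where k: "k \<in> Mor C T R" "g = h \<cdot> k" using approx T by blast
      thus ?thesis
        using g(2) pull_deflation_zero[OF r] pull_Comp[OF d(3,2) TO d(1,5) k(1) d(6)] pull_zero_right[OF d(2) TO d(1) k(1)]
        unfolding k(2) by metis
    qed
    thus "ext_zero C T K" using ext_zero_closed[OF TO d(1)] unfolding ext_zero_def by blast
  qed
  thus ?thesis using R(1) r by blast
qed

lemma tilting_coresolution:
  assumes X: "X \<in> Obj C"
  shows "\<exists>L\<in>\<T>. \<exists>N\<in>\<T>. \<exists>x y \<delta>. realises C X L N x y \<delta>"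
proof -
  obtain L x N y where L: "L \<in> \<T>" "x \<in> Mor C X L" "conflation C X L N x y"
    and approx: "\<And>T g. T \<in> \<T> \<Longrightarrow> g \<in> Mor C X T \<Longrightarrow> \<exists>k\<in>Mor C L T. g = k \<cdot> x"
    using tilting_approx_left[OF X] by metis
  obtain \<delta> where r: "realises C X L N x y \<delta>" using L by (auto simp: conflation_def)
  note d = realisesD[OF r]
  have "N \<in> \<T>"
  proof (rule tiltingI_left[OF d(3)])
    fix T assume T: "T \<in> \<T>"
    note TO = tilting_obj[OF T]
    have "\<epsilon> = \<zero>\<^bsub>Ext C N T\<^esub>" if \<epsilon>: "\<epsilon> \<in> carrier (Ext C N T)" for \<epsilon>
    proof -
      have "pull C y \<epsilon> = \<zero>\<^bsub>Ext C L T\<^esub>"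
        using pull_closed[OF d(3,2) TO d(5) \<epsilon>] tilting_rigid[OF L(1) T] by (simp add: ext_zero_def)
      then obtain g where g: "g \<in> Mor C X T" "\<epsilon> = push C g \<delta>" using ext_connecting_op[OF r TO \<epsilon>] by blast
      then obtain k where k: "k \<in> Mor C L T" "g = k \<cdot> x" using approx T by blast
      thus ?thesis
        using g(2) push_inflation_zero[OF r] push_Comp[OF d(3,1,2) TO d(4) k(1) d(6)] push_zero_right[OF d(3,2) TO k(1)]
        unfolding k(2) by metis
    qed
    thus "ext_zero C N T" using ext_zero_closed[OF d(3) TO] unfolding ext_zero_def by blast
  qed
  thus ?thesis using L(1) r by blast
qed

end

section \<open>Grothendieck groups\<close>

text \<open>The homomorphism from the free abelian group to the integers that extends \<open>x\<close>.\<close>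

definition frag_val :: "('a \<Rightarrow> int) \<Rightarrow> ('a \<Rightarrow>\<^sub>0 int) \<Rightarrow> int" where
  "frag_val x a = (\<Sum>k\<in>Poly_Mapping.keys a. Poly_Mapping.lookup a k * x k)"

lemma frag_val_superset:
  assumes "finite S" "Poly_Mapping.keys a \<subseteq> S"
  shows "frag_val x a = (\<Sum>k\<in>S. Poly_Mapping.lookup a k * x k)"
  unfolding frag_val_def using assms by (intro sum.mono_neutral_left) (auto simp: in_keys_iff)

lemma frag_val_add: "frag_val x (a + b) = frag_val x a + frag_val x b"
proof -
  let ?S = "Poly_Mapping.keys a \<union> Poly_Mapping.keys b"
  have "frag_val x c = (\<Sum>k\<in>?S. Poly_Mapping.lookup c k * x k)" if "c \<in> {a, b, a + b}" for c
    using that keys_add[of a b] by (intro frag_val_superset) auto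
  thus ?thesis by (simp add: Poly_Mapping.lookup_add distrib_right sum.distrib)
qed

lemma frag_val_neg: "frag_val x (- a) = - frag_val x a"
  by (simp add: frag_val_def sum_negf)

lemma frag_val_of: "frag_val x (frag_of a) = x a"
  by (simp add: frag_val_def)

lemma frag_val_diff: "frag_val x (a - b) = frag_val x a - frag_val x b"
  using frag_val_add[of x a "- b"] by (simp add: frag_val_neg)

lemma frag_val_zero: "frag_val x 0 = 0"
  by (simp add: frag_val_def)

lemma frag_val_swap: "frag_val (\<lambda>M. frag_val (d M) b) a = frag_val (\<lambda>T. frag_val (\<lambda>M. d M T) a) b"
  unfolding frag_val_def sum_distrib_left by (subst sum.swap) (simp add: ac_simps)

lemma frag_val_add_fun: "frag_val (\<lambda>k. x k + y k) a = frag_val x a + frag_val y a"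
  by (simp add: frag_val_def distrib_left sum.distrib)

context
  fixes S :: "'a set" and R :: "('a \<times> 'a \<times> 'a) set"
  assumes R: "\<And>A B D. (A, B, D) \<in> R \<Longrightarrow> A \<in> S \<and> B \<in> S \<and> D \<in> S"
begin

private abbreviation (input) "F \<equiv> free_Abelian_group S"
private abbreviation (input) "gens \<equiv> {frag_of B - frag_of A - frag_of D | A B D. (A, B, D) \<in> R}"

interpretation F: comm_group "free_Abelian_group S" by (rule abelian_free_Abelian_group)

lemma groth_gens_closed: "gens \<subseteq> carrier F"
proof
  fix r assume "r \<in> gens"
  then obtain A B D where r: "(A, B, D) \<in> R" "r = frag_of B - frag_of A - frag_of D" by blast
  have m: "A \<in> S" "B \<in> S" "D \<in> S" using R r(1) by blast+
  show "r \<in> carrier F"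
    using m keys_diff[of "frag_of B - frag_of A" "frag_of D"] keys_diff[of "frag_of B" "frag_of A"]
    unfolding r(2) by auto
qed

lemma groth_relations_normal: "groth_relations S R \<lhd> F"
  unfolding groth_relations_def
  using F.generate_is_subgroup[OF groth_gens_closed] F.subgroup_imp_normal by blast

interpretation N: normal "groth_relations S R" "free_Abelian_group S" by (rule groth_relations_normal)

lemma groth_relations_keys: "h \<in> groth_relations S R \<Longrightarrow> Poly_Mapping.keys h \<subseteq> S"
  using subsetD[OF N.subset, of h] by simp

lemma groth_group_comm: "comm_group (groth_group S R)"
  unfolding groth_group_def using F.abelian_FactGroup N.subgroup_axioms by blast

lemma groth_class_closed: "X \<in> S \<Longrightarrow> groth_class S R X \<in> carrier (groth_group S R)"
  by (auto simp: groth_class_def groth_group_def FactGroup_def RCOSETS_def)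

lemma groth_carrierE:
  assumes "v \<in> carrier (groth_group S R)"
  obtains a where "Poly_Mapping.keys a \<subseteq> S" "v = groth_relations S R #>\<^bsub>F\<^esub> a"
  using assms by (auto simp: groth_group_def FactGroup_def RCOSETS_def)

lemma groth_coset_closed:
  "Poly_Mapping.keys a \<subseteq> S \<Longrightarrow> groth_relations S R #>\<^bsub>F\<^esub> a \<in> carrier (groth_group S R)"
  by (auto simp: groth_group_def FactGroup_def RCOSETS_def)

lemma groth_coset_mem:
  "a' \<in> groth_relations S R #>\<^bsub>F\<^esub> a \<longleftrightarrow> (\<exists>h\<in>groth_relations S R. a' = h + a)"
  by (auto simp: r_coset_def)

lemma groth_coset_mult:
  "Poly_Mapping.keys a \<subseteq> S \<Longrightarrow> Poly_Mapping.keys b \<subseteq> S \<Longrightarrow>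
    (groth_relations S R #>\<^bsub>F\<^esub> a) \<otimes>\<^bsub>groth_group S R\<^esub> (groth_relations S R #>\<^bsub>F\<^esub> b)
      = groth_relations S R #>\<^bsub>F\<^esub> (a + b)"
  using N.rcos_sum[of a b] by (simp add: groth_group_def)

lemma groth_coset_inv:
  "Poly_Mapping.keys a \<subseteq> S \<Longrightarrow>
    inv\<^bsub>groth_group S R\<^esub> (groth_relations S R #>\<^bsub>F\<^esub> a) = groth_relations S R #>\<^bsub>F\<^esub> (- a)"
  using N.inv_FactGroup[of "groth_relations S R #>\<^bsub>F\<^esub> a"] N.rcos_inv[of a] groth_coset_closed[of a]
  by (simp add: groth_group_def)

lemma groth_class_rel:
  assumes "(A, B, D) \<in> R"
  shows "groth_class S R B = groth_class S R A \<otimes>\<^bsub>groth_group S R\<^esub> groth_class S R D"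
proof -
  have m: "A \<in> S" "B \<in> S" "D \<in> S" using R assms by blast+
  have "frag_of B - frag_of A - frag_of D \<in> groth_relations S R"
    unfolding groth_relations_def using assms by (intro generate.incl) auto
  hence "frag_of B \<in> groth_relations S R #>\<^bsub>F\<^esub> (frag_of A + frag_of D)"
    unfolding groth_coset_mem by (intro bexI[of _ "frag_of B - frag_of A - frag_of D"]) auto
  hence "groth_relations S R #>\<^bsub>F\<^esub> (frag_of A + frag_of D) = groth_relations S R #>\<^bsub>F\<^esub> frag_of B"
    using m keys_add[of "frag_of A" "frag_of D"] by (intro F.repr_independence N.subgroup_axioms) auto
  thus ?thesis using groth_coset_mult[of "frag_of A" "frag_of D"] m by (simp add: groth_class_def)
qed

text \<open>An additive function on generators kills all relations; it is the source of the independence of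
  representatives in the pairing.\<close>

lemma groth_relations_vanish:
  assumes x: "\<And>A B D. (A, B, D) \<in> R \<Longrightarrow> x B = x A + x D" and h: "h \<in> groth_relations S R"
  shows "frag_val x h = 0"
  using h unfolding groth_relations_def
proof (induction rule: generate.induct)
  case one thus ?case by (simp add: frag_val_zero)
next
  case (incl h)
  then obtain A B D where *: "(A, B, D) \<in> R" "h = frag_of B + - frag_of A + - frag_of D" by auto
  show ?case unfolding *(2) frag_val_add frag_val_neg frag_val_of using x[OF *(1)] by simp
next
  case (inv h)
  then obtain A B D where *: "(A, B, D) \<in> R" "h = frag_of B + - frag_of A + - frag_of D" by auto
  have "frag_val x h = 0" unfolding *(2) frag_val_add frag_val_neg frag_val_of using x[OF *(1)] by simp
  moreover have "inv\<^bsub>F\<^esub> h = - h"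
    using subsetD[OF groth_gens_closed inv] by (intro inv_free_Abelian_group) simp
  ultimately show ?case by (simp add: frag_val_neg)
next
  case (eng h1 h2) thus ?case by (simp add: frag_val_add)
qed

lemma groth_coset_val:
  assumes x: "\<And>A B D. (A, B, D) \<in> R \<Longrightarrow> x B = x A + x D"
    and "a' \<in> groth_relations S R #>\<^bsub>F\<^esub> a"
  shows "frag_val x a' = frag_val x a"
  using assms(2) groth_relations_vanish[of x, OF x] by (auto simp: groth_coset_mem frag_val_add)

lemma groth_coset_self: "Poly_Mapping.keys a \<subseteq> S \<Longrightarrow> a \<in> groth_relations S R #>\<^bsub>F\<^esub> a"
  using F.rcos_self[OF _ N.subgroup_axioms] by simp

text \<open>The universal property, in the form in which the maps on Grothendieck groups are defined.\<close>

lemma groth_universal: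
  assumes H: "comm_group H" and \<phi>: "\<And>X. X \<in> S \<Longrightarrow> \<phi> X \<in> carrier H"
    and rel: "\<And>A B D. (A, B, D) \<in> R \<Longrightarrow> \<phi> B = \<phi> A \<otimes>\<^bsub>H\<^esub> \<phi> D"
    and X: "X \<in> S"
  shows "(THE f. f \<in> hom (groth_group S R) H \<inter> extensional (carrier (groth_group S R)) \<and>
    (\<forall>X\<in>S. f (groth_class S R X) = \<phi> X)) (groth_class S R X) = \<phi> X"
proof -
  interpret H: comm_group H by fact
  let ?P = "\<lambda>f. f \<in> hom (groth_group S R) H \<inter> extensional (carrier (groth_group S R)) \<and>
    (\<forall>X\<in>S. f (groth_class S R X) = \<phi> X)"
  interpret Q: comm_group "groth_group S R" by (rule groth_group_comm)
  obtain h where h: "h \<in> hom F H" "\<And>x. x \<in> S \<Longrightarrow> h (frag_of x) = \<phi> x"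
    using H.free_Abelian_group_universal[of \<phi> S] \<phi> by blast
  interpret h: group_hom F H h using h(1) by unfold_locales
  have "gens \<subseteq> kernel F H h"
  proof
    fix r assume rg: "r \<in> gens"
    then obtain A B D where r: "(A, B, D) \<in> R" "r = frag_of B + - frag_of A + - frag_of D" by auto
    have m: "A \<in> S" "B \<in> S" "D \<in> S" using R r by blast+
    have neg: "h (- frag_of Y) = inv\<^bsub>H\<^esub> \<phi> Y" if "Y \<in> S" for Y
      using h.hom_inv[of "frag_of Y"] that h(2) by simp
    have k: "Poly_Mapping.keys (frag_of B + - frag_of A) \<subseteq> S"
      using m keys_add[of "frag_of B" "- frag_of A"] by auto
    have "h r = (\<phi> B \<otimes>\<^bsub>H\<^esub> inv\<^bsub>H\<^esub> \<phi> A) \<otimes>\<^bsub>H\<^esub> inv\<^bsub>H\<^esub> \<phi> D"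
      using h.hom_mult[of "frag_of B + - frag_of A" "- frag_of D"] h.hom_mult[of "frag_of B" "- frag_of A"]
        m k neg h(2) by (simp add: r(2))
    also have "\<dots> = \<phi> B \<otimes>\<^bsub>H\<^esub> (inv\<^bsub>H\<^esub> \<phi> A \<otimes>\<^bsub>H\<^esub> inv\<^bsub>H\<^esub> \<phi> D)" using \<phi> m by (simp add: H.m_assoc)
    also have "\<dots> = \<phi> B \<otimes>\<^bsub>H\<^esub> inv\<^bsub>H\<^esub> \<phi> B"
      unfolding rel[OF r(1)] using H.inv_mult[of "\<phi> A" "\<phi> D"] \<phi> m by simp
    also have "\<dots> = \<one>\<^bsub>H\<^esub>" using \<phi> m by simp
    finally have "h r = \<one>\<^bsub>H\<^esub>" .
    moreover have "r \<in> carrier F" using rg groth_gens_closed by blast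
    ultimately show "r \<in> kernel F H h" unfolding kernel_def by blast
  qed
  hence "groth_relations S R \<subseteq> kernel F H h"
    unfolding groth_relations_def using F.generate_subgroup_incl h.subgroup_kernel by blast
  then obtain g where g: "g \<in> hom (groth_group S R) H"
    "\<And>x. x \<in> carrier F \<Longrightarrow> g (groth_relations S R #>\<^bsub>F\<^esub> x) = h x"
    using h.FactGroup_universal_kernel[OF groth_relations_normal] by (auto simp: groth_group_def)
  define f where "f = restrict g (carrier (groth_group S R))"
  have fhom: "f \<in> hom (groth_group S R) H"
    unfolding f_def by (rule homI) (use g(1) Q.m_closed in \<open>auto simp: hom_def\<close>)
  have "f (groth_class S R X) = \<phi> X" if "X \<in> S" for X
    using g(2)[of "frag_of X"] h(2)[OF that] groth_class_closed[OF that] that by (simp add: f_def groth_class_def)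
  hence f: "?P f" using fhom by (simp add: f_def)
  have "f' = f" if "?P f'" for f'
  proof (rule extensionalityI)
    show "f' \<in> extensional (carrier (groth_group S R))" "f \<in> extensional (carrier (groth_group S R))"
      using that f by auto
    fix v assume "v \<in> carrier (groth_group S R)"
    then obtain a where a: "Poly_Mapping.keys a \<subseteq> S" "v = groth_relations S R #>\<^bsub>F\<^esub> a"
      by (rule groth_carrierE)
    interpret f: group_hom "groth_group S R" H f using f by unfold_locales auto
    interpret f': group_hom "groth_group S R" H f' using that by unfold_locales auto
    have "f' (groth_relations S R #>\<^bsub>F\<^esub> a) = f (groth_relations S R #>\<^bsub>F\<^esub> a)"
    proof (rule free_Abelian_group_induct[OF a(1)])
      have "groth_relations S R #>\<^bsub>F\<^esub> 0 = \<one>\<^bsub>groth_group S R\<^esub>"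
        using F.coset_mult_one[of "groth_relations S R"] N.subset by (simp add: groth_group_def FactGroup_def)
      thus "f' (groth_relations S R #>\<^bsub>F\<^esub> 0) = f (groth_relations S R #>\<^bsub>F\<^esub> 0)" by simp
    next
      fix a b assume ab: "Poly_Mapping.keys a \<subseteq> S" "Poly_Mapping.keys b \<subseteq> S"
        "f' (groth_relations S R #>\<^bsub>F\<^esub> a) = f (groth_relations S R #>\<^bsub>F\<^esub> a)"
        "f' (groth_relations S R #>\<^bsub>F\<^esub> b) = f (groth_relations S R #>\<^bsub>F\<^esub> b)"
      have "groth_relations S R #>\<^bsub>F\<^esub> (a - b) = (groth_relations S R #>\<^bsub>F\<^esub> a) \<otimes>\<^bsub>groth_group S R\<^esub>
          inv\<^bsub>groth_group S R\<^esub> (groth_relations S R #>\<^bsub>F\<^esub> b)"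
        using ab(1,2) groth_coset_mult[of a "- b"] by (simp add: groth_coset_inv)
      thus "f' (groth_relations S R #>\<^bsub>F\<^esub> (a - b)) = f (groth_relations S R #>\<^bsub>F\<^esub> (a - b))"
        using ab groth_coset_closed by simp
    next
      fix Y assume Y: "Y \<in> S"
      have "f' (groth_class S R Y) = f (groth_class S R Y)"
        using bspec[OF conjunct2[OF f] Y] bspec[OF conjunct2[OF that] Y] by simp
      thus "f' (groth_relations S R #>\<^bsub>F\<^esub> frag_of Y) = f (groth_relations S R #>\<^bsub>F\<^esub> frag_of Y)"
        unfolding groth_class_def .
    qed
    thus "f' v = f v" by (simp add: a(2))
  qed
  with f have "(THE f. ?P f) = f" by (rule the_equality)
  thus ?thesis using bspec[OF conjunct2[OF f] X] by simp
qed

end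

subsection \<open>Dimensions of modules over a linear category\<close>

lemma lfdD:
  assumes "M \<in> lfd A" "X \<in> Obj A"
  shows "vectorspace class_ring (Val M X)" "vectorspace.fin_dim class_ring (Val M X)"
  using assms by (auto simp: lfd_def is_cmod_def)

lemma exact_sequence_dim:
  assumes "(L, M, N) \<in> exact_sequences A" "X \<in> Obj A"
  shows "vectorspace.dim class_ring (Val M X) = vectorspace.dim class_ring (Val L X) + vectorspace.dim class_ring (Val N X)"
proof -
  obtain \<eta> \<theta> where "cmod_hom A L M \<eta>" "cmod_hom A M N \<theta>" and *: "L \<in> lfd A" "M \<in> lfd A" "N \<in> lfd A"
    "inj_on (\<eta> X) (carrier (Val L X))"
    "\<eta> X ` carrier (Val L X) = {v \<in> carrier (Val M X). \<theta> X v = \<zero>\<^bsub>Val N X\<^esub>}"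
    "\<theta> X ` carrier (Val M X) = carrier (Val N X)"
    using assms by (auto simp: exact_sequences_def)
  hence "\<eta> X \<in> lin_maps (Val L X) (Val M X)" "\<theta> X \<in> lin_maps (Val M X) (Val N X)"
    using assms(2) by (auto simp: cmod_hom_def)
  from dim_exact[OF lfdD(1)[OF *(1) assms(2)] lfdD(1)[OF *(2) assms(2)] lfdD(1)[OF *(3) assms(2)] this *(4-6)
      lfdD(2)[OF *(2) assms(2)]]
  show ?thesis .
qed

context linear_category
begin

text \<open>A module turns the biproduct into the exact sequence \<open>M(X) \<rightarrow> M(Z) \<rightarrow> M(Y)\<close>, with \<open>M(p)\<close> injective and
  \<open>M(j)\<close> surjective. Exactness in the middle is \<open>v = M(p) (M(i) v) + M(q) (M(j) v)\<close>.\<close>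

lemma cmod_direct_sum_dim:
  assumes M: "M \<in> lfd C" and ds: "is_direct_sum C X Y Z"
  shows "vectorspace.dim class_ring (Val M Z) = vectorspace.dim class_ring (Val M X) + vectorspace.dim class_ring (Val M Y)"
proof -
  obtain i j p q where bp: "biproduct C X Y Z i j p q" using ds by (auto simp: is_direct_sum_def)
  have obj: "X \<in> Obj C" "Y \<in> Obj C" "Z \<in> Obj C" using bp by (auto simp: biproduct_def)
  have m: "i \<in> Mor C X Z" "j \<in> Mor C Y Z" "p \<in> Mor C Z X" "q \<in> Mor C Z Y"
    and e: "p \<cdot> i = Ident C X" "q \<cdot> j = Ident C Y" "q \<cdot> i = \<zero>\<^bsub>Hom C X Y\<^esub>" "p \<cdot> j = \<zero>\<^bsub>Hom C Y X\<^esub>"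
      "(i \<cdot> p) \<oplus>\<^bsub>Hom C Z Z\<^esub> (j \<cdot> q) = Ident C Z" using bp by (auto simp: biproduct_def)
  have cm: "is_cmod C M" using M by (simp add: lfd_def)
  have lin: "A \<in> Obj C \<Longrightarrow> B \<in> Obj C \<Longrightarrow> f \<in> Mor C A B \<Longrightarrow> Act M f \<in> lin_maps (Val M B) (Val M A)" for A B f
    using cm by (auto simp: is_cmod_def)
  have lin': "A \<in> Obj C \<Longrightarrow> B \<in> Obj C \<Longrightarrow> v \<in> carrier (Val M B) \<Longrightarrow> (\<lambda>f. Act M f v) \<in> lin_maps (Hom C A B) (Val M A)" for A B v
    using cm by (auto simp: is_cmod_def)
  have act1: "A \<in> Obj C \<Longrightarrow> v \<in> carrier (Val M A) \<Longrightarrow> Act M (Ident C A) v = v" for A v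
    using cm by (auto simp: is_cmod_def)
  have act2: "A \<in> Obj C \<Longrightarrow> B \<in> Obj C \<Longrightarrow> D \<in> Obj C \<Longrightarrow> f \<in> Mor C A B \<Longrightarrow> g \<in> Mor C B D \<Longrightarrow>
      v \<in> carrier (Val M D) \<Longrightarrow> Act M (g \<cdot> f) v = Act M f (Act M g v)" for A B D f g v
    using cm unfolding is_cmod_def by blast
  note vs = lfdD(1)[OF M obj(1)] lfdD(1)[OF M obj(2)] lfdD(1)[OF M obj(3)]
  interpret VX: vectorspace class_ring "Val M X" by fact
  interpret VZ: vectorspace class_ring "Val M Z" by fact
  have pi: "Act M i (Act M p v) = v" if "v \<in> carrier (Val M X)" for v
    using act2[OF obj(1,3,1) m(1,3) that] act1[OF obj(1) that] e by simp
  have qj: "Act M j (Act M q v) = v" if "v \<in> carrier (Val M Y)" for v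
    using act2[OF obj(2,3,2) m(2,4) that] act1[OF obj(2) that] e by simp
  have pj: "Act M j (Act M p v) = \<zero>\<^bsub>Val M Y\<^esub>" if "v \<in> carrier (Val M X)" for v
    using act2[OF obj(2,3,1) m(2,3) that] lin_maps_zero[OF Hom_vectorspace[OF obj(2,1)] vs(2) lin'[OF obj(2,1) that]] e by simp
  have split: "v = Act M p (Act M i v) \<oplus>\<^bsub>Val M Z\<^esub> Act M q (Act M j v)" if v: "v \<in> carrier (Val M Z)" for v
  proof -
    have "v = Act M (Ident C Z) v" using act1[OF obj(3) v] by simp
    also have "\<dots> = Act M (i \<cdot> p) v \<oplus>\<^bsub>Val M Z\<^esub> Act M (j \<cdot> q) v"
      unfolding e(5)[symmetric]
      by (rule lin_maps_add[OF lin'[OF obj(3,3) v] comp_mor[OF obj(3,1,3) m(3,1)] comp_mor[OF obj(3,2,3) m(4,2)]])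
    finally show ?thesis using act2[OF obj(3,1,3) m(3,1) v] act2[OF obj(3,2,3) m(4,2) v] by simp
  qed
  show ?thesis
  proof (rule dim_exact[OF vs(1,3,2) lin[OF obj(3,1) m(3)] lin[OF obj(2,3) m(2)]])
    show "inj_on (Act M p) (carrier (Val M X))" by (rule inj_on_inverseI[of _ "Act M i"]) (rule pi)
    show "vectorspace.fin_dim class_ring (Val M Z)" using lfdD(2)[OF M obj(3)] .
    show "Act M j ` carrier (Val M Z) = carrier (Val M Y)"
      using qj lin_maps_closed[OF lin[OF obj(3,2) m(4)]] lin_maps_closed[OF lin[OF obj(2,3) m(2)]]
      by (auto simp: image_iff) metis
    show "Act M p ` carrier (Val M X) = {v \<in> carrier (Val M Z). Act M j v = \<zero>\<^bsub>Val M Y\<^esub>}"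
    proof (intro equalityI subsetI)
      fix v assume "v \<in> Act M p ` carrier (Val M X)"
      thus "v \<in> {v \<in> carrier (Val M Z). Act M j v = \<zero>\<^bsub>Val M Y\<^esub>}"
        using pj lin_maps_closed[OF lin[OF obj(3,1) m(3)]] by auto
    next
      fix v assume "v \<in> {v \<in> carrier (Val M Z). Act M j v = \<zero>\<^bsub>Val M Y\<^esub>}"
      hence v: "v \<in> carrier (Val M Z)" "Act M j v = \<zero>\<^bsub>Val M Y\<^esub>" by auto
      have iv: "Act M i v \<in> carrier (Val M X)" using lin_maps_closed[OF lin[OF obj(1,3) m(1)] v(1)] .
      have "v = Act M p (Act M i v)"
        using split[OF v(1)] v(2) lin_maps_zero[OF vs(2,3) lin[OF obj(3,2) m(4)]]
          lin_maps_closed[OF lin[OF obj(3,1) m(3)] iv] by simp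
      thus "v \<in> Act M p ` carrier (Val M X)" using iv by blast
    qed
  qed
qed

subsection \<open>The pairing\<close>

abbreviation (input) mdim :: "('k, 'o, 'm, 'm set) cmod \<Rightarrow> 'o \<Rightarrow> int" where
  "mdim M T \<equiv> int (vectorspace.dim class_ring (Val M T))"

lemma exact_sequences_closed:
  "(L, M, N) \<in> exact_sequences C \<Longrightarrow> L \<in> lfd C \<and> M \<in> lfd C \<and> N \<in> lfd C"
  by (auto simp: exact_sequences_def)

lemma split_sequences_closed:
  "(X, Z, Y) \<in> split_sequences C \<Longrightarrow> X \<in> Obj C \<and> Z \<in> Obj C \<and> Y \<in> Obj C"
  by (auto simp: split_sequences_def is_direct_sum_def biproduct_def)

abbreviation (input) lfd_coset :: "(('k, 'o, 'm, 'm set) cmod \<Rightarrow>\<^sub>0 int) \<Rightarrow> (('k, 'o, 'm, 'm set) cmod \<Rightarrow>\<^sub>0 int) set" where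
  "lfd_coset a \<equiv> groth_relations (lfd C) (exact_sequences C) #>\<^bsub>free_Abelian_group (lfd C)\<^esub> a"

abbreviation (input) obj_coset :: "('o \<Rightarrow>\<^sub>0 int) \<Rightarrow> ('o \<Rightarrow>\<^sub>0 int) set" where
  "obj_coset b \<equiv> groth_relations (Obj C) (split_sequences C) #>\<^bsub>free_Abelian_group (Obj C)\<^esub> b"

text \<open>The form is additive in each variable separately, so it may be computed on arbitrary representatives.\<close>

lemma pairing_cosets:
  assumes a: "Poly_Mapping.keys a \<subseteq> lfd C" and b: "Poly_Mapping.keys b \<subseteq> Obj C"
  shows "pairing C (lfd_coset a) (obj_coset b) = frag_val (\<lambda>M. frag_val (mdim M) b) a"
proof -
  have eq: "(\<Sum>M\<in>Poly_Mapping.keys a'. \<Sum>T\<in>Poly_Mapping.keys b'.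
      Poly_Mapping.lookup a' M * Poly_Mapping.lookup b' T * mdim M T) = frag_val (\<lambda>M. frag_val (mdim M) b') a'" for a' b'
    by (simp add: frag_val_def sum_distrib_left mult.assoc)
  have val: "frag_val (\<lambda>M. frag_val (mdim M) b') a' = frag_val (\<lambda>M. frag_val (mdim M) b) a"
    if a': "a' \<in> lfd_coset a" and b': "b' \<in> obj_coset b" for a' b'
  proof -
    have kb: "Poly_Mapping.keys b' \<subseteq> Obj C"
    proof -
      obtain h where h: "h \<in> groth_relations (Obj C) (split_sequences C)" "b' = h + b"
        using b' groth_coset_mem[of "split_sequences C" "Obj C", OF split_sequences_closed] by blast
      thus ?thesis using groth_relations_keys[of "split_sequences C" "Obj C" h, OF split_sequences_closed] b keys_add[of h b] by auto
    qed
    have "frag_val (\<lambda>M. frag_val (mdim M) b') a' = frag_val (\<lambda>M. frag_val (mdim M) b') a"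
    proof (rule groth_coset_val[OF exact_sequences_closed _ a'])
      fix L M N :: "('k, 'o, 'm, 'm set) cmod" assume ex: "(L, M, N) \<in> exact_sequences C"
      have "frag_val (mdim M) b' = frag_val (\<lambda>T. mdim L T + mdim N T) b'"
        unfolding frag_val_def by (rule sum.cong) (use exact_sequence_dim[OF ex] kb in auto)
      thus "frag_val (mdim M) b' = frag_val (mdim L) b' + frag_val (mdim N) b'" by (simp add: frag_val_add_fun)
    qed
    also have "\<dots> = frag_val (\<lambda>M. frag_val (mdim M) b) a"
      unfolding frag_val_def[of _ a]
    proof (rule sum.cong[OF refl])
      fix M assume "M \<in> Poly_Mapping.keys a"
      hence M: "M \<in> lfd C" using a by blast
      have "frag_val (mdim M) b' = frag_val (mdim M) b"
      proof (rule groth_coset_val[OF split_sequences_closed _ b'])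
        fix X Z Y assume "(X, Z, Y) \<in> split_sequences C"
        thus "mdim M Z = mdim M X + mdim M Y"
          using cmod_direct_sum_dim[OF M, of X Y Z] by (simp add: split_sequences_def)
      qed
      thus "Poly_Mapping.lookup a M * frag_val (mdim M) b' = Poly_Mapping.lookup a M * frag_val (mdim M) b" by simp
    qed
    finally show ?thesis .
  qed
  have "a \<in> lfd_coset a" "b \<in> obj_coset b"
    using groth_coset_self[of "exact_sequences C" "lfd C", OF exact_sequences_closed a]
      groth_coset_self[of "split_sequences C" "Obj C", OF split_sequences_closed b] by auto
  thus ?thesis unfolding pairing_def eq using val by (intro the_equality) metis+
qed

lemma K0_comm: "comm_group (K0 C)"
  unfolding K0_def by (rule groth_group_comm) (rule split_sequences_closed)

lemma K0_lfd_comm: "comm_group (K0_lfd C)"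
  unfolding K0_lfd_def by (rule groth_group_comm) (rule exact_sequences_closed)

lemma K0_class_closed: "X \<in> Obj C \<Longrightarrow> K0_class C X \<in> carrier (K0 C)"
  unfolding K0_def K0_class_def by (rule groth_class_closed) (rule split_sequences_closed)

lemma K0_class_sum: "is_direct_sum C X Y Z \<Longrightarrow> K0_class C Z = K0_class C X \<otimes>\<^bsub>K0 C\<^esub> K0_class C Y"
  unfolding K0_def K0_class_def
  by (rule groth_class_rel[OF split_sequences_closed]) (auto simp: split_sequences_def)

lemma K0_lfd_class_closed: "M \<in> lfd C \<Longrightarrow> K0_lfd_class C M \<in> carrier (K0_lfd C)"
  unfolding K0_lfd_def K0_lfd_class_def by (rule groth_class_closed) (rule exact_sequences_closed)

lemma K0_carrierE:
  assumes "w \<in> carrier (K0 C)"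
  obtains b where "Poly_Mapping.keys b \<subseteq> Obj C" "w = obj_coset b"
  using assms groth_carrierE[of "split_sequences C" "Obj C" w, OF split_sequences_closed] unfolding K0_def by blast

lemma K0_lfd_carrierE:
  assumes "v \<in> carrier (K0_lfd C)"
  obtains a where "Poly_Mapping.keys a \<subseteq> lfd C" "v = lfd_coset a"
  using assms groth_carrierE[of "exact_sequences C" "lfd C" v, OF exact_sequences_closed] unfolding K0_lfd_def by blast

lemma pairing_mult_left:
  assumes "v \<in> carrier (K0_lfd C)" "v' \<in> carrier (K0_lfd C)" "w \<in> carrier (K0 C)"
  shows "pairing C (v \<otimes>\<^bsub>K0_lfd C\<^esub> v') w = pairing C v w + pairing C v' w"
proof -
  obtain a a' b where *: "Poly_Mapping.keys a \<subseteq> lfd C" "v = lfd_coset a" "Poly_Mapping.keys a' \<subseteq> lfd C" "v' = lfd_coset a'"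
    "Poly_Mapping.keys b \<subseteq> Obj C" "w = obj_coset b"
    using assms K0_lfd_carrierE K0_carrierE by metis
  have k: "Poly_Mapping.keys (a + a') \<subseteq> lfd C" using *(1,3) keys_add[of a a'] by auto
  have "v \<otimes>\<^bsub>K0_lfd C\<^esub> v' = lfd_coset (a + a')"
    unfolding *(2,4) K0_lfd_def by (rule groth_coset_mult[OF exact_sequences_closed *(1,3)])
  thus ?thesis using * k by (simp add: pairing_cosets frag_val_add)
qed

lemma pairing_inv_left:
  assumes "v \<in> carrier (K0_lfd C)" "w \<in> carrier (K0 C)"
  shows "pairing C (inv\<^bsub>K0_lfd C\<^esub> v) w = - pairing C v w"
proof -
  obtain a b where *: "Poly_Mapping.keys a \<subseteq> lfd C" "v = lfd_coset a" "Poly_Mapping.keys b \<subseteq> Obj C" "w = obj_coset b"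
    using assms K0_lfd_carrierE K0_carrierE by metis
  have "inv\<^bsub>K0_lfd C\<^esub> v = lfd_coset (- a)"
    unfolding *(2) K0_lfd_def by (rule groth_coset_inv[OF exact_sequences_closed *(1)])
  thus ?thesis using * by (simp add: pairing_cosets frag_val_neg)
qed

lemma pairing_class_diff:
  assumes "M \<in> lfd C" "X \<in> Obj C" "Y \<in> Obj C"
  shows "pairing C (K0_lfd_class C M) (K0_class C X \<otimes>\<^bsub>K0 C\<^esub> inv\<^bsub>K0 C\<^esub> K0_class C Y) = mdim M X - mdim M Y"
proof -
  have k: "Poly_Mapping.keys (frag_of X + - frag_of Y) \<subseteq> Obj C"
    using assms keys_add[of "frag_of X" "- frag_of Y"] by auto
  have "inv\<^bsub>K0 C\<^esub> K0_class C Y = obj_coset (- frag_of Y)"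
    unfolding K0_def K0_class_def groth_class_def
    by (rule groth_coset_inv[OF split_sequences_closed]) (use assms in auto)
  hence "K0_class C X \<otimes>\<^bsub>K0 C\<^esub> inv\<^bsub>K0 C\<^esub> K0_class C Y = obj_coset (frag_of X + - frag_of Y)"
    unfolding K0_def K0_class_def groth_class_def
    using groth_coset_mult[of "split_sequences C" "Obj C" "frag_of X" "- frag_of Y", OF split_sequences_closed] assms by simp
  thus ?thesis using k assms
    by (simp add: K0_lfd_class_def groth_class_def pairing_cosets frag_val_of frag_val_diff)
qed

lemma pairing_class:
  assumes "M \<in> lfd C" "X \<in> Obj C"
  shows "pairing C (K0_lfd_class C M) (K0_class C X) = mdim M X"
  unfolding K0_lfd_class_def K0_class_def groth_class_def using assms
  by (subst pairing_cosets) (auto simp: frag_val_of)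

text \<open>Exchanging the two summations shows that the form is determined by its values on classes of objects.\<close>

lemma pairing_determined:
  assumes v: "v \<in> carrier (K0_lfd C)" and z: "\<And>X. X \<in> Obj C \<Longrightarrow> pairing C v (K0_class C X) = 0"
    and w: "w \<in> carrier (K0 C)"
  shows "pairing C v w = 0"
proof -
  obtain a b where *: "Poly_Mapping.keys a \<subseteq> lfd C" "v = lfd_coset a" "Poly_Mapping.keys b \<subseteq> Obj C" "w = obj_coset b"
    using v w K0_lfd_carrierE K0_carrierE by metis
  have "frag_val (\<lambda>M. mdim M T) a = 0" if "T \<in> Obj C" for T
    using z[OF that] *(1) that pairing_cosets[of a "frag_of T"] unfolding *(2) K0_class_def groth_class_def
    by (simp add: frag_val_of)
  hence "frag_val (\<lambda>T. frag_val (\<lambda>M. mdim M T) a) b = 0"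
    using *(3) unfolding frag_val_def[of _ b] by (intro sum.neutral) auto
  thus ?thesis using * by (simp add: pairing_cosets frag_val_swap[of mdim])
qed

lemma left_kernel_normal: "left_kernel C \<lhd> K0_lfd C"
proof -
  interpret G: comm_group "K0_lfd C" by (rule K0_lfd_comm)
  have "pairing C \<one>\<^bsub>K0_lfd C\<^esub> w = 0" if "w \<in> carrier (K0 C)" for w
    using pairing_mult_left[OF G.one_closed G.one_closed that] by simp
  hence "subgroup (left_kernel C) (K0_lfd C)"
    by (intro G.subgroupI) (auto simp: left_kernel_def pairing_mult_left pairing_inv_left)
  thus ?thesis by (rule G.subgroup_imp_normal)
qed

lemma num_pairing_coset:
  assumes v: "v \<in> carrier (K0_lfd C)" and w: "w \<in> carrier (K0 C)"
  shows "num_pairing C (left_kernel C #>\<^bsub>K0_lfd C\<^esub> v) w = pairing C v w"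
proof -
  interpret G: comm_group "K0_lfd C" by (rule K0_lfd_comm)
  interpret N: normal "left_kernel C" "K0_lfd C" by (rule left_kernel_normal)
  have "pairing C a w = pairing C v w" if a: "a \<in> left_kernel C #>\<^bsub>K0_lfd C\<^esub> v" for a
  proof -
    obtain l where l: "l \<in> left_kernel C" "a = l \<otimes>\<^bsub>K0_lfd C\<^esub> v"
      using a unfolding r_coset_def by blast
    have "l \<in> carrier (K0_lfd C)" "pairing C l w = 0" using l(1) w unfolding left_kernel_def by blast+
    thus ?thesis using pairing_mult_left[of l v w] v w l(2) by simp
  qed
  moreover have "v \<in> left_kernel C #>\<^bsub>K0_lfd C\<^esub> v" using v by (rule G.rcos_self[OF _ N.subgroup_axioms])
  ultimately show ?thesis unfolding num_pairing_def by (intro the_equality) metis+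
qed

lemma num_pairing_class:
  "M \<in> lfd C \<Longrightarrow> w \<in> carrier (K0 C) \<Longrightarrow> num_pairing C (K0_num_class C M) w = pairing C (K0_lfd_class C M) w"
  unfolding K0_num_class_def by (rule num_pairing_coset[OF K0_lfd_class_closed])

text \<open>
  An element of the numerical Grothendieck group is determined by its values on objects. So a function
  on objects is the coordinate vector of such an element as soon as it is, up to sign, the dimension
  vector of a module.
\<close>

lemma num_element_of_dimension_vector:
  assumes Q: "Q \<in> lfd C" and c: "(\<forall>T\<in>Obj C. c T = mdim Q T) \<or> (\<forall>T\<in>Obj C. c T = - mdim Q T)"
    and T: "T \<in> Obj C"
  shows "num_pairing C (THE w. w \<in> carrier (K0_num C) \<and> (\<forall>T\<in>Obj C. num_pairing C w (K0_class C T) = c T)) (K0_class C T) = c T"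
proof -
  let ?P = "\<lambda>w. w \<in> carrier (K0_num C) \<and> (\<forall>T\<in>Obj C. num_pairing C w (K0_class C T) = c T)"
  let ?coset = "\<lambda>v. left_kernel C #>\<^bsub>K0_lfd C\<^esub> v"
  interpret G: comm_group "K0_lfd C" by (rule K0_lfd_comm)
  interpret N: normal "left_kernel C" "K0_lfd C" by (rule left_kernel_normal)
  have carr: "w \<in> carrier (K0_num C) \<longleftrightarrow> (\<exists>v\<in>carrier (K0_lfd C). w = ?coset v)" for w
    by (auto simp: K0_num_def FactGroup_def RCOSETS_def)
  note q = K0_lfd_class_closed[OF Q]
  have np: "num_pairing C (?coset v) (K0_class C T) = pairing C v (K0_class C T)"
    if "v \<in> carrier (K0_lfd C)" "T \<in> Obj C" for v T
    using num_pairing_coset that K0_class_closed by blast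
  have ex: "\<exists>w. ?P w"
    using c
  proof
    assume "\<forall>T\<in>Obj C. c T = mdim Q T"
    thus ?thesis using q Q by (intro exI[of _ "?coset (K0_lfd_class C Q)"]) (auto simp: carr np pairing_class)
  next
    assume "\<forall>T\<in>Obj C. c T = - mdim Q T"
    thus ?thesis using q Q
      by (intro exI[of _ "?coset (inv\<^bsub>K0_lfd C\<^esub> K0_lfd_class C Q)"])
        (auto simp: carr np pairing_class pairing_inv_left K0_class_closed)
  qed
  have uniq: "w = w'" if w: "?P w" and w': "?P w'" for w w'
  proof -
    obtain v v' where v: "v \<in> carrier (K0_lfd C)" "w = ?coset v" "v' \<in> carrier (K0_lfd C)" "w' = ?coset v'"
      using conjunct1[OF w] conjunct1[OF w'] unfolding carr by (elim bexE)
    have "pairing C (v \<otimes>\<^bsub>K0_lfd C\<^esub> inv\<^bsub>K0_lfd C\<^esub> v') y = 0" if "y \<in> carrier (K0 C)" for y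
    proof (rule pairing_determined[OF _ _ that])
      show "v \<otimes>\<^bsub>K0_lfd C\<^esub> inv\<^bsub>K0_lfd C\<^esub> v' \<in> carrier (K0_lfd C)" using v by simp
      show "pairing C (v \<otimes>\<^bsub>K0_lfd C\<^esub> inv\<^bsub>K0_lfd C\<^esub> v') (K0_class C X) = 0" if "X \<in> Obj C" for X
        using bspec[OF conjunct2[OF w] that] bspec[OF conjunct2[OF w'] that] v(1,3) that np[OF v(1) that] np[OF v(3) that]
        unfolding v(2,4) by (simp add: pairing_mult_left pairing_inv_left K0_class_closed)
    qed
    hence "v \<otimes>\<^bsub>K0_lfd C\<^esub> inv\<^bsub>K0_lfd C\<^esub> v' \<in> left_kernel C"
      using G.m_closed[OF v(1) G.inv_closed[OF v(3)]] unfolding left_kernel_def by blast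
    moreover have "v = (v \<otimes>\<^bsub>K0_lfd C\<^esub> inv\<^bsub>K0_lfd C\<^esub> v') \<otimes>\<^bsub>K0_lfd C\<^esub> v'" using v(1,3) by (simp add: G.m_assoc)
    ultimately have "v \<in> ?coset v'" unfolding r_coset_def UN_iff singleton_iff by (rule bexI[rotated])
    hence "?coset v' = ?coset v" by (rule G.repr_independence[OF _ v(3) N.subgroup_axioms])
    thus ?thesis using v by simp
  qed
  have "\<exists>!w. ?P w" using ex uniq by (rule ex_ex1I)
  from theI'[OF this] show ?thesis using T by (rule bspec[OF conjunct2])
qed

end

section \<open>Modules from two-term complexes\<close>

context linear_category
begin

text \<open>A presheaf of quotients \<open>V X / W X\<close> need only be functorial modulo \<open>W\<close>. This is the situation for
  maps of complexes, which are determined by what they lift only up to homotopy.\<close>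

lemma quot_cmod:
  fixes V :: "'o \<Rightarrow> ('k, 'v) module" and W :: "'o \<Rightarrow> 'v set" and M :: "('k, 'o, 'm, 'v set) cmod"
  assumes sub: "\<And>X. X \<in> Obj C \<Longrightarrow> VectorSpace.subspace class_ring (W X) (V X)"
    and lin: "\<And>X Y f. \<lbrakk>X \<in> Obj C; Y \<in> Obj C; f \<in> Mor C X Y\<rbrakk> \<Longrightarrow> \<phi> f \<in> lin_maps (V Y) (V X)"
    and add: "\<And>X Y f g v. \<lbrakk>X \<in> Obj C; Y \<in> Obj C; f \<in> Mor C X Y; g \<in> Mor C X Y; v \<in> carrier (V Y)\<rbrakk>
      \<Longrightarrow> W X +>\<^bsub>V X\<^esub> \<phi> (f \<oplus>\<^bsub>Hom C X Y\<^esub> g) v = W X +>\<^bsub>V X\<^esub> (\<phi> f v \<oplus>\<^bsub>V X\<^esub> \<phi> g v)"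
    and smult: "\<And>X Y f c v. \<lbrakk>X \<in> Obj C; Y \<in> Obj C; f \<in> Mor C X Y; v \<in> carrier (V Y)\<rbrakk>
      \<Longrightarrow> W X +>\<^bsub>V X\<^esub> \<phi> (c \<odot>\<^bsub>Hom C X Y\<^esub> f) v = W X +>\<^bsub>V X\<^esub> (c \<odot>\<^bsub>V X\<^esub> \<phi> f v)"
    and ident: "\<And>X v. \<lbrakk>X \<in> Obj C; v \<in> carrier (V X)\<rbrakk> \<Longrightarrow> W X +>\<^bsub>V X\<^esub> \<phi> (Ident C X) v = W X +>\<^bsub>V X\<^esub> v"
    and comp: "\<And>X Y Z f g v. \<lbrakk>X \<in> Obj C; Y \<in> Obj C; Z \<in> Obj C; f \<in> Mor C X Y; g \<in> Mor C Y Z; v \<in> carrier (V Z)\<rbrakk>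
      \<Longrightarrow> W X +>\<^bsub>V X\<^esub> \<phi> (g \<cdot> f) v = W X +>\<^bsub>V X\<^esub> \<phi> f (\<phi> g v)"
    and Val: "\<And>X. X \<in> Obj C \<Longrightarrow> Val M X = quot_space (V X) (W X)"
    and Act: "\<And>X Y f v. \<lbrakk>X \<in> Obj C; Y \<in> Obj C; f \<in> Mor C X Y; v \<in> carrier (V Y)\<rbrakk>
      \<Longrightarrow> Act M f (W Y +>\<^bsub>V Y\<^esub> v) = W X +>\<^bsub>V X\<^esub> \<phi> f v"
  shows "is_cmod C M"
proof -
  have vs: "vectorspace class_ring (V X)" if "X \<in> Obj C" for X using sub[OF that] by (simp add: subspace_iff)
  have "Act M f \<in> lin_maps (Val M Y) (Val M X)" if XY: "X \<in> Obj C" "Y \<in> Obj C" "f \<in> Mor C X Y" for X Y f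
  proof -
    interpret VY: abelian_group "V Y" using vs_abelian_group[OF vs[OF XY(2)]] .
    note l = lin[OF XY]
    show ?thesis
      unfolding Val[OF XY(1)] Val[OF XY(2)]
      by (rule lin_mapsI)
        (auto simp: quot_carrier[OF sub[OF XY(1)]] quot_carrier[OF sub[OF XY(2)]] Act[OF XY] lin_maps_closed[OF l]
          quot_add[OF sub[OF XY(1)]] quot_add[OF sub[OF XY(2)]] quot_smult[OF sub[OF XY(1)]] quot_smult[OF sub[OF XY(2)]]
          lin_maps_add[OF l] lin_maps_smult[OF l] vs_smult_closed[OF vs[OF XY(2)]])
  qed
  moreover have "(\<lambda>f. Act M f c) \<in> lin_maps (Hom C X Y) (Val M X)"
    if XY: "X \<in> Obj C" "Y \<in> Obj C" and c: "c \<in> carrier (Val M Y)" for X Y c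
  proof -
    obtain v where v: "v \<in> carrier (V Y)" "c = W Y +>\<^bsub>V Y\<^esub> v"
      using c by (auto simp: Val[OF XY(2)] quot_carrier[OF sub[OF XY(2)]])
    interpret H: abelian_group "Hom C X Y" using hom_abelian_group[OF XY] .
    have cl: "\<phi> f v \<in> carrier (V X)" if "f \<in> Mor C X Y" for f using lin_maps_closed[OF lin[OF XY that] v(1)] .
    show ?thesis
      unfolding Val[OF XY(1)] v(2)
      by (rule lin_mapsI)
        (simp_all add: Act[OF XY _ v(1)] cl quot_carrier[OF sub[OF XY(1)]] quot_add[OF sub[OF XY(1)]]
          quot_smult[OF sub[OF XY(1)]] add[OF XY _ _ v(1)] smult[OF XY _ v(1)] vs_smult_closed[OF Hom_vectorspace[OF XY]])
  qed
  moreover have "Act M (Ident C X) c = c" if X: "X \<in> Obj C" and c: "c \<in> carrier (Val M X)" for X c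
    using c by (auto simp: Val[OF X] quot_carrier[OF sub[OF X]] Act[OF X X Ident_closed[OF X]] ident[OF X])
  moreover have "Act M (g \<cdot> f) c = Act M f (Act M g c)"
    if XYZ: "X \<in> Obj C" "Y \<in> Obj C" "Z \<in> Obj C" and fg: "f \<in> Mor C X Y" "g \<in> Mor C Y Z" and c: "c \<in> carrier (Val M Z)"
    for X Y Z f g c
    using c
    by (auto simp: Val[OF XYZ(3)] quot_carrier[OF sub[OF XYZ(3)]] Act[OF XYZ(1,3) comp_mor[OF XYZ fg]]
        Act[OF XYZ(1,2) fg(1)] Act[OF XYZ(2,3) fg(2)] comp[OF XYZ fg] lin_maps_closed[OF lin[OF XYZ(2,3) fg(2)]])
  ultimately show ?thesis
    unfolding is_cmod_def using Val quot_vs[OF sub] by simp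
qed

lemma precomp_lin:
  assumes "X \<in> Obj C" "Y \<in> Obj C" "Z \<in> Obj C" "f \<in> Mor C X Y"
  shows "(\<lambda>v. v \<cdot> f) \<in> lin_maps (Hom C Y Z) (Hom C X Z)"
  using Comp_linear_left[OF assms] .

abbreviation head :: "'o \<Rightarrow> 'o \<Rightarrow> ('k, 'm set) module" where
  "head U V \<equiv> quot_space (Hom C V U) (rad C V U)"

text \<open>Precomposition acts on \<open>Hom(-, U)\<close> and preserves the radical.\<close>

lemma simple_is_cmod:
  assumes U: "U \<in> Obj C"
  shows "is_cmod C (simple_cmod C U)"
proof (rule quot_cmod[where V = "\<lambda>X. Hom C X U" and W = "\<lambda>X. rad C X U" and \<phi> = "\<lambda>f v. v \<cdot> f"])
  fix X assume X: "X \<in> Obj C"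
  show "VectorSpace.subspace class_ring (rad C X U) (Hom C X U)" using rad_subspace[OF X U] .
  show "Val (simple_cmod C U) X = head U X" by (simp add: simple_cmod_def)
  fix v assume "v \<in> Mor C X U"
  thus "rad C X U +>\<^bsub>Hom C X U\<^esub> (v \<cdot> Ident C X) = rad C X U +>\<^bsub>Hom C X U\<^esub> v" using X U by (simp add: Comp_Ident)
next
  fix X Y f assume XY: "X \<in> Obj C" "Y \<in> Obj C" "f \<in> Mor C X Y"
  show "(\<lambda>v. v \<cdot> f) \<in> lin_maps (Hom C Y U) (Hom C X U)" using precomp_lin XY U by blast
  fix v assume v: "v \<in> Mor C Y U"
  fix c show "rad C X U +>\<^bsub>Hom C X U\<^esub> (v \<cdot> (c \<odot>\<^bsub>Hom C X Y\<^esub> f)) = rad C X U +>\<^bsub>Hom C X U\<^esub> (c \<odot>\<^bsub>Hom C X U\<^esub> (v \<cdot> f))"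
    using XY v U by (simp add: cat_simps)
next
  fix X Y f g v assume "X \<in> Obj C" "Y \<in> Obj C" "f \<in> Mor C X Y" "g \<in> Mor C X Y" "v \<in> Mor C Y U"
  thus "rad C X U +>\<^bsub>Hom C X U\<^esub> (v \<cdot> (f \<oplus>\<^bsub>Hom C X Y\<^esub> g)) = rad C X U +>\<^bsub>Hom C X U\<^esub> (v \<cdot> f \<oplus>\<^bsub>Hom C X U\<^esub> v \<cdot> g)"
    using U by (simp add: cat_simps)
next
  fix X Y Z f g v assume "X \<in> Obj C" "Y \<in> Obj C" "Z \<in> Obj C" "f \<in> Mor C X Y" "g \<in> Mor C Y Z" "v \<in> Mor C Z U"
  thus "rad C X U +>\<^bsub>Hom C X U\<^esub> (v \<cdot> (g \<cdot> f)) = rad C X U +>\<^bsub>Hom C X U\<^esub> (v \<cdot> g \<cdot> f)"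
    using U by (simp add: cat_simps)
next
  fix X Y f v assume XY: "X \<in> Obj C" "Y \<in> Obj C" and f: "f \<in> Mor C X Y" and v: "v \<in> Mor C Y U"
  note sub = rad_subspace[OF XY(1) U] and sub' = rad_subspace[OF XY(2) U]
  note vf = comp_mor[OF XY U f v]
  have cong: "rad C X U +>\<^bsub>Hom C X U\<^esub> (u \<cdot> f) = rad C X U +>\<^bsub>Hom C X U\<^esub> (v \<cdot> f)" if u: "u \<in> rad C Y U +>\<^bsub>Hom C Y U\<^esub> v" for u
  proof -
    obtain r where r: "r \<in> rad C Y U" "u = r \<oplus>\<^bsub>Hom C Y U\<^esub> v" using u coset_mem[OF sub'] by blast
    have rf: "r \<cdot> f \<in> rad C X U" using rad_comp_right[OF XY U f r(1)] .
    have "u \<cdot> f = v \<cdot> f \<oplus>\<^bsub>Hom C X U\<^esub> r \<cdot> f"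
      unfolding r(2) using lin_maps_add[OF precomp_lin[OF XY U f] rad_mor[OF r(1)] v] hom_add_comm[OF XY(1) U vf rad_mor[OF rf]] by simp
    thus ?thesis using coset_eqI[OF sub vf rf] by blast
  qed
  have carr: "u \<in> Mor C Y U" if "u \<in> rad C Y U +>\<^bsub>Hom C Y U\<^esub> v" for u
    using abelian_subgroup.a_elemrcos_carrier[OF subspace_abelian_subgroup[OF sub'] v that] .
  have dom: "Z = X" if "Z \<in> Obj C" "u \<in> Mor C Y U" "u \<cdot> f \<in> Mor C Z U" for Z u
    using Hom_disjoint[OF XY(1) U that(1) U comp_mor[OF XY U f that(2)] that(3)] by simp
  show "Act (simple_cmod C U) f (rad C Y U +>\<^bsub>Hom C Y U\<^esub> v) = rad C X U +>\<^bsub>Hom C X U\<^esub> (v \<cdot> f)"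
  proof (intro equalityI subsetI)
    fix h assume "h \<in> Act (simple_cmod C U) f (rad C Y U +>\<^bsub>Hom C Y U\<^esub> v)"
    then obtain u Z where u: "u \<in> rad C Y U +>\<^bsub>Hom C Y U\<^esub> v" "Z \<in> Obj C" "u \<cdot> f \<in> Mor C Z U"
      "h \<in> rad C Z U +>\<^bsub>Hom C Z U\<^esub> (u \<cdot> f)" by (auto simp: simple_cmod_def)
    have "Z = X" using dom[OF u(2) carr[OF u(1)] u(3)] .
    thus "h \<in> rad C X U +>\<^bsub>Hom C X U\<^esub> (v \<cdot> f)" using u(4) cong[OF u(1)] by simp
  next
    fix h assume "h \<in> rad C X U +>\<^bsub>Hom C X U\<^esub> (v \<cdot> f)"
    thus "h \<in> Act (simple_cmod C U) f (rad C Y U +>\<^bsub>Hom C Y U\<^esub> v)"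
      using coset_self[OF sub' v] vf XY(1) by (auto simp: simple_cmod_def)
  qed
qed

lemma linear_category_full_sub:
  assumes "\<T> \<subseteq> Obj C"
  shows "linear_category (full_sub C \<T>)"
proof -
  have o: "X \<in> Obj C" if "X \<in> \<T>" for X using that assms by blast
  show ?thesis
  proof (rule linear_category.intro, goal_cases)
    case (1 X Y) thus ?case using Hom_vectorspace[of X Y] o by simp
  next
    case (2 X Y X' Y' f) thus ?case using Hom_disjoint[of X Y X' Y' f] o by simp
  next
    case (3 X) thus ?case using Ident_closed[of X] o by simp
  next
    case (4 X Y Z f) thus ?case using Comp_linear_left[of X Y Z f] o by simp
  next
    case (5 X Y Z g) thus ?case using Comp_linear_right[of X Y Z g] o by simp
  next
    case (6 X Y f) thus ?case using Comp_Ident[of X Y f] o by simp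
  next
    case (7 X Y f) thus ?case using Ident_Comp[of X Y f] o by simp
  next
    case (8 W X Y Z f g h) thus ?case using Comp_assoc[of W X Y Z f g h] o by simp
  qed
qed

end

text \<open>Complexes \<open>d X : A X \<rightarrow> B X\<close>, functorial in \<open>X\<close> up to homotopy: \<open>lift X Y a \<kappa> \<rho>\<close> says that the map
  \<open>(\<kappa>, \<rho>)\<close> of complexes lifts \<open>a\<close>. The homotopies for \<open>\<kappa>\<close> and \<open>\<rho>\<close> may be different, because the inflations of an
  extriangulated category need not be monomorphisms. The assumption \<open>homotopy\<close> says that a map from \<open>A X'\<close> to
  \<open>B X\<close>, regarded as a map of complexes of degree one, is null-homotopic. The quotients \<open>head U V\<close> of
  \<open>Hom(V, U)\<close> by the radical form the functor that is applied to the complexes.\<close>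

locale two_term_family = linear_category C
  for C :: "('k::field, 'o, 'm, 'z) lcat_scheme" (structure) +
  fixes \<T> :: "'o set" and A B :: "'o \<Rightarrow> 'o" and d :: "'o \<Rightarrow> 'm"
    and lift :: "'o \<Rightarrow> 'o \<Rightarrow> 'm \<Rightarrow> 'm \<Rightarrow> 'm \<Rightarrow> bool" and U :: 'o
  assumes U: "U \<in> Obj C"
    and T_obj: "X \<in> \<T> \<Longrightarrow> X \<in> Obj C" and A_obj: "X \<in> \<T> \<Longrightarrow> A X \<in> Obj C" and B_obj: "X \<in> \<T> \<Longrightarrow> B X \<in> Obj C"
    and d_mor: "X \<in> \<T> \<Longrightarrow> d X \<in> Mor C (A X) (B X)"
    and lift_exists: "\<lbrakk>X \<in> \<T>; Y \<in> \<T>; a \<in> Mor C X Y\<rbrakk> \<Longrightarrow> \<exists>\<kappa> \<rho>. lift X Y a \<kappa> \<rho>"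
    and lift_mor: "\<lbrakk>X \<in> \<T>; Y \<in> \<T>; lift X Y a \<kappa> \<rho>\<rbrakk> \<Longrightarrow>
      \<kappa> \<in> Mor C (A X) (A Y) \<and> \<rho> \<in> Mor C (B X) (B Y) \<and> \<rho> \<cdot> d X = d Y \<cdot> \<kappa>"
    and lift_ident: "X \<in> \<T> \<Longrightarrow> lift X X (Ident C X) (Ident C (A X)) (Ident C (B X))"
    and lift_add: "\<lbrakk>X \<in> \<T>; Y \<in> \<T>; a \<in> Mor C X Y; b \<in> Mor C X Y; lift X Y a \<kappa> \<rho>; lift X Y b \<kappa>' \<rho>'\<rbrakk> \<Longrightarrow>
      lift X Y (a \<oplus>\<^bsub>Hom C X Y\<^esub> b) (\<kappa> \<oplus>\<^bsub>Hom C (A X) (A Y)\<^esub> \<kappa>') (\<rho> \<oplus>\<^bsub>Hom C (B X) (B Y)\<^esub> \<rho>')"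
    and lift_smult: "\<lbrakk>X \<in> \<T>; Y \<in> \<T>; a \<in> Mor C X Y; lift X Y a \<kappa> \<rho>\<rbrakk> \<Longrightarrow>
      lift X Y (c \<odot>\<^bsub>Hom C X Y\<^esub> a) (c \<odot>\<^bsub>Hom C (A X) (A Y)\<^esub> \<kappa>) (c \<odot>\<^bsub>Hom C (B X) (B Y)\<^esub> \<rho>)"
    and lift_comp: "\<lbrakk>X \<in> \<T>; Y \<in> \<T>; Z \<in> \<T>; a \<in> Mor C X Y; b \<in> Mor C Y Z; lift X Y a \<kappa> \<rho>; lift Y Z b \<kappa>' \<rho>'\<rbrakk> \<Longrightarrow>
      lift X Z (b \<cdot> a) (\<kappa>' \<cdot> \<kappa>) (\<rho>' \<cdot> \<rho>)"
    and lift_unique: "\<lbrakk>X \<in> \<T>; Y \<in> \<T>; a \<in> Mor C X Y; lift X Y a \<kappa> \<rho>; lift X Y a \<kappa>' \<rho>'\<rbrakk> \<Longrightarrow>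
      (\<exists>s\<in>Mor C (B X) (A Y). \<kappa> = \<kappa>' \<oplus>\<^bsub>Hom C (A X) (A Y)\<^esub> s \<cdot> d X) \<and>
      (\<exists>s\<in>Mor C (B X) (A Y). \<rho> = \<rho>' \<oplus>\<^bsub>Hom C (B X) (B Y)\<^esub> d Y \<cdot> s)"
    and homotopy: "\<lbrakk>X \<in> \<T>; X' \<in> \<T>; g \<in> Mor C (A X') (B X)\<rbrakk> \<Longrightarrow>
      \<exists>\<beta>\<in>Mor C (B X') (B X). \<exists>\<alpha>\<in>Mor C (A X') (A X). g = \<beta> \<cdot> d X' \<oplus>\<^bsub>Hom C (A X') (B X)\<^esub> d X \<cdot> \<alpha>"
    and section_exists: "\<lbrakk>X \<in> \<T>; v \<in> Mor C (B X) U; v \<notin> rad C (B X) U\<rbrakk> \<Longrightarrow> \<exists>t\<in>Mor C U (B X). v \<cdot> t = Ident C U"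
    and head_fin_dim: "X \<in> \<T> \<Longrightarrow> vectorspace.fin_dim class_ring (head U (A X)) \<and> vectorspace.fin_dim class_ring (head U (B X))"
begin

text \<open>The maps that vanish in the cokernel of \<open>head U (B X) \<rightarrow> head U (A X)\<close>.\<close>

definition bounded_maps :: "'o \<Rightarrow> 'm set" where
  "bounded_maps X = {w. \<exists>r\<in>rad C (A X) U. \<exists>h\<in>Mor C (B X) U. w = r \<oplus>\<^bsub>Hom C (A X) U\<^esub> h \<cdot> d X}"

text \<open>Representatives for the kernel of \<open>head U (B X) \<rightarrow> head U (A X)\<close>.\<close>

definition cycle_maps :: "'o \<Rightarrow> ('k, 'm) module" where
  "cycle_maps X = (Hom C (B X) U)\<lparr>carrier := {v \<in> Mor C (B X) U. v \<cdot> d X \<in> rad C (A X) U}\<rparr>"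

definition lift_pair :: "'m \<Rightarrow> 'm \<times> 'm" where
  "lift_pair a = (SOME p. lift (source C a) (target C a) a (fst p) (snd p))"

text \<open>Cokernel and kernel are realised as quotients of spaces of morphisms, so that their elements are sets of
  morphisms like those of simple modules.\<close>

definition coker_mod :: "('k, 'o, 'm, 'm set) cmod" where
  "coker_mod = \<lparr>Val = (\<lambda>X. quot_space (Hom C (A X) U) (bounded_maps X)),
    Act = (\<lambda>a. quot_map (Hom C (A (target C a)) U) (bounded_maps (target C a))
      (Hom C (A (source C a)) U) (bounded_maps (source C a)) (\<lambda>v. v \<cdot> fst (lift_pair a)))\<rparr>"

definition ker_mod :: "('k, 'o, 'm, 'm set) cmod" where
  "ker_mod = \<lparr>Val = (\<lambda>X. quot_space (cycle_maps X) (rad C (B X) U)),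
    Act = (\<lambda>a. quot_map (cycle_maps (target C a)) (rad C (B (target C a)) U)
      (cycle_maps (source C a)) (rad C (B (source C a)) U) (\<lambda>v. v \<cdot> snd (lift_pair a)))\<rparr>"

lemma lift_pair:
  assumes "X \<in> \<T>" "Y \<in> \<T>" "a \<in> Mor C X Y"
  shows "lift X Y a (fst (lift_pair a)) (snd (lift_pair a))"
proof -
  have st: "source C a = X" "target C a = Y" 
    using source_target[OF T_obj[OF assms(1)] T_obj[OF assms(2)] assms(3)] by simp_all
  have "\<exists>p. lift X Y a (fst p) (snd p)" using lift_exists[OF assms] by auto
  from someI_ex[OF this] show ?thesis by (simp add: lift_pair_def st)
qed

lemma rad_bounded:
  assumes X: "X \<in> \<T>" and r: "r \<in> rad C (A X) U"
  shows "r \<in> bounded_maps X"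
proof -
  note o = A_obj[OF X] B_obj[OF X] and dm = d_mor[OF X]
  interpret H: abelian_group "Hom C (A X) U" using hom_abelian_group[OF o(1) U] .
  have z: "\<zero>\<^bsub>Hom C (B X) U\<^esub> \<in> Mor C (B X) U" using o U by (simp add: cat_simps)
  have "\<zero>\<^bsub>Hom C (B X) U\<^esub> \<cdot> d X = \<zero>\<^bsub>Hom C (A X) U\<^esub>" using o U dm by (simp add: cat_simps)
  hence "r = r \<oplus>\<^bsub>Hom C (A X) U\<^esub> \<zero>\<^bsub>Hom C (B X) U\<^esub> \<cdot> d X" using rad_mor[OF r] by simp
  thus ?thesis using r z unfolding bounded_maps_def by blast
qed

lemma boundary_bounded:
  assumes X: "X \<in> \<T>" and h: "h \<in> Mor C (B X) U"
  shows "h \<cdot> d X \<in> bounded_maps X"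
proof -
  note o = A_obj[OF X] B_obj[OF X] and dm = d_mor[OF X]
  interpret H: abelian_group "Hom C (A X) U" using hom_abelian_group[OF o(1) U] .
  have "h \<cdot> d X = \<zero>\<^bsub>Hom C (A X) U\<^esub> \<oplus>\<^bsub>Hom C (A X) U\<^esub> h \<cdot> d X" using comp_mor[OF o U dm h] by simp
  thus ?thesis using rad_zero[OF o(1) U] h unfolding bounded_maps_def by blast
qed

lemma bounded_subspace:
  assumes X: "X \<in> \<T>"
  shows "VectorSpace.subspace class_ring (bounded_maps X) (Hom C (A X) U)"
proof -
  note o = A_obj[OF X] B_obj[OF X] and dm = d_mor[OF X]
  interpret H: vectorspace class_ring "Hom C (A X) U" using Hom_vectorspace[OF o(1) U] .
  note rs = rad_subspace[OF o(1) U]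
  have hd: "h \<cdot> d X \<in> Mor C (A X) U" if "h \<in> Mor C (B X) U" for h using comp_mor[OF o U dm that] .
  note lin = precomp_lin[OF o U dm]
  have zero: "\<zero>\<^bsub>Hom C (A X) U\<^esub> \<in> bounded_maps X"
    using rad_bounded[OF X rad_zero[OF o(1) U]] .
  have add: "u \<oplus>\<^bsub>Hom C (A X) U\<^esub> v \<in> bounded_maps X" if uv: "u \<in> bounded_maps X" "v \<in> bounded_maps X" for u v
  proof -
    obtain r h where u: "r \<in> rad C (A X) U" "h \<in> Mor C (B X) U" "u = r \<oplus>\<^bsub>Hom C (A X) U\<^esub> h \<cdot> d X"
      using uv(1) by (auto simp: bounded_maps_def)
    obtain r' h' where v: "r' \<in> rad C (A X) U" "h' \<in> Mor C (B X) U" "v = r' \<oplus>\<^bsub>Hom C (A X) U\<^esub> h' \<cdot> d X"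
      using uv(2) by (auto simp: bounded_maps_def)
    have "u \<oplus>\<^bsub>Hom C (A X) U\<^esub> v = (r \<oplus>\<^bsub>Hom C (A X) U\<^esub> r') \<oplus>\<^bsub>Hom C (A X) U\<^esub> (h \<cdot> d X \<oplus>\<^bsub>Hom C (A X) U\<^esub> h' \<cdot> d X)"
      unfolding u(3) v(3) using rad_mor[OF u(1)] rad_mor[OF v(1)] hd[OF u(2)] hd[OF v(2)] by (simp add: H.M.a_ac)
    also have "h \<cdot> d X \<oplus>\<^bsub>Hom C (A X) U\<^esub> h' \<cdot> d X = (h \<oplus>\<^bsub>Hom C (B X) U\<^esub> h') \<cdot> d X"
      using lin_maps_add[OF lin u(2) v(2)] by simp
    finally show ?thesis
      using rad_add[OF o(1) U u(1) v(1)] abelian_monoid.a_closed[OF abelian_group.axioms(1)[OF hom_abelian_group[OF o(2) U]] u(2) v(2)]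
      unfolding bounded_maps_def by blast
  qed
  have smult: "c \<odot>\<^bsub>Hom C (A X) U\<^esub> u \<in> bounded_maps X" if uu: "u \<in> bounded_maps X" for u c
  proof -
    obtain r h where u: "r \<in> rad C (A X) U" "h \<in> Mor C (B X) U" "u = r \<oplus>\<^bsub>Hom C (A X) U\<^esub> h \<cdot> d X"
      using uu by (auto simp: bounded_maps_def)
    have "c \<odot>\<^bsub>Hom C (A X) U\<^esub> u = c \<odot>\<^bsub>Hom C (A X) U\<^esub> r \<oplus>\<^bsub>Hom C (A X) U\<^esub> (c \<odot>\<^bsub>Hom C (B X) U\<^esub> h) \<cdot> d X"
      unfolding u(3) using H.smult_r_distr[of c r "h \<cdot> d X"] rad_mor[OF u(1)] hd[OF u(2)] lin_maps_smult[OF lin u(2)] by simp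
    thus ?thesis
      using rad_smult[OF o(1) U u(1)] vs_smult_closed[OF Hom_vectorspace[OF o(2) U] u(2)] unfolding bounded_maps_def by blast
  qed
  have "bounded_maps X \<subseteq> Mor C (A X) U" using rad_mor hd by (auto simp: bounded_maps_def)
  thus ?thesis using zero add smult Hom_vectorspace[OF o(1) U] by (auto simp: subspace_iff)
qed

lemma cycle_carrier: "v \<in> carrier (cycle_maps X) \<longleftrightarrow> v \<in> Mor C (B X) U \<and> v \<cdot> d X \<in> rad C (A X) U"
  by (simp add: cycle_maps_def)

lemma cycle_add: "u \<oplus>\<^bsub>cycle_maps X\<^esub> v = u \<oplus>\<^bsub>Hom C (B X) U\<^esub> v"
  and cycle_smult: "c \<odot>\<^bsub>cycle_maps X\<^esub> v = c \<odot>\<^bsub>Hom C (B X) U\<^esub> v"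
  and cycle_zero: "\<zero>\<^bsub>cycle_maps X\<^esub> = \<zero>\<^bsub>Hom C (B X) U\<^esub>"
  by (simp_all add: cycle_maps_def)

lemma cycle_subspace:
  assumes X: "X \<in> \<T>"
  shows "VectorSpace.subspace class_ring (carrier (cycle_maps X)) (Hom C (B X) U)"
proof -
  note o = A_obj[OF X] B_obj[OF X] and dm = d_mor[OF X]
  note lin = precomp_lin[OF o U dm] and rs = rad_subspace[OF o(1) U]
  note vA = Hom_vectorspace[OF o(1) U] and vB = Hom_vectorspace[OF o(2) U]
  interpret HB: vectorspace class_ring "Hom C (B X) U" by fact
  show ?thesis
    unfolding subspace_iff
    using vB lin_maps_zero[OF vB vA lin] rad_zero[OF o(1) U] rad_add[OF o(1) U] rad_smult[OF o(1) U] vs_smult_closed[OF vB]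
    by (auto simp: cycle_carrier lin_maps_add[OF lin] lin_maps_smult[OF lin])
qed

lemma cycle_vs: "X \<in> \<T> \<Longrightarrow> vectorspace class_ring (cycle_maps X)"
  using vs_restrict[OF cycle_subspace] by (simp add: cycle_maps_def)

lemma rad_cycle_subspace:
  assumes X: "X \<in> \<T>"
  shows "VectorSpace.subspace class_ring (rad C (B X) U) (cycle_maps X)"
  using rad_subspace[OF B_obj[OF X] U] cycle_vs[OF X] rad_comp_right[OF A_obj[OF X] B_obj[OF X] U d_mor[OF X]]
  by (auto simp: subspace_iff cycle_carrier cycle_add cycle_smult cycle_zero)

lemma bounded_precomp:
  assumes XY: "X \<in> \<T>" "Y \<in> \<T>" and l: "lift X Y a \<kappa> \<rho>" and w: "w \<in> bounded_maps Y"
  shows "w \<cdot> \<kappa> \<in> bounded_maps X"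
proof -
  note o = A_obj[OF XY(1)] A_obj[OF XY(2)] B_obj[OF XY(1)] B_obj[OF XY(2)] and dm = d_mor[OF XY(1)] d_mor[OF XY(2)]
  have m: "\<kappa> \<in> Mor C (A X) (A Y)" "\<rho> \<in> Mor C (B X) (B Y)" "\<rho> \<cdot> d X = d Y \<cdot> \<kappa>"
    using lift_mor[OF XY l] by auto
  obtain r h where rh: "r \<in> rad C (A Y) U" "h \<in> Mor C (B Y) U" "w = r \<oplus>\<^bsub>Hom C (A Y) U\<^esub> h \<cdot> d Y"
    using w by (auto simp: bounded_maps_def)
  have "w \<cdot> \<kappa> = r \<cdot> \<kappa> \<oplus>\<^bsub>Hom C (A X) U\<^esub> h \<cdot> (d Y \<cdot> \<kappa>)"
    unfolding rh(3) using rad_mor[OF rh(1)] rh(2) m(1) o dm U by (simp add: cat_simps)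
  also have "h \<cdot> (d Y \<cdot> \<kappa>) = (h \<cdot> \<rho>) \<cdot> d X"
    unfolding m(3)[symmetric] using rh(2) m(2) o dm U by (simp add: cat_simps)
  finally show ?thesis
    using rad_comp_right[OF o(1,2) U m(1) rh(1)] comp_mor[OF o(3,4) U m(2) rh(2)] unfolding bounded_maps_def by blast
qed

lemma cycle_precomp:
  assumes XY: "X \<in> \<T>" "Y \<in> \<T>" and l: "lift X Y a \<kappa> \<rho>" and v: "v \<in> carrier (cycle_maps Y)"
  shows "v \<cdot> \<rho> \<in> carrier (cycle_maps X)"
proof -
  note o = A_obj[OF XY(1)] A_obj[OF XY(2)] B_obj[OF XY(1)] B_obj[OF XY(2)] and dm = d_mor[OF XY(1)] d_mor[OF XY(2)]
  have m: "\<kappa> \<in> Mor C (A X) (A Y)" "\<rho> \<in> Mor C (B X) (B Y)" "\<rho> \<cdot> d X = d Y \<cdot> \<kappa>"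
    using lift_mor[OF XY l] by auto
  have v': "v \<in> Mor C (B Y) U" "v \<cdot> d Y \<in> rad C (A Y) U" using v by (auto simp: cycle_carrier)
  have "(v \<cdot> \<rho>) \<cdot> d X = v \<cdot> (\<rho> \<cdot> d X)" using v'(1) m(2) o dm U by (simp add: cat_simps)
  also have "\<dots> = (v \<cdot> d Y) \<cdot> \<kappa>" unfolding m(3) using v'(1) m(1) o dm U by (simp add: cat_simps)
  also have "\<dots> \<in> rad C (A X) U" using rad_comp_right[OF o(1,2) U m(1) v'(2)] .
  finally show ?thesis using comp_mor[OF o(3,4) U m(2) v'(1)] by (simp add: cycle_carrier)
qed

text \<open>Two lifts of one morphism differ by a map through \<open>d\<close>, and composites through \<open>d\<close> vanish in
  the cokernel.\<close>

lemma coker_lift_cong: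
  assumes XY: "X \<in> \<T>" "Y \<in> \<T>" and a: "a \<in> Mor C X Y" and l: "lift X Y a \<kappa> \<rho>" "lift X Y a \<kappa>' \<rho>'"
    and v: "v \<in> Mor C (A Y) U"
  shows "bounded_maps X +>\<^bsub>Hom C (A X) U\<^esub> (v \<cdot> \<kappa>) = bounded_maps X +>\<^bsub>Hom C (A X) U\<^esub> (v \<cdot> \<kappa>')"
proof -
  note o = A_obj[OF XY(1)] A_obj[OF XY(2)] B_obj[OF XY(1)] and dm = d_mor[OF XY(1)]
  obtain s where s: "s \<in> Mor C (B X) (A Y)" "\<kappa> = \<kappa>' \<oplus>\<^bsub>Hom C (A X) (A Y)\<^esub> s \<cdot> d X"
    using lift_unique[OF XY a l] by blast
  have m: "\<kappa>' \<in> Mor C (A X) (A Y)" using lift_mor[OF XY l(2)] by blast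
  have "v \<cdot> \<kappa> = v \<cdot> \<kappa>' \<oplus>\<^bsub>Hom C (A X) U\<^esub> (v \<cdot> s) \<cdot> d X" unfolding s(2) using m s(1) v o dm U by (simp add: cat_simps)
  thus ?thesis
    using coset_eqI[OF bounded_subspace[OF XY(1)] comp_mor[OF o(1,2) U m v]
        boundary_bounded[OF XY(1) comp_mor[OF o(3,2) U s(1) v]]] by blast
qed

lemma ker_lift_cong:
  assumes XY: "X \<in> \<T>" "Y \<in> \<T>" and a: "a \<in> Mor C X Y" and l: "lift X Y a \<kappa> \<rho>" "lift X Y a \<kappa>' \<rho>'"
    and v: "v \<in> carrier (cycle_maps Y)"
  shows "rad C (B X) U +>\<^bsub>cycle_maps X\<^esub> (v \<cdot> \<rho>) = rad C (B X) U +>\<^bsub>cycle_maps X\<^esub> (v \<cdot> \<rho>')"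
proof -
  note o = A_obj[OF XY(2)] B_obj[OF XY(1)] B_obj[OF XY(2)] and dm = d_mor[OF XY(2)]
  have v': "v \<in> Mor C (B Y) U" "v \<cdot> d Y \<in> rad C (A Y) U" using v by (auto simp: cycle_carrier)
  obtain s where s: "s \<in> Mor C (B X) (A Y)" "\<rho> = \<rho>' \<oplus>\<^bsub>Hom C (B X) (B Y)\<^esub> d Y \<cdot> s"
    using lift_unique[OF XY a l] by blast
  have m: "\<rho>' \<in> Mor C (B X) (B Y)" using lift_mor[OF XY l(2)] by blast
  have "v \<cdot> \<rho> = v \<cdot> \<rho>' \<oplus>\<^bsub>cycle_maps X\<^esub> (v \<cdot> d Y) \<cdot> s"
    unfolding s(2) cycle_add using m s(1) v' o dm U by (simp add: cat_simps)
  thus ?thesis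
    using coset_eqI[OF rad_cycle_subspace[OF XY(1)] cycle_precomp[OF XY l(2) v] rad_comp_right[OF o(2,1) U s(1) v'(2)]] by blast
qed

lemma coker_is_cmod: "is_cmod (full_sub C \<T>) coker_mod"
proof (rule linear_category.quot_cmod[where V = "\<lambda>X. Hom C (A X) U" and W = bounded_maps
      and \<phi> = "\<lambda>a v. v \<cdot> fst (lift_pair a)"], goal_cases)
  case 1 show ?case using linear_category_full_sub T_obj by blast
next
  case (2 X) thus ?case using bounded_subspace by simp
next
  case (3 X Y a)
  hence XY: "X \<in> \<T>" "Y \<in> \<T>" "a \<in> Mor C X Y" by auto
  show ?case using precomp_lin[OF A_obj[OF XY(1)] A_obj[OF XY(2)] U] lift_mor[OF XY(1,2) lift_pair[OF XY]] by blast
next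
  case (4 X Y a b v)
  hence XY: "X \<in> \<T>" "Y \<in> \<T>" "a \<in> Mor C X Y" "b \<in> Mor C X Y" and v: "v \<in> Mor C (A Y) U" by auto
  note la = lift_pair[OF XY(1-3)] and lb = lift_pair[OF XY(1,2,4)]
  have ab: "a \<oplus>\<^bsub>Hom C X Y\<^esub> b \<in> Mor C X Y" using XY T_obj by (simp add: cat_simps)
  have "v \<cdot> (fst (lift_pair a) \<oplus>\<^bsub>Hom C (A X) (A Y)\<^esub> fst (lift_pair b)) =
      v \<cdot> fst (lift_pair a) \<oplus>\<^bsub>Hom C (A X) U\<^esub> v \<cdot> fst (lift_pair b)"
    using lift_mor[OF XY(1,2) la] lift_mor[OF XY(1,2) lb] v A_obj XY(1,2) U by (simp add: cat_simps)
  thus ?case using coker_lift_cong[OF XY(1,2) ab lift_pair[OF XY(1,2) ab] lift_add[OF XY la lb] v] by simp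
next
  case (5 X Y a c v)
  hence XY: "X \<in> \<T>" "Y \<in> \<T>" "a \<in> Mor C X Y" and v: "v \<in> Mor C (A Y) U" by auto
  note la = lift_pair[OF XY]
  have ca: "c \<odot>\<^bsub>Hom C X Y\<^esub> a \<in> Mor C X Y" using XY T_obj by (simp add: cat_simps)
  have "v \<cdot> (c \<odot>\<^bsub>Hom C (A X) (A Y)\<^esub> fst (lift_pair a)) = c \<odot>\<^bsub>Hom C (A X) U\<^esub> (v \<cdot> fst (lift_pair a))"
    using lift_mor[OF XY(1,2) la] v A_obj XY(1,2) U by (simp add: cat_simps)
  thus ?case using coker_lift_cong[OF XY(1,2) ca lift_pair[OF XY(1,2) ca] lift_smult[OF XY la] v] by simp
next
  case (6 X v)
  hence X: "X \<in> \<T>" and v: "v \<in> Mor C (A X) U" by auto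
  note IX = Ident_closed[OF T_obj[OF X]]
  show ?case using coker_lift_cong[OF X X IX lift_pair[OF X X IX] lift_ident[OF X] v] Comp_Ident[OF A_obj[OF X] U v] by simp
next
  case (7 X Y Z a b v)
  hence XYZ: "X \<in> \<T>" "Y \<in> \<T>" "Z \<in> \<T>" and ab: "a \<in> Mor C X Y" "b \<in> Mor C Y Z" and v: "v \<in> Mor C (A Z) U" by auto
  note la = lift_pair[OF XYZ(1,2) ab(1)] and lb = lift_pair[OF XYZ(2,3) ab(2)]
  have ba: "b \<cdot> a \<in> Mor C X Z" using comp_mor[OF T_obj T_obj T_obj ab] XYZ by blast
  have "v \<cdot> (fst (lift_pair b) \<cdot> fst (lift_pair a)) = v \<cdot> fst (lift_pair b) \<cdot> fst (lift_pair a)"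
    using lift_mor[OF XYZ(1,2) la] lift_mor[OF XYZ(2,3) lb] v A_obj XYZ U by (simp add: cat_simps)
  thus ?case using coker_lift_cong[OF XYZ(1,3) ba lift_pair[OF XYZ(1,3) ba] lift_comp[OF XYZ ab la lb] v] by simp
next
  case (8 X) show ?case by (simp add: coker_mod_def)
next
  case (9 X Y a v)
  hence XY: "X \<in> \<T>" "Y \<in> \<T>" "a \<in> Mor C X Y" and v: "v \<in> Mor C (A Y) U" by auto
  have st: "source C a = X" "target C a = Y" 
    using source_target[OF T_obj[OF XY(1)] T_obj[OF XY(2)] XY(3)] by simp_all
  note la = lift_pair[OF XY]
  show ?case
    unfolding coker_mod_def cmod.simps st
    using quot_map_coset[OF bounded_subspace[OF XY(2)] bounded_subspace[OF XY(1)] precomp_lin[OF A_obj[OF XY(1)] A_obj[OF XY(2)] U]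
        bounded_precomp[OF XY(1,2) la] v] lift_mor[OF XY(1,2) la] by blast
qed

lemma ker_precomp_lin:
  assumes XY: "X \<in> \<T>" "Y \<in> \<T>" and l: "lift X Y a \<kappa> \<rho>"
  shows "(\<lambda>v. v \<cdot> \<rho>) \<in> lin_maps (cycle_maps Y) (cycle_maps X)"
proof -
  have \<rho>: "\<rho> \<in> Mor C (B X) (B Y)" using lift_mor[OF XY l] by blast
  note lin = precomp_lin[OF B_obj[OF XY(1)] B_obj[OF XY(2)] U \<rho>]
  show ?thesis
    by (rule lin_mapsI[OF cycle_precomp[OF XY l]])
      (auto simp: cycle_add cycle_smult cycle_carrier lin_maps_add[OF lin] lin_maps_smult[OF lin])
qed

lemma ker_is_cmod: "is_cmod (full_sub C \<T>) ker_mod"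
proof (rule linear_category.quot_cmod[where V = cycle_maps and W = "\<lambda>X. rad C (B X) U"
      and \<phi> = "\<lambda>a v. v \<cdot> snd (lift_pair a)"], goal_cases)
  case 1 show ?case using linear_category_full_sub T_obj by blast
next
  case (2 X) thus ?case using rad_cycle_subspace by simp
next
  case (3 X Y a)
  hence XY: "X \<in> \<T>" "Y \<in> \<T>" "a \<in> Mor C X Y" by auto
  show ?case using ker_precomp_lin[OF XY(1,2) lift_pair[OF XY]] .
next
  case (4 X Y a b v)
  hence XY: "X \<in> \<T>" "Y \<in> \<T>" "a \<in> Mor C X Y" "b \<in> Mor C X Y" and v: "v \<in> carrier (cycle_maps Y)" by auto
  note la = lift_pair[OF XY(1-3)] and lb = lift_pair[OF XY(1,2,4)]
  have ab: "a \<oplus>\<^bsub>Hom C X Y\<^esub> b \<in> Mor C X Y" using XY T_obj by (simp add: cat_simps)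
  have "v \<in> Mor C (B Y) U" using v by (simp add: cycle_carrier)
  hence "v \<cdot> (snd (lift_pair a) \<oplus>\<^bsub>Hom C (B X) (B Y)\<^esub> snd (lift_pair b)) =
      v \<cdot> snd (lift_pair a) \<oplus>\<^bsub>cycle_maps X\<^esub> v \<cdot> snd (lift_pair b)"
    using lift_mor[OF XY(1,2) la] lift_mor[OF XY(1,2) lb] B_obj XY(1,2) U by (simp add: cycle_add cat_simps)
  thus ?case using ker_lift_cong[OF XY(1,2) ab lift_pair[OF XY(1,2) ab] lift_add[OF XY la lb] v] by simp
next
  case (5 X Y a c v)
  hence XY: "X \<in> \<T>" "Y \<in> \<T>" "a \<in> Mor C X Y" and v: "v \<in> carrier (cycle_maps Y)" by auto
  note la = lift_pair[OF XY]
  have ca: "c \<odot>\<^bsub>Hom C X Y\<^esub> a \<in> Mor C X Y" using XY T_obj by (simp add: cat_simps)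
  have "v \<in> Mor C (B Y) U" using v by (simp add: cycle_carrier)
  hence "v \<cdot> (c \<odot>\<^bsub>Hom C (B X) (B Y)\<^esub> snd (lift_pair a)) = c \<odot>\<^bsub>cycle_maps X\<^esub> (v \<cdot> snd (lift_pair a))"
    using lift_mor[OF XY(1,2) la] B_obj XY(1,2) U by (simp add: cycle_smult cat_simps)
  thus ?case using ker_lift_cong[OF XY(1,2) ca lift_pair[OF XY(1,2) ca] lift_smult[OF XY la] v] by simp
next
  case (6 X v)
  hence X: "X \<in> \<T>" and v: "v \<in> carrier (cycle_maps X)" by auto
  note IX = Ident_closed[OF T_obj[OF X]]
  have "v \<in> Mor C (B X) U" using v by (simp add: cycle_carrier)
  thus ?case using ker_lift_cong[OF X X IX lift_pair[OF X X IX] lift_ident[OF X] v] Comp_Ident[OF B_obj[OF X] U] by simp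
next
  case (7 X Y Z a b v)
  hence XYZ: "X \<in> \<T>" "Y \<in> \<T>" "Z \<in> \<T>" and ab: "a \<in> Mor C X Y" "b \<in> Mor C Y Z" and v: "v \<in> carrier (cycle_maps Z)" by auto
  note la = lift_pair[OF XYZ(1,2) ab(1)] and lb = lift_pair[OF XYZ(2,3) ab(2)]
  have ba: "b \<cdot> a \<in> Mor C X Z" using comp_mor[OF T_obj T_obj T_obj ab] XYZ by blast
  have "v \<in> Mor C (B Z) U" using v by (simp add: cycle_carrier)
  hence "v \<cdot> (snd (lift_pair b) \<cdot> snd (lift_pair a)) = v \<cdot> snd (lift_pair b) \<cdot> snd (lift_pair a)"
    using lift_mor[OF XYZ(1,2) la] lift_mor[OF XYZ(2,3) lb] B_obj XYZ U by (simp add: cat_simps)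
  thus ?case using ker_lift_cong[OF XYZ(1,3) ba lift_pair[OF XYZ(1,3) ba] lift_comp[OF XYZ ab la lb] v] by simp
next
  case (8 X) show ?case by (simp add: ker_mod_def)
next
  case (9 X Y a v)
  hence XY: "X \<in> \<T>" "Y \<in> \<T>" "a \<in> Mor C X Y" and v: "v \<in> carrier (cycle_maps Y)" by auto
  have st: "source C a = X" "target C a = Y" 
    using source_target[OF T_obj[OF XY(1)] T_obj[OF XY(2)] XY(3)] by simp_all
  note la = lift_pair[OF XY]
  have \<rho>: "snd (lift_pair a) \<in> Mor C (B X) (B Y)" using lift_mor[OF XY(1,2) la] by blast
  show ?case
    unfolding ker_mod_def cmod.simps st
    using quot_map_coset[OF rad_cycle_subspace[OF XY(2)] rad_cycle_subspace[OF XY(1)] ker_precomp_lin[OF XY(1,2) la]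
        rad_comp_right[OF B_obj[OF XY(1)] B_obj[OF XY(2)] U \<rho>] v] .
qed

abbreviation boundary_map :: "'o \<Rightarrow> 'm set \<Rightarrow> 'm set" where
  "boundary_map X \<equiv> quot_map (Hom C (B X) U) (rad C (B X) U) (Hom C (A X) U) (rad C (A X) U) (\<lambda>v. v \<cdot> d X)"

context
  fixes X assumes X: "X \<in> \<T>"
begin

private lemmas o = A_obj[OF X] B_obj[OF X]
private lemmas lin = precomp_lin[OF o U d_mor[OF X]]
private lemmas sA = rad_subspace[OF o(1) U]
private lemmas sB = rad_subspace[OF o(2) U]
private lemmas sbd = bounded_subspace[OF X]
private lemmas scy = rad_cycle_subspace[OF X]

private lemma rad_d: "w \<in> rad C (B X) U \<Longrightarrow> w \<cdot> d X \<in> rad C (A X) U"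
  using rad_comp_right[OF o U d_mor[OF X]] .

private lemma id_A: "(\<lambda>v. v) \<in> lin_maps (Hom C (A X) U) (Hom C (A X) U)"
  by (rule lin_mapsI) auto

private lemma id_B: "(\<lambda>v. v) \<in> lin_maps (cycle_maps X) (Hom C (B X) U)"
  by (rule lin_mapsI) (auto simp: cycle_add cycle_smult cycle_carrier)

lemmas boundary_lin = quot_map_lin[OF sB sA lin rad_d]

lemma coker_exact:
  "quot_map (Hom C (A X) U) (rad C (A X) U) (Hom C (A X) U) (bounded_maps X) (\<lambda>v. v) ` carrier (head U (A X))
     = carrier (Val coker_mod X)"
  "quot_map (Hom C (A X) U) (rad C (A X) U) (Hom C (A X) U) (bounded_maps X) (\<lambda>v. v) \<in> lin_maps (head U (A X)) (Val coker_mod X)"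
  using quot_map_surj[OF sA sbd id_A rad_bounded[OF X]] quot_map_lin[OF sA sbd id_A rad_bounded[OF X]]
  by (auto simp: coker_mod_def)

lemma coker_lfd: "vectorspace.fin_dim class_ring (Val coker_mod X)"
  using fin_dim_surj[OF quot_vs[OF sA] _ coker_exact(2,1)] head_fin_dim[OF X] quot_vs[OF sbd] by (simp add: coker_mod_def)

lemma ker_inj:
  "inj_on (quot_map (cycle_maps X) (rad C (B X) U) (Hom C (B X) U) (rad C (B X) U) (\<lambda>v. v)) (carrier (Val ker_mod X))"
  "quot_map (cycle_maps X) (rad C (B X) U) (Hom C (B X) U) (rad C (B X) U) (\<lambda>v. v) \<in> lin_maps (Val ker_mod X) (head U (B X))"
  using quot_map_inj[OF scy sB id_B] quot_map_lin[OF scy sB id_B] by (auto simp: ker_mod_def)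

lemma ker_lfd: "vectorspace.fin_dim class_ring (Val ker_mod X)"
  using fin_dim_inj[OF _ quot_vs[OF sB] ker_inj(2,1)] head_fin_dim[OF X] quot_vs[OF scy] by (simp add: ker_mod_def)

lemma coker_dim:
  assumes inj: "\<And>v. v \<in> Mor C (B X) U \<Longrightarrow> v \<cdot> d X \<in> rad C (A X) U \<Longrightarrow> v \<in> rad C (B X) U"
  shows "vectorspace.dim class_ring (head U (A X)) =
    vectorspace.dim class_ring (head U (B X)) + vectorspace.dim class_ring (Val coker_mod X)"
proof (rule dim_exact[OF quot_vs[OF sB] quot_vs[OF sA] _ boundary_lin coker_exact(2)])
  show "vectorspace class_ring (Val coker_mod X)" using quot_vs[OF sbd] by (simp add: coker_mod_def)
  show "inj_on (boundary_map X) (carrier (head U (B X)))"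
    using quot_map_inj[OF sB sA lin rad_d] inj by blast
  show "vectorspace.fin_dim class_ring (head U (A X))" using head_fin_dim[OF X] by blast
  let ?q = "quot_map (Hom C (A X) U) (rad C (A X) U) (Hom C (A X) U) (bounded_maps X) (\<lambda>v. v)"
  show "?q ` carrier (head U (A X)) = carrier (Val coker_mod X)" by (rule coker_exact)
  have q0: "?q (rad C (A X) U +>\<^bsub>Hom C (A X) U\<^esub> w) = \<zero>\<^bsub>Val coker_mod X\<^esub> \<longleftrightarrow> w \<in> bounded_maps X" if "w \<in> Mor C (A X) U" for w
    using quot_map_zero_iff[OF sA sbd id_A rad_bounded[OF X] that] by (simp add: coker_mod_def)
  have b: "boundary_map X (rad C (B X) U +>\<^bsub>Hom C (B X) U\<^esub> v) = rad C (A X) U +>\<^bsub>Hom C (A X) U\<^esub> (v \<cdot> d X)"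
    if "v \<in> Mor C (B X) U" for v using quot_map_coset[OF sB sA lin rad_d that] .
  show "boundary_map X ` carrier (head U (B X)) = {c \<in> carrier (head U (A X)). ?q c = \<zero>\<^bsub>Val coker_mod X\<^esub>}"
  proof (intro equalityI subsetI)
    fix c assume "c \<in> boundary_map X ` carrier (head U (B X))"
    then obtain v where v: "v \<in> Mor C (B X) U" "c = rad C (A X) U +>\<^bsub>Hom C (A X) U\<^esub> (v \<cdot> d X)"
      by (auto simp: quot_carrier[OF sB] b)
    have "v \<cdot> d X \<in> Mor C (A X) U" using comp_mor[OF o U d_mor[OF X] v(1)] .
    thus "c \<in> {c \<in> carrier (head U (A X)). ?q c = \<zero>\<^bsub>Val coker_mod X\<^esub>}"
      using q0 boundary_bounded[OF X v(1)] unfolding v(2) by (simp add: quot_carrier[OF sA])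
  next
    fix c assume "c \<in> {c \<in> carrier (head U (A X)). ?q c = \<zero>\<^bsub>Val coker_mod X\<^esub>}"
    then obtain w where w: "w \<in> Mor C (A X) U" "c = rad C (A X) U +>\<^bsub>Hom C (A X) U\<^esub> w" "?q c = \<zero>\<^bsub>Val coker_mod X\<^esub>"
      by (auto simp: quot_carrier[OF sA])
    hence "w \<in> bounded_maps X" using q0 by simp
    then obtain r h where rh: "r \<in> rad C (A X) U" "h \<in> Mor C (B X) U" "w = r \<oplus>\<^bsub>Hom C (A X) U\<^esub> h \<cdot> d X"
      by (auto simp: bounded_maps_def)
    note hd = comp_mor[OF o U d_mor[OF X] rh(2)]
    have "w = h \<cdot> d X \<oplus>\<^bsub>Hom C (A X) U\<^esub> r" unfolding rh(3) using hom_add_comm[OF o(1) U rad_mor[OF rh(1)] hd] .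
    hence "c = boundary_map X (rad C (B X) U +>\<^bsub>Hom C (B X) U\<^esub> h)"
      unfolding w(2) b[OF rh(2)] using coset_eqI[OF sA hd rh(1)] by blast
    thus "c \<in> boundary_map X ` carrier (head U (B X))" using rh(2) by (auto simp: quot_carrier[OF sB])
  qed
qed

lemma ker_dim:
  assumes surj: "\<And>w. w \<in> Mor C (A X) U \<Longrightarrow> w \<in> bounded_maps X"
  shows "vectorspace.dim class_ring (head U (B X)) =
    vectorspace.dim class_ring (Val ker_mod X) + vectorspace.dim class_ring (head U (A X))"
proof (rule dim_exact[OF _ quot_vs[OF sB] quot_vs[OF sA] ker_inj(2) boundary_lin ker_inj(1)])
  show "vectorspace class_ring (Val ker_mod X)" using quot_vs[OF scy] by (simp add: ker_mod_def)
  show "vectorspace.fin_dim class_ring (head U (B X))" using head_fin_dim[OF X] by blast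
  let ?q = "quot_map (cycle_maps X) (rad C (B X) U) (Hom C (B X) U) (rad C (B X) U) (\<lambda>v. v)"
  have q: "?q (rad C (B X) U +>\<^bsub>cycle_maps X\<^esub> v) = rad C (B X) U +>\<^bsub>Hom C (B X) U\<^esub> v" if "v \<in> carrier (cycle_maps X)" for v
    using quot_map_coset[OF scy sB id_B _ that] .
  have b0: "boundary_map X (rad C (B X) U +>\<^bsub>Hom C (B X) U\<^esub> v) = \<zero>\<^bsub>head U (A X)\<^esub> \<longleftrightarrow> v \<cdot> d X \<in> rad C (A X) U"
    if "v \<in> Mor C (B X) U" for v using quot_map_zero_iff[OF sB sA lin rad_d that] .
  show "boundary_map X ` carrier (head U (B X)) = carrier (head U (A X))"
  proof (rule quot_map_surj[OF sB sA lin rad_d])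
    fix w assume "w \<in> Mor C (A X) U"
    hence "w \<in> bounded_maps X" by (rule surj)
    then obtain r h where rh: "r \<in> rad C (A X) U" "h \<in> Mor C (B X) U" "w = r \<oplus>\<^bsub>Hom C (A X) U\<^esub> h \<cdot> d X"
      by (auto simp: bounded_maps_def)
    note hd = comp_mor[OF o U d_mor[OF X] rh(2)]
    have "w = h \<cdot> d X \<oplus>\<^bsub>Hom C (A X) U\<^esub> r" unfolding rh(3) using hom_add_comm[OF o(1) U rad_mor[OF rh(1)] hd] .
    thus "\<exists>v\<in>Mor C (B X) U. rad C (A X) U +>\<^bsub>Hom C (A X) U\<^esub> w = rad C (A X) U +>\<^bsub>Hom C (A X) U\<^esub> (v \<cdot> d X)"
      using coset_eqI[OF sA hd rh(1)] rh(2) by blast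
  qed
  show "?q ` carrier (Val ker_mod X) = {c \<in> carrier (head U (B X)). boundary_map X c = \<zero>\<^bsub>head U (A X)\<^esub>}"
  proof (intro equalityI subsetI)
    fix c assume "c \<in> ?q ` carrier (Val ker_mod X)"
    then obtain v where v: "v \<in> carrier (cycle_maps X)" "c = rad C (B X) U +>\<^bsub>Hom C (B X) U\<^esub> v"
      by (auto simp: ker_mod_def quot_carrier[OF scy] q)
    thus "c \<in> {c \<in> carrier (head U (B X)). boundary_map X c = \<zero>\<^bsub>head U (A X)\<^esub>}"
      using b0 by (auto simp: cycle_carrier quot_carrier[OF sB])
  next
    fix c assume "c \<in> {c \<in> carrier (head U (B X)). boundary_map X c = \<zero>\<^bsub>head U (A X)\<^esub>}"
    then obtain v where v: "v \<in> Mor C (B X) U" "c = rad C (B X) U +>\<^bsub>Hom C (B X) U\<^esub> v" "v \<cdot> d X \<in> rad C (A X) U"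
      using b0 by (auto simp: quot_carrier[OF sB])
    hence "v \<in> carrier (cycle_maps X)" by (simp add: cycle_carrier)
    thus "c \<in> ?q ` carrier (Val ker_mod X)" using q v(2) by (auto simp: ker_mod_def quot_carrier[OF scy] image_iff)
  qed
qed

end

text \<open>
  If \<open>v d\<close> is radical for some non-radical \<open>v : B X \<rightarrow> U\<close>, choose \<open>t\<close> with \<open>v t = 1\<close>. Any
  \<open>w : A X' \<rightarrow> U\<close> is \<open>v (t w)\<close>, and writing \<open>t w = \<beta> d + d \<alpha>\<close> shows that \<open>w\<close> is \<open>(v \<beta>) d\<close> up to
  the radical map \<open>v d \<alpha>\<close>.
\<close>

lemma dichotomy:
  "(\<forall>X\<in>\<T>. \<forall>v\<in>Mor C (B X) U. v \<cdot> d X \<in> rad C (A X) U \<longrightarrow> v \<in> rad C (B X) U) \<or>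
   (\<forall>X\<in>\<T>. \<forall>w\<in>Mor C (A X) U. w \<in> bounded_maps X)"
proof (rule disjCI)
  assume "\<not> (\<forall>X\<in>\<T>. \<forall>w\<in>Mor C (A X) U. w \<in> bounded_maps X)"
  then obtain X' w where X': "X' \<in> \<T>" and w: "w \<in> Mor C (A X') U" "w \<notin> bounded_maps X'" by blast
  show "\<forall>X\<in>\<T>. \<forall>v\<in>Mor C (B X) U. v \<cdot> d X \<in> rad C (A X) U \<longrightarrow> v \<in> rad C (B X) U"
  proof (intro ballI impI, rule ccontr)
    fix X v assume X: "X \<in> \<T>" and v: "v \<in> Mor C (B X) U" "v \<cdot> d X \<in> rad C (A X) U" "v \<notin> rad C (B X) U"
    note o = A_obj[OF X] B_obj[OF X] A_obj[OF X'] B_obj[OF X'] and dm = d_mor[OF X] d_mor[OF X']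
    obtain t where t: "t \<in> Mor C U (B X)" "v \<cdot> t = Ident C U" using section_exists[OF X v(1,3)] by blast
    have tw: "t \<cdot> w \<in> Mor C (A X') (B X)" using comp_mor[OF o(3) U o(2) w(1) t(1)] .
    obtain \<beta> \<alpha> where ba: "\<beta> \<in> Mor C (B X') (B X)" "\<alpha> \<in> Mor C (A X') (A X)"
      "t \<cdot> w = \<beta> \<cdot> d X' \<oplus>\<^bsub>Hom C (A X') (B X)\<^esub> d X \<cdot> \<alpha>" using homotopy[OF X X' tw] by blast
    have "w = (v \<cdot> t) \<cdot> w" unfolding t(2) using Ident_Comp[OF o(3) U w(1)] by simp
    also have "\<dots> = v \<cdot> (t \<cdot> w)" using v(1) t(1) w(1) o U by (simp add: cat_simps)
    also have "\<dots> = (v \<cdot> \<beta>) \<cdot> d X' \<oplus>\<^bsub>Hom C (A X') U\<^esub> (v \<cdot> d X) \<cdot> \<alpha>"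
      unfolding ba(3) using v(1) ba(1,2) o dm U by (simp add: cat_simps)
    also have "\<dots> = (v \<cdot> d X) \<cdot> \<alpha> \<oplus>\<^bsub>Hom C (A X') U\<^esub> (v \<cdot> \<beta>) \<cdot> d X'"
      using v(1) ba(1,2) o dm U by (intro hom_add_comm) (simp_all add: cat_simps)
    finally have "w \<in> bounded_maps X'"
      using rad_comp_right[OF o(3,1) U ba(2) v(2)] comp_mor[OF o(4,2) U ba(1) v(1)] unfolding bounded_maps_def by blast
    thus False using w(2) by blast
  qed
qed

text \<open>
  If \<open>head U (B X) \<rightarrow> head U (A X)\<close> is injective for all \<open>X\<close>, the difference of dimensions is the dimension of the
  cokernel; if it is surjective for all \<open>X\<close>, it is minus the dimension of the kernel.
\<close>

theorem dimension_difference_realised: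
  "\<exists>Q\<in>lfd (full_sub C \<T>).
    (\<forall>X\<in>\<T>. int (vectorspace.dim class_ring (head U (A X))) - int (vectorspace.dim class_ring (head U (B X))) = mdim Q X) \<or>
    (\<forall>X\<in>\<T>. int (vectorspace.dim class_ring (head U (A X))) - int (vectorspace.dim class_ring (head U (B X))) = - mdim Q X)"
  using dichotomy
proof
  assume "\<forall>X\<in>\<T>. \<forall>v\<in>Mor C (B X) U. v \<cdot> d X \<in> rad C (A X) U \<longrightarrow> v \<in> rad C (B X) U"
  hence "\<forall>X\<in>\<T>. int (vectorspace.dim class_ring (head U (A X))) - int (vectorspace.dim class_ring (head U (B X))) = mdim coker_mod X"
    using coker_dim by simp
  moreover have "coker_mod \<in> lfd (full_sub C \<T>)" using coker_is_cmod coker_lfd by (simp add: lfd_def)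
  ultimately show ?thesis by blast
next
  assume "\<forall>X\<in>\<T>. \<forall>w\<in>Mor C (A X) U. w \<in> bounded_maps X"
  hence "\<forall>X\<in>\<T>. int (vectorspace.dim class_ring (head U (A X))) - int (vectorspace.dim class_ring (head U (B X))) = - mdim ker_mod X"
    using ker_dim by simp
  moreover have "ker_mod \<in> lfd (full_sub C \<T>)" using ker_is_cmod ker_lfd by (simp add: lfd_def)
  ultimately show ?thesis by blast
qed

end

section \<open>Index and coindex\<close>

text \<open>A morphism of conflations which is compatible with the extensions. Conflations are tuples
  \<open>(Y, E, X, x, y, \<delta>)\<close>. The resolved object is the third entry of a resolution and the first entry of a
  coresolution, and both cases share the lemmas on sums and composites.\<close>

definition conf_mor ::
  "('k, 'o, 'm, 'e, 'z) extri_scheme \<Rightarrow> 'o \<times> 'o \<times> 'o \<times> 'm \<times> 'm \<times> 'e \<Rightarrow> 'o \<times> 'o \<times> 'o \<times> 'm \<times> 'm \<times> 'e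
    \<Rightarrow> 'm \<Rightarrow> 'm \<Rightarrow> 'm \<Rightarrow> bool" where
  "conf_mor C = (\<lambda>(Y, E, X, x, y, \<delta>) (Y', E', X', x', y', \<delta>') a b c.
     a \<in> Mor C Y Y' \<and> b \<in> Mor C E E' \<and> c \<in> Mor C X X' \<and>
     b \<cdot>\<^bsub>C\<^esub> x = x' \<cdot>\<^bsub>C\<^esub> a \<and> c \<cdot>\<^bsub>C\<^esub> y = y' \<cdot>\<^bsub>C\<^esub> b \<and> push C a \<delta> = pull C c \<delta>')"

context extriangulated_category
begin

lemma conf_mor_ident:
  assumes "realises C Y E X x y \<delta>"
  shows "conf_mor C (Y, E, X, x, y, \<delta>) (Y, E, X, x, y, \<delta>) (Ident C Y) (Ident C E) (Ident C X)"
proof -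
  note r = realisesD[OF assms]
  show ?thesis
    using r push_Ident[OF r(3,1,6)] pull_Ident[OF r(3,1,6)]
    by (simp add: conf_mor_def Ident_closed Comp_Ident Ident_Comp)
qed

context
  fixes Y E X x y \<delta> Y' E' X' x' y' \<delta>'
  assumes conf: "realises C Y E X x y \<delta>" "realises C Y' E' X' x' y' \<delta>'"
begin

private lemmas r = realisesD[OF conf(1)]
private lemmas r' = realisesD[OF conf(2)]

lemma conf_mor_add:
  assumes m: "conf_mor C (Y, E, X, x, y, \<delta>) (Y', E', X', x', y', \<delta>') a b c"
      "conf_mor C (Y, E, X, x, y, \<delta>) (Y', E', X', x', y', \<delta>') a' b' c'"
  shows "conf_mor C (Y, E, X, x, y, \<delta>) (Y', E', X', x', y', \<delta>')
    (a \<oplus>\<^bsub>Hom C Y Y'\<^esub> a') (b \<oplus>\<^bsub>Hom C E E'\<^esub> b') (c \<oplus>\<^bsub>Hom C X X'\<^esub> c')"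
proof -
  have k: "a \<in> Mor C Y Y'" "b \<in> Mor C E E'" "c \<in> Mor C X X'" "b \<cdot> x = x' \<cdot> a" "c \<cdot> y = y' \<cdot> b" "push C a \<delta> = pull C c \<delta>'"
    using m(1) by (auto simp: conf_mor_def)
  have k': "a' \<in> Mor C Y Y'" "b' \<in> Mor C E E'" "c' \<in> Mor C X X'" "b' \<cdot> x = x' \<cdot> a'" "c' \<cdot> y = y' \<cdot> b'" "push C a' \<delta> = pull C c' \<delta>'"
    using m(2) by (auto simp: conf_mor_def)
  have "(b \<oplus>\<^bsub>Hom C E E'\<^esub> b') \<cdot> x = x' \<cdot> (a \<oplus>\<^bsub>Hom C Y Y'\<^esub> a')"
    using lin_maps_add[OF Comp_linear_left[OF r(1,2) r'(2) r(4)] k(2) k'(2)]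
      lin_maps_add[OF Comp_linear_right[OF r(1) r'(1,2,4)] k(1) k'(1)] k(4) k'(4) by simp
  moreover have "(c \<oplus>\<^bsub>Hom C X X'\<^esub> c') \<cdot> y = y' \<cdot> (b \<oplus>\<^bsub>Hom C E E'\<^esub> b')"
    using lin_maps_add[OF Comp_linear_left[OF r(2,3) r'(3) r(5)] k(3) k'(3)]
      lin_maps_add[OF Comp_linear_right[OF r(2) r'(2,3,5)] k(2) k'(2)] k(5) k'(5) by simp
  moreover have "push C (a \<oplus>\<^bsub>Hom C Y Y'\<^esub> a') \<delta> = pull C (c \<oplus>\<^bsub>Hom C X X'\<^esub> c') \<delta>'"
    using lin_maps_add[OF push_linear_mor[OF r(3,1) r'(1) r(6)] k(1) k'(1)]
      lin_maps_add[OF pull_linear_mor[OF r'(3) r(3) r'(1,6)] k(3) k'(3)] k(6) k'(6) by simp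
  ultimately show ?thesis
    using k(1-3) k'(1-3) vs_add_closed[OF Hom_vectorspace] r r' by (simp add: conf_mor_def)
qed

lemma conf_mor_smult:
  assumes m: "conf_mor C (Y, E, X, x, y, \<delta>) (Y', E', X', x', y', \<delta>') a b c"
  shows "conf_mor C (Y, E, X, x, y, \<delta>) (Y', E', X', x', y', \<delta>')
    (s \<odot>\<^bsub>Hom C Y Y'\<^esub> a) (s \<odot>\<^bsub>Hom C E E'\<^esub> b) (s \<odot>\<^bsub>Hom C X X'\<^esub> c)"
proof -
  have k: "a \<in> Mor C Y Y'" "b \<in> Mor C E E'" "c \<in> Mor C X X'" "b \<cdot> x = x' \<cdot> a" "c \<cdot> y = y' \<cdot> b" "push C a \<delta> = pull C c \<delta>'"
    using m by (auto simp: conf_mor_def)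
  have "(s \<odot>\<^bsub>Hom C E E'\<^esub> b) \<cdot> x = x' \<cdot> (s \<odot>\<^bsub>Hom C Y Y'\<^esub> a)"
    using lin_maps_smult[OF Comp_linear_left[OF r(1,2) r'(2) r(4)] k(2)]
      lin_maps_smult[OF Comp_linear_right[OF r(1) r'(1,2,4)] k(1)] k(4) by simp
  moreover have "(s \<odot>\<^bsub>Hom C X X'\<^esub> c) \<cdot> y = y' \<cdot> (s \<odot>\<^bsub>Hom C E E'\<^esub> b)"
    using lin_maps_smult[OF Comp_linear_left[OF r(2,3) r'(3) r(5)] k(3)]
      lin_maps_smult[OF Comp_linear_right[OF r(2) r'(2,3,5)] k(2)] k(5) by simp
  moreover have "push C (s \<odot>\<^bsub>Hom C Y Y'\<^esub> a) \<delta> = pull C (s \<odot>\<^bsub>Hom C X X'\<^esub> c) \<delta>'"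
    using lin_maps_smult[OF push_linear_mor[OF r(3,1) r'(1) r(6)] k(1)]
      lin_maps_smult[OF pull_linear_mor[OF r'(3) r(3) r'(1,6)] k(3)] k(6) by simp
  ultimately show ?thesis
    using k(1-3) vs_smult_closed[OF Hom_vectorspace] r r' by (simp add: conf_mor_def)
qed

lemma conf_mor_comp:
  assumes conf'': "realises C Y'' E'' X'' x'' y'' \<delta>''"
    and m: "conf_mor C (Y, E, X, x, y, \<delta>) (Y', E', X', x', y', \<delta>') a b c"
      "conf_mor C (Y', E', X', x', y', \<delta>') (Y'', E'', X'', x'', y'', \<delta>'') a' b' c'"
  shows "conf_mor C (Y, E, X, x, y, \<delta>) (Y'', E'', X'', x'', y'', \<delta>'') (a' \<cdot> a) (b' \<cdot> b) (c' \<cdot> c)"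
proof -
  note r'' = realisesD[OF conf'']
  have k: "a \<in> Mor C Y Y'" "b \<in> Mor C E E'" "c \<in> Mor C X X'" "b \<cdot> x = x' \<cdot> a" "c \<cdot> y = y' \<cdot> b" "push C a \<delta> = pull C c \<delta>'"
    using m(1) by (auto simp: conf_mor_def)
  have k': "a' \<in> Mor C Y' Y''" "b' \<in> Mor C E' E''" "c' \<in> Mor C X' X''" "b' \<cdot> x' = x'' \<cdot> a'" "c' \<cdot> y' = y'' \<cdot> b'"
    "push C a' \<delta>' = pull C c' \<delta>''"
    using m(2) by (auto simp: conf_mor_def)
  have "(b' \<cdot> b) \<cdot> x = b' \<cdot> (b \<cdot> x)" using Comp_assoc[OF r(1,2) r'(2) r''(2) r(4) k(2) k'(2)] .
  also have "\<dots> = (b' \<cdot> x') \<cdot> a" unfolding k(4) using Comp_assoc[OF r(1) r'(1,2) r''(2) k(1) r'(4) k'(2)] by simp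
  also have "\<dots> = x'' \<cdot> (a' \<cdot> a)" unfolding k'(4) using Comp_assoc[OF r(1) r'(1) r''(1,2) k(1) k'(1) r''(4)] .
  finally have 1: "(b' \<cdot> b) \<cdot> x = x'' \<cdot> (a' \<cdot> a)" .
  have "(c' \<cdot> c) \<cdot> y = c' \<cdot> (c \<cdot> y)" using Comp_assoc[OF r(2,3) r'(3) r''(3) r(5) k(3) k'(3)] .
  also have "\<dots> = (c' \<cdot> y') \<cdot> b" unfolding k(5) using Comp_assoc[OF r(2) r'(2,3) r''(3) k(2) r'(5) k'(3)] by simp
  also have "\<dots> = y'' \<cdot> (b' \<cdot> b)" unfolding k'(5) using Comp_assoc[OF r(2) r'(2) r''(2,3) k(2) k'(2) r''(5)] .
  finally have 2: "(c' \<cdot> c) \<cdot> y = y'' \<cdot> (b' \<cdot> b)" .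
  have "push C (a' \<cdot> a) \<delta> = push C a' (pull C c \<delta>')"
    using push_Comp[OF r(3,1) r'(1) r''(1) k(1) k'(1) r(6)] k(6) by simp
  also have "\<dots> = pull C c (push C a' \<delta>')" using pull_push[OF r'(3) r(3) r'(1) r''(1) k(3) k'(1) r'(6)] by simp
  also have "\<dots> = pull C (c' \<cdot> c) \<delta>''"
    unfolding k'(6) using pull_Comp[OF r''(3) r'(3) r(3) r''(1) k'(3) k(3) r''(6)] by simp
  finally have 3: "push C (a' \<cdot> a) \<delta> = pull C (c' \<cdot> c) \<delta>''" .
  show ?thesis
    using 1 2 3 comp_mor[OF r(1) r'(1) r''(1) k(1) k'(1)] comp_mor[OF r(2) r'(2) r''(2) k(2) k'(2)]
      comp_mor[OF r(3) r'(3) r''(3) k(3) k'(3)] by (simp add: conf_mor_def)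
qed

end

lemma extend_inflation_diff:
  assumes conf: "realises C Y E X x y \<delta>" and W: "W \<in> Obj C"
    and g: "g \<in> Mor C Y W" "g' \<in> Mor C Y W" "push C g \<delta> = push C g' \<delta>"
  shows "\<exists>k\<in>Mor C E W. g = g' \<oplus>\<^bsub>Hom C Y W\<^esub> k \<cdot> x"
proof -
  note r = realisesD[OF conf]
  interpret A: abelian_group "Ext C X W" using ext_abelian_group[OF r(3) W] .
  note lin = push_linear_mor[OF r(3,1) W r(6)]
  note gg = hom_minus_closed[OF r(1) W g(1,2)]
  have "push C (g \<ominus>\<^bsub>Hom C Y W\<^esub> g') \<delta> \<oplus>\<^bsub>Ext C X W\<^esub> push C g' \<delta> = push C g' \<delta>"
    using lin_maps_add[OF lin gg g(2)] hom_minus_iff[OF r(1) W g(1,2) gg] g(3) by simp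
  hence "push C (g \<ominus>\<^bsub>Hom C Y W\<^esub> g') \<delta> = \<zero>\<^bsub>Ext C X W\<^esub>"
    using lin_maps_closed[OF lin gg] lin_maps_closed[OF lin g(2)] by simp
  then obtain k where k: "k \<in> Mor C E W" "g \<ominus>\<^bsub>Hom C Y W\<^esub> g' = k \<cdot> x" using extend_inflation[OF conf W gg] by blast
  have kx: "k \<cdot> x \<in> Mor C Y W" using comp_mor[OF r(1,2) W r(4) k(1)] .
  hence "k \<cdot> x \<oplus>\<^bsub>Hom C Y W\<^esub> g' = g" using hom_minus_iff[OF r(1) W g(1,2)] k(2) by blast
  thus ?thesis using hom_add_comm[OF r(1) W kx g(2)] k(1) by auto
qed

lemma lift_deflation_diff:
  assumes conf: "realises C Y E X x y \<delta>" and W: "W \<in> Obj C"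
    and g: "g \<in> Mor C W X" "g' \<in> Mor C W X" "pull C g \<delta> = pull C g' \<delta>"
  shows "\<exists>k\<in>Mor C W E. g = g' \<oplus>\<^bsub>Hom C W X\<^esub> y \<cdot> k"
proof -
  note r = realisesD[OF conf]
  interpret A: abelian_group "Ext C W Y" using ext_abelian_group[OF W r(1)] .
  note lin = pull_linear_mor[OF r(3) W r(1,6)]
  note gg = hom_minus_closed[OF W r(3) g(1,2)]
  have "pull C (g \<ominus>\<^bsub>Hom C W X\<^esub> g') \<delta> \<oplus>\<^bsub>Ext C W Y\<^esub> pull C g' \<delta> = pull C g' \<delta>"
    using lin_maps_add[OF lin gg g(2)] hom_minus_iff[OF W r(3) g(1,2) gg] g(3) by simp
  hence "pull C (g \<ominus>\<^bsub>Hom C W X\<^esub> g') \<delta> = \<zero>\<^bsub>Ext C W Y\<^esub>"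
    using lin_maps_closed[OF lin gg] lin_maps_closed[OF lin g(2)] by simp
  then obtain k where k: "k \<in> Mor C W E" "g \<ominus>\<^bsub>Hom C W X\<^esub> g' = y \<cdot> k" using lift_deflation[OF conf W gg] by blast
  have yk: "y \<cdot> k \<in> Mor C W X" using comp_mor[OF W r(2,3) k(1) r(5)] .
  hence "y \<cdot> k \<oplus>\<^bsub>Hom C W X\<^esub> g' = g" using hom_minus_iff[OF W r(3) g(1,2)] k(2) by blast
  thus ?thesis using hom_add_comm[OF W r(3) yk g(2)] k(1) by auto
qed

end

lemma rad_full_sub: "rad (full_sub C \<T>) X Y = rad C X Y"
  by (simp add: rad_def iso_mor_def)

lemma is_direct_sum_full_sub:
  assumes "\<T> \<subseteq> Obj C"
  shows "is_direct_sum (full_sub C \<T>) X Y Z \<longleftrightarrow> is_direct_sum C X Y Z \<and> X \<in> \<T> \<and> Y \<in> \<T> \<and> Z \<in> \<T>"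
  using assms by (auto simp: is_direct_sum_def biproduct_def)

context cluster_tilting_subcategory
begin

lemma tilting_subset: "\<T> \<subseteq> Obj C"
  using tilting_obj by blast

abbreviation "\<K> \<equiv> K0 (full_sub C \<T>)"
abbreviation "cls \<equiv> K0_class (full_sub C \<T>)"

lemma full_sub_linear: "linear_category (full_sub C \<T>)"
  using linear_category_full_sub[OF tilting_subset] .

lemma cls_closed: "X \<in> \<T> \<Longrightarrow> cls X \<in> carrier \<K>"
  using linear_category.K0_class_closed[OF full_sub_linear, of X] by simp

lemma cls_sum: "is_direct_sum C X Y Z \<Longrightarrow> X \<in> \<T> \<Longrightarrow> Y \<in> \<T> \<Longrightarrow> cls Z = cls X \<otimes>\<^bsub>\<K>\<^esub> cls Y"
  using linear_category.K0_class_sum[OF full_sub_linear, of X Y Z] is_direct_sum_full_sub[OF tilting_subset, of X Y Z]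
    tilting_direct_sum by blast

lemma \<K>_comm: "comm_group \<K>"
  using linear_category.K0_comm[OF full_sub_linear] .

text \<open>In an abelian group, \<open>r - k = r' - k'\<close> follows from \<open>k + r' = k' + r\<close>.\<close>

lemma cls_diff_eq:
  assumes "K \<in> \<T>" "R \<in> \<T>" "K' \<in> \<T>" "R' \<in> \<T>" and ds: "is_direct_sum C K R' M" "is_direct_sum C K' R M"
  shows "cls R \<otimes>\<^bsub>\<K>\<^esub> inv\<^bsub>\<K>\<^esub> cls K = cls R' \<otimes>\<^bsub>\<K>\<^esub> inv\<^bsub>\<K>\<^esub> cls K'"
proof -
  interpret G: comm_group \<K> by (rule \<K>_comm)
  note c = cls_closed[OF assms(1)] cls_closed[OF assms(2)] cls_closed[OF assms(3)] cls_closed[OF assms(4)]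
  have e: "cls K \<otimes>\<^bsub>\<K>\<^esub> cls R' = cls K' \<otimes>\<^bsub>\<K>\<^esub> cls R"
    using cls_sum[OF ds(1) assms(1,4)] cls_sum[OF ds(2) assms(3,2)] by simp
  have "cls R = inv\<^bsub>\<K>\<^esub> cls K' \<otimes>\<^bsub>\<K>\<^esub> (cls K \<otimes>\<^bsub>\<K>\<^esub> cls R')"
    unfolding e using c by (simp add: G.m_assoc[symmetric])
  hence "cls R \<otimes>\<^bsub>\<K>\<^esub> inv\<^bsub>\<K>\<^esub> cls K = (inv\<^bsub>\<K>\<^esub> cls K' \<otimes>\<^bsub>\<K>\<^esub> (cls R' \<otimes>\<^bsub>\<K>\<^esub> cls K)) \<otimes>\<^bsub>\<K>\<^esub> inv\<^bsub>\<K>\<^esub> cls K"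
    using c G.m_comm by simp
  also have "\<dots> = inv\<^bsub>\<K>\<^esub> cls K' \<otimes>\<^bsub>\<K>\<^esub> (cls R' \<otimes>\<^bsub>\<K>\<^esub> (cls K \<otimes>\<^bsub>\<K>\<^esub> inv\<^bsub>\<K>\<^esub> cls K))"
    using c by (simp only: G.m_assoc G.m_closed G.inv_closed)
  also have "\<dots> = cls R' \<otimes>\<^bsub>\<K>\<^esub> inv\<^bsub>\<K>\<^esub> cls K'"
    using c G.m_comm by simp
  finally show ?thesis .
qed

lemma cls_diff_sum:
  assumes "K \<in> \<T>" "R \<in> \<T>" "K' \<in> \<T>" "R' \<in> \<T>" and ds: "is_direct_sum C K K' K2" "is_direct_sum C R R' R2"
  shows "cls R2 \<otimes>\<^bsub>\<K>\<^esub> inv\<^bsub>\<K>\<^esub> cls K2 = (cls R \<otimes>\<^bsub>\<K>\<^esub> inv\<^bsub>\<K>\<^esub> cls K) \<otimes>\<^bsub>\<K>\<^esub> (cls R' \<otimes>\<^bsub>\<K>\<^esub> inv\<^bsub>\<K>\<^esub> cls K')"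
proof -
  interpret G: comm_group \<K> by (rule \<K>_comm)
  note c = cls_closed[OF assms(1)] cls_closed[OF assms(2)] cls_closed[OF assms(3)] cls_closed[OF assms(4)]
  show ?thesis
    unfolding cls_sum[OF ds(1) assms(1,3)] cls_sum[OF ds(2) assms(2,4)]
    using c by (simp add: G.inv_mult G.m_ac)
qed

lemma index_eq:
  assumes r: "realises C K R X f h \<delta>" and KR: "K \<in> \<T>" "R \<in> \<T>"
  shows "index C \<T> X = cls R \<otimes>\<^bsub>\<K>\<^esub> inv\<^bsub>\<K>\<^esub> cls K"
  unfolding index_def
proof (rule the_equality)
  show "\<exists>K'\<in>\<T>. \<exists>R'\<in>\<T>. \<exists>x y. conflation C K' R' X x y \<and>
    cls R \<otimes>\<^bsub>\<K>\<^esub> inv\<^bsub>\<K>\<^esub> cls K = cls R' \<otimes>\<^bsub>\<K>\<^esub> inv\<^bsub>\<K>\<^esub> cls K'"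
    using r KR unfolding conflation_def by blast
next
  fix v assume "\<exists>K\<in>\<T>. \<exists>R\<in>\<T>. \<exists>x y. conflation C K R X x y \<and> v = cls R \<otimes>\<^bsub>\<K>\<^esub> inv\<^bsub>\<K>\<^esub> cls K"
  then obtain K' R' x y \<delta>' where *: "K' \<in> \<T>" "R' \<in> \<T>" "realises C K' R' X x y \<delta>'" "v = cls R' \<otimes>\<^bsub>\<K>\<^esub> inv\<^bsub>\<K>\<^esub> cls K'"
    unfolding conflation_def by blast
  obtain M where "is_direct_sum C K R' M" "is_direct_sum C K' R M"
    using schanuel[OF r *(3)] tilting_rigid KR * by blast
  from cls_diff_eq[OF KR *(1,2) this] show "v = cls R \<otimes>\<^bsub>\<K>\<^esub> inv\<^bsub>\<K>\<^esub> cls K" using *(4) by simp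
qed

lemma coindex_eq:
  assumes r: "realises C X L N x y \<delta>" and LN: "L \<in> \<T>" "N \<in> \<T>"
  shows "coindex C \<T> X = cls L \<otimes>\<^bsub>\<K>\<^esub> inv\<^bsub>\<K>\<^esub> cls N"
  unfolding coindex_def
proof (rule the_equality)
  show "\<exists>L'\<in>\<T>. \<exists>N'\<in>\<T>. \<exists>x y. conflation C X L' N' x y \<and>
    cls L \<otimes>\<^bsub>\<K>\<^esub> inv\<^bsub>\<K>\<^esub> cls N = cls L' \<otimes>\<^bsub>\<K>\<^esub> inv\<^bsub>\<K>\<^esub> cls N'"
    unfolding conflation_def using r LN by blast
next
  fix v assume "\<exists>L\<in>\<T>. \<exists>N\<in>\<T>. \<exists>x y. conflation C X L N x y \<and> v = cls L \<otimes>\<^bsub>\<K>\<^esub> inv\<^bsub>\<K>\<^esub> cls N"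
  then obtain L' N' x' y' \<delta>' where *: "L' \<in> \<T>" "N' \<in> \<T>" "realises C X L' N' x' y' \<delta>'" "v = cls L' \<otimes>\<^bsub>\<K>\<^esub> inv\<^bsub>\<K>\<^esub> cls N'"
    unfolding conflation_def by blast
  obtain M where "is_direct_sum C N' L M" "is_direct_sum C N L' M"
    using schanuel_op[OF r *(3)] tilting_rigid LN * by blast
  from cls_diff_eq[OF *(2,1) LN(2,1) this] show "v = cls L \<otimes>\<^bsub>\<K>\<^esub> inv\<^bsub>\<K>\<^esub> cls N" using *(4) by simp
qed

lemma index_closed:
  assumes "X \<in> Obj C" shows "index C \<T> X \<in> carrier \<K>"
proof -
  interpret G: comm_group \<K> by (rule \<K>_comm)
  obtain K R f h \<delta> where *: "K \<in> \<T>" "R \<in> \<T>" "realises C K R X f h \<delta>" using tilting_resolution[OF assms] by blast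
  show ?thesis unfolding index_eq[OF *(3,1,2)] using cls_closed * by simp
qed

lemma coindex_closed:
  assumes "X \<in> Obj C" shows "coindex C \<T> X \<in> carrier \<K>"
proof -
  interpret G: comm_group \<K> by (rule \<K>_comm)
  obtain L N f h \<delta> where *: "L \<in> \<T>" "N \<in> \<T>" "realises C X L N f h \<delta>" using tilting_coresolution[OF assms] by blast
  show ?thesis unfolding coindex_eq[OF *(3,1,2)] using cls_closed * by simp
qed

lemma index_sum:
  assumes ds: "is_direct_sum C X Y Z"
  shows "index C \<T> Z = index C \<T> X \<otimes>\<^bsub>\<K>\<^esub> index C \<T> Y"
proof -
  have o: "X \<in> Obj C" "Y \<in> Obj C" using ds by (auto simp: is_direct_sum_def biproduct_def)
  obtain K R f h \<delta> where a: "K \<in> \<T>" "R \<in> \<T>" "realises C K R X f h \<delta>" using tilting_resolution[OF o(1)] by blast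
  obtain K' R' f' h' \<delta>' where b: "K' \<in> \<T>" "R' \<in> \<T>" "realises C K' R' Y f' h' \<delta>'" using tilting_resolution[OF o(2)] by blast
  obtain K2 R2 where d: "is_direct_sum C K K' K2" "is_direct_sum C R R' R2"
    using direct_sum_exists tilting_obj a(1,2) b(1,2) by meson
  obtain x y \<epsilon> where "realises C K2 R2 Z x y \<epsilon>"
    using conflation_direct_sum[OF _ _ d ds] a(3) b(3) unfolding conflation_def by blast
  from index_eq[OF this tilting_direct_sum[OF d(1) a(1) b(1)] tilting_direct_sum[OF d(2) a(2) b(2)]]
  show ?thesis unfolding index_eq[OF a(3,1,2)] index_eq[OF b(3,1,2)] using cls_diff_sum[OF a(1,2) b(1,2) d] by simp
qed

lemma coindex_sum:
  assumes ds: "is_direct_sum C X Y Z"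
  shows "coindex C \<T> Z = coindex C \<T> X \<otimes>\<^bsub>\<K>\<^esub> coindex C \<T> Y"
proof -
  have o: "X \<in> Obj C" "Y \<in> Obj C" using ds by (auto simp: is_direct_sum_def biproduct_def)
  obtain L N f h \<delta> where a: "L \<in> \<T>" "N \<in> \<T>" "realises C X L N f h \<delta>" using tilting_coresolution[OF o(1)] by blast
  obtain L' N' f' h' \<delta>' where b: "L' \<in> \<T>" "N' \<in> \<T>" "realises C Y L' N' f' h' \<delta>'" using tilting_coresolution[OF o(2)] by blast
  obtain L2 N2 where d: "is_direct_sum C L L' L2" "is_direct_sum C N N' N2"
    using direct_sum_exists tilting_obj a(1,2) b(1,2) by meson
  obtain x y \<epsilon> where "realises C Z L2 N2 x y \<epsilon>"
    using conflation_direct_sum[OF _ _ ds d] a(3) b(3) unfolding conflation_def by blast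
  from coindex_eq[OF this tilting_direct_sum[OF d(1) a(1) b(1)] tilting_direct_sum[OF d(2) a(2) b(2)]]
  show ?thesis unfolding coindex_eq[OF a(3,1,2)] coindex_eq[OF b(3,1,2)] using cls_diff_sum[OF a(2,1) b(2,1) d(2,1)] by simp
qed

end

locale tilting_pair = \<T>: cluster_tilting_subcategory C \<T> + \<U>: cluster_tilting_subcategory C \<U>
  for C :: "('k::field, 'o, 'm, 'e, 'z) extri_scheme" (structure) and \<T> \<U>
begin

lemma index_map_class:
  assumes T: "T \<in> \<T>"
  shows "index_map C \<T> \<U> (K0_class (full_sub C \<T>) T) = index C \<U> T"
proof -
  let ?A = "full_sub C \<T>"
  have "(THE f. f \<in> hom (groth_group (Obj ?A) (split_sequences ?A)) \<U>.\<K> \<inter> extensional (carrier (groth_group (Obj ?A) (split_sequences ?A))) \<and>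
    (\<forall>X\<in>Obj ?A. f (groth_class (Obj ?A) (split_sequences ?A) X) = index C \<U> X)) (groth_class (Obj ?A) (split_sequences ?A) T)
    = index C \<U> T"
  proof (rule groth_universal[OF linear_category.split_sequences_closed[OF \<T>.full_sub_linear] \<U>.\<K>_comm])
    show "index C \<U> X \<in> carrier \<U>.\<K>" if "X \<in> Obj ?A" for X using \<U>.index_closed \<T>.tilting_obj that by simp
    show "index C \<U> Z = index C \<U> X \<otimes>\<^bsub>\<U>.\<K>\<^esub> index C \<U> Y" if "(X, Z, Y) \<in> split_sequences ?A" for X Z Y
      using that \<U>.index_sum is_direct_sum_full_sub[OF \<T>.tilting_subset] by (auto simp: split_sequences_def)
  qed (use T in simp_all)
  thus ?thesis unfolding index_map_def by (simp add: K0_def K0_class_def)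
qed

lemma coindex_map_class:
  assumes T: "T \<in> \<T>"
  shows "coindex_map C \<T> \<U> (K0_class (full_sub C \<T>) T) = coindex C \<U> T"
proof -
  let ?A = "full_sub C \<T>"
  have "(THE f. f \<in> hom (groth_group (Obj ?A) (split_sequences ?A)) \<U>.\<K> \<inter> extensional (carrier (groth_group (Obj ?A) (split_sequences ?A))) \<and>
    (\<forall>X\<in>Obj ?A. f (groth_class (Obj ?A) (split_sequences ?A) X) = coindex C \<U> X)) (groth_class (Obj ?A) (split_sequences ?A) T)
    = coindex C \<U> T"
  proof (rule groth_universal[OF linear_category.split_sequences_closed[OF \<T>.full_sub_linear] \<U>.\<K>_comm])
    show "coindex C \<U> X \<in> carrier \<U>.\<K>" if "X \<in> Obj ?A" for X using \<U>.coindex_closed \<T>.tilting_obj that by simp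
    show "coindex C \<U> Z = coindex C \<U> X \<otimes>\<^bsub>\<U>.\<K>\<^esub> coindex C \<U> Y" if "(X, Z, Y) \<in> split_sequences ?A" for X Z Y
      using that \<U>.coindex_sum is_direct_sum_full_sub[OF \<T>.tilting_subset] by (auto simp: split_sequences_def)
  qed (use T in simp_all)
  thus ?thesis unfolding coindex_map_def by (simp add: K0_def K0_class_def)
qed

end

section \<open>Sign-coherence at a summand with local endomorphism ring\<close>

text \<open>Locality of the endomorphism ring of \<open>U\<close> enters only through \<open>retraction\<close>: a morphism to \<open>U\<close>
  outside the radical is a split epimorphism.\<close>

locale tilting_pair_summand = tilting_pair C \<T> \<U>
  for C :: "('k::field, 'o, 'm, 'e, 'z) extri_scheme" (structure) and \<T> \<U> +
  fixes U :: 'o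
  assumes U_mem: "U \<in> \<U>"
    and retraction: "\<lbrakk>V \<in> \<U>; v \<in> Mor C V U; v \<notin> rad C V U\<rbrakk> \<Longrightarrow> \<exists>t\<in>Mor C U V. v \<cdot> t = Ident C U"
    and fin_dim: "V \<in> \<U> \<Longrightarrow> vectorspace.fin_dim class_ring (\<T>.head U V)"
begin

lemma U_obj: "U \<in> Obj C"
  using U_mem \<U>.tilting_obj by blast

abbreviation "\<D> V \<equiv> int (vectorspace.dim class_ring (\<T>.head U V))"

lemma resolution_exists: "\<exists>K R f h \<delta>. \<forall>X\<in>\<T>. K X \<in> \<U> \<and> R X \<in> \<U> \<and> realises C (K X) (R X) X (f X) (h X) (\<delta> X)"
proof -
  have "\<forall>X. \<exists>K R f h \<delta>. X \<in> \<T> \<longrightarrow> K \<in> \<U> \<and> R \<in> \<U> \<and> realises C K R X f h \<delta>"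
    using \<U>.tilting_resolution \<T>.tilting_obj by blast
  thus ?thesis by metis
qed

lemma coresolution_exists: "\<exists>L N x y \<delta>. \<forall>X\<in>\<T>. L X \<in> \<U> \<and> N X \<in> \<U> \<and> realises C X (L X) (N X) (x X) (y X) (\<delta> X)"
proof -
  have "\<forall>X. \<exists>L N x y \<delta>. X \<in> \<T> \<longrightarrow> L \<in> \<U> \<and> N \<in> \<U> \<and> realises C X L N x y \<delta>"
    using \<U>.tilting_coresolution \<T>.tilting_obj by blast
  thus ?thesis by metis
qed

lemma ext_TT: "X \<in> \<T> \<Longrightarrow> Y \<in> \<T> \<Longrightarrow> \<epsilon> \<in> carrier (Ext C X Y) \<Longrightarrow> \<epsilon> = \<zero>\<^bsub>Ext C X Y\<^esub>"
  using \<T>.tilting_rigid unfolding ext_zero_def by blast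

lemma ext_UU: "X \<in> \<U> \<Longrightarrow> Y \<in> \<U> \<Longrightarrow> \<epsilon> \<in> carrier (Ext C X Y) \<Longrightarrow> \<epsilon> = \<zero>\<^bsub>Ext C X Y\<^esub>"
  using \<U>.tilting_rigid unfolding ext_zero_def by blast

text \<open>A map \<open>X \<rightarrow> Y\<close> in \<open>\<T>\<close> lifts to the resolutions because \<open>\<U>\<close> is rigid. For the assumption on degree one maps,
  \<open>h g : K X' \<rightarrow> X\<close> extends to \<open>R X'\<close>, because \<open>\<T>\<close> is rigid, and the extension lifts along \<open>h\<close>, because \<open>\<U>\<close> is.\<close>

lemma resolution_family:
  assumes R: "\<forall>X\<in>\<T>. K X \<in> \<U> \<and> R X \<in> \<U> \<and> realises C (K X) (R X) X (f X) (h X) (\<delta> X)"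
  shows "two_term_family C \<T> K R f
    (\<lambda>X Y a \<kappa> \<rho>. conf_mor C (K X, R X, X, f X, h X, \<delta> X) (K Y, R Y, Y, f Y, h Y, \<delta> Y) \<kappa> \<rho> a) U"
proof -
  have K: "X \<in> \<T> \<Longrightarrow> K X \<in> \<U>" and RU: "X \<in> \<T> \<Longrightarrow> R X \<in> \<U>"
    and r: "X \<in> \<T> \<Longrightarrow> realises C (K X) (R X) X (f X) (h X) (\<delta> X)" for X using R by auto
  note d = \<T>.realisesD[OF r]
  show ?thesis
  proof (unfold_locales, goal_cases)
    case 1 show ?case by (rule U_obj)
  next
    case (2 X) thus ?case using d(3) by blast
  next
    case (3 X) thus ?case using d(1) by blast
  next
    case (4 X) thus ?case using d(2) by blast
  next
    case (5 X) thus ?case using d(4) by blast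
  next
    case (6 X Y a)
    note dX = d[OF 6(1)] and dY = d[OF 6(2)]
    have ah: "a \<cdot> h X \<in> Mor C (R X) Y" using \<T>.comp_mor[OF dX(2,3) dY(3) dX(5) 6(3)] .
    have "pull C (a \<cdot> h X) (\<delta> Y) = \<zero>\<^bsub>Ext C (R X) (K Y)\<^esub>"
      using ext_UU[OF RU[OF 6(1)] K[OF 6(2)] \<T>.pull_closed[OF dY(3) dX(2) dY(1) ah dY(6)]] .
    then obtain \<rho> where \<rho>: "\<rho> \<in> Mor C (R X) (R Y)" "a \<cdot> h X = h Y \<cdot> \<rho>"
      using \<T>.lift_deflation[OF r[OF 6(2)] dX(2) ah] by blast
    obtain \<kappa> where \<kappa>: "\<kappa> \<in> Mor C (K X) (K Y)" "\<rho> \<cdot> f X = f Y \<cdot> \<kappa>" "push C \<kappa> (\<delta> X) = pull C a (\<delta> Y)"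
      using \<T>.ET3_op[OF r[OF 6(1)] r[OF 6(2)] \<rho>(1) 6(3) \<rho>(2)] by blast
    show ?case using \<rho> \<kappa> 6(3) by (auto simp: conf_mor_def)
  next
    case (7 X Y a \<kappa> \<rho>) thus ?case by (simp add: conf_mor_def)
  next
    case (8 X) show ?case by (rule \<T>.conf_mor_ident[OF r[OF 8]])
  next
    case (9 X Y a b \<kappa> \<rho> \<kappa>' \<rho>') show ?case by (rule \<T>.conf_mor_add[OF r[OF 9(1)] r[OF 9(2)] 9(5,6)])
  next
    case (10 X Y a \<kappa> \<rho> c) show ?case by (rule \<T>.conf_mor_smult[OF r[OF 10(1)] r[OF 10(2)] 10(4)])
  next
    case (11 X Y Z a b \<kappa> \<rho> \<kappa>' \<rho>')
    show ?case by (rule \<T>.conf_mor_comp[OF r[OF 11(1)] r[OF 11(2)] r[OF 11(3)] 11(6,7)])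
  next
    case (12 X Y a \<kappa> \<rho> \<kappa>' \<rho>')
    note dX = d[OF 12(1)] and dY = d[OF 12(2)]
    have "push C \<kappa> (\<delta> X) = push C \<kappa>' (\<delta> X)" "h Y \<cdot> \<rho> = h Y \<cdot> \<rho>'" using 12(4,5) by (auto simp: conf_mor_def)
    thus ?case
      using \<T>.extend_inflation_diff[OF r[OF 12(1)] dY(1), of \<kappa> \<kappa>'] \<T>.factor_inflation_diff[OF r[OF 12(2)] dX(2), of \<rho> \<rho>'] 12(4,5)
      by (simp add: conf_mor_def)
  next
    case (13 X X' g)
    note dX = d[OF 13(1)] and dX' = d[OF 13(2)]
    have hg: "h X \<cdot> g \<in> Mor C (K X') X" using \<T>.comp_mor[OF dX'(1) dX(2,3) 13(3) dX(5)] .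
    have "push C (h X \<cdot> g) (\<delta> X') = \<zero>\<^bsub>Ext C X' X\<^esub>"
      using ext_TT[OF 13(2,1) \<T>.push_closed[OF dX'(3,1) dX(3) hg dX'(6)]] .
    then obtain b where b: "b \<in> Mor C (R X') X" "h X \<cdot> g = b \<cdot> f X'"
      using \<T>.extend_inflation[OF r[OF 13(2)] dX(3) hg] by blast
    have "pull C b (\<delta> X) = \<zero>\<^bsub>Ext C (R X') (K X)\<^esub>"
      using ext_UU[OF RU[OF 13(2)] K[OF 13(1)] \<T>.pull_closed[OF dX(3) dX'(2) dX(1) b(1) dX(6)]] .
    then obtain \<beta> where \<beta>: "\<beta> \<in> Mor C (R X') (R X)" "b = h X \<cdot> \<beta>"
      using \<T>.lift_deflation[OF r[OF 13(1)] dX'(2) b(1)] by blast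
    have "h X \<cdot> g = h X \<cdot> (\<beta> \<cdot> f X')"
      unfolding b(2) \<beta>(2) using \<T>.Comp_assoc[OF dX'(1,2) dX(2,3) dX'(4) \<beta>(1) dX(5)] .
    from \<T>.factor_inflation_diff[OF r[OF 13(1)] dX'(1) 13(3) \<T>.comp_mor[OF dX'(1,2) dX(2) dX'(4) \<beta>(1)] this]
    show ?case using \<beta>(1) by blast
  next
    case (14 X v) thus ?case using retraction RU by blast
  next
    case (15 X) thus ?case using fin_dim K RU by blast
  qed
qed

text \<open>Dually, \<open>g x : X' \<rightarrow> N X\<close> lifts to \<open>L X\<close>, because \<open>\<T>\<close> is rigid, and the lift extends to \<open>L X'\<close>, because
  \<open>\<U>\<close> is.\<close>

lemma coresolution_family:
  assumes R: "\<forall>X\<in>\<T>. L X \<in> \<U> \<and> N X \<in> \<U> \<and> realises C X (L X) (N X) (x X) (y X) (\<delta> X)"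
  shows "two_term_family C \<T> L N y
    (\<lambda>X Y a \<kappa> \<rho>. conf_mor C (X, L X, N X, x X, y X, \<delta> X) (Y, L Y, N Y, x Y, y Y, \<delta> Y) a \<kappa> \<rho>) U"
proof -
  have L: "X \<in> \<T> \<Longrightarrow> L X \<in> \<U>" and N: "X \<in> \<T> \<Longrightarrow> N X \<in> \<U>"
    and r: "X \<in> \<T> \<Longrightarrow> realises C X (L X) (N X) (x X) (y X) (\<delta> X)" for X using R by auto
  note d = \<T>.realisesD[OF r]
  show ?thesis
  proof (unfold_locales, goal_cases)
    case 1 show ?case by (rule U_obj)
  next
    case (2 X) thus ?case using d(1) by blast
  next
    case (3 X) thus ?case using d(2) by blast
  next
    case (4 X) thus ?case using d(3) by blast
  next
    case (5 X) thus ?case using d(5) by blast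
  next
    case (6 X Y a)
    note dX = d[OF 6(1)] and dY = d[OF 6(2)]
    have xa: "x Y \<cdot> a \<in> Mor C X (L Y)" using \<T>.comp_mor[OF dX(1) dY(1,2) 6(3) dY(4)] .
    have "push C (x Y \<cdot> a) (\<delta> X) = \<zero>\<^bsub>Ext C (N X) (L Y)\<^esub>"
      using ext_UU[OF N[OF 6(1)] L[OF 6(2)] \<T>.push_closed[OF dX(3,1) dY(2) xa dX(6)]] .
    then obtain \<kappa> where \<kappa>: "\<kappa> \<in> Mor C (L X) (L Y)" "x Y \<cdot> a = \<kappa> \<cdot> x X"
      using \<T>.extend_inflation[OF r[OF 6(1)] dY(2) xa] by blast
    obtain \<rho> where \<rho>: "\<rho> \<in> Mor C (N X) (N Y)" "\<rho> \<cdot> y X = y Y \<cdot> \<kappa>" "push C a (\<delta> X) = pull C \<rho> (\<delta> Y)"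
      using \<T>.ET3[OF r[OF 6(1)] r[OF 6(2)] 6(3) \<kappa>(1) \<kappa>(2)[symmetric]] by blast
    show ?case using \<rho> \<kappa>(1) \<kappa>(2)[symmetric] 6(3) by (auto simp: conf_mor_def)
  next
    case (7 X Y a \<kappa> \<rho>) thus ?case by (simp add: conf_mor_def)
  next
    case (8 X) show ?case by (rule \<T>.conf_mor_ident[OF r[OF 8]])
  next
    case (9 X Y a b \<kappa> \<rho> \<kappa>' \<rho>') show ?case by (rule \<T>.conf_mor_add[OF r[OF 9(1)] r[OF 9(2)] 9(5,6)])
  next
    case (10 X Y a \<kappa> \<rho> c) show ?case by (rule \<T>.conf_mor_smult[OF r[OF 10(1)] r[OF 10(2)] 10(4)])
  next
    case (11 X Y Z a b \<kappa> \<rho> \<kappa>' \<rho>')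
    show ?case by (rule \<T>.conf_mor_comp[OF r[OF 11(1)] r[OF 11(2)] r[OF 11(3)] 11(6,7)])
  next
    case (12 X Y a \<kappa> \<rho> \<kappa>' \<rho>')
    note dX = d[OF 12(1)] and dY = d[OF 12(2)]
    have "pull C \<rho> (\<delta> Y) = pull C \<rho>' (\<delta> Y)" "\<kappa> \<cdot> x X = \<kappa>' \<cdot> x X" using 12(4,5) by (auto simp: conf_mor_def)
    thus ?case
      using \<T>.lift_deflation_diff[OF r[OF 12(2)] dX(3), of \<rho> \<rho>'] \<T>.factor_deflation_diff[OF r[OF 12(1)] dY(2), of \<kappa> \<kappa>'] 12(4,5)
      by (simp add: conf_mor_def)
  next
    case (13 X X' g)
    note dX = d[OF 13(1)] and dX' = d[OF 13(2)]
    have gx: "g \<cdot> x X' \<in> Mor C X' (N X)" using \<T>.comp_mor[OF dX'(1,2) dX(3) dX'(4) 13(3)] .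
    have "pull C (g \<cdot> x X') (\<delta> X) = \<zero>\<^bsub>Ext C X' X\<^esub>"
      using ext_TT[OF 13(2,1) \<T>.pull_closed[OF dX(3) dX'(1) dX(1) gx dX(6)]] .
    then obtain b where b: "b \<in> Mor C X' (L X)" "g \<cdot> x X' = y X \<cdot> b"
      using \<T>.lift_deflation[OF r[OF 13(1)] dX'(1) gx] by blast
    have "push C b (\<delta> X') = \<zero>\<^bsub>Ext C (N X') (L X)\<^esub>"
      using ext_UU[OF N[OF 13(2)] L[OF 13(1)] \<T>.push_closed[OF dX'(3,1) dX(2) b(1) dX'(6)]] .
    then obtain \<alpha> where \<alpha>: "\<alpha> \<in> Mor C (L X') (L X)" "b = \<alpha> \<cdot> x X'"
      using \<T>.extend_inflation[OF r[OF 13(2)] dX(2) b(1)] by blast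
    note ya = \<T>.comp_mor[OF dX'(2) dX(2,3) \<alpha>(1) dX(5)]
    have "g \<cdot> x X' = (y X \<cdot> \<alpha>) \<cdot> x X'"
      unfolding b(2) \<alpha>(2) using \<T>.Comp_assoc[OF dX'(1,2) dX(2,3) dX'(4) \<alpha>(1) dX(5)] by simp
    from \<T>.factor_deflation_diff[OF r[OF 13(2)] dX(3) 13(3) ya this]
    obtain \<beta> where \<beta>: "\<beta> \<in> Mor C (N X') (N X)" "g = y X \<cdot> \<alpha> \<oplus>\<^bsub>Hom C (L X') (N X)\<^esub> \<beta> \<cdot> y X'" by blast
    have "g = \<beta> \<cdot> y X' \<oplus>\<^bsub>Hom C (L X') (N X)\<^esub> y X \<cdot> \<alpha>"
      unfolding \<beta>(2) using \<T>.hom_add_comm[OF dX'(2) dX(3) ya \<T>.comp_mor[OF dX'(2,3) dX(3) dX'(5) \<beta>(1)]] .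
    thus ?case using \<alpha>(1) \<beta>(1) by blast
  next
    case (14 X v) thus ?case using retraction N by blast
  next
    case (15 X) thus ?case using fin_dim L N by blast
  qed
qed

abbreviation "\<S> \<equiv> simple_cmod (full_sub C \<U>) U"

lemma simple_lfd: "\<S> \<in> lfd (full_sub C \<U>)"
  using linear_category.simple_is_cmod[OF \<U>.full_sub_linear, of U] U_mem fin_dim
  by (simp add: lfd_def simple_cmod_def rad_full_sub)

text \<open>The simple module at \<open>U\<close> counts copies of \<open>U\<close>, with weight \<open>d\<^sub>U\<close>.\<close>

lemma simple_pairing:
  assumes "X \<in> \<U>" "Y \<in> \<U>"
  shows "num_pairing (full_sub C \<U>) (K0_num_class (full_sub C \<U>) \<S>)
    (\<U>.cls X \<otimes>\<^bsub>\<U>.\<K>\<^esub> inv\<^bsub>\<U>.\<K>\<^esub> \<U>.cls Y) = \<D> X - \<D> Y"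
proof -
  interpret G: comm_group \<U>.\<K> by (rule \<U>.\<K>_comm)
  have "\<U>.cls X \<otimes>\<^bsub>\<U>.\<K>\<^esub> inv\<^bsub>\<U>.\<K>\<^esub> \<U>.cls Y \<in> carrier \<U>.\<K>" using \<U>.cls_closed assms by simp
  thus ?thesis
    using linear_category.num_pairing_class[OF \<U>.full_sub_linear simple_lfd]
      linear_category.pairing_class_diff[OF \<U>.full_sub_linear simple_lfd, of X Y] assms
    by (simp add: simple_cmod_def rad_full_sub)
qed

lemma sign_coherent_of_module:
  fixes Q :: "('k, 'o, 'm, 'm set) cmod" and c :: "'o \<Rightarrow> int"
  assumes Q: "Q \<in> lfd (full_sub C \<T>)"
    and c: "(\<forall>T\<in>\<T>. c T = int (vectorspace.dim class_ring (Val Q T))) \<or> (\<forall>T\<in>\<T>. c T = - int (vectorspace.dim class_ring (Val Q T)))"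
  shows "sign_coherent (full_sub C \<T>) (THE w. w \<in> carrier (K0_num (full_sub C \<T>)) \<and>
    (\<forall>T\<in>\<T>. num_pairing (full_sub C \<T>) w (K0_class (full_sub C \<T>) T) = c T))"
proof -
  have "num_pairing (full_sub C \<T>) (THE w. w \<in> carrier (K0_num (full_sub C \<T>)) \<and>
    (\<forall>T\<in>\<T>. num_pairing (full_sub C \<T>) w (K0_class (full_sub C \<T>) T) = c T)) (K0_class (full_sub C \<T>) T) = c T"
    if "T \<in> \<T>" for T
    using linear_category.num_element_of_dimension_vector[OF \<T>.full_sub_linear Q, of c T] c that by simp
  moreover have "T \<in> \<T>" if "indecomposable (full_sub C \<T>) T" for T using that by (simp add: indecomposable_def)
  ultimately show ?thesis using c unfolding sign_coherent_def by auto
qed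

theorem index_adj_sign_coherent:
  "sign_coherent (full_sub C \<T>) (index_adj C \<U> \<T> (K0_num_class (full_sub C \<U>) \<S>))"
proof -
  obtain L N x y \<delta> where r: "\<forall>X\<in>\<T>. L X \<in> \<U> \<and> N X \<in> \<U> \<and> realises C X (L X) (N X) (x X) (y X) (\<delta> X)"
    using coresolution_exists by blast
  have v: "num_pairing (full_sub C \<U>) (K0_num_class (full_sub C \<U>) \<S>) (coindex_map C \<T> \<U> (K0_class (full_sub C \<T>) T))
    = \<D> (L T) - \<D> (N T)" if "T \<in> \<T>" for T
    using coindex_map_class[OF that] \<U>.coindex_eq[of T "L T" "N T"] bspec[OF r that] simple_pairing by metis
  obtain Q :: "('k, 'o, 'm, 'm set) cmod" where "Q \<in> lfd (full_sub C \<T>)"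
    "(\<forall>T\<in>\<T>. \<D> (L T) - \<D> (N T) = int (vectorspace.dim class_ring (Val Q T))) \<or>
     (\<forall>T\<in>\<T>. \<D> (L T) - \<D> (N T) = - int (vectorspace.dim class_ring (Val Q T)))"
    using two_term_family.dimension_difference_realised[OF coresolution_family[OF r]] by blast
  thus ?thesis unfolding index_adj_def by (intro sign_coherent_of_module) (auto simp: v)
qed

theorem coindex_adj_sign_coherent:
  "sign_coherent (full_sub C \<T>) (coindex_adj C \<U> \<T> (K0_num_class (full_sub C \<U>) \<S>))"
proof -
  obtain K R f h \<delta> where r: "\<forall>X\<in>\<T>. K X \<in> \<U> \<and> R X \<in> \<U> \<and> realises C (K X) (R X) X (f X) (h X) (\<delta> X)"
    using resolution_exists by blast
  have v: "num_pairing (full_sub C \<U>) (K0_num_class (full_sub C \<U>) \<S>) (index_map C \<T> \<U> (K0_class (full_sub C \<T>) T))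
    = \<D> (R T) - \<D> (K T)" if "T \<in> \<T>" for T
    using index_map_class[OF that] \<U>.index_eq[of "K T" "R T" T] bspec[OF r that] simple_pairing by metis
  obtain Q :: "('k, 'o, 'm, 'm set) cmod" where "Q \<in> lfd (full_sub C \<T>)"
    "(\<forall>T\<in>\<T>. \<D> (K T) - \<D> (R T) = int (vectorspace.dim class_ring (Val Q T))) \<or>
     (\<forall>T\<in>\<T>. \<D> (K T) - \<D> (R T) = - int (vectorspace.dim class_ring (Val Q T)))"
    using two_term_family.dimension_difference_realised[OF resolution_family[OF r]] by blast
  thus ?thesis unfolding coindex_adj_def by (intro sign_coherent_of_module) (auto simp: v algebra_simps)
qed

end

section \<open>Local endomorphism rings\<close>

subsection \<open>Limits in pseudocompact spaces\<close>

text \<open>In the inverse limit, the cosets of a Cauchy sequence become constant at each stage.\<close>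

lemma pseudocompact_limit:
  fixes V :: "('k::field, 'v) module"
  assumes V: "vectorspace class_ring V" and pc: "pseudocompact_space V \<tau>"
    and z: "\<And>k. z k \<in> carrier V"
    and cauchy: "\<And>W. openin \<tau> W \<Longrightarrow> \<zero>\<^bsub>V\<^esub> \<in> W \<Longrightarrow> \<exists>m. \<forall>k\<ge>m. z k \<ominus>\<^bsub>V\<^esub> z m \<in> W"
  shows "\<exists>v. limitin \<tau> z v sequentially"
proof -
  obtain \<W> where W: "\<And>W. W \<in> \<W> \<Longrightarrow> VectorSpace.subspace class_ring W V" "\<And>W. W \<in> \<W> \<Longrightarrow> openin \<tau> W"
    and homeo: "homeomorphic_map \<tau>
          (subtopology (product_topology (\<lambda>U. discrete_topology (a_rcosets\<^bsub>V\<^esub> U)) \<W>)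
             {c. \<forall>U\<in>\<W>. \<forall>U'\<in>\<W>. U \<subseteq> U' \<longrightarrow> c U \<subseteq> c U'})
          (\<lambda>v. \<lambda>U\<in>\<W>. U +>\<^bsub>V\<^esub> v)"
    and top: "topspace \<tau> = carrier V"
    using pc unfolding pseudocompact_space_def by blast
  let ?P = "product_topology (\<lambda>U. discrete_topology (a_rcosets\<^bsub>V\<^esub> U)) \<W>"
  let ?S = "{c. \<forall>U\<in>\<W>. \<forall>U'\<in>\<W>. U \<subseteq> U' \<longrightarrow> c U \<subseteq> c U'}"
  let ?f = "\<lambda>v. \<lambda>U\<in>\<W>. U +>\<^bsub>V\<^esub> v"
  obtain g where hg: "homeomorphic_maps \<tau> (subtopology ?P ?S) ?f g" using homeo homeomorphic_map_maps by blast
  have "\<exists>m. \<forall>k\<ge>m. z k \<ominus>\<^bsub>V\<^esub> z m \<in> W" if "W \<in> \<W>" for W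
    using cauchy[OF W(2)[OF that]] W(1)[OF that] by (simp add: subspace_iff)
  then obtain m where m: "\<And>W k. W \<in> \<W> \<Longrightarrow> m W \<le> k \<Longrightarrow> z k \<ominus>\<^bsub>V\<^esub> z (m W) \<in> W" by metis
  define c where "c = (\<lambda>W\<in>\<W>. W +>\<^bsub>V\<^esub> z (m W))"
  have const: "W +>\<^bsub>V\<^esub> z k = c W" if "W \<in> \<W>" "m W \<le> k" for W k
    using coset_eq_iff[OF W(1)[OF that(1)] z z] m[OF that] that(1) by (simp add: c_def)
  have coset: "W +>\<^bsub>V\<^esub> v \<in> a_rcosets\<^bsub>V\<^esub> W" if "v \<in> carrier V" for W v
    using that by (auto simp: A_RCOSETS_def')
  have cS: "c \<in> ?S"
  proof (intro CollectI ballI impI)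
    fix W W' assume WW: "W \<in> \<W>" "W' \<in> \<W>" "W \<subseteq> W'"
    have "W +>\<^bsub>V\<^esub> z (max (m W) (m W')) \<subseteq> W' +>\<^bsub>V\<^esub> z (max (m W) (m W'))"
      using WW(3) by (auto simp: a_r_coset_def')
    thus "c W \<subseteq> c W'" using const[OF WW(1), of "max (m W) (m W')"] const[OF WW(2), of "max (m W) (m W')"] by simp
  qed
  have "c \<in> topspace ?P" using coset[OF z] by (auto simp: c_def)
  hence lim: "limitin (subtopology ?P ?S) (\<lambda>k. ?f (z k)) c sequentially"
    unfolding limitin_subtopology limitin_componentwise
  proof (intro conjI ballI)
    show "c \<in> ?S" by (rule cS)
    show "\<forall>\<^sub>F k in sequentially. ?f (z k) \<in> ?S" by (intro always_eventually) (auto simp: a_r_coset_def')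
    show "c \<in> extensional \<W>" by (simp add: c_def)
    show "\<forall>\<^sub>F k in sequentially. ?f (z k) \<in> topspace ?P" using coset[OF z] by (intro always_eventually) auto
    fix W assume WW: "W \<in> \<W>"
    have "\<forall>\<^sub>F k in sequentially. ?f (z k) W = c W"
      unfolding eventually_sequentially using const[OF WW] WW by auto
    moreover have "c W \<in> a_rcosets\<^bsub>V\<^esub> W" using coset[OF z] WW by (simp add: c_def)
    ultimately show "limitin (discrete_topology (a_rcosets\<^bsub>V\<^esub> W)) (\<lambda>k. ?f (z k) W) (c W) sequentially"
      by (intro limitin_eventually) auto
  qed
  have "limitin \<tau> (g \<circ> (\<lambda>k. ?f (z k))) (g c) sequentially"
    using continuous_map_limit[OF _ lim] hg unfolding homeomorphic_maps_def by blast
  moreover have "g \<circ> (\<lambda>k. ?f (z k)) = z"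
    using hg z top unfolding homeomorphic_maps_def by auto
  ultimately show ?thesis by auto
qed

subsection \<open>Comaximal elements\<close>

definition comaximal :: "'a::comm_ring_1 \<Rightarrow> 'a \<Rightarrow> bool" where
  "comaximal u v \<longleftrightarrow> (\<exists>a b. a * u + b * v = 1)"

lemma comaximal_sym: "comaximal u v \<Longrightarrow> comaximal v u"
  unfolding comaximal_def by (metis add.commute)

lemma comaximal_mult:
  assumes "comaximal u v" "comaximal u w" shows "comaximal u (v * w)"
proof -
  obtain a b a' b' where e: "a * u + b * v = 1" "a' * u + b' * w = 1" using assms by (auto simp: comaximal_def)
  have "(a * u + b * v) * (a' * u + b' * w) = 1" by (simp add: e)
  hence "(a * a' * u + a * b' * w + b * v * a') * u + (b * b') * (v * w) = 1" by (simp add: algebra_simps)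
  thus ?thesis unfolding comaximal_def by blast
qed

lemma comaximal_power: "comaximal u v \<Longrightarrow> comaximal u (v ^ n)"
proof (induction n)
  case 0 show ?case unfolding comaximal_def by (intro exI[of _ 0] exI[of _ 1]) simp
next
  case (Suc n) thus ?case using comaximal_mult by simp
qed

context linear_category
begin

lemma one_sided_inverses_iso:
  assumes U: "U \<in> Obj C" and m: "x \<in> Mor C U U" "l \<in> Mor C U U" "r \<in> Mor C U U"
    and e: "l \<cdot> x = Ident C U" "x \<cdot> r = Ident C U"
  shows "iso_mor C U U x"
proof -
  have "l = l \<cdot> (x \<cdot> r)" using m U by (simp add: e(2) Comp_Ident)
  also have "\<dots> = (l \<cdot> x) \<cdot> r" using m U by (simp add: cat_simps)
  also have "\<dots> = r" using m U by (simp add: e(1) Ident_Comp)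
  finally show ?thesis using m e unfolding iso_mor_def by blast
qed

subsection \<open>Polynomials in an endomorphism\<close>

definition eval_poly :: "'o \<Rightarrow> 'm \<Rightarrow> 'k poly \<Rightarrow> 'm" where
  "eval_poly U x p = foldr (\<lambda>a y. a \<odot>\<^bsub>Hom C U U\<^esub> Ident C U \<oplus>\<^bsub>Hom C U U\<^esub> x \<cdot> y) (coeffs p) \<zero>\<^bsub>Hom C U U\<^esub>"

context
  fixes U x assumes U: "U \<in> Obj C" and x: "x \<in> Mor C U U"
begin

interpretation E: vectorspace class_ring "Hom C U U" by (rule Hom_vectorspace[OF U U])

private lemmas comp_U = comp_mor[OF U U U]
private lemmas I = Ident_closed[OF U]
private lemmas sm = vs_smult_closed[OF Hom_vectorspace[OF U U]]

lemma eval_poly_0: "eval_poly U x 0 = \<zero>\<^bsub>Hom C U U\<^esub>"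
  by (simp add: eval_poly_def)

lemma eval_poly_pCons:
  "eval_poly U x (pCons a p) = a \<odot>\<^bsub>Hom C U U\<^esub> Ident C U \<oplus>\<^bsub>Hom C U U\<^esub> x \<cdot> eval_poly U x p"
proof (cases "a = 0 \<and> p = 0")
  case True
  have "x \<cdot> \<zero>\<^bsub>Hom C U U\<^esub> = \<zero>\<^bsub>Hom C U U\<^esub>" using U x by (simp add: cat_simps)
  moreover have "0 \<odot>\<^bsub>Hom C U U\<^esub> Ident C U = \<zero>\<^bsub>Hom C U U\<^esub>" using E.smult_l_null[OF I] by simp
  ultimately show ?thesis using True by (simp add: eval_poly_def)
next
  case False thus ?thesis by (auto simp: eval_poly_def cCons_def)
qed

lemma eval_poly_closed: "eval_poly U x p \<in> Mor C U U"
proof (induction p rule: pCons_induct)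
  case 0 show ?case by (simp add: eval_poly_0)
next
  case (pCons a p) thus ?case using sm[OF I] comp_U[OF _ x] by (simp add: eval_poly_pCons)
qed

lemma eval_poly_add: "eval_poly U x (p + q) = eval_poly U x p \<oplus>\<^bsub>Hom C U U\<^esub> eval_poly U x q"
proof (induction p q rule: poly_induct2)
  case 0 show ?case by (simp add: eval_poly_0)
next
  case (pCons a p b q)
  have c: "x \<cdot> eval_poly U x p \<in> Mor C U U" "x \<cdot> eval_poly U x q \<in> Mor C U U" using comp_U[OF eval_poly_closed x] by blast+
  have "x \<cdot> (eval_poly U x p \<oplus>\<^bsub>Hom C U U\<^esub> eval_poly U x q) = x \<cdot> eval_poly U x p \<oplus>\<^bsub>Hom C U U\<^esub> x \<cdot> eval_poly U x q"
    using lin_maps_add[OF Comp_linear_right[OF U U U x] eval_poly_closed eval_poly_closed] .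
  moreover have "(a + b) \<odot>\<^bsub>Hom C U U\<^esub> Ident C U = a \<odot>\<^bsub>Hom C U U\<^esub> Ident C U \<oplus>\<^bsub>Hom C U U\<^esub> b \<odot>\<^bsub>Hom C U U\<^esub> Ident C U"
    using E.smult_l_distr[of a b "Ident C U"] I by simp
  ultimately show ?case using pCons c sm[OF I] by (simp add: eval_poly_pCons E.M.a_ac)
qed

lemma eval_poly_diff: "eval_poly U x (p - q) = eval_poly U x p \<ominus>\<^bsub>Hom C U U\<^esub> eval_poly U x q"
proof -
  have "eval_poly U x (p - q) \<oplus>\<^bsub>Hom C U U\<^esub> eval_poly U x q = eval_poly U x p"
    using eval_poly_add[of "p - q" q] by simp
  thus ?thesis using hom_minus_iff[OF U U eval_poly_closed[of p] eval_poly_closed[of q] eval_poly_closed[of "p - q"]] by simp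
qed

lemma eval_poly_smult: "eval_poly U x (Polynomial.smult c p) = c \<odot>\<^bsub>Hom C U U\<^esub> eval_poly U x p"
proof (induction p rule: pCons_induct)
  case 0 show ?case using E.smult_r_null[of c] by (simp add: eval_poly_0)
next
  case (pCons a p)
  have c: "x \<cdot> eval_poly U x p \<in> Mor C U U" using comp_U[OF eval_poly_closed x] .
  have "(c * a) \<odot>\<^bsub>Hom C U U\<^esub> Ident C U = c \<odot>\<^bsub>Hom C U U\<^esub> (a \<odot>\<^bsub>Hom C U U\<^esub> Ident C U)"
    using E.smult_assoc1[of c a "Ident C U"] I by simp
  moreover have "c \<odot>\<^bsub>Hom C U U\<^esub> (a \<odot>\<^bsub>Hom C U U\<^esub> Ident C U \<oplus>\<^bsub>Hom C U U\<^esub> x \<cdot> eval_poly U x p) =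
      c \<odot>\<^bsub>Hom C U U\<^esub> (a \<odot>\<^bsub>Hom C U U\<^esub> Ident C U) \<oplus>\<^bsub>Hom C U U\<^esub> c \<odot>\<^bsub>Hom C U U\<^esub> (x \<cdot> eval_poly U x p)"
    using E.smult_r_distr[of c "a \<odot>\<^bsub>Hom C U U\<^esub> Ident C U" "x \<cdot> eval_poly U x p"] sm[OF I] c by simp
  moreover have "x \<cdot> (c \<odot>\<^bsub>Hom C U U\<^esub> eval_poly U x p) = c \<odot>\<^bsub>Hom C U U\<^esub> (x \<cdot> eval_poly U x p)"
    using lin_maps_smult[OF Comp_linear_right[OF U U U x] eval_poly_closed] .
  ultimately show ?case using pCons by (simp add: eval_poly_pCons)
qed

lemma eval_poly_mult: "eval_poly U x (p * q) = eval_poly U x p \<cdot> eval_poly U x q"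
proof (induction p rule: pCons_induct)
  case 0 show ?case using eval_poly_closed[of q] U by (simp add: eval_poly_0 cat_simps)
next
  case (pCons a p)
  have z: "0 \<odot>\<^bsub>Hom C U U\<^esub> Ident C U = \<zero>\<^bsub>Hom C U U\<^esub>" using E.smult_l_null[OF I] by simp
  have c: "x \<cdot> (eval_poly U x p \<cdot> eval_poly U x q) \<in> Mor C U U" using comp_U[OF comp_U[OF eval_poly_closed eval_poly_closed] x] .
  have "eval_poly U x (pCons a p * q) = a \<odot>\<^bsub>Hom C U U\<^esub> eval_poly U x q \<oplus>\<^bsub>Hom C U U\<^esub> x \<cdot> (eval_poly U x p \<cdot> eval_poly U x q)"
    using c by (simp add: mult_pCons_left eval_poly_add eval_poly_smult eval_poly_pCons pCons.IH z)
  also have "\<dots> = eval_poly U x (pCons a p) \<cdot> eval_poly U x q"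
    using eval_poly_closed[of p] eval_poly_closed[of q] x U by (simp add: eval_poly_pCons cat_simps)
  finally show ?case .
qed

lemma eval_poly_1: "eval_poly U x 1 = Ident C U"
  using I sm[OF I] comp_zero_right[of x U U] x U E.smult_one[OF I]
  by (simp add: one_pCons eval_poly_pCons eval_poly_0 mor_iff)

lemma eval_poly_X: "eval_poly U x [:0, 1:] = x"
proof -
  have "eval_poly U x [:1:] = Ident C U" using eval_poly_1 by (simp add: one_pCons)
  thus ?thesis using E.smult_l_null[OF I] x U by (simp add: eval_poly_pCons[of 0] Comp_Ident)
qed

lemma eval_poly_commute: "eval_poly U x p \<cdot> eval_poly U x q = eval_poly U x q \<cdot> eval_poly U x p"
  by (simp add: eval_poly_mult[symmetric] mult.commute)

lemma iso_eval_factor: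
  assumes "iso_mor C U U (eval_poly U x (p * q))"
  shows "iso_mor C U U (eval_poly U x p)"
proof -
  note cl = eval_poly_closed[of p] eval_poly_closed[of q]
  obtain w where w: "w \<in> Mor C U U" "w \<cdot> eval_poly U x (p * q) = Ident C U" "eval_poly U x (p * q) \<cdot> w = Ident C U"
    using assms by (auto simp: iso_mor_def)
  have "(w \<cdot> eval_poly U x q) \<cdot> eval_poly U x p = w \<cdot> eval_poly U x (p * q)"
    unfolding eval_poly_mult eval_poly_commute[of p q] using Comp_assoc[OF U U U U cl(1,2) w(1)] .
  moreover have "eval_poly U x p \<cdot> (eval_poly U x q \<cdot> w) = eval_poly U x (p * q) \<cdot> w"
    unfolding eval_poly_mult using Comp_assoc[OF U U U U w(1) cl(2,1)] by simp
  ultimately show ?thesis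
    using one_sided_inverses_iso[OF U cl(1) comp_U[OF cl(2) w(1)] comp_U[OF w(1) cl(2)]] w(2,3) by simp
qed

text \<open>The powers of \<open>x\<close> become linearly dependent modulo the radical: some power is a combination of lower ones.\<close>

lemma radical_polynomial:
  assumes fd: "vectorspace.fin_dim class_ring (D_space C U)"
  shows "\<exists>p. p \<noteq> 0 \<and> eval_poly U x p \<in> rad C U U"
proof -
  let ?J = "rad C U U" and ?V = "Hom C U U"
  note sub = rad_subspace[OF U U]
  have Qvs: "vectorspace class_ring (D_space C U)" unfolding D_space_def by (rule quot_vs[OF sub])
  interpret Q: vectorspace class_ring "D_space C U" by (rule Qvs)
  define s where "s n = ?J +>\<^bsub>?V\<^esub> eval_poly U x (monom 1 n)" for n
  have scl: "s n \<in> carrier (D_space C U)" for n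
    using eval_poly_closed by (auto simp: s_def D_space_def quot_carrier[OF sub])
  have "\<exists>n. s n \<in> Q.span (s ` {..<n})"
  proof (rule ccontr)
    assume no: "\<nexists>n. s n \<in> Q.span (s ` {..<n})"
    have "Q.lin_indpt (s ` {..<n}) \<and> card (s ` {..<n}) = n" for n
    proof (induction n)
      case 0 show ?case by (simp add: Q.lin_dep_def)
    next
      case (Suc n)
      have S: "s ` {..<n} \<subseteq> carrier (D_space C U)" using scl by auto
      have new: "s n \<notin> s ` {..<n}" using no Q.in_own_span[OF S] by blast
      have "Q.lin_indpt (s ` {..<n} \<union> {s n})"
        using Q.lin_dep_iff_in_span[OF S _ scl new] Suc no by blast
      thus ?case using Suc new by (simp add: lessThan_Suc)
    qed
    hence "Suc Q.dim \<le> Q.dim" using Q.li_le_dim(2)[of "s ` {..<Suc Q.dim}"] fd scl by (metis image_subset_iff)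
    thus False by simp
  qed
  then obtain n where n: "s n \<in> Q.span (s ` {..<n})" by blast
  define N where "N = {?J +>\<^bsub>?V\<^esub> eval_poly U x q | q. \<forall>i\<ge>n. coeff q i = 0}"
  have Nsub: "submodule class_ring N (D_space C U)"
  proof (rule submodule.intro)
    show "Module.module class_ring (D_space C U)" by (rule vs_module[OF Qvs])
    show "N \<subseteq> carrier (D_space C U)" using eval_poly_closed by (auto simp: N_def D_space_def quot_carrier[OF sub])
    show "v \<oplus>\<^bsub>D_space C U\<^esub> w \<in> N" if vw: "v \<in> N" "w \<in> N" for v w
    proof -
      obtain p q where "\<forall>i\<ge>n. coeff p i = 0" "v = ?J +>\<^bsub>?V\<^esub> eval_poly U x p" "\<forall>i\<ge>n. coeff q i = 0" "w = ?J +>\<^bsub>?V\<^esub> eval_poly U x q"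
        using vw by (auto simp: N_def)
      thus ?thesis unfolding N_def D_space_def
        by (auto simp: quot_add[OF sub] eval_poly_closed eval_poly_add[symmetric] intro!: exI[of _ "p + q"])
    qed
    show "\<zero>\<^bsub>D_space C U\<^esub> \<in> N" unfolding N_def D_space_def quot_zero[OF sub]
      by (auto simp: eval_poly_0[symmetric] intro!: exI[of _ 0])
    show "c \<odot>\<^bsub>D_space C U\<^esub> v \<in> N" if v: "v \<in> N" for c v
    proof -
      obtain p where "\<forall>i\<ge>n. coeff p i = 0" "v = ?J +>\<^bsub>?V\<^esub> eval_poly U x p" using v by (auto simp: N_def)
      thus ?thesis unfolding N_def D_space_def
        by (auto simp: quot_smult[OF sub] eval_poly_closed eval_poly_smult[symmetric] intro!: exI[of _ "Polynomial.smult c p"])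
    qed
  qed
  have "s ` {..<n} \<subseteq> N" by (auto simp: N_def s_def intro!: exI[of _ "monom 1 _"])
  hence "s n \<in> N" using Q.span_is_subset[OF _ Nsub] n by blast
  then obtain q where q: "\<forall>i\<ge>n. coeff q i = 0" "s n = ?J +>\<^bsub>?V\<^esub> eval_poly U x q" by (auto simp: N_def)
  have "eval_poly U x (monom 1 n - q) \<in> ?J"
    using coset_eq_iff[OF sub eval_poly_closed eval_poly_closed] q(2) by (simp add: s_def eval_poly_diff)
  moreover have "monom 1 n - q \<noteq> 0"
  proof
    assume "monom 1 n - q = 0"
    hence "coeff (monom 1 n - q) n = 0" by simp
    thus False using q(1) by simp
  qed
  ultimately show ?thesis by blast
qed

end

subsection \<open>Powers of the radical\<close>

lemma rad_pow_mor:
  assumes "X \<in> Obj C" "Y \<in> Obj C"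
  shows "rad_pow C n X Y \<subseteq> Mor C X Y"
  using assms
proof (induction n arbitrary: Y)
  case 0 show ?case by simp
next
  case (Suc n)
  interpret H: vectorspace class_ring "Hom C X Y" using Hom_vectorspace[OF Suc.prems] .
  show ?case unfolding rad_pow.simps
    using Suc.IH Suc.prems comp_mor rad_mor by (intro H.span_is_subset2) blast
qed

lemma rad_pow_comp:
  assumes XZY: "X \<in> Obj C" "Z \<in> Obj C" "Y \<in> Obj C" and f: "f \<in> rad_pow C n X Z" and g: "g \<in> rad C Z Y"
  shows "g \<cdot> f \<in> rad_pow C (Suc n) X Y"
proof -
  interpret H: vectorspace class_ring "Hom C X Y" using Hom_vectorspace[OF XZY(1,3)] .
  have "{g \<cdot> f |f g Z. Z \<in> Obj C \<and> f \<in> rad_pow C n X Z \<and> g \<in> rad C Z Y} \<subseteq> Mor C X Y"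
    using comp_mor[OF XZY(1) _ XZY(3)] subsetD[OF rad_pow_mor[OF XZY(1)]] rad_mor by auto
  from H.in_own_span[OF this] show ?thesis using f g XZY(2) unfolding rad_pow.simps by blast
qed

lemma rad_pow_1_subset:
  assumes XY: "X \<in> Obj C" "Y \<in> Obj C"
  shows "rad_pow C 1 X Y \<subseteq> rad C X Y"
proof -
  interpret H: vectorspace class_ring "Hom C X Y" using Hom_vectorspace[OF XY] .
  have "submodule class_ring (rad C X Y) (Hom C X Y)" using rad_subspace[OF XY] by (simp add: VectorSpace.subspace_def)
  moreover have "{g \<cdot> f |f g Z. Z \<in> Obj C \<and> f \<in> Mor C X Z \<and> g \<in> rad C Z Y} \<subseteq> rad C X Y"
    using rad_comp_right XY by blast
  ultimately show ?thesis using H.span_is_subset by simp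
qed

text \<open>
  Let \<open>p = T q\<close> be a polynomial with \<open>p(x)\<close> in the radical, where \<open>T\<close> is a power of the variable
  and \<open>q\<close> is prime to it. Modulo \<open>p\<^sup>n\<close> there is an idempotent \<open>e n\<close> which is \<open>1\<close> modulo
  \<open>T\<^sup>n\<close> and \<open>0\<close> modulo \<open>q\<^sup>n\<close>. The elements \<open>e n\<close> at \<open>x\<close> converge to an idempotent. If the latter is
  \<open>0\<close>, then \<open>T\<close> at \<open>x\<close> is invertible, if it is \<open>1\<close>, then \<open>T\<close> at \<open>x\<close> is radical.
\<close>

theorem radically_pseudocompact_local:
  assumes U: "U \<in> Obj C" and rpc: "radically_pseudocompact C"
    and fd: "vectorspace.fin_dim class_ring (D_space C U)"
    and idem: "\<And>e. e \<in> Mor C U U \<Longrightarrow> e \<cdot> e = e \<Longrightarrow> e = \<zero>\<^bsub>Hom C U U\<^esub> \<or> e = Ident C U"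
    and x: "x \<in> Mor C U U"
  shows "iso_mor C U U x \<or> iso_mor C U U (Ident C U \<ominus>\<^bsub>Hom C U U\<^esub> x)"
proof -
  let ?J = "rad C U U" and ?V = "Hom C U U" and ?ev = "eval_poly U x"
  interpret E: vectorspace class_ring ?V by (rule Hom_vectorspace[OF U U])
  note I = Ident_closed[OF U] and cl = eval_poly_closed[OF U x]
  obtain \<tau>s where pch: "pseudocompact_homs C \<tau>s"
    and op': "\<forall>X\<in>Obj C. \<forall>Y\<in>Obj C. \<forall>W. openin (\<tau>s X Y) W \<longleftrightarrow>
           W \<subseteq> Mor C X Y \<and> (\<forall>f\<in>W. \<exists>n. rad_pow C n X Y +>\<^bsub>Hom C X Y\<^esub> f \<subseteq> W)"
    using rpc unfolding radically_pseudocompact_def by (elim exE conjE)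
  note op = bspec[OF bspec[OF op'], THEN spec]
  define \<tau> where "\<tau> = \<tau>s U U"
  have pc: "pseudocompact_space ?V \<tau>"
    and cont: "continuous_map (prod_topology \<tau> \<tau>) \<tau> (\<lambda>(g, f). g \<cdot> f)"
    using pch U unfolding pseudocompact_homs_def \<tau>_def by auto
  have top: "topspace \<tau> = Mor C U U" and haus: "Hausdorff_space \<tau>"
    and contadd: "continuous_map (prod_topology \<tau> \<tau>) \<tau> (\<lambda>(u, v). u \<oplus>\<^bsub>?V\<^esub> v)"
    using pc unfolding pseudocompact_space_def by auto
  have nbhd: "\<exists>n. rad_pow C n U U \<subseteq> W" if W: "openin \<tau> W" "\<zero>\<^bsub>?V\<^esub> \<in> W" for W
  proof -
    obtain n where n: "rad_pow C n U U +>\<^bsub>?V\<^esub> \<zero>\<^bsub>?V\<^esub> \<subseteq> W" using W op[OF U U] unfolding \<tau>_def by blast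
    have "f \<in> rad_pow C n U U +>\<^bsub>?V\<^esub> \<zero>\<^bsub>?V\<^esub>" if "f \<in> rad_pow C n U U" for f
    proof -
      have "f \<in> Mor C U U" using subsetD[OF rad_pow_mor[OF U U] that] .
      hence "f = f \<oplus>\<^bsub>?V\<^esub> \<zero>\<^bsub>?V\<^esub>" by simp
      thus ?thesis unfolding a_r_coset_def' using that by blast
    qed
    thus ?thesis using n by blast
  qed
  obtain p0 where p0: "p0 \<noteq> 0" "?ev p0 \<in> ?J" using radical_polynomial[OF U x fd] by blast
  obtain q where q: "p0 = [:- 0, 1:] ^ (order 0 p0) * q" "\<not> [:- 0, 1:] dvd q" using order_decomp[OF p0(1)] by blast
  define X where "X = [:0, 1 :: 'k:]"
  define T where "T = X ^ Suc (order 0 p0)"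
  \<comment> \<open>One factor more than the order of \<open>p0\<close> at \<open>0\<close>, so that \<open>T\<close> is divisible by the variable.\<close>
  define p where "p = T * q"
  have evX: "?ev X = x" unfolding X_def by (rule eval_poly_X[OF U x])
  have pq: "p = X * p0" using q(1) by (simp add: p_def T_def X_def mult.assoc)
  have pJ: "?ev p \<in> ?J"
    unfolding pq eval_poly_mult[OF U x] evX using rad_comp_left[OF U U U p0(2) x] .
  have "comaximal X q"
  proof -
    obtain c s where cs: "q = pCons c s" by (cases q)
    have c: "c \<noteq> 0"
    proof
      assume "c = 0"
      hence "q = [:- 0, 1:] * s" by (simp add: cs)
      hence "[:- 0, 1:] dvd q" by (rule dvdI)
      thus False using q(2) by blast
    qed
    have "q = [:c:] + X * s" by (simp add: cs X_def)
    hence "(- [:inverse c:] * s) * X + [:inverse c:] * q = [:inverse c:] * [:c:]" by (simp add: algebra_simps)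
    also have "\<dots> = 1" using c by (simp add: one_pCons)
    finally show ?thesis unfolding comaximal_def by blast
  qed
  hence "comaximal q T" unfolding T_def using comaximal_power comaximal_sym by blast
  hence "comaximal (T ^ n) (q ^ n)" for n using comaximal_power comaximal_sym by blast
  then obtain a b where ab: "\<And>n. a n * T ^ n + b n * q ^ n = 1" unfolding comaximal_def by metis
  define e where "e n = b n * q ^ n" for n
  have e1: "1 - e n = a n * T ^ n" for n using ab[of n] by (simp add: e_def algebra_simps)
  have powJ: "?ev (p ^ n * r) \<in> rad_pow C n U U" for n r
  proof (induction n)
    case 0 show ?case using cl by simp
  next
    case (Suc n)
    have "?ev (p ^ Suc n * r) = ?ev p \<cdot> ?ev (p ^ n * r)" by (simp add: eval_poly_mult[OF U x, symmetric] mult.assoc)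
    thus ?case using rad_pow_comp[OF U U U Suc pJ] by simp
  qed
  have diff: "\<exists>r. e k - e n = p ^ n * r" if "n \<le> k" for n k
  proof -
    obtain j where j: "k = n + j" using \<open>n \<le> k\<close> le_Suc_ex by blast
    have "e k - e n = e k * (1 - e n) - (1 - e k) * e n" by (simp add: algebra_simps)
    also have "\<dots> = p ^ n * (b k * q ^ j * a n - a k * T ^ j * b n)"
      unfolding e1 by (simp add: e_def j p_def power_add power_mult_distrib algebra_simps)
    finally show ?thesis by blast
  qed
  \<comment> \<open>\<open>e\<close> and \<open>1 - e\<close> are multiples of \<open>q\<^sup>n\<close> and of \<open>T\<^sup>n\<close>, so their product is one of \<open>p\<^sup>n\<close>.\<close>
  have idem_e: "e n * e n - e n = p ^ n * (- a n * b n)" for n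
  proof -
    have "e n * e n - e n = - (e n * (1 - e n))" by (simp add: algebra_simps)
    also have "\<dots> = p ^ n * (- a n * b n)" unfolding e1 by (simp add: e_def p_def power_mult_distrib algebra_simps)
    finally show ?thesis .
  qed
  define z where "z n = ?ev (e n)" for n
  have zc: "z n \<in> Mor C U U" for n using cl by (simp add: z_def)
  have "\<exists>v. limitin \<tau> z v sequentially"
  proof (rule pseudocompact_limit[OF Hom_vectorspace[OF U U] pc zc])
    fix W assume "openin \<tau> W" "\<zero>\<^bsub>?V\<^esub> \<in> W"
    then obtain n where n: "rad_pow C n U U \<subseteq> W" using nbhd by blast
    have "z k \<ominus>\<^bsub>?V\<^esub> z n \<in> W" if "n \<le> k" for k
      using diff[OF that] powJ n by (metis z_def eval_poly_diff[OF U x] subsetD)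
    thus "\<exists>m. \<forall>k\<ge>m. z k \<ominus>\<^bsub>?V\<^esub> z m \<in> W" by blast
  qed
  then obtain v where v: "limitin \<tau> z v sequentially" by blast
  have vc: "v \<in> Mor C U U" using limitin_topspace[OF v] top by simp
  have vv: "limitin \<tau> (\<lambda>n. z n \<cdot> z n) (v \<cdot> v) sequentially"
    using continuous_map_limit[OF cont, of "\<lambda>n. (z n, z n)" "(v, v)"] v
    by (simp add: limitin_pairwise o_def)
  have small: "limitin \<tau> (\<lambda>n. z n \<cdot> z n \<ominus>\<^bsub>?V\<^esub> z n) \<zero>\<^bsub>?V\<^esub> sequentially"
    unfolding limitin_sequentially
  proof (intro conjI allI impI)
    show "\<zero>\<^bsub>?V\<^esub> \<in> topspace \<tau>" by (simp add: top)
    fix W assume "openin \<tau> W \<and> \<zero>\<^bsub>?V\<^esub> \<in> W"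
    then obtain n where n: "rad_pow C n U U \<subseteq> W" using nbhd by blast
    have "z k \<cdot> z k \<ominus>\<^bsub>?V\<^esub> z k \<in> W" if "n \<le> k" for k
    proof -
      obtain j where j: "k = n + j" using \<open>n \<le> k\<close> le_Suc_ex by blast
      have "z k \<cdot> z k \<ominus>\<^bsub>?V\<^esub> z k = ?ev (p ^ n * (p ^ j * (- a k * b k)))"
        unfolding z_def eval_poly_mult[OF U x, symmetric] eval_poly_diff[OF U x, symmetric] idem_e
        by (simp add: j power_add mult.assoc)
      thus ?thesis by (simp only: subsetD[OF n powJ])
    qed
    thus "\<exists>N. \<forall>k. N \<le> k \<longrightarrow> z k \<cdot> z k \<ominus>\<^bsub>?V\<^esub> z k \<in> W" by blast
  qed
  have "limitin \<tau> (\<lambda>n. (z n \<cdot> z n \<ominus>\<^bsub>?V\<^esub> z n) \<oplus>\<^bsub>?V\<^esub> z n) (\<zero>\<^bsub>?V\<^esub> \<oplus>\<^bsub>?V\<^esub> v) sequentially"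
    using continuous_map_limit[OF contadd, of "\<lambda>n. (z n \<cdot> z n \<ominus>\<^bsub>?V\<^esub> z n, z n)" "(\<zero>\<^bsub>?V\<^esub>, v)"] v small
    by (simp add: limitin_pairwise o_def)
  moreover have "(z n \<cdot> z n \<ominus>\<^bsub>?V\<^esub> z n) \<oplus>\<^bsub>?V\<^esub> z n = z n \<cdot> z n" for n
    using hom_minus_iff[OF U U comp_mor[OF U U U zc zc] zc hom_minus_closed[OF U U comp_mor[OF U U U zc zc] zc]] by blast
  ultimately have "limitin \<tau> (\<lambda>n. z n \<cdot> z n) v sequentially" using vc by simp
  hence "v \<cdot> v = v" using limitin_Hausdorff_unique[OF vv _ _ haus] by simp
  hence "v = \<zero>\<^bsub>?V\<^esub> \<or> v = Ident C U" using idem[OF vc] by blast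
  have Jopen: "openin \<tau> (?J +>\<^bsub>?V\<^esub> w)" if w: "w \<in> Mor C U U" for w
  proof -
    have "rad_pow C 1 U U +>\<^bsub>?V\<^esub> f \<subseteq> ?J +>\<^bsub>?V\<^esub> w" if f: "f \<in> ?J +>\<^bsub>?V\<^esub> w" for f
    proof
      fix y assume "y \<in> rad_pow C 1 U U +>\<^bsub>?V\<^esub> f"
      then obtain g where g: "g \<in> ?J" "y = g \<oplus>\<^bsub>?V\<^esub> f" using rad_pow_1_subset[OF U U] by (auto simp: a_r_coset_def')
      obtain h where h: "h \<in> ?J" "f = h \<oplus>\<^bsub>?V\<^esub> w" using f by (auto simp: a_r_coset_def')
      have "y = (g \<oplus>\<^bsub>?V\<^esub> h) \<oplus>\<^bsub>?V\<^esub> w" unfolding g(2) h(2) using rad_mor[OF g(1)] rad_mor[OF h(1)] w by (simp add: E.M.a_assoc)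
      thus "y \<in> ?J +>\<^bsub>?V\<^esub> w" using rad_add[OF U U g(1) h(1)] by (auto simp: a_r_coset_def')
    qed
    moreover have "?J +>\<^bsub>?V\<^esub> w \<subseteq> Mor C U U" using rad_mor w by (auto simp: a_r_coset_def')
    ultimately show ?thesis unfolding \<tau>_def using op[OF U U] by blast
  qed
  have near: "\<exists>n>0. z n \<in> ?J +>\<^bsub>?V\<^esub> v"
  proof -
    have "v \<in> ?J +>\<^bsub>?V\<^esub> v" using coset_self[OF rad_subspace[OF U U] vc] .
    then obtain N where "\<forall>n. N \<le> n \<longrightarrow> z n \<in> ?J +>\<^bsub>?V\<^esub> v" using v Jopen[OF vc] unfolding limitin_sequentially by blast
    thus ?thesis by (intro exI[of _ "Suc N"]) auto
  qed
  have unit: "iso_mor C U U (Ident C U \<ominus>\<^bsub>?V\<^esub> j)" if j: "j \<in> ?J" for j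
  proof -
    have "iso_mor C U U (Ident C U \<ominus>\<^bsub>?V\<^esub> (Ident C U \<cdot> j))" using j I unfolding rad_def by blast
    thus ?thesis using Ident_Comp[OF U U rad_mor[OF j]] by simp
  qed
  obtain n j where n: "n > 0" and j: "j \<in> ?J" "z n = j \<oplus>\<^bsub>?V\<^esub> v" using near by (auto simp: a_r_coset_def')
  obtain i where i: "n = Suc i" using n by (cases n) auto
  from \<open>v = \<zero>\<^bsub>?V\<^esub> \<or> v = Ident C U\<close> show ?thesis
  proof
    assume "v = \<zero>\<^bsub>?V\<^esub>"
    hence "z n \<in> ?J" using j rad_mor[OF j(1)] by simp
    hence "iso_mor C U U (?ev (1 - e n))" using unit by (simp add: z_def eval_poly_diff[OF U x] eval_poly_1[OF U x])
    moreover have "1 - e n = X * (X ^ order 0 p0 * T ^ i * a n)" unfolding e1 i by (simp add: T_def algebra_simps)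
    ultimately show ?thesis using iso_eval_factor[OF U x, of X] evX by metis
  next
    assume v1: "v = Ident C U"
    note jm = rad_mor[OF j(1)]
    have nj: "\<ominus>\<^bsub>?V\<^esub> j \<in> ?J" using rad_smult[OF U U j(1), of "- 1"] vs_smult_minus_one[OF Hom_vectorspace[OF U U] jm] by simp
    have "Ident C U \<ominus>\<^bsub>?V\<^esub> (\<ominus>\<^bsub>?V\<^esub> j) = z n" unfolding j(2) v1 a_minus_def using jm I E.M.a_comm by simp
    hence "iso_mor C U U (?ev (q * (q ^ i * b n)))" using unit[OF nj] by (simp add: z_def e_def i algebra_simps)
    hence "iso_mor C U U (?ev q)" by (rule iso_eval_factor[OF U x])
    then obtain w where w: "w \<in> Mor C U U" "?ev q \<cdot> w = Ident C U" by (auto simp: iso_mor_def)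
    have "?ev T = ?ev p \<cdot> w"
      using Comp_assoc[OF U U U U w(1) cl[of q] cl[of T]] w(2) Comp_Ident[OF U U cl[of T]] by (simp add: p_def eval_poly_mult[OF U x])
    hence "?ev T \<in> ?J" using rad_comp_right[OF U U U w(1) pJ] by simp
    hence "iso_mor C U U (?ev (1 - T))" using unit by (simp add: eval_poly_diff[OF U x] eval_poly_1[OF U x])
    moreover have "1 - T = (1 - X) * (\<Sum>i<Suc (order 0 p0). X ^ i)" unfolding T_def by (rule one_diff_power_eq)
    ultimately have "iso_mor C U U (?ev (1 - X))" using iso_eval_factor[OF U x, of "1 - X"] by metis
    thus ?thesis by (simp add: eval_poly_diff[OF U x] eval_poly_1[OF U x] evX)
  qed
qed

subsection \<open>Idempotents of indecomposable objects\<close>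

lemma zero_morphism_through_zero_object:
  assumes "X \<in> Obj C" "Y \<in> Obj C" "zero_object C Z" "f \<in> Mor C X Z" "g \<in> Mor C Z Y"
  shows "g \<cdot> f = \<zero>\<^bsub>Hom C X Y\<^esub>"
proof -
  have Z: "Z \<in> Obj C" "Ident C Z = \<zero>\<^bsub>Hom C Z Z\<^esub>" using assms(3) by (auto simp: zero_object_def)
  have "f = Ident C Z \<cdot> f" using Ident_Comp[OF assms(1) Z(1) assms(4)] by simp
  also have "\<dots> = \<zero>\<^bsub>Hom C X Z\<^esub>" unfolding Z(2) using assms Z(1) by (simp add: cat_simps)
  finally show ?thesis using assms(1,2,5) Z(1) by (simp add: cat_simps)
qed

text \<open>Splitting \<open>e\<close> and \<open>1 - e\<close> decomposes the object.\<close>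

lemma indecomposable_idempotents:
  assumes ic: "idempotent_complete C" and ind: "indecomposable C U"
    and e: "e \<in> Mor C U U" "e \<cdot> e = e"
  shows "e = \<zero>\<^bsub>Hom C U U\<^esub> \<or> e = Ident C U"
proof -
  have U: "U \<in> Obj C" using ind by (simp add: indecomposable_def)
  interpret E: abelian_group "Hom C U U" by (rule hom_abelian_group[OF U U])
  note I = Ident_closed[OF U]
  define d where "d = Ident C U \<ominus>\<^bsub>Hom C U U\<^esub> e"
  have d: "d \<in> Mor C U U" "d \<oplus>\<^bsub>Hom C U U\<^esub> e = Ident C U"
    using hom_minus_closed[OF U U I e(1)] hom_minus_iff[OF U U I e(1)] by (auto simp: d_def)
  have ee: "e \<cdot> e \<in> Mor C U U" "d \<cdot> e \<in> Mor C U U" "e \<cdot> d \<in> Mor C U U" "d \<cdot> d \<in> Mor C U U"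
    using comp_mor[OF U U U] e(1) d(1) by blast+
  have "d \<cdot> e \<oplus>\<^bsub>Hom C U U\<^esub> e \<cdot> e = \<zero>\<^bsub>Hom C U U\<^esub> \<oplus>\<^bsub>Hom C U U\<^esub> e \<cdot> e"
    using lin_maps_add[OF Comp_linear_left[OF U U U e(1)] d(1) e(1)] Ident_Comp[OF U U e(1)] by (simp add: d(2) e)
  hence de: "d \<cdot> e = \<zero>\<^bsub>Hom C U U\<^esub>" using hom_cancel[OF U U ee(2) E.zero_closed ee(1)] by blast
  have "e \<cdot> d \<oplus>\<^bsub>Hom C U U\<^esub> e \<cdot> e = \<zero>\<^bsub>Hom C U U\<^esub> \<oplus>\<^bsub>Hom C U U\<^esub> e \<cdot> e"
    using lin_maps_add[OF Comp_linear_right[OF U U U e(1)] d(1) e(1)] Comp_Ident[OF U U e(1)] by (simp add: d(2) e)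
  hence ed: "e \<cdot> d = \<zero>\<^bsub>Hom C U U\<^esub>" using hom_cancel[OF U U ee(3) E.zero_closed ee(1)] by blast
  have dd: "d \<cdot> d = d"
    using lin_maps_add[OF Comp_linear_right[OF U U U d(1)] d(1) e(1)] Comp_Ident[OF U U d(1)] ee(4) by (simp add: d(2) de)
  obtain Y r s where Y: "Y \<in> Obj C" "r \<in> Mor C U Y" "s \<in> Mor C Y U" "s \<cdot> r = e" "r \<cdot> s = Ident C Y"
    using bspec[OF bspec[OF ic[unfolded idempotent_complete_def] U] e(1)] e(2) by blast
  obtain Y' r' s' where Y': "Y' \<in> Obj C" "r' \<in> Mor C U Y'" "s' \<in> Mor C Y' U" "s' \<cdot> r' = d" "r' \<cdot> s' = Ident C Y'"
    using bspec[OF bspec[OF ic[unfolded idempotent_complete_def] U] d(1)] dd by blast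
  have "r' \<cdot> s = (r' \<cdot> s') \<cdot> (r' \<cdot> s) \<cdot> (r \<cdot> s)"
    using Y(1,2,3) Y'(1,2,3) U by (simp add: Y(5) Y'(5) cat_simps)
  also have "\<dots> = r' \<cdot> (((s' \<cdot> r') \<cdot> (s \<cdot> r)) \<cdot> s)" using Y(1,2,3) Y'(1,2,3) U by (simp add: cat_simps)
  also have "\<dots> = \<zero>\<^bsub>Hom C Y Y'\<^esub>" unfolding Y(4) Y'(4) de using Y(1,2,3) Y'(1,2,3) U by (simp add: cat_simps)
  finally have 1: "r' \<cdot> s = \<zero>\<^bsub>Hom C Y Y'\<^esub>" .
  have "r \<cdot> s' = (r \<cdot> s) \<cdot> (r \<cdot> s') \<cdot> (r' \<cdot> s')"
    using Y(1,2,3) Y'(1,2,3) U by (simp add: Y(5) Y'(5) cat_simps)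
  also have "\<dots> = r \<cdot> (((s \<cdot> r) \<cdot> (s' \<cdot> r')) \<cdot> s')" using Y(1,2,3) Y'(1,2,3) U by (simp add: cat_simps)
  also have "\<dots> = \<zero>\<^bsub>Hom C Y' Y\<^esub>" unfolding Y(4) Y'(4) ed using Y(1,2,3) Y'(1,2,3) U by (simp add: cat_simps)
  finally have 2: "r \<cdot> s' = \<zero>\<^bsub>Hom C Y' Y\<^esub>" .
  have "biproduct C Y Y' U s s' r r'"
    using U Y Y' 1 2 d(2) E.a_comm[OF d(1) e(1)] by (simp add: biproduct_def)
  hence "zero_object C Y \<or> zero_object C Y'" using ind unfolding indecomposable_def is_direct_sum_def by blast
  thus ?thesis
  proof
    assume "zero_object C Y"
    hence "e = \<zero>\<^bsub>Hom C U U\<^esub>" using zero_morphism_through_zero_object[OF U U _ Y(2,3)] Y(4) by simp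
    thus ?thesis by blast
  next
    assume "zero_object C Y'"
    hence "d = \<zero>\<^bsub>Hom C U U\<^esub>" using zero_morphism_through_zero_object[OF U U _ Y'(2,3)] Y'(4) by simp
    thus ?thesis using d(2) e(1) by simp
  qed
qed

text \<open>
  For a local summand \<open>Y\<close> of \<open>U\<close>, the idempotent through \<open>Y\<close> is non-zero, hence the identity. So \<open>U\<close> is isomorphic to
  \<open>Y\<close>, and invertibility can be tested after conjugation.
\<close>

lemma krull_schmidt_local:
  assumes ks: "krull_schmidt C" and U: "U \<in> Obj C" "\<not> zero_object C U"
    and idem: "\<And>e. e \<in> Mor C U U \<Longrightarrow> e \<cdot> e = e \<Longrightarrow> e = \<zero>\<^bsub>Hom C U U\<^esub> \<or> e = Ident C U"
    and x: "x \<in> Mor C U U"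
  shows "iso_mor C U U x \<or> iso_mor C U U (Ident C U \<ominus>\<^bsub>Hom C U U\<^esub> x)"
proof -
  interpret E: abelian_group "Hom C U U" by (rule hom_abelian_group[OF U(1) U(1)])
  note I = Ident_closed[OF U(1)]
  obtain n :: nat and X i p where
    dec: "\<forall>k<n. local_object C (X k) \<and> i k \<in> Mor C (X k) U \<and> p k \<in> Mor C U (X k)"
    and orth: "\<forall>k<n. \<forall>l<n. p k \<cdot> i l = (if k = l then Ident C (X k) else \<zero>\<^bsub>Hom C (X l) (X k)\<^esub>)"
    and sum: "finsum (Hom C U U) (\<lambda>k. i k \<cdot> p k) {..<n} = Ident C U"
    using bspec[OF ks[unfolded krull_schmidt_def] U(1)] by (elim exE conjE)
  have "n \<noteq> 0"
  proof
    assume "n = 0"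
    hence "Ident C U = \<zero>\<^bsub>Hom C U U\<^esub>" using sum by simp
    thus False using U by (simp add: zero_object_def)
  qed
  define Y where "Y = X 0"
  define j where "j = i 0"
  define q where "q = p 0"
  have Y: "local_object C Y" "j \<in> Mor C Y U" "q \<in> Mor C U Y" "q \<cdot> j = Ident C Y"
    using dec orth \<open>n \<noteq> 0\<close> by (auto simp: Y_def j_def q_def)
  have YO: "Y \<in> Obj C" and Ynz: "\<not> zero_object C Y" using Y(1) by (auto simp: local_object_def)
  have jq: "j \<cdot> q \<in> Mor C U U" using comp_mor[OF U(1) YO U(1) Y(3,2)] .
  have "(j \<cdot> q) \<cdot> (j \<cdot> q) = j \<cdot> ((q \<cdot> j) \<cdot> q)" using Y(2,3) YO U(1) by (simp add: cat_simps)
  also have "\<dots> = j \<cdot> q" using Y(2,3) YO U(1) by (simp add: Y(4) cat_simps)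
  finally have "j \<cdot> q = \<zero>\<^bsub>Hom C U U\<^esub> \<or> j \<cdot> q = Ident C U" using idem[OF jq] by blast
  moreover have "j \<cdot> q \<noteq> \<zero>\<^bsub>Hom C U U\<^esub>"
  proof
    assume z: "j \<cdot> q = \<zero>\<^bsub>Hom C U U\<^esub>"
    have "Ident C Y = (q \<cdot> j) \<cdot> (q \<cdot> j)" using YO by (simp add: Y(4) cat_simps)
    also have "\<dots> = q \<cdot> ((j \<cdot> q) \<cdot> j)" using Y(2,3) YO U(1) by (simp add: cat_simps)
    also have "\<dots> = \<zero>\<^bsub>Hom C Y Y\<^esub>" unfolding z using Y(2,3) YO U(1) by (simp add: cat_simps)
    finally show False using Ynz YO by (simp add: zero_object_def)
  qed
  ultimately have jq1: "j \<cdot> q = Ident C U" by blast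
  have conj_iso: "iso_mor C U U y" if y: "y \<in> Mor C U U" and iso: "iso_mor C Y Y (q \<cdot> (y \<cdot> j))" for y
  proof -
    obtain g where g: "g \<in> Mor C Y Y" "g \<cdot> (q \<cdot> (y \<cdot> j)) = Ident C Y" "(q \<cdot> (y \<cdot> j)) \<cdot> g = Ident C Y"
      using iso by (auto simp: iso_mor_def)
    have m: "j \<cdot> (g \<cdot> q) \<in> Mor C U U" using g(1) Y(2,3) YO U(1) by (simp add: cat_simps)
    have "(j \<cdot> (g \<cdot> q)) \<cdot> y = j \<cdot> ((g \<cdot> (q \<cdot> (y \<cdot> (j \<cdot> q)))))"
      unfolding jq1 using g(1) y Y(2,3) YO U(1) by (simp add: cat_simps)
    also have "\<dots> = j \<cdot> ((g \<cdot> (q \<cdot> (y \<cdot> j))) \<cdot> q)" using g(1) y Y(2,3) YO U(1) by (simp add: cat_simps)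
    also have "\<dots> = Ident C U" unfolding g(2) using Y(2,3) YO U(1) by (simp add: cat_simps jq1)
    finally have l: "(j \<cdot> (g \<cdot> q)) \<cdot> y = Ident C U" .
    have "y \<cdot> (j \<cdot> (g \<cdot> q)) = (j \<cdot> q) \<cdot> (y \<cdot> (j \<cdot> (g \<cdot> q)))"
      unfolding jq1 using g(1) y Y(2,3) YO U(1) by (simp add: cat_simps)
    also have "\<dots> = j \<cdot> (((q \<cdot> (y \<cdot> j)) \<cdot> g) \<cdot> q)" using g(1) y Y(2,3) YO U(1) by (simp add: cat_simps)
    also have "\<dots> = Ident C U" unfolding g(3) using Y(2,3) YO U(1) by (simp add: cat_simps jq1)
    finally show ?thesis using l m y unfolding iso_mor_def by blast
  qed
  define y where "y = Ident C U \<ominus>\<^bsub>Hom C U U\<^esub> x"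
  have y: "y \<in> Mor C U U" "y \<oplus>\<^bsub>Hom C U U\<^esub> x = Ident C U"
    using hom_minus_closed[OF U(1,1) I x] hom_minus_iff[OF U(1,1) I x] by (auto simp: y_def)
  have "q \<cdot> (y \<cdot> j) \<oplus>\<^bsub>Hom C Y Y\<^esub> q \<cdot> (x \<cdot> j) = q \<cdot> ((y \<oplus>\<^bsub>Hom C U U\<^esub> x) \<cdot> j)"
    using y(1) x Y(2,3) YO U(1) by (simp add: cat_simps)
  also have "\<dots> = Ident C Y" unfolding y(2) using Y(2,3) YO U(1) by (simp add: cat_simps Y(4))
  finally have "q \<cdot> (y \<cdot> j) \<oplus>\<^bsub>Hom C Y Y\<^esub> q \<cdot> (x \<cdot> j) = Ident C Y" .
  moreover have "iso_mor C Y Y (Ident C Y)"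
    unfolding iso_mor_def using YO by (intro conjI bexI[of _ "Ident C Y"]) (simp_all add: cat_simps)
  moreover have "q \<cdot> (y \<cdot> j) \<in> Mor C Y Y" "q \<cdot> (x \<cdot> j) \<in> Mor C Y Y" using y(1) x Y(2,3) YO U(1) by (simp_all add: cat_simps)
  ultimately have "iso_mor C Y Y (q \<cdot> (y \<cdot> j)) \<or> iso_mor C Y Y (q \<cdot> (x \<cdot> j))" using Y(1) unfolding local_object_def by metis
  thus ?thesis using conj_iso[OF y(1)] conj_iso[OF x] unfolding y_def by blast
qed

subsection \<open>Finite-dimensional heads\<close>

text \<open>\<open>Hom(V, U)\<close> is a corner of the endomorphism ring of \<open>V \<oplus> U\<close>, and its radical is the corner of the radical.\<close>

lemma head_fin_dim_of_sum:
  assumes o: "V \<in> Obj C" "U \<in> Obj C" "W \<in> Obj C" and bp: "biproduct C V U W i j p q"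
    and fd: "vectorspace.fin_dim class_ring (D_space C W)"
  shows "vectorspace.fin_dim class_ring (head U V)"
proof -
  have m: "i \<in> Mor C V W" "j \<in> Mor C U W" "p \<in> Mor C W V" "q \<in> Mor C W U" and e: "p \<cdot> i = Ident C V" "q \<cdot> j = Ident C U"
    using bp by (auto simp: biproduct_def)
  note sub = rad_subspace[OF o(1,2)] and sub' = rad_subspace[OF o(3,3)]
  have lin: "(\<lambda>v. j \<cdot> (v \<cdot> p)) \<in> lin_maps (Hom C V U) (Hom C W W)"
    by (rule lin_mapsI) (use m o in \<open>simp_all add: cat_simps\<close>)
  have rd: "j \<cdot> (v \<cdot> p) \<in> rad C W W" if "v \<in> rad C V U" for v
    using rad_comp_left[OF o(3,2,3) rad_comp_right[OF o(3,1,2) m(3) that] m(2)] .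
  have inj: "v \<in> rad C V U" if v: "v \<in> Mor C V U" "j \<cdot> (v \<cdot> p) \<in> rad C W W" for v
  proof -
    have "(q \<cdot> (j \<cdot> (v \<cdot> p))) \<cdot> i = (q \<cdot> j) \<cdot> (v \<cdot> (p \<cdot> i))" using v(1) m o by (simp add: cat_simps)
    also have "\<dots> = v" unfolding e using v(1) o by (simp add: cat_simps)
    finally show ?thesis
      using rad_comp_right[OF o(1,3,2) m(1) rad_comp_left[OF o(3,3,2) v(2) m(4)]] by simp
  qed
  show ?thesis
    using fin_dim_inj[OF quot_vs[OF sub] quot_vs[OF sub'] quot_map_lin[OF sub sub' lin rd] quot_map_inj[OF sub sub' lin rd inj]] fd
    by (simp add: D_space_def)
qed

text \<open>A non-radical map \<open>v : X \<rightarrow> U\<close> from a local object is an isomorphism: it has a section \<open>t\<close>, and \<open>1 - t v\<close> is killed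
  by \<open>v\<close>, so \<open>t v\<close> is the invertible one. Hence every map \<open>X \<rightarrow> U\<close> is a multiple of \<open>v\<close> modulo the radical.\<close>

lemma head_fin_dim_local:
  assumes X: "local_object C X" and U: "U \<in> Obj C" "\<not> zero_object C U"
    and loc: "\<And>f. f \<in> Mor C U U \<Longrightarrow> iso_mor C U U f \<or> iso_mor C U U (Ident C U \<ominus>\<^bsub>Hom C U U\<^esub> f)"
    and fd: "vectorspace.fin_dim class_ring (D_space C U)"
  shows "vectorspace.fin_dim class_ring (head U X)"
proof -
  have XO: "X \<in> Obj C" using X by (simp add: local_object_def)
  interpret X: abelian_group "Hom C X X" by (rule hom_abelian_group[OF XO XO])
  note sub = rad_subspace[OF XO U(1)] and subU = rad_subspace[OF U(1,1)] and I = Ident_closed[OF XO]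
  have "\<exists>v\<in>Mor C X U. \<forall>u\<in>Mor C X U. \<exists>f\<in>Mor C U U. rad C X U +>\<^bsub>Hom C X U\<^esub> u = rad C X U +>\<^bsub>Hom C X U\<^esub> (f \<cdot> v)"
  proof (cases "Mor C X U \<subseteq> rad C X U")
    case True
    let ?z = "\<zero>\<^bsub>Hom C X U\<^esub>"
    have z: "?z \<in> Mor C X U" and Iz: "Ident C U \<cdot> ?z = ?z" using XO U(1) by (simp_all add: cat_simps)
    have "rad C X U +>\<^bsub>Hom C X U\<^esub> u = rad C X U +>\<^bsub>Hom C X U\<^esub> (Ident C U \<cdot> ?z)" if "u \<in> Mor C X U" for u
      unfolding Iz using coset_eq_zero_iff[OF sub that] True that by (auto simp: quot_zero[OF sub])
    thus ?thesis using z Ident_closed[OF U(1)] by blast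
  next
    case False
    then obtain v where v: "v \<in> Mor C X U" "v \<notin> rad C X U" by blast
    obtain t where t: "t \<in> Mor C U X" "v \<cdot> t = Ident C U" using not_rad_section[OF XO U(1) loc v] by blast
    note tv = comp_mor[OF XO U(1) XO v(1) t(1)]
    define w where "w = Ident C X \<ominus>\<^bsub>Hom C X X\<^esub> (t \<cdot> v)"
    have w: "w \<in> Mor C X X" "w \<oplus>\<^bsub>Hom C X X\<^esub> t \<cdot> v = Ident C X"
      using hom_minus_closed[OF XO XO I tv] hom_minus_iff[OF XO XO I tv] by (auto simp: w_def)
    have vtv: "v \<cdot> (t \<cdot> v) = v"
    proof -
      have "v \<cdot> (t \<cdot> v) = (v \<cdot> t) \<cdot> v" using v(1) t(1) XO U(1) by (simp add: cat_simps)
      thus ?thesis using v(1) XO U(1) by (simp add: t(2) cat_simps)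
    qed
    have vw: "v \<cdot> w = \<zero>\<^bsub>Hom C X U\<^esub>"
    proof -
      interpret XU: abelian_group "Hom C X U" by (rule hom_abelian_group[OF XO U(1)])
      have "v \<cdot> w \<oplus>\<^bsub>Hom C X U\<^esub> v \<cdot> (t \<cdot> v) = v \<cdot> Ident C X"
        using lin_maps_add[OF Comp_linear_right[OF XO XO U(1) v(1)] w(1) tv] by (simp add: w(2))
      hence "v \<cdot> w \<oplus>\<^bsub>Hom C X U\<^esub> v = \<zero>\<^bsub>Hom C X U\<^esub> \<oplus>\<^bsub>Hom C X U\<^esub> v" using v(1) XO U(1) by (simp add: vtv Comp_Ident)
      thus ?thesis using hom_cancel[OF XO U(1) comp_mor[OF XO XO U(1) w(1) v(1)] XU.zero_closed v(1)] by blast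
    qed
    have "iso_mor C X X (Ident C X)"
      unfolding iso_mor_def using XO by (intro conjI bexI[of _ "Ident C X"]) (simp_all add: cat_simps)
    hence "iso_mor C X X w \<or> iso_mor C X X (t \<cdot> v)" using X w tv unfolding local_object_def by metis
    moreover have "\<not> iso_mor C X X w"
    proof
      assume "iso_mor C X X w"
      then obtain g where g: "g \<in> Mor C X X" "w \<cdot> g = Ident C X" by (auto simp: iso_mor_def)
      have "v = v \<cdot> (w \<cdot> g)" using v(1) XO U(1) by (simp add: g(2) Comp_Ident)
      also have "\<dots> = (v \<cdot> w) \<cdot> g" using v(1) w(1) g(1) XO U(1) by (simp add: cat_simps)
      also have "\<dots> = \<zero>\<^bsub>Hom C X U\<^esub>" unfolding vw using g(1) XO U(1) by (simp add: cat_simps)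
      finally have "v = \<zero>\<^bsub>Hom C X U\<^esub>" .
      hence "Ident C U = \<zero>\<^bsub>Hom C U U\<^esub>" using t XO U(1) by (simp add: t(2)[symmetric] cat_simps)
      thus False using U by (simp add: zero_object_def)
    qed
    ultimately obtain g where g: "g \<in> Mor C X X" "g \<cdot> (t \<cdot> v) = Ident C X" by (auto simp: iso_mor_def)
    have "rad C X U +>\<^bsub>Hom C X U\<^esub> u = rad C X U +>\<^bsub>Hom C X U\<^esub> ((u \<cdot> (g \<cdot> t)) \<cdot> v)" if u: "u \<in> Mor C X U" for u
    proof -
      have "(u \<cdot> (g \<cdot> t)) \<cdot> v = u \<cdot> (g \<cdot> (t \<cdot> v))" using u g(1) t(1) v(1) XO U(1) by (simp add: cat_simps)
      thus ?thesis using u XO U(1) by (simp add: g(2) Comp_Ident)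
    qed
    moreover have "u \<cdot> (g \<cdot> t) \<in> Mor C U U" if "u \<in> Mor C X U" for u using that g(1) t(1) XO U(1) by (simp add: cat_simps)
    ultimately show ?thesis using v(1) by blast
  qed
  then obtain v where v: "v \<in> Mor C X U"
    "\<And>u. u \<in> Mor C X U \<Longrightarrow> \<exists>f\<in>Mor C U U. rad C X U +>\<^bsub>Hom C X U\<^esub> u = rad C X U +>\<^bsub>Hom C X U\<^esub> (f \<cdot> v)" by blast
  note lin = Comp_linear_left[OF XO U(1,1) v(1)] and rd = rad_comp_right[OF XO U(1,1) v(1)]
  show ?thesis
    using fin_dim_surj[OF quot_vs[OF subU] quot_vs[OF sub] quot_map_lin[OF subU sub lin rd] quot_map_surj[OF subU sub lin rd v(2)]] fd
    by (simp add: D_space_def)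
qed

text \<open>The part of the head that is visible through an endomorphism \<open>e\<close> of \<open>V\<close>. It is subadditive in \<open>e\<close>, which
  reduces \<open>V\<close> to its local summands.\<close>

definition head_part :: "'o \<Rightarrow> 'o \<Rightarrow> 'm \<Rightarrow> 'm set set" where
  "head_part U V e = (\<lambda>v. rad C V U +>\<^bsub>Hom C V U\<^esub> (v \<cdot> e)) ` Mor C V U"

lemma krull_schmidt_head_fin_dim:
  assumes ks: "krull_schmidt C" and V: "V \<in> Obj C" and U: "U \<in> Obj C"
    and fdX: "\<And>X. local_object C X \<Longrightarrow> vectorspace.fin_dim class_ring (head U X)"
  shows "vectorspace.fin_dim class_ring (head U V)"
proof -
  let ?H = "head U V"
  note sub = rad_subspace[OF V U]
  interpret E: abelian_group "Hom C V V" by (rule hom_abelian_group[OF V V])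
  interpret H: vectorspace class_ring ?H by (rule quot_vs[OF sub])
  have part_sub: "VectorSpace.subspace class_ring (head_part U V e) ?H" if e: "e \<in> Mor C V V" for e
  proof -
    have "(\<lambda>v. rad C V U +>\<^bsub>Hom C V U\<^esub> (v \<cdot> e)) \<in> lin_maps (Hom C V U) ?H"
      using comp_mor[OF V V U e] V U e
      by (intro lin_mapsI)
        (auto simp: quot_carrier[OF sub] quot_add[OF sub] quot_smult[OF sub] lin_maps_add[OF Comp_linear_left[OF V V U e]]
          lin_maps_smult[OF Comp_linear_left[OF V V U e]])
    from image_subspace[OF Hom_vectorspace[OF V U] quot_vs[OF sub] this] show ?thesis by (simp add: head_part_def)
  qed
  let ?fd = "\<lambda>W. vectorspace.fin_dim class_ring (?H\<lparr>carrier := W\<rparr>)"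
  have mono: "?fd W" if W: "VectorSpace.subspace class_ring W ?H" and W': "VectorSpace.subspace class_ring W' ?H" and le: "W \<subseteq> W'" and fd: "?fd W'" for W W'
  proof -
    have "VectorSpace.subspace class_ring W (?H\<lparr>carrier := W'\<rparr>)"
      using W vs_restrict[OF W'] le by (simp add: subspace_iff)
    from fin_dim_subspace[OF this fd] show ?thesis by simp
  qed
  obtain n :: nat and X i p where
    dec: "\<forall>k<n. local_object C (X k) \<and> i k \<in> Mor C (X k) V \<and> p k \<in> Mor C V (X k)"
    and sum: "finsum (Hom C V V) (\<lambda>k. i k \<cdot> p k) {..<n} = Ident C V"
    using bspec[OF ks[unfolded krull_schmidt_def] V] by (elim exE conjE)
  have XO: "X k \<in> Obj C" if "k < n" for k using dec that by (auto simp: local_object_def)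
  have ip: "i k \<cdot> p k \<in> Mor C V V" if "k < n" for k using comp_mor[OF V XO[OF that] V] dec that by blast
  have one: "?fd (head_part U V (i k \<cdot> p k))" if k: "k < n" for k
  proof -
    have ik: "i k \<in> Mor C (X k) V" and pk: "p k \<in> Mor C V (X k)" using dec k by auto
    note subX = rad_subspace[OF XO[OF k] U]
    note lin = Comp_linear_left[OF V XO[OF k] U pk] and rd = rad_comp_right[OF V XO[OF k] U pk]
    let ?q = "quot_map (Hom C (X k) U) (rad C (X k) U) (Hom C V U) (rad C V U) (\<lambda>v. v \<cdot> p k)"
    note ql = quot_map_lin[OF subX sub lin rd]
    have S: "VectorSpace.subspace class_ring (?q ` carrier (head U (X k))) ?H"
      using image_subspace[OF quot_vs[OF subX] quot_vs[OF sub] ql] .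
    have "?fd (?q ` carrier (head U (X k)))"
      using fin_dim_surj[OF quot_vs[OF subX] vs_restrict[OF S] lin_maps_into_image[OF ql]] fdX dec k by simp
    moreover have "head_part U V (i k \<cdot> p k) \<subseteq> ?q ` carrier (head U (X k))"
    proof
      fix c assume "c \<in> head_part U V (i k \<cdot> p k)"
      then obtain v where v: "v \<in> Mor C V U" "c = rad C V U +>\<^bsub>Hom C V U\<^esub> (v \<cdot> (i k \<cdot> p k))" by (auto simp: head_part_def)
      note vi = comp_mor[OF XO[OF k] V U ik v(1)]
      have "?q (rad C (X k) U +>\<^bsub>Hom C (X k) U\<^esub> (v \<cdot> i k)) = rad C V U +>\<^bsub>Hom C V U\<^esub> ((v \<cdot> i k) \<cdot> p k)"
        by (rule quot_map_coset[OF subX sub lin rd vi])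
      hence "c = ?q (rad C (X k) U +>\<^bsub>Hom C (X k) U\<^esub> (v \<cdot> i k))"
        unfolding v(2) using Comp_assoc[OF V XO[OF k] V U pk ik v(1)] by simp
      thus "c \<in> ?q ` carrier (head U (X k))" using vi by (auto simp: quot_carrier[OF subX])
    qed
    ultimately show ?thesis using mono[OF part_sub[OF ip[OF k]] S] by blast
  qed
  have add: "?fd (head_part U V (e \<oplus>\<^bsub>Hom C V V\<^esub> e'))"
    if e: "e \<in> Mor C V V" "e' \<in> Mor C V V" and fd: "?fd (head_part U V e)" "?fd (head_part U V e')" for e e'
  proof -
    note s = part_sub[OF e(1)] part_sub[OF e(2)]
    have "head_part U V (e \<oplus>\<^bsub>Hom C V V\<^esub> e') \<subseteq> H.subspace_sum (head_part U V e) (head_part U V e')"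
    proof
      fix c assume "c \<in> head_part U V (e \<oplus>\<^bsub>Hom C V V\<^esub> e')"
      then obtain v where v: "v \<in> Mor C V U" "c = rad C V U +>\<^bsub>Hom C V U\<^esub> (v \<cdot> (e \<oplus>\<^bsub>Hom C V V\<^esub> e'))" by (auto simp: head_part_def)
      have "c = (rad C V U +>\<^bsub>Hom C V U\<^esub> (v \<cdot> e)) \<oplus>\<^bsub>?H\<^esub> (rad C V U +>\<^bsub>Hom C V U\<^esub> (v \<cdot> e'))"
        unfolding v(2) lin_maps_add[OF Comp_linear_right[OF V V U v(1)] e] using quot_add[OF sub] comp_mor[OF V V U _ v(1)] e by simp
      thus "c \<in> H.subspace_sum (head_part U V e) (head_part U V e')"
        using v(1) unfolding H.submodule_sum_def head_part_def by auto
    qed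
    thus ?thesis
      using mono[OF part_sub H.sum_is_subspace[OF s]] H.fin_dim_subspace_sum[OF s fd] e by simp
  qed
  have "finsum (Hom C V V) (\<lambda>k. i k \<cdot> p k) {..<m} \<in> Mor C V V \<and> ?fd (head_part U V (finsum (Hom C V V) (\<lambda>k. i k \<cdot> p k) {..<m}))"
    if "m \<le> n" for m
    using that
  proof (induction m)
    case 0
    have z: "v \<cdot> \<zero>\<^bsub>Hom C V V\<^esub> = \<zero>\<^bsub>Hom C V U\<^esub>" if "v \<in> Mor C V U" for v using that V U by (simp add: cat_simps)
    have "head_part U V \<zero>\<^bsub>Hom C V V\<^esub> \<subseteq> {\<zero>\<^bsub>?H\<^esub>}" using z by (auto simp: head_part_def quot_zero[OF sub])
    moreover have "\<zero>\<^bsub>?H\<^esub> \<in> head_part U V \<zero>\<^bsub>Hom C V V\<^esub>" using part_sub[of "\<zero>\<^bsub>Hom C V V\<^esub>"] by (simp add: subspace_iff)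
    ultimately have eq: "head_part U V \<zero>\<^bsub>Hom C V V\<^esub> = {\<zero>\<^bsub>?H\<^esub>}" by blast
    interpret Z: vectorspace class_ring "?H\<lparr>carrier := {\<zero>\<^bsub>?H\<^esub>}\<rparr>"
      using vs_restrict[OF part_sub[of "\<zero>\<^bsub>Hom C V V\<^esub>"]] unfolding eq by simp
    have "Z.span {} = {\<zero>\<^bsub>?H\<^esub>}" using Z.span_empty by simp
    hence "Z.fin_dim" unfolding Z.fin_dim_def by (intro exI[of _ "{}"]) simp
    thus ?case using eq by simp
  next
    case (Suc m)
    hence m: "m < n" "m \<le> n" by auto
    have "finsum (Hom C V V) (\<lambda>k. i k \<cdot> p k) {..<Suc m} = i m \<cdot> p m \<oplus>\<^bsub>Hom C V V\<^esub> finsum (Hom C V V) (\<lambda>k. i k \<cdot> p k) {..<m}"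
      unfolding lessThan_Suc using ip m by (intro E.finsum_insert) auto
    thus ?case using add[OF ip[OF m(1)] _ one[OF m(1)]] Suc.IH[OF m(2)] ip[OF m(1)] by simp
  qed
  from this[of n] have "?fd (head_part U V (Ident C V))" by (simp add: sum)
  moreover have "head_part U V (Ident C V) = carrier ?H"
    using Comp_Ident[OF V U] by (auto simp: head_part_def quot_carrier[OF sub])
  ultimately show ?thesis by simp
qed

end

lemma D_space_full_sub: "D_space (full_sub C \<T>) X = D_space C X"
  by (simp add: D_space_def rad_full_sub)

lemma zero_object_full_sub: "\<T> \<subseteq> Obj C \<Longrightarrow> zero_object (full_sub C \<T>) X \<longleftrightarrow> zero_object C X \<and> X \<in> \<T>"
  by (auto simp: zero_object_def)

text \<open>A cluster-tilting subcategory contains the summands of its objects.\<close>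

lemma (in cluster_tilting_subcategory) indecomposable_full_sub:
  assumes ind: "indecomposable (full_sub C \<T>) X"
  shows "indecomposable C X"
proof -
  have X: "X \<in> \<T>" "\<not> zero_object C X"
    using ind zero_object_full_sub[OF tilting_subset, of X] by (auto simp: indecomposable_def)
  have "zero_object C Y \<or> zero_object C Z" if ds: "is_direct_sum C Y Z X" for Y Z
  proof -
    obtain i j p q where bp: "biproduct C Y Z X i j p q" using ds by (auto simp: is_direct_sum_def)
    hence "Y \<in> \<T>" "Z \<in> \<T>" using tilting_retract[OF X(1)] unfolding biproduct_def by blast+
    hence "is_direct_sum (full_sub C \<T>) Y Z X" using ds X(1) is_direct_sum_full_sub[OF tilting_subset] by blast
    thus ?thesis using ind zero_object_full_sub[OF tilting_subset] unfolding indecomposable_def by blast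
  qed
  thus ?thesis using X tilting_obj unfolding indecomposable_def by blast
qed

section \<open>Sign-coherence in cluster categories\<close>

theorem corollary3p54:
  fixes C :: "('k::field, 'o, 'm, 'e) extri"
    and \<T> \<U> :: "'o set"
    and U :: 'o
  assumes "perfect_field TYPE('k)"
    and "compact_cluster_category TYPE('p) TYPE('n) C \<or>
         skew_symmetric_cluster_category TYPE('p) TYPE('n) C"
    and "cluster_tilting C \<T>"
    and "cluster_tilting C \<U>"
    and "indecomposable (full_sub C \<U>) U"
  shows "sign_coherent (full_sub C \<T>)
           (index_adj C \<U> \<T> (K0_num_class (full_sub C \<U>) (simple_cmod (full_sub C \<U>) U))) \<and>
         sign_coherent (full_sub C \<T>)
           (coindex_adj C \<U> \<T> (K0_num_class (full_sub C \<U>) (simple_cmod (full_sub C \<U>) U)))"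
proof -
  have cc: "cluster_category TYPE('p) TYPE('n) C"
    using assms(2) by (auto simp: compact_cluster_category_def skew_symmetric_cluster_category_def)
  hence "extriangulated_category C" and ic: "idempotent_complete C" by (auto simp: cluster_category_def)
  then interpret extriangulated_category C by simp
  interpret \<U>: cluster_tilting_subcategory C \<U> by unfold_locales (rule assms(4))
  interpret tilting_pair C \<T> \<U> by unfold_locales (rule assms(3))
  have UU: "U \<in> \<U>" using assms(5) by (simp add: indecomposable_def)
  note U = \<U>.tilting_obj[OF UU]
  have ind: "indecomposable C U" using \<U>.indecomposable_full_sub[OF assms(5)] .
  hence nz: "\<not> zero_object C U" by (simp add: indecomposable_def)
  note idem = indecomposable_idempotents[OF ic ind]
  have loc: "iso_mor C U U x \<or> iso_mor C U U (Ident C U \<ominus>\<^bsub>Hom C U U\<^esub> x)" if x: "x \<in> Mor C U U" for x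
    using assms(2)
  proof
    assume c: "compact_cluster_category TYPE('p) TYPE('n) C"
    hence "radically_pseudocompact (full_sub C \<U>)" "vectorspace.fin_dim class_ring (D_space C U)"
      using assms(4) U by (auto simp: compact_cluster_category_def)
    thus ?thesis
      using linear_category.radically_pseudocompact_local[OF \<U>.full_sub_linear, of U x] UU idem x
      by (simp add: D_space_full_sub iso_mor_def)
  next
    assume "skew_symmetric_cluster_category TYPE('p) TYPE('n) C"
    hence "krull_schmidt C" by (simp add: skew_symmetric_cluster_category_def)
    from krull_schmidt_local[OF this U nz idem x] show ?thesis .
  qed
  have fd: "vectorspace.fin_dim class_ring (head U V)" if V: "V \<in> Obj C" for V
    using assms(2)
  proof
    assume c: "compact_cluster_category TYPE('p) TYPE('n) C"
    obtain W i j p q where bp: "biproduct C V U W i j p q" using direct_sum_exists[OF V U] by (auto simp: is_direct_sum_def)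
    hence W: "W \<in> Obj C" by (simp add: biproduct_def)
    show ?thesis using head_fin_dim_of_sum[OF V U W bp] c W by (auto simp: compact_cluster_category_def)
  next
    assume s: "skew_symmetric_cluster_category TYPE('p) TYPE('n) C"
    hence "vectorspace.fin_dim class_ring (D_space C U)" "krull_schmidt C"
      using ind by (auto simp: skew_symmetric_cluster_category_def)
    thus ?thesis using krull_schmidt_head_fin_dim[OF _ V U head_fin_dim_local[OF _ U nz loc]] by blast
  qed
  interpret tilting_pair_summand C \<T> \<U> U
  proof unfold_locales
    show "U \<in> \<U>" by (rule UU)
    show "\<exists>t\<in>Mor C U V. v \<cdot>\<^bsub>C\<^esub> t = Ident C U" if "V \<in> \<U>" "v \<in> Mor C V U" "v \<notin> rad C V U" for V v
      using not_rad_section[OF \<U>.tilting_obj[OF that(1)] U loc that(2,3)] by blast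
    show "vectorspace.fin_dim class_ring (head U V)" if "V \<in> \<U>" for V using fd[OF \<U>.tilting_obj[OF that]] .
  qed
  show ?thesis using index_adj_sign_coherent coindex_adj_sign_coherent by blast
qed

end
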